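(* Let $0<\varepsilon<\tfrac14u_{\min}$. Any local minimizer $\bar u\in BV(\Omega)$ over $BV(\Omega)$ of $$J(u)=F(\Phi(u))+\alpha\,G(u)+\beta\,\mathrm{TV}(u),\qquad F(w)=\tfrac12\|y(w)-z\|_{L^2(\Omega)}^2,$$ satisfies $$-F'(\Phi(\bar u))\Phi'(\bar u)\in\alpha\,\partial G(\bar u)+\beta\,\partial\mathrm{TV}(\bar u)\subset L^{s/2}(\Omega),$$ where $G$ and $\mathrm{TV}$ are considered as extended real-valued convex functionals on $L^{\frac{s}{s-2}}(\Omega)$ and $\partial$ denotes the convex subdifferential (a subset of the dual space $L^{s/2}(\Omega)$).
   Context: Setting. $d\in\mathbb N$, and $\Omega\subset\mathbb R^d$ is a bounded strongly Lipschitz domain (locally, after a rigid change of coordinates, $\partial\Omega$ is the graph of a Lipschitz function with $\Omega$ lying on one side). $\alpha,\beta>0$, $f,z\in L^2(\Omega)$, $0<u_{\min}<u_{\max}<\infty$, and $0=u_1<u_2<\dots<u_m=u_{\max}-u_{\min}$ are given. Total variation: $BV(\Omega)$ is the space of $v\in L^1(\Omega)$ whose distributional derivative $Dv$ is a finite $\mathbb R^d$-valued Radon measure, and $\mathrm{TV}(v)=|Dv|(\Omega)$ (isotropic, Euclidean norm), $\mathrm{TV}(v)=\infty$ for $v\notin BV(\Omega)$; $\|v\|_{BV}=\|v\|_{L^1}+\mathrm{TV}(v)$. Local minimizers are understood with respect to the $BV$ norm. Multi-bang penalty: $G(u)=\int_\Omega g(u(x))\,dx$ with $g(t)=-u_mt$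 for $t\le u_1$; $g(t)=\frac12\big((u_i+u_{i+1})t-u_iu_{i+1}\big)$ for $t\in[u_i,u_{i+1}]$, $1\le i<m$; $g(t)=u_mt-\frac12u_m^2$ for $t\ge u_m$. Superposition operator: $[\Phi(v)](x)=\varphi_\varepsilon(v(x))$ and $\Phi'(v)$ is identified with the function $x\mapsto\varphi_\varepsilon'(v(x))\in L^\infty(\Omega)$, where $\varphi_\varepsilon=u_{\min}+\rho\in C^{1,1}(\mathbb R)$ with $\rho(t)=-\varepsilon$ for $t\le-\varepsilon$; $\rho(t)=-\frac{1}{\varepsilon^2}t^3-\frac1\varepsilon t^2+t$ for $t\in[-\varepsilon,0]$; $\rho(t)=t$ for $t\in[0,u_m]$; $\rho(t)=-\frac1{\varepsilon^2}t^3+\frac{3u_m+\varepsilon}{\varepsilon^2}t^2+\frac{\varepsilon^2-2u_m\varepsilon-3u_m^2}{\varepsilon^2}t+\frac{u_m^3+u_m^2\varepsilon}{\varepsilon^2}$ for $t\in[u_m,u_m+\varepsilon]$; $\rho(t)=u_m+\varepsilon$ for $t\ge u_m+\varepsilon$. State, tracking term: let $\hat U=\{w\in L^\infty(\Omega):\frac12u_{\min}-2\varepsilon<w<2u_{\max}+2\varepsilon\text{ a.e.}\}$, an open subset of $L^\infty(\Omega)$. For $w\in\hat U$, $y(w)\in H^1_0(\Omega)$ is the unique weak solution of $-\operatorname{div}(w\nabla y)=f$ in $\Omega$, $y=0$ on $\partial\Omega$, and $p(w)\in H^1_0(\Omega)$ is the unique weak solution of $-\operatorname{div}(w\nabla p)=-(y(w)-z)$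 in $\Omega$, $p=0$ on $\partial\Omega$. $F:\hat U\to\mathbb R$ is Fréchet differentiable with derivative represented by $F'(w)=\nabla y(w)\cdot\nabla p(w)\in L^{s/2}(\Omega)$, i.e. $F'(w)h=\int_\Omega h\,\nabla y(w)\cdot\nabla p(w)\,dx$; $F'(\Phi(\bar u))\Phi'(\bar u)$ is the pointwise product of functions. Exponent $s$: $s>2$ is a fixed exponent such that $L^2(\Omega)$ embeds continuously into $W^{-1,s}(\Omega)=(W^{1,s'}_0(\Omega))^*$, $\frac1s+\frac1{s'}=1$, and such that for some $K_s>0$, for all $w\in\hat U$ and all $r\in L^2(\Omega)$, the weak solution $y\in H^1_0(\Omega)$ of $-\operatorname{div}(w\nabla y)=r$ satisfies $\|y\|_{W^{1,s}(\Omega)}\le K_s\|r\|_{W^{-1,s}(\Omega)}$. (Such an $s$ exists.) *)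

theory Defs
  imports "HOL-Analysis.Analysis"
begin

text \<open>
  Conventions.  \<open>\<real>\<^sup>d\<close> is a type of class \<open>euclidean_space\<close>.  Elements of function spaces
  over \<open>\<Omega>\<close> are represented by total functions that are only looked at through \<^term>\<open>lebesgue_on \<Omega>\<close>;
  values outside \<open>\<Omega>\<close> are irrelevant, and equality in the function spaces is equality a.e. on \<open>\<Omega>\<close>.
  Objects that are unique only up to null sets (weak gradients, weak solutions) are chosen
  with \<open>SOME\<close>; everything defined from them depends on the a.e. class only.
\<close>

section \<open>Domains\<close>

text \<open>After a rigid motion the direction \<open>e\<close> is the last coordinate axis, and
  \<open>y - (y \<bullet> e) *\<^sub>R e\<close> are the remaining coordinates of \<open>y\<close>.\<close>

definition strongly_lipschitz_boundary :: "'a::euclidean_space set \<Rightarrow> bool" where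
  "strongly_lipschitz_boundary \<Omega> \<longleftrightarrow>
     (\<forall>x\<in>frontier \<Omega>. \<exists>e U L. \<exists>\<gamma> :: 'a \<Rightarrow> real.
        norm e = 1 \<and> open U \<and> x \<in> U \<and> L-lipschitz_on {v. v \<bullet> e = 0} \<gamma> \<and>
        \<Omega> \<inter> U = {y \<in> U. y \<bullet> e < \<gamma> (y - (y \<bullet> e) *\<^sub>R e)} \<and>
        frontier \<Omega> \<inter> U = {y \<in> U. y \<bullet> e = \<gamma> (y - (y \<bullet> e) *\<^sub>R e)})"

definition bounded_lipschitz_domain :: "'a::euclidean_space set \<Rightarrow> bool" where
  "bounded_lipschitz_domain \<Omega> \<longleftrightarrow>
     open \<Omega> \<and> connected \<Omega> \<and> \<Omega> \<noteq> {} \<and> bounded \<Omega> \<and> strongly_lipschitz_boundary \<Omega>"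


section \<open>Lebesgue and Sobolev spaces\<close>

definition Lp :: "real \<Rightarrow> 'a::euclidean_space set \<Rightarrow> ('a \<Rightarrow> 'b::euclidean_space) set" where
  "Lp p \<Omega> = {v \<in> borel_measurable (lebesgue_on \<Omega>).
              integrable (lebesgue_on \<Omega>) (\<lambda>x. norm (v x) powr p)}"

definition Lp_norm :: "real \<Rightarrow> 'a::euclidean_space set \<Rightarrow> ('a \<Rightarrow> 'b::euclidean_space) \<Rightarrow> real" where
  "Lp_norm p \<Omega> v = (\<integral>x. norm (v x) powr p \<partial>lebesgue_on \<Omega>) powr (1 / p)"

definition Linfty :: "'a::euclidean_space set \<Rightarrow> ('a \<Rightarrow> real) set" where
  "Linfty \<Omega> = {w \<in> borel_measurable (lebesgue_on \<Omega>). \<exists>C. AE x in lebesgue_on \<Omega>. \<bar>w x\<bar> \<le> C}"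

definition partial_deriv :: "'a::euclidean_space \<Rightarrow> ('a \<Rightarrow> real) \<Rightarrow> 'a \<Rightarrow> real" where
  "partial_deriv b \<psi> x = frechet_derivative \<psi> (at x) b"

primrec Ck :: "nat \<Rightarrow> ('a::euclidean_space \<Rightarrow> real) \<Rightarrow> bool" where
  "Ck 0 \<psi> \<longleftrightarrow> continuous_on UNIV \<psi>"
| "Ck (Suc k) \<psi> \<longleftrightarrow> (\<forall>x. \<psi> differentiable at x) \<and> (\<forall>b\<in>Basis. Ck k (partial_deriv b \<psi>))"

text \<open>\<open>C\<^sub>c\<^sup>\<infinity>(\<Omega>)\<close>, its elements being extended by zero to the whole space.\<close>

definition test_functions :: "'a::euclidean_space set \<Rightarrow> ('a \<Rightarrow> real) set" where
  "test_functions \<Omega> = {\<psi>. (\<forall>k. Ck k \<psi>) \<and>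
     compact (closure {x. \<psi> x \<noteq> 0}) \<and> closure {x. \<psi> x \<noteq> 0} \<subseteq> \<Omega>}"

definition locally_integrable :: "'a::euclidean_space set \<Rightarrow> ('a \<Rightarrow> 'b::euclidean_space) \<Rightarrow> bool" where
  "locally_integrable \<Omega> v \<longleftrightarrow> (\<forall>K. compact K \<and> K \<subseteq> \<Omega> \<longrightarrow> integrable (lebesgue_on K) v)"

definition is_weak_grad :: "'a::euclidean_space set \<Rightarrow> ('a \<Rightarrow> real) \<Rightarrow> ('a \<Rightarrow> 'a) \<Rightarrow> bool" where
  "is_weak_grad \<Omega> v V \<longleftrightarrow> locally_integrable \<Omega> v \<and> locally_integrable \<Omega> V \<and>
     (\<forall>b\<in>Basis. \<forall>\<psi>\<in>test_functions \<Omega>.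
        (\<integral>x. v x * partial_deriv b \<psi> x \<partial>lebesgue_on \<Omega>) =
        - (\<integral>x. (V x \<bullet> b) * \<psi> x \<partial>lebesgue_on \<Omega>))"

definition weak_grad :: "'a::euclidean_space set \<Rightarrow> ('a \<Rightarrow> real) \<Rightarrow> ('a \<Rightarrow> 'a)" where
  "weak_grad \<Omega> v = (SOME V. is_weak_grad \<Omega> v V)"

definition W1p :: "real \<Rightarrow> 'a::euclidean_space set \<Rightarrow> ('a \<Rightarrow> real) set" where
  "W1p p \<Omega> = {v \<in> Lp p \<Omega>. \<exists>V\<in>Lp p \<Omega>. is_weak_grad \<Omega> v V}"

definition W1p_norm :: "real \<Rightarrow> 'a::euclidean_space set \<Rightarrow> ('a \<Rightarrow> real) \<Rightarrow> real" where
  "W1p_norm p \<Omega> v = (Lp_norm p \<Omega> v powr p + Lp_norm p \<Omega> (weak_grad \<Omega> v) powr p) powr (1 / p)"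

definition W1p0 :: "real \<Rightarrow> 'a::euclidean_space set \<Rightarrow> ('a \<Rightarrow> real) set" where
  "W1p0 p \<Omega> = {v \<in> W1p p \<Omega>. \<forall>\<delta>>0. \<exists>\<psi>\<in>test_functions \<Omega>. W1p_norm p \<Omega> (\<lambda>x. v x - \<psi> x) < \<delta>}"

abbreviation H10 :: "'a::euclidean_space set \<Rightarrow> ('a \<Rightarrow> real) set" where
  "H10 \<equiv> W1p0 2"

text \<open>Norm in \<open>W\<^sup>-\<^sup>1\<^sup>,\<^sup>s(\<Omega>) = (W\<^sub>0\<^sup>1\<^sup>,\<^sup>s\<^sup>'(\<Omega>))\<^sup>*\<close>, \<open>s' = s / (s - 1)\<close>, of the functional
  \<open>v \<mapsto> \<integral> r v\<close> induced by a function \<open>r\<close>.\<close>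

definition Wm1_norm :: "real \<Rightarrow> 'a::euclidean_space set \<Rightarrow> ('a \<Rightarrow> real) \<Rightarrow> ereal" where
  "Wm1_norm s \<Omega> r =
     (SUP v \<in> {v \<in> W1p0 (s / (s - 1)) \<Omega>. W1p_norm (s / (s - 1)) \<Omega> v \<le> 1}.
        ereal \<bar>\<integral>x. r x * v x \<partial>lebesgue_on \<Omega>\<bar>)"

text \<open>Integrability is required explicitly because the Bochner integral of a non-integrable
  function is \<open>0\<close>.\<close>

definition L2_embeds_Wm1 :: "real \<Rightarrow> 'a::euclidean_space set \<Rightarrow> bool" where
  "L2_embeds_Wm1 s \<Omega> \<longleftrightarrow>
     (\<exists>C. \<forall>r\<in>Lp 2 \<Omega>.
        (\<forall>v\<in>W1p0 (s / (s - 1)) \<Omega>. integrable (lebesgue_on \<Omega>) (\<lambda>x. r x * v x)) \<and>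
        Wm1_norm s \<Omega> r \<le> ereal (C * Lp_norm 2 \<Omega> r))"


section \<open>Functions of bounded variation\<close>

text \<open>\<open>\<nu>\<close> is the finite vector-valued Radon measure \<open>Dv\<close> on the Borel subsets of \<open>\<Omega>\<close>.  Its
  components are finite signed measures, i.e. differences \<open>P b - N b\<close> of finite Borel measures
  (automatically Radon), and integration against a component is defined through such a
  decomposition.\<close>

definition is_distr_deriv ::
    "'a::euclidean_space set \<Rightarrow> ('a \<Rightarrow> real) \<Rightarrow> ('a set \<Rightarrow> 'a) \<Rightarrow> bool" where
  "is_distr_deriv \<Omega> v \<nu> \<longleftrightarrow>
     (\<exists>P N :: 'a \<Rightarrow> 'a measure. \<forall>b\<in>Basis.
        finite_measure (P b) \<and> sets (P b) = sets (restrict_space borel \<Omega>) \<and>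
        finite_measure (N b) \<and> sets (N b) = sets (restrict_space borel \<Omega>) \<and>
        (\<forall>A\<in>sets (restrict_space borel \<Omega>). \<nu> A \<bullet> b = measure (P b) A - measure (N b) A) \<and>
        (\<forall>\<psi>\<in>test_functions \<Omega>.
           (\<integral>x. v x * partial_deriv b \<psi> x \<partial>lebesgue_on \<Omega>) =
           - ((\<integral>x. \<psi> x \<partial>P b) - (\<integral>x. \<psi> x \<partial>N b))))"

definition BV :: "'a::euclidean_space set \<Rightarrow> ('a \<Rightarrow> real) set" where
  "BV \<Omega> = {v. integrable (lebesgue_on \<Omega>) v \<and> (\<exists>\<nu>. is_distr_deriv \<Omega> v \<nu>)}"

definition distr_deriv :: "'a::euclidean_space set \<Rightarrow> ('a \<Rightarrow> real) \<Rightarrow> ('a set \<Rightarrow> 'a)" where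
  "distr_deriv \<Omega> v = (SOME \<nu>. is_distr_deriv \<Omega> v \<nu>)"

text \<open>\<open>|\<nu>|(\<Omega>)\<close>, with the Euclidean norm on the values of \<open>\<nu>\<close>.\<close>

definition variation_on :: "'a::euclidean_space set \<Rightarrow> ('a set \<Rightarrow> 'a) \<Rightarrow> ereal" where
  "variation_on \<Omega> \<nu> =
     (SUP A \<in> {A :: nat \<Rightarrow> 'a set. range A \<subseteq> sets (restrict_space borel \<Omega>) \<and>
                 disjoint_family A \<and> (\<Union>i. A i) = \<Omega>}.
        (\<Sum>i. ereal (norm (\<nu> (A i)))))"

definition TV :: "'a::euclidean_space set \<Rightarrow> ('a \<Rightarrow> real) \<Rightarrow> ereal" where
  "TV \<Omega> v = (if v \<in> BV \<Omega> then variation_on \<Omega> (distr_deriv \<Omega> v) else \<infinity>)"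

definition BV_norm :: "'a::euclidean_space set \<Rightarrow> ('a \<Rightarrow> real) \<Rightarrow> ereal" where
  "BV_norm \<Omega> v = ereal (\<integral>x. \<bar>v x\<bar> \<partial>lebesgue_on \<Omega>) + TV \<Omega> v"

definition local_minimizer_BV ::
    "'a::euclidean_space set \<Rightarrow> (('a \<Rightarrow> real) \<Rightarrow> ereal) \<Rightarrow> ('a \<Rightarrow> real) \<Rightarrow> bool" where
  "local_minimizer_BV \<Omega> J u \<longleftrightarrow> u \<in> BV \<Omega> \<and>
     (\<exists>\<delta>>0. \<forall>v\<in>BV \<Omega>. BV_norm \<Omega> (\<lambda>x. v x - u x) < ereal \<delta> \<longrightarrow> J u \<le> J v)"


section \<open>Convex subdifferential on \<open>L\<^sup>p(\<Omega>)\<close>\<close>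

text \<open>The dual of \<open>L\<^sup>p(\<Omega>)\<close>, \<open>1 < p < \<infinity>\<close>, is identified with \<open>L\<^sup>q(\<Omega>)\<close>, \<open>q = p / (p - 1)\<close>.
  The subdifferential is empty outside the effective domain, in particular if \<open>u\<close> is not
  in \<open>L\<^sup>p(\<Omega>)\<close>.\<close>

definition subdifferential_Lp ::
    "real \<Rightarrow> 'a::euclidean_space set \<Rightarrow> (('a \<Rightarrow> real) \<Rightarrow> ereal) \<Rightarrow> ('a \<Rightarrow> real) \<Rightarrow> ('a \<Rightarrow> real) set" where
  "subdifferential_Lp p \<Omega> H u =
     {\<xi> \<in> Lp (p / (p - 1)) \<Omega>. u \<in> Lp p \<Omega> \<and> \<bar>H u\<bar> \<noteq> \<infinity> \<and>
        (\<forall>v\<in>Lp p \<Omega>. H u + ereal (\<integral>x. \<xi> x * (v x - u x) \<partial>lebesgue_on \<Omega>) \<le> H v)}"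


definition weighted_sum ::
    "real \<Rightarrow> ('a \<Rightarrow> real) set \<Rightarrow> real \<Rightarrow> ('a \<Rightarrow> real) set \<Rightarrow> ('a \<Rightarrow> real) set" where
  "weighted_sum \<alpha> A \<beta> B = {(\<lambda>x. \<alpha> * \<xi> x + \<beta> * \<eta> x) | \<xi> \<eta>. \<xi> \<in> A \<and> \<eta> \<in> B}"


section \<open>Multi-bang penalty\<close>

text \<open>In the middle branch \<open>i\<close> is an index with \<open>t \<in> [us i, us (i + 1)]\<close>; adjacent branches agree
  at the nodes.\<close>

definition multibang :: "(nat \<Rightarrow> real) \<Rightarrow> nat \<Rightarrow> real \<Rightarrow> real" where
  "multibang us m t =
     (if t \<le> us 1 then - us m * t
      else if us m \<le> t then us m * t - (us m)\<^sup>2 / 2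
      else let i = Max {i \<in> {1..<m}. us i \<le> t}
           in ((us i + us (Suc i)) * t - us i * us (Suc i)) / 2)"

lemma multibang_middle:
  assumes "us 1 = 0" and mono: "\<And>i. i \<in> {1..<m} \<Longrightarrow> us i < us (Suc i)"
    and i: "i \<in> {1..<m}" and t: "us i \<le> t" "t \<le> us (Suc i)"
  shows "multibang us m t = ((us i + us (Suc i)) * t - us i * us (Suc i)) / 2"
proof -
  have le: "us j < us k" if "1 \<le> j" "j < k" "k \<le> m" for j k
    using that(2,3)
  proof (induction k)
    case (Suc k)
    have "us k < us (Suc k)" using Suc.prems \<open>1 \<le> j\<close> by (intro mono) auto
    then show ?case using Suc by (cases "j = k") auto
  qed simp
  show ?thesis
  proof (cases "t \<le> us 1")
    case True
    have "i = 1"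
    proof (rule ccontr)
      assume "i \<noteq> 1"
      then have "us 1 < us i" using i by (intro le) auto
      then show False using True t by simp
    qed
    then show ?thesis using True t \<open>us 1 = 0\<close> by (simp add: multibang_def)
  next
    case F1: False
    show ?thesis
    proof (cases "us m \<le> t")
      case True
      have "Suc i = m"
      proof (rule ccontr)
        assume "Suc i \<noteq> m"
        then have "us (Suc i) < us m" using i by (intro le) auto
        then show False using True t by simp
      qed
      then show ?thesis using F1 True t
        by (simp add: multibang_def power2_eq_square field_simps)
    next
      case F2: False
      show ?thesis
      proof (cases "t = us (Suc i)")
        case True
        have "Suc i \<in> {1..<m}" using i F2 True by (cases "Suc i = m") auto
        moreover have "j \<le> Suc i" if "j \<in> {1..<m}" "us j \<le> t" for j
          using le[of "Suc i" j] that i True by force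
        ultimately have "Max {i \<in> {1..<m}. us i \<le> t} = Suc i"
          using True by (intro Max_eqI) auto
        then show ?thesis using F1 F2 True
          by (simp add: multibang_def field_simps)
      next
        case False
        have "j \<le> i" if "j \<in> {1..<m}" "us j \<le> t" for j
          using le[of "Suc i" j] that i False t by (cases "j = Suc i") force+
        then have "Max {i \<in> {1..<m}. us i \<le> t} = i"
          using i t by (intro Max_eqI) auto
        then show ?thesis using F1 F2 by (simp add: multibang_def)
      qed
    qed
  qed
qed

definition multibang_functional ::
    "'a::euclidean_space set \<Rightarrow> (nat \<Rightarrow> real) \<Rightarrow> nat \<Rightarrow> ('a \<Rightarrow> real) \<Rightarrow> real" where
  "multibang_functional \<Omega> us m u = (\<integral>x. multibang us m (u x) \<partial>lebesgue_on \<Omega>)"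


section \<open>Smoothed truncation\<close>

definition rho :: "real \<Rightarrow> real \<Rightarrow> real \<Rightarrow> real" where
  "rho \<epsilon> um t =
     (if t \<le> - \<epsilon> then - \<epsilon>
      else if t \<le> 0 then - (1 / \<epsilon>\<^sup>2) * t ^ 3 - (1 / \<epsilon>) * t\<^sup>2 + t
      else if t \<le> um then t
      else if t \<le> um + \<epsilon> then
        - (1 / \<epsilon>\<^sup>2) * t ^ 3 + (3 * um + \<epsilon>) / \<epsilon>\<^sup>2 * t\<^sup>2
        + (\<epsilon>\<^sup>2 - 2 * um * \<epsilon> - 3 * um\<^sup>2) / \<epsilon>\<^sup>2 * t + (um ^ 3 + um\<^sup>2 * \<epsilon>) / \<epsilon>\<^sup>2
      else um + \<epsilon>)"

definition phi :: "real \<Rightarrow> real \<Rightarrow> real \<Rightarrow> real \<Rightarrow> real" where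
  "phi \<epsilon> umin umax t = umin + rho \<epsilon> (umax - umin) t"

definition superpos :: "real \<Rightarrow> real \<Rightarrow> real \<Rightarrow> ('a \<Rightarrow> real) \<Rightarrow> 'a \<Rightarrow> real" where
  "superpos \<epsilon> umin umax v = (\<lambda>x. phi \<epsilon> umin umax (v x))"

definition superpos_deriv :: "real \<Rightarrow> real \<Rightarrow> real \<Rightarrow> ('a \<Rightarrow> real) \<Rightarrow> 'a \<Rightarrow> real" where
  "superpos_deriv \<epsilon> umin umax v = (\<lambda>x. deriv (phi \<epsilon> umin umax) (v x))"


section \<open>State equation and tracking functional\<close>

definition admissible_coeff :: "'a::euclidean_space set \<Rightarrow> real \<Rightarrow> real \<Rightarrow> real \<Rightarrow> ('a \<Rightarrow> real) set" where
  "admissible_coeff \<Omega> \<epsilon> umin umax = {w \<in> Linfty \<Omega>.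
     AE x in lebesgue_on \<Omega>. umin / 2 - 2 * \<epsilon> < w x \<and> w x < 2 * umax + 2 * \<epsilon>}"

text \<open>\<open>y\<close> solves \<open>-div (w \<nabla>y) = r\<close> in \<open>\<Omega>\<close>, \<open>y = 0\<close> on the boundary.\<close>

definition weak_solution ::
    "'a::euclidean_space set \<Rightarrow> ('a \<Rightarrow> real) \<Rightarrow> ('a \<Rightarrow> real) \<Rightarrow> ('a \<Rightarrow> real) \<Rightarrow> bool" where
  "weak_solution \<Omega> w r y \<longleftrightarrow> y \<in> H10 \<Omega> \<and>
     (\<forall>v\<in>H10 \<Omega>. (\<integral>x. w x * (weak_grad \<Omega> y x \<bullet> weak_grad \<Omega> v x) \<partial>lebesgue_on \<Omega>) =
                 (\<integral>x. r x * v x \<partial>lebesgue_on \<Omega>))"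

definition state :: "'a::euclidean_space set \<Rightarrow> ('a \<Rightarrow> real) \<Rightarrow> ('a \<Rightarrow> real) \<Rightarrow> 'a \<Rightarrow> real" where
  "state \<Omega> f w = (SOME y. weak_solution \<Omega> w f y)"

definition adjoint_state ::
    "'a::euclidean_space set \<Rightarrow> ('a \<Rightarrow> real) \<Rightarrow> ('a \<Rightarrow> real) \<Rightarrow> ('a \<Rightarrow> real) \<Rightarrow> 'a \<Rightarrow> real" where
  "adjoint_state \<Omega> f z w = (SOME p. weak_solution \<Omega> w (\<lambda>x. - (state \<Omega> f w x - z x)) p)"

definition tracking ::
    "'a::euclidean_space set \<Rightarrow> ('a \<Rightarrow> real) \<Rightarrow> ('a \<Rightarrow> real) \<Rightarrow> ('a \<Rightarrow> real) \<Rightarrow> real" where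
  "tracking \<Omega> f z w = 1 / 2 * (Lp_norm 2 \<Omega> (\<lambda>x. state \<Omega> f w x - z x))\<^sup>2"

text \<open>The function representing the Frechet derivative of \<open>tracking\<close> with respect to \<open>w\<close>.\<close>

definition tracking_deriv ::
    "'a::euclidean_space set \<Rightarrow> ('a \<Rightarrow> real) \<Rightarrow> ('a \<Rightarrow> real) \<Rightarrow> ('a \<Rightarrow> real) \<Rightarrow> 'a \<Rightarrow> real" where
  "tracking_deriv \<Omega> f z w =
     (\<lambda>x. weak_grad \<Omega> (state \<Omega> f w) x \<bullet> weak_grad \<Omega> (adjoint_state \<Omega> f z w) x)"

definition regularity_exponent ::
    "'a::euclidean_space set \<Rightarrow> real \<Rightarrow> real \<Rightarrow> real \<Rightarrow> real \<Rightarrow> bool" where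
  "regularity_exponent \<Omega> \<epsilon> umin umax s \<longleftrightarrow> s > 2 \<and> L2_embeds_Wm1 s \<Omega> \<and>
     (\<exists>K>0. \<forall>w\<in>admissible_coeff \<Omega> \<epsilon> umin umax. \<forall>r\<in>Lp 2 \<Omega>. \<forall>y.
        weak_solution \<Omega> w r y \<longrightarrow>
        y \<in> W1p s \<Omega> \<and> ereal (W1p_norm s \<Omega> y) \<le> ereal K * Wm1_norm s \<Omega> r)"

definition objective ::
    "'a::euclidean_space set \<Rightarrow> real \<Rightarrow> real \<Rightarrow> real \<Rightarrow> real \<Rightarrow> real \<Rightarrow> (nat \<Rightarrow> real) \<Rightarrow> nat \<Rightarrow>
     ('a \<Rightarrow> real) \<Rightarrow> ('a \<Rightarrow> real) \<Rightarrow> ('a \<Rightarrow> real) \<Rightarrow> ereal" where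
  "objective \<Omega> \<alpha> \<beta> \<epsilon> umin umax us m f z u =
     ereal (tracking \<Omega> f z (superpos \<epsilon> umin umax u))
     + ereal \<alpha> * ereal (multibang_functional \<Omega> us m u)
     + ereal \<beta> * TV \<Omega> u"

end

theory Submission
  imports Defs "HOL-Library.Function_Algebras"
begin

text \<open>
  The map \<open>F \<circ> \<Phi>\<close> is differentiable only in bounded directions, so \<open>ubar\<close> is first
  compared with its truncation at \<open>R = umax - umin + \<epsilon>\<close>.  Beyond \<open>\<plusminus>R\<close> the function \<open>phi\<close> is constant,
  \<open>TV\<close> does not increase under composition with 1-Lipschitz maps, and \<open>G\<close> strictly decreases;
  hence \<open>\<bar>ubar\<bar> \<le> R\<close> almost everywhere.  Minimality along the segment from \<open>ubar\<close> to a bounded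
  \<open>v \<in> BV\<close> now gives, with \<open>h = v - ubar\<close>,
  \<open>0 \<le> \<integral> F' \<Phi>' h + \<alpha> \<integral> max (g'\<^sub>-(ubar) h) (g'\<^sub>+(ubar) h) + \<beta> (TV v - TV ubar)\<close>,
  where the derivative of the tracking term is computed with the adjoint state.  Truncating \<open>v\<close>
  extends the inequality to all of \<open>BV \<inter> L\<^sup>p\<close>, \<open>p = s / (s - 2)\<close>.  By Hahn-Banach and Radon-Nikodym the
  middle term can be replaced by \<open>\<integral> \<xi> h\<close> with a measurable \<open>\<xi>\<close> between \<open>\<alpha> g'\<^sub>-(ubar)\<close> and
  \<open>\<alpha> g'\<^sub>+(ubar)\<close>.  Then \<open>\<xi> / \<alpha>\<close> is a subgradient of \<open>G\<close>, and the inequality says that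
  \<open>(- F' \<Phi>' - \<xi>) / \<beta>\<close> is one of \<open>TV\<close>.

  The contraction property of \<open>TV\<close> uses the same representation: difference quotients bound
  \<open>\<phi> \<mapsto> \<integral> T(u) \<partial>\<^sub>e\<phi>\<close> by \<open>\<integral> \<bar>\<phi>\<bar> d\<bar>D\<^sub>eu\<bar>\<close>, so every directional derivative of \<open>T \<circ> u\<close> has a density of
  modulus at most one with respect to \<open>\<bar>D\<^sub>eu\<bar>\<close>.
\<close>

section \<open>Functions of class \<open>C\<^sup>k\<close>\<close>

text \<open>The objective is not convex and minimality is only local in the BV norm, whereas the
  subdifferentials live on L^p with p = s / (s - 2), the conjugate of the exponent s / 2 of the
  reduced gradient. So a sum rule for convex subdifferentials cannot be the starting point: one
  variational inequality on BV is derived first, and only its nonsmooth middle term is split off.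
  Since the penalty is Lipschitz, that term is controlled by the L^1 norm, which makes the
  multiplier bounded.

  \<open>state\<close> and \<open>adjoint_state\<close> are \<open>SOME\<close> choices, so nothing
  is known about them until weak solutions are shown to exist. Likewise \<open>TV\<close> sees a
  function through a measure picked by \<open>SOME\<close>; it becomes computable by writing Dv =
  \<Theta> \<sigma> and TV v as the integral of |\<Theta>| against \<sigma>.

  Smoothness enters mainly through one fact: test functions determine the integrals of bounded Borel
  functions. It yields the uniqueness of weak gradients and of derivative measures, and it turns the
  fundamental theorem of calculus into the difference estimate behind the contraction property of
  TV.\<close>

lemma partial_deriv_eq:
  "(f has_derivative f') (at x) \<Longrightarrow> partial_deriv b f x = f' b"
  unfolding partial_deriv_def by (metis frechet_derivative_at)

text \<open>\<open>Ck\<close> asks for continuity only at the bottom of its recursion, so this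
  descent is where differentiability becomes continuity. The product rule relies on it, because it
  multiplies an undifferentiated factor by a derivative of the other one.\<close>

lemma Ck_Suc_D: "Ck (Suc k) \<psi> \<Longrightarrow> Ck k \<psi>"
proof (induction k arbitrary: \<psi>)
  case 0
  then show ?case
    by (auto intro!: continuous_at_imp_continuous_on differentiable_imp_continuous_within)
next
  case (Suc k)
  then show ?case by (metis Ck.simps(2))
qed

lemma Ck_const: "Ck k (\<lambda>x. c)"
proof (induction k arbitrary: c)
  case (Suc k)
  have "partial_deriv b (\<lambda>x. c) = (\<lambda>x::'a. 0)" for b
    by (rule ext, subst partial_deriv_eq[OF has_derivative_const]) simp
  with Suc show ?case by simp
qed simp

lemma partial_deriv_add:
  assumes "f differentiable at x" "g differentiable at x"
  shows "partial_deriv b (\<lambda>x. f x + g x) x = partial_deriv b f x + partial_deriv b g x"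
  using assms unfolding frechet_derivative_works
  by (subst partial_deriv_eq[OF has_derivative_add]) (auto simp: partial_deriv_def)

lemma partial_deriv_cmult:
  assumes "f differentiable at x"
  shows "partial_deriv b (\<lambda>x. c * f x) x = c * partial_deriv b f x"
  using assms unfolding frechet_derivative_works
  by (subst partial_deriv_eq[OF has_derivative_mult_right]) (auto simp: partial_deriv_def)

lemma partial_deriv_mult:
  assumes "f differentiable at x" "g differentiable at x"
  shows "partial_deriv b (\<lambda>x. f x * g x) x = f x * partial_deriv b g x + partial_deriv b f x * g x"
  using assms unfolding frechet_derivative_works
  by (subst partial_deriv_eq[OF has_derivative_mult]) (auto simp: partial_deriv_def)

lemma partial_deriv_shift:
  assumes "f differentiable at (x - v)"
  shows "partial_deriv b (\<lambda>x. f (x - v)) x = partial_deriv b f (x - v)"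
proof -
  have "(f has_derivative frechet_derivative f (at (x - v))) (at (x - v))"
    using assms by (simp add: frechet_derivative_works)
  then have "((\<lambda>x. f (x - v)) has_derivative frechet_derivative f (at (x - v))) (at x)"
    by (rule has_derivative_compose[rotated]) (auto intro!: derivative_eq_intros)
  from partial_deriv_eq[OF this] show ?thesis by (simp add: partial_deriv_def)
qed

lemma Ck_add: "Ck k f \<Longrightarrow> Ck k g \<Longrightarrow> Ck k (\<lambda>x. f x + g x)"
proof (induction k arbitrary: f g)
  case 0 then show ?case by (auto intro: continuous_intros)
next
  case (Suc k)
  have "partial_deriv b (\<lambda>x. f x + g x) = (\<lambda>x. partial_deriv b f x + partial_deriv b g x)" for b
    using Suc.prems by (intro ext partial_deriv_add) auto
  with Suc show ?case by auto
qed

lemma Ck_cmult: "Ck k f \<Longrightarrow> Ck k (\<lambda>x. c * f x)"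
proof (induction k arbitrary: f)
  case 0 then show ?case by (auto intro: continuous_intros)
next
  case (Suc k)
  have "partial_deriv b (\<lambda>x. c * f x) = (\<lambda>x. c * partial_deriv b f x)" for b
    using Suc.prems by (intro ext partial_deriv_cmult) auto
  with Suc show ?case by auto
qed

lemma Ck_mult: "Ck k f \<Longrightarrow> Ck k g \<Longrightarrow> Ck k (\<lambda>x. f x * g x)"
proof (induction k arbitrary: f g)
  case 0 then show ?case by (auto intro: continuous_intros)
next
  case (Suc k)
  have "partial_deriv b (\<lambda>x. f x * g x) = (\<lambda>x. f x * partial_deriv b g x + partial_deriv b f x * g x)" for b
    using Suc.prems by (intro ext partial_deriv_mult) auto
  with Suc Ck_Suc_D[of k f] Ck_Suc_D[of k g] show ?case
    by (auto intro!: Ck_add)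
qed

lemma Ck_prod: "finite A \<Longrightarrow> (\<And>i. i \<in> A \<Longrightarrow> Ck k (f i)) \<Longrightarrow> Ck k (\<lambda>x. \<Prod>i\<in>A. f i x)"
  by (induction A rule: finite_induct) (auto intro: Ck_const Ck_mult)

lemma Ck_sum: "finite A \<Longrightarrow> (\<And>i. i \<in> A \<Longrightarrow> Ck k (f i)) \<Longrightarrow> Ck k (\<lambda>x. \<Sum>i\<in>A. f i x)"
  by (induction A rule: finite_induct) (auto intro: Ck_const Ck_add)

lemma Ck_shift: "Ck k f \<Longrightarrow> Ck k (\<lambda>x. f (x - v))"
proof (induction k arbitrary: f)
  case 0 then show ?case
    by (auto intro!: continuous_intros elim: continuous_on_compose2)
next
  case (Suc k)
  have d: "(\<lambda>x. f (x - v)) differentiable at x" for x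
    using Suc.prems by (intro differentiable_compose[where g="\<lambda>x. x - v" and f=f]) auto
  have "partial_deriv b (\<lambda>x. f (x - v)) = (\<lambda>x. partial_deriv b f (x - v))" for b
    using Suc.prems by (intro ext partial_deriv_shift) auto
  with Suc d show ?case by auto
qed

lemma Ck_inner: "Ck k (\<lambda>x. x \<bullet> e)"
proof (cases k)
  case (Suc n)
  have "partial_deriv b (\<lambda>x. x \<bullet> e) = (\<lambda>x. b \<bullet> e)" for b
    by (rule ext, rule partial_deriv_eq[where f' = "\<lambda>x. x \<bullet> e"]) (auto intro!: derivative_eq_intros)
  then show ?thesis using Suc by (auto intro: Ck_const)
qed (auto intro!: continuous_intros)

section \<open>A smooth function vanishing on the negative half-line\<close>

text \<open>The index makes the family closed under differentiation up to linear combinations: the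
  derivative of \<open>flat n\<close> is \<open>flat (n + 2) - n * flat (n + 1)\<close>. Smoothness
  of exp (-1/t), extended by zero, then follows by one induction over all n simultaneously.\<close>

definition flat :: "nat \<Rightarrow> real \<Rightarrow> real" where
  "flat n t = (if t \<le> 0 then 0 else exp (- 1 / t) / t ^ n)"

text \<open>From the right, the substitution x = 1/t turns this into the decay of x^n exp (-x) at
  infinity.\<close>

lemma flat_tendsto_0: "(flat n \<longlongrightarrow> 0) (at 0)"
proof -
  have "((\<lambda>t. (inverse t) ^ n / exp (inverse t)) \<longlongrightarrow> 0) (at_right (0::real))"
    by (rule filterlim_compose[OF tendsto_power_div_exp_0 filterlim_inverse_at_top_right])
  moreover have "\<forall>\<^sub>F t in at_right 0. (inverse t) ^ n / exp (inverse t) = flat n t"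
    using eventually_at_right_less[of "0::real"]
    by eventually_elim (simp add: flat_def exp_minus field_simps power_inverse)
  ultimately have R: "(flat n \<longlongrightarrow> 0) (at_right 0)"
    by (blast intro: Lim_transform_eventually)
  have "\<forall>\<^sub>F t in at_left (0::real). flat n t = 0"
    using eventually_at_left_real[of "-1" "0::real"] by (auto elim!: eventually_mono simp: flat_def)
  then have L: "(flat n \<longlongrightarrow> 0) (at_left 0)"
    by (simp add: tendsto_eventually)
  from L R show ?thesis by (simp add: filterlim_split_at)
qed

lemma flat_deriv:
  "(flat n has_real_derivative (flat (n + 2) t - of_nat n * flat (n + 1) t)) (at t)"
proof -
  consider "t < 0" | "t = 0" | "t > 0" by linarith
  then show ?thesis
  proof cases
    case 1
    have "(flat n has_real_derivative 0) (at t)"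
      by (rule has_field_derivative_transform_within_open[of "\<lambda>_. 0" 0 t "{..<0}"])
        (use 1 in \<open>auto simp: flat_def\<close>)
    then show ?thesis using 1 by (simp add: flat_def)
  next
    case 2
    \<comment> \<open>The difference quotient of \<open>flat n\<close> at 0 is
      \<open>flat (Suc n)\<close> itself.\<close>
    have "((\<lambda>y. (flat n y - flat n 0) / (y - 0)) \<longlongrightarrow> 0) (at 0)"
      by (rule Lim_transform_eventually[OF flat_tendsto_0[of "Suc n"]])
         (auto intro!: eventuallyI simp: flat_def)
    then show ?thesis using 2 by (simp add: has_field_derivative_iff flat_def)
  next
    case 3
    have "((\<lambda>t. exp (- 1 / t) / t ^ n) has_real_derivative
        (exp (- 1 / t) * (1 / t\<^sup>2) * t ^ n - exp (-1/t) * (of_nat n * t ^ (n - 1))) / (t ^ n * t ^ n)) (at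
          t)"
      using 3 by (auto intro!: derivative_eq_intros simp: power2_eq_square)
    also have "(exp (- 1 / t) * (1 / t\<^sup>2) * t ^ n - exp (-1/t) * (of_nat n * t ^ (n - 1))) / (t ^ n * t ^ n)
        = flat (n + 2) t - of_nat n * flat (n + 1) t"
    proof (cases n)
      case 0 then show ?thesis using 3 by (simp add: flat_def power2_eq_square)
    next
      case (Suc k)
      then show ?thesis using 3
        by (simp add: flat_def divide_simps) (simp add: algebra_simps, simp add: power2_eq_square)
    qed
    finally show ?thesis
      by (rule has_field_derivative_transform_within_open[of _ _ _ "{0<..}"])
        (use 3 in \<open>auto simp: flat_def\<close>)
  qed
qed

lemma flat_affine_has_derivative:
  "((\<lambda>x::'a::euclidean_space. flat n (x \<bullet> e + c)) has_derivative
     (\<lambda>h. (flat (n + 2) (x \<bullet> e + c) - of_nat n * flat (n + 1) (x \<bullet> e + c)) * (h \<bullet> e))) (at x)"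
proof -
  have "((\<lambda>x::'a. x \<bullet> e + c) has_derivative (\<lambda>h. h \<bullet> e)) (at x)"
    by (auto intro!: derivative_eq_intros)
  moreover have "(flat n has_derivative (*) (flat (n + 2) (x \<bullet> e + c) - of_nat n * flat (n + 1) (x \<bullet> e
    + c)))
      (at (x \<bullet> e + c))"
    using flat_deriv has_field_derivative_def by blast
  ultimately show ?thesis by (rule has_derivative_compose)
qed

lemma Ck_flat: "Ck k (\<lambda>x::'a::euclidean_space. flat n (x \<bullet> e + c))"
proof (induction k arbitrary: n)
  case 0
  show ?case
    using flat_affine_has_derivative[of n e c]
    by (auto intro!: continuous_at_imp_continuous_on has_derivative_continuous)
next
  case (Suc k)
  have "partial_deriv b (\<lambda>x::'a. flat n (x \<bullet> e + c)) =
     (\<lambda>x. (b \<bullet> e) * (flat (n + 2) (x \<bullet> e + c) + (- of_nat n) * flat (n + 1) (x \<bullet> e + c)))" for b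
    by (rule ext, subst partial_deriv_eq[OF flat_affine_has_derivative]) (simp add: algebra_simps)
  moreover have "Ck k (\<lambda>x::'a. (b \<bullet> e) * (flat (n + 2) (x \<bullet> e + c) + (- of_nat n) * flat (n + 1) (x \<bullet> e
    + c)))" for b
    by (intro Ck_cmult Ck_add Suc)
  moreover have "(\<lambda>x::'a. flat n (x \<bullet> e + c)) differentiable at x" for x
    using flat_affine_has_derivative differentiable_def by blast
  ultimately show ?case by simp
qed

text \<open>A smooth function that vanishes off the open box for r > 0. The parameter r sharpens it:
  exp (-1 / (r t)) tends to 1 for every t > 0, so the bumps converge to the indicator of the box
  while staying between 0 and 1.\<close>

definition box_bump :: "'a::euclidean_space \<Rightarrow> 'a \<Rightarrow> real \<Rightarrow> 'a \<Rightarrow> real" where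
  "box_bump a b r x = (\<Prod>i\<in>Basis. flat 0 (r * (x \<bullet> i - a \<bullet> i)) * flat 0 (r * (b \<bullet> i - x \<bullet> i)))"

lemma Ck_box_bump: "Ck k (box_bump a b r)"
proof -
  have "Ck k (\<lambda>x. flat 0 (r * (x \<bullet> i - a \<bullet> i)))" for i
    using Ck_flat[of k 0 "r *\<^sub>R i" "- r * (a \<bullet> i)"] by (simp add: algebra_simps)
  moreover have "Ck k (\<lambda>x. flat 0 (r * (b \<bullet> i - x \<bullet> i)))" for i
    using Ck_flat[of k 0 "(- r) *\<^sub>R i" "r * (b \<bullet> i)"] by (simp add: algebra_simps)
  ultimately show ?thesis unfolding box_bump_def[abs_def] by (intro Ck_prod Ck_mult) auto
qed

lemma flat_0_bounds: "0 \<le> flat 0 t" "flat 0 t \<le> 1"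
  by (auto simp: flat_def)

lemma box_bump_bounds: "0 \<le> box_bump a b r x" "box_bump a b r x \<le> 1"
  unfolding box_bump_def
  by (auto intro!: prod_nonneg prod_le_1 mult_nonneg_nonneg mult_le_one flat_0_bounds)

lemma box_bump_eq_0:
  assumes "r > 0" "x \<notin> box a b"
  shows "box_bump a b r x = 0"
proof -
  obtain i where i: "i \<in> Basis" "x \<bullet> i \<le> a \<bullet> i \<or> b \<bullet> i \<le> x \<bullet> i"
    using assms(2) by (auto simp: mem_box not_less)
  then have "r * (x \<bullet> i - a \<bullet> i) \<le> 0 \<or> r * (b \<bullet> i - x \<bullet> i) \<le> 0"
    using assms(1) by (auto simp: mult_le_0_iff)
  then have "flat 0 (r * (x \<bullet> i - a \<bullet> i)) * flat 0 (r * (b \<bullet> i - x \<bullet> i)) = 0"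
    by (auto simp: flat_def)
  then show ?thesis unfolding box_bump_def using i by (intro prod_zero) auto
qed

lemma flat_0_scale_tendsto:
  assumes "t > 0" shows "(\<lambda>n. flat 0 (real (Suc n) * t)) \<longlonglongrightarrow> 1"
proof -
  have "(\<lambda>n. exp (- (1 / t) * inverse (real (Suc n)))) \<longlonglongrightarrow> exp (- (1 / t) * 0)"
    by (intro tendsto_intros LIMSEQ_inverse_real_of_nat)
  moreover have "exp (- (1 / t) * inverse (real (Suc n))) = flat 0 (real (Suc n) * t)" for n
  proof -
    have "0 < real (Suc n) * t" using assms by simp
    then have "\<not> real (Suc n) * t \<le> 0" by linarith
    then show ?thesis unfolding flat_def by (simp add: divide_simps mult.commute)
  qed
  ultimately show ?thesis by simp
qed

lemma box_bump_tendsto: "(\<lambda>n. box_bump a b (real (Suc n)) x) \<longlonglongrightarrow> indicator (box a b) x"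
proof (cases "x \<in> box a b")
  case True
  then have "(\<lambda>n. box_bump a b (real (Suc n)) x) \<longlonglongrightarrow> (\<Prod>i\<in>(Basis::'a set). 1 * 1)"
    unfolding box_bump_def
    by (intro tendsto_prod tendsto_mult flat_0_scale_tendsto) (auto simp: mem_box)
  then show ?thesis using True by simp
next
  case False
  then show ?thesis by (simp add: box_bump_eq_0 del: of_nat_Suc)
qed

section \<open>Test functions\<close>

lemma test_functionsI:
  assumes "\<And>k. Ck k \<psi>" "compact K" "K \<subseteq> \<Omega>" "\<And>x. x \<notin> K \<Longrightarrow> \<psi> x = 0"
  shows "\<psi> \<in> test_functions \<Omega>"
proof -
  have "closure {x. \<psi> x \<noteq> 0} \<subseteq> K"
    using assms by (intro closure_minimal compact_imp_closed) auto
  moreover from this have "compact (closure {x. \<psi> x \<noteq> 0})"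
    using assms(2) by (meson closed_closure compact_eq_bounded_closed bounded_subset)
  ultimately show ?thesis using assms unfolding test_functions_def by auto
qed

lemma test_functionsE:
  assumes "\<psi> \<in> test_functions \<Omega>"
  obtains K where "compact K" "K \<subseteq> \<Omega>" "\<And>x. x \<notin> K \<Longrightarrow> \<psi> x = 0"
  using assms that[of "closure {x. \<psi> x \<noteq> 0}"] closure_subset
  unfolding test_functions_def by (smt (verit) mem_Collect_eq subset_iff)

lemma test_Ck: "\<psi> \<in> test_functions \<Omega> \<Longrightarrow> Ck k \<psi>"
  by (simp add: test_functions_def)

lemma box_bump_test: "r > 0 \<Longrightarrow> cbox a b \<subseteq> \<Omega> \<Longrightarrow> box_bump a b r \<in> test_functions \<Omega>"
  by (rule test_functionsI[of _ "cbox a b"])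
    (use box_subset_cbox in \<open>auto intro!: Ck_box_bump box_bump_eq_0\<close>)

lemma test_mono: "\<psi> \<in> test_functions A \<Longrightarrow> A \<subseteq> B \<Longrightarrow> \<psi> \<in> test_functions B"
  by (auto simp: test_functions_def)

lemma test_outside: "\<psi> \<in> test_functions \<Omega> \<Longrightarrow> x \<notin> \<Omega> \<Longrightarrow> \<psi> x = 0"
  by (elim test_functionsE) auto

lemma test_mult:
  assumes "\<psi> \<in> test_functions \<Omega>" "\<And>k. Ck k \<zeta>"
  shows "(\<lambda>x. \<zeta> x * \<psi> x) \<in> test_functions \<Omega>"
  using assms(1) by (elim test_functionsE, intro test_functionsI)
    (auto intro!: Ck_mult assms test_Ck[OF assms(1)])

lemma test_cmult: "\<psi> \<in> test_functions \<Omega> \<Longrightarrow> (\<lambda>x. c * \<psi> x) \<in> test_functions \<Omega>"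
  by (intro test_mult Ck_const)

lemma test_minus: "\<psi> \<in> test_functions \<Omega> \<Longrightarrow> (\<lambda>x. - \<psi> x) \<in> test_functions \<Omega>"
  using test_cmult[of \<psi> \<Omega> "-1"] by simp

lemma test_add:
  assumes "\<psi> \<in> test_functions \<Omega>" "\<zeta> \<in> test_functions \<Omega>"
  shows "(\<lambda>x. \<psi> x + \<zeta> x) \<in> test_functions \<Omega>"
proof -
  obtain K where K: "compact K" "K \<subseteq> \<Omega>" "\<And>x. x \<notin> K \<Longrightarrow> \<psi> x = 0"
    using test_functionsE[OF assms(1)] by metis
  obtain L where L: "compact L" "L \<subseteq> \<Omega>" "\<And>x. x \<notin> L \<Longrightarrow> \<zeta> x = 0"
    using test_functionsE[OF assms(2)] by metis
  show ?thesis
    by (rule test_functionsI[of _ "K \<union> L"]) (use K L assms in \<open>auto intro!: Ck_add test_Ck[OF assms(1)]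
      test_Ck[OF assms(2)]\<close>)
qed

lemma test_zero: "(\<lambda>x. 0) \<in> test_functions \<Omega>"
  by (rule test_functionsI[of _ "{}"]) (auto intro: Ck_const)

lemma test_differentiable: "\<psi> \<in> test_functions \<Omega> \<Longrightarrow> \<psi> differentiable at x"
  using test_Ck[of \<psi> \<Omega> "Suc 0"] by simp

lemma test_has_derivative:
  assumes "\<psi> \<in> test_functions \<Omega>"
  shows "(\<psi> has_derivative (\<lambda>h. partial_deriv h \<psi> x)) (at x)"
  using test_differentiable[OF assms, of x] unfolding frechet_derivative_works partial_deriv_def
  by (simp add: eta_contract_eq)

lemma test_continuous: "\<psi> \<in> test_functions \<Omega> \<Longrightarrow> continuous_on A \<psi>"
  using test_Ck[of \<psi> \<Omega> 0] continuous_on_subset by (auto simp del: Ck.simps(2))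

lemma test_measurable: "\<psi> \<in> test_functions \<Omega> \<Longrightarrow> \<psi> \<in> borel_measurable borel"
  by (intro borel_measurable_continuous_onI test_continuous)

lemma partial_deriv_basis:
  assumes "f differentiable at x"
  shows "partial_deriv e f x = (\<Sum>b\<in>Basis. (e \<bullet> b) * partial_deriv b f x)"
proof -
  have "linear (frechet_derivative f (at x))"
    using assms by (rule linear_frechet_derivative)
  then interpret linear "frechet_derivative f (at x)" .
  have "frechet_derivative f (at x) e = frechet_derivative f (at x) (\<Sum>b\<in>Basis. (e \<bullet> b) *\<^sub>R b)"
    by (simp add: euclidean_representation)
  also have "\<dots> = (\<Sum>b\<in>Basis. (e \<bullet> b) * frechet_derivative f (at x) b)"
    by (simp add: sum scale)
  finally show ?thesis by (simp add: partial_deriv_def)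
qed

lemma partial_deriv_outside:
  assumes "\<And>x. x \<notin> K \<Longrightarrow> \<psi> x = 0" "closed K" "x \<notin> K"
  shows "partial_deriv e \<psi> x = 0"
proof -
  have "(\<psi> has_derivative (\<lambda>h. 0)) (at x)"
    by (rule has_derivative_transform_within_open[of "\<lambda>_. 0" _ _ _ "- K"])
      (use assms in \<open>auto intro!: derivative_eq_intros\<close>)
  then show ?thesis by (rule partial_deriv_eq)
qed

lemma test_partial_deriv:
  assumes "\<psi> \<in> test_functions \<Omega>"
  shows "partial_deriv e \<psi> \<in> test_functions \<Omega>"
proof -
  obtain K where K: "compact K" "K \<subseteq> \<Omega>" "\<And>x. x \<notin> K \<Longrightarrow> \<psi> x = 0"
    using test_functionsE[OF assms] by metis
  have eq: "partial_deriv e \<psi> = (\<lambda>x. \<Sum>b\<in>Basis. (e \<bullet> b) * partial_deriv b \<psi> x)"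
    using test_differentiable[OF assms] by (intro ext partial_deriv_basis)
  have "Ck k (partial_deriv b \<psi>)" if "b \<in> Basis" for b k
    using test_Ck[OF assms, of "Suc k"] that by simp
  then have "Ck k (partial_deriv e \<psi>)" for k
    unfolding eq by (intro Ck_sum Ck_cmult) auto
  then show ?thesis
    using K by (intro test_functionsI[of _ K] partial_deriv_outside[of K]) (auto dest: compact_imp_closed)
qed

lemma test_bounded:
  assumes "\<psi> \<in> test_functions \<Omega>"
  obtains B where "\<And>x. \<bar>\<psi> x\<bar> \<le> B" "B > 0"
proof -
  obtain K where K: "compact K" "K \<subseteq> \<Omega>" "\<And>x. x \<notin> K \<Longrightarrow> \<psi> x = 0"
    using test_functionsE[OF assms] by metis
  have "bounded (\<psi> ` K)"
    using K test_continuous[OF assms] by (intro compact_imp_bounded compact_continuous_image)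
  then obtain B where B: "B > 0" "\<And>x. x \<in> K \<Longrightarrow> norm (\<psi> x) \<le> B"
    by (auto simp: bounded_pos)
  have "\<bar>\<psi> x\<bar> \<le> B" for x using B K(3)[of x] by (cases "x \<in> K") auto
  then show ?thesis using B that by blast
qed

text \<open>Translation moves the support, hence two domains: test functions on a small
  neighbourhood \<open>W\<close> of a compact set remain test functions of the larger
  \<open>\<Omega>\<close> after a short shift.\<close>

lemma test_shift:
  assumes "\<psi> \<in> test_functions W" "\<And>x. x \<in> W \<Longrightarrow> x + v \<in> \<Omega>"
  shows "(\<lambda>x. \<psi> (x - v)) \<in> test_functions \<Omega>"
proof -
  obtain K where K: "compact K" "K \<subseteq> W" "\<And>x. x \<notin> K \<Longrightarrow> \<psi> x = 0"
    using test_functionsE[OF assms(1)] by metis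
  show ?thesis
  proof (rule test_functionsI[of _ "(\<lambda>x. x + v) ` K"])
    show "compact ((\<lambda>x. x + v) ` K)"
      using K by (intro compact_continuous_image continuous_intros)
    show "\<psi> (x - v) = 0" if "x \<notin> (\<lambda>x. x + v) ` K" for x
      using that by (intro K(3)) force
  qed (use K assms in \<open>auto intro!: Ck_shift test_Ck[OF assms(1)]\<close>)
qed

text \<open>The map \<open>f\<close> and the free measure allow one statement to serve
  \<open>lborel\<close>, \<open>lebesgue_on \<Omega>\<close>, the derivative measure, and its
  product with the unit interval, where \<open>f\<close> is the shear (x, s) -> x - s v.\<close>

lemma test_integrable:
  assumes "\<psi> \<in> test_functions \<Omega>" "integrable M \<theta>" "f \<in> M \<rightarrow>\<^sub>M borel"
  shows "integrable M (\<lambda>x. \<psi> (f x) * \<theta> x)"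
proof -
  obtain B where B: "\<And>x. \<bar>\<psi> x\<bar> \<le> B" "B > 0" using test_bounded[OF assms(1)] by metis
  have [measurable]: "\<psi> \<in> borel_measurable borel" "\<theta> \<in> borel_measurable M" "f \<in> M \<rightarrow>\<^sub>M borel"
    using assms test_measurable by auto
  show ?thesis
  proof (rule Bochner_Integration.integrable_bound)
    show "integrable M (\<lambda>x. B * \<theta> x)" using assms by simp
    show "AE x in M. norm (\<psi> (f x) * \<theta> x) \<le> norm (B * \<theta> x)"
      using B by (auto simp: abs_mult intro!: mult_right_mono)
  qed measurable
qed

section \<open>Integrable functions tested against smooth functions\<close>

lemma integrable_indicator_comp:
  fixes \<theta> :: "'b \<Rightarrow> real"
  assumes "integrable M \<theta>" "f \<in> M \<rightarrow>\<^sub>M borel" "A \<in> sets borel"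
  shows "integrable M (\<lambda>x. indicator A (f x) * \<theta> x)"
proof (rule Bochner_Integration.integrable_bound[OF assms(1)])
  show "(\<lambda>x. indicator A (f x) * \<theta> x) \<in> borel_measurable M"
    using assms by measurable
qed (auto split: split_indicator)

lemma integral_indicator_sums:
  fixes \<theta> :: "'b \<Rightarrow> real" and A :: "nat \<Rightarrow> 'a::topological_space set"
  assumes \<theta>: "integrable M \<theta>" and f: "f \<in> M \<rightarrow>\<^sub>M borel"
    and A: "\<And>i. A i \<in> sets borel" "disjoint_family A"
  shows "(\<lambda>i. \<integral>x. indicator (A i) (f x) * \<theta> x \<partial>M) sums (\<integral>x. indicator (\<Union>i. A i) (f x) * \<theta> x \<partial>M)"
proof -
  have "(\<lambda>n. \<integral>x. indicator (\<Union>i<n. A i) (f x) * \<theta> x \<partial>M) \<longlonglongrightarrow> (\<integral>x. indicator (\<Union>i. A i) (f x) * \<theta> x \<partial>M)"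
  proof (rule integral_dominated_convergence[where w="\<lambda>x. norm (\<theta> x)"])
    show "AE x in M. (\<lambda>n. indicator (\<Union>i<n. A i) (f x) * \<theta> x) \<longlonglongrightarrow> indicator (\<Union>i. A i) (f x) * \<theta> x"
      by (intro AE_I2 tendsto_mult LIMSEQ_indicator_UN tendsto_const)
    show "(\<lambda>x. indicator (\<Union>i. A i) (f x) * \<theta> x) \<in> borel_measurable M"
      using integrable_indicator_comp[OF \<theta> f, of "\<Union>i. A i"] A by auto
    show "(\<lambda>x. indicator (\<Union>i<n. A i) (f x) * \<theta> x) \<in> borel_measurable M" for n
      using integrable_indicator_comp[OF \<theta> f, of "\<Union>i<n. A i"] A by auto
  qed (use \<theta> in \<open>auto split: split_indicator\<close>)
  moreover have "(\<integral>x. indicator (\<Union>i<n. A i) (f x) * \<theta> x \<partial>M) = (\<Sum>i<n. \<integral>x. indicator (A i) (f x) * \<theta> x \<partial>M)"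
    for n
  proof -
    have "indicator (\<Union>i<n. A i) y = (\<Sum>i<n. indicator (A i) y :: real)" for y
      by (intro indicator_UN_disjoint) (use A in \<open>auto simp: disjoint_family_on_def\<close>)
    then have "(\<integral>x. indicator (\<Union>i<n. A i) (f x) * \<theta> x \<partial>M) = (\<integral>x. (\<Sum>i<n. indicator (A i) (f x) * \<theta> x) \<partial>M)"
      by (simp add: sum_distrib_right)
    also have "\<dots> = (\<Sum>i<n. \<integral>x. indicator (A i) (f x) * \<theta> x \<partial>M)"
      by (intro Bochner_Integration.integral_sum integrable_indicator_comp assms)
    finally show ?thesis .
  qed
  ultimately show ?thesis by (simp add: sums_def)
qed

text \<open>The two sides are signed measures evaluated at A, the images of \<theta> M under f and
  of \<eta> N under g. Box bumps show that they agree on open boxes whose closure lies in \<Omega>;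
  a Dynkin argument inside each box and a countable cover by boxes do the rest. The source spaces
  may differ, so that Lebesgue measure can be compared with a product measure.\<close>

lemma test_functions_determine_sets:
  fixes \<Omega> :: "'a::euclidean_space set" and \<theta> :: "'b \<Rightarrow> real" and \<eta> :: "'c \<Rightarrow> real"
  assumes \<Omega>: "open \<Omega>" and f: "f \<in> M \<rightarrow>\<^sub>M borel" and g: "g \<in> N \<rightarrow>\<^sub>M borel"
    and \<theta>: "integrable M \<theta>" and \<eta>: "integrable N \<eta>"
    and eq: "\<And>\<psi>. \<psi> \<in> test_functions \<Omega> \<Longrightarrow> (\<integral>x. \<psi> (f x) * \<theta> x \<partial>M) = (\<integral>y. \<psi> (g y) * \<eta> y \<partial>N)"
    and A: "A \<in> sets borel" "A \<subseteq> \<Omega>"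
  shows "(\<integral>x. indicator A (f x) * \<theta> x \<partial>M) = (\<integral>y. indicator A (g y) * \<eta> y \<partial>N)"
proof -
  define D where "D A \<longleftrightarrow> (\<integral>x. indicator A (f x) * \<theta> x \<partial>M) = (\<integral>y. indicator A (g y) * \<eta> y \<partial>N)" for A
  have box: "D (box a b)" if "cbox a b \<subseteq> \<Omega>" for a b
  proof -
    have lim: "(\<lambda>n. \<integral>x. box_bump a b (real (Suc n)) (f x) * \<theta> x \<partial>M) \<longlonglongrightarrow> (\<integral>x. indicator (box a b) (f x) * \<theta> x
      \<partial>M)"
      if \<theta>: "integrable M \<theta>" and f: "f \<in> M \<rightarrow>\<^sub>M borel" for f :: "'d \<Rightarrow> 'a" and \<theta> :: "'d \<Rightarrow> real" and M
    proof (rule integral_dominated_convergence[where w="\<lambda>x. norm (\<theta> x)"])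
      show "AE x in M. (\<lambda>n. box_bump a b (real (Suc n)) (f x) * \<theta> x) \<longlonglongrightarrow> indicator (box a b) (f x) * \<theta> x"
        by (intro AE_I2 tendsto_mult box_bump_tendsto tendsto_const)
      show "(\<lambda>x. box_bump a b (real (Suc n)) (f x) * \<theta> x) \<in> borel_measurable M" for n
        by (intro borel_measurable_integrable test_integrable[OF box_bump_test _ f] \<theta> \<open>cbox a b \<subseteq> \<Omega>\<close>) auto
      show "(\<lambda>x. indicator (box a b) (f x) * \<theta> x) \<in> borel_measurable M"
        using integrable_indicator_comp[OF \<theta> f, of "box a b"] by auto
      show "AE x in M. norm (box_bump a b (real (Suc n)) (f x) * \<theta> x) \<le> norm (\<theta> x)" for n
        using box_bump_bounds[of a b "real (Suc n)"] by (auto simp: abs_mult intro!: mult_left_le_one_le)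
    qed (use \<theta> in auto)
    have "(\<integral>x. box_bump a b (real (Suc n)) (f x) * \<theta> x \<partial>M)
      = (\<integral>y. box_bump a b (real (Suc n)) (g y) * \<eta> y \<partial>N)" for n
      by (intro eq box_bump_test that) auto
    with lim[OF \<theta> f] lim[OF \<eta> g] show ?thesis unfolding D_def by (auto intro: LIMSEQ_unique)
  qed
  have D_diff: "D (A - B)" if "D A" "D B" "B \<subseteq> A" "A \<in> sets borel" "B \<in> sets borel" for A B
  proof -
    have d: "(\<integral>x. indicator (A - B) (f x) * \<theta> x \<partial>M) = (\<integral>x. indicator A (f x) * \<theta> x \<partial>M)
      - (\<integral>x. indicator B (f x) * \<theta> x \<partial>M)"
      if \<theta>: "integrable M \<theta>" and f: "f \<in> M \<rightarrow>\<^sub>M borel" for f :: "'d \<Rightarrow> 'a" and \<theta> :: "'d \<Rightarrow> real" and M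
    proof -
      have "(\<integral>x. indicator (A - B) (f x) * \<theta> x \<partial>M) = (\<integral>x. indicator A (f x) * \<theta> x
        - indicator B (f x) * \<theta> x \<partial>M)"
        by (intro Bochner_Integration.integral_cong)
          (use \<open>B \<subseteq> A\<close> in \<open>auto split: split_indicator\<close>)
      then show ?thesis
        by (simp add: integrable_indicator_comp[OF that] \<open>A \<in> sets borel\<close> \<open>B \<in> sets borel\<close>)
    qed
    show ?thesis using that(1,2) unfolding D_def d[OF \<theta> f] d[OF \<eta> g] by simp
  qed
  have D_UN: "D (\<Union>i. A i)" if A: "\<And>i. A i \<in> sets borel" "disjoint_family A" "\<And>i. D (A i)" for A ::
    "nat \<Rightarrow> 'a set"
    unfolding D_def
    using integral_indicator_sums[OF \<theta> f A(1,2)] integral_indicator_sums[OF \<eta> g A(1,2)]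
    unfolding A(3)[unfolded D_def] by (rule sums_unique2)
  \<comment> \<open>Equality of the total masses is not known, so complements are taken relative to
    a fixed box, whose own value is already known to agree.\<close>
  have sub: "D (A \<inter> box a b)" if ab: "cbox a b \<subseteq> \<Omega>" and A: "A \<in> sets borel" for A a b
  proof -
    let ?G = "range (\<lambda>(a, b). box a b :: 'a set)"
    have borel: "sigma_sets UNIV ?G = sets (borel :: 'a measure)"
      by (simp add: borel_eq_box)
    have "Int_stable ?G"
      by (auto simp: Int_stable_def box_Int_box)
    moreover have "?G \<subseteq> Pow UNIV" by simp
    moreover have "A \<in> sigma_sets UNIV ?G" using A by (simp add: borel)
    ultimately show ?thesis
    proof (induction rule: sigma_sets_induct_disjoint)
      case (basic A)
      then obtain c d where "A = box c d" by auto
      then have "A \<inter> box a b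
        = box (\<Sum>i\<in>Basis. max (c \<bullet> i) (a \<bullet> i) *\<^sub>R i) (\<Sum>i\<in>Basis. min (d \<bullet> i) (b \<bullet> i) *\<^sub>R i)"
        by (simp add: box_Int_box)
      moreover have "cbox (\<Sum>i\<in>Basis. max (c \<bullet> i) (a \<bullet> i) *\<^sub>R i) (\<Sum>i\<in>Basis. min (d \<bullet> i) (b \<bullet> i) *\<^sub>R i) \<subseteq>
        cbox a b"
        by (auto simp: mem_box)
      ultimately show ?case using box ab by force
    next
      case empty
      then show ?case by (simp add: D_def)
    next
      case (compl A)
      have "(UNIV - A) \<inter> box a b = box a b - (A \<inter> box a b)" by auto
      moreover have "D (box a b - (A \<inter> box a b))"
        using compl by (intro D_diff box ab) (auto simp: borel)
      ultimately show ?case by simp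
    next
      case (union A)
      have "(\<Union>i. A i) \<inter> box a b = (\<Union>i. A i \<inter> box a b)" by auto
      moreover have "A i \<in> sets borel" for i using union(2) by (auto simp: borel)
      then have "D (\<Union>i. A i \<inter> box a b)"
        using union by (intro D_UN) (auto simp: disjoint_family_on_def)
      ultimately show ?case by simp
    qed
  qed
  define BB where "BB = {X. \<exists>a b. X = box a b \<and> cbox a b \<subseteq> \<Omega>}"
  have "\<exists>B :: nat \<Rightarrow> 'a set. range B \<subseteq> BB \<and> (\<Union>i. B i) = \<Omega>"
  proof -
    have o: "\<And>S. S \<in> BB \<Longrightarrow> open S" by (auto simp: BB_def)
    have "\<exists>F\<subseteq>BB. countable F \<and> \<Union>F = \<Union>BB" by (rule Lindelof[OF o]) (assumption, blast)
    then obtain F where F: "F \<subseteq> BB" "countable F" "\<Union>F = \<Union>BB" by auto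
    have "\<Union>BB = \<Omega>"
    proof
      show "\<Union>BB \<subseteq> \<Omega>" using box_subset_cbox by (force simp: BB_def)
      show "\<Omega> \<subseteq> \<Union>BB"
      proof
        fix x assume "x \<in> \<Omega>"
        obtain a b where "x \<in> box a b" "cbox a b \<subseteq> \<Omega>"
          using open_contains_cbox[OF \<Omega> \<open>x \<in> \<Omega>\<close>] by metis
        then show "x \<in> \<Union>BB" unfolding BB_def by blast
      qed
    qed
    \<comment> \<open>The empty set is adjoined to have a nonempty family to enumerate, also when
      \<open>\<Omega>\<close> is empty. It is a box whose corners are in the wrong order.\<close>
    moreover have "F \<union> {{}} \<subseteq> BB"
    proof -
      obtain i :: 'a where "i \<in> Basis" using nonempty_Basis by blast
      then have "box (One::'a) 0 = {}" "cbox (One::'a) 0 = {}"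
        unfolding box_eq_empty by force+
      moreover from this have "{} \<in> BB" by (metis (mono_tags, lifting) BB_def empty_subsetI mem_Collect_eq)
      ultimately show ?thesis using F by blast
    qed
    ultimately show ?thesis
      using range_from_nat_into[of "F \<union> {{}}"] F
      by (intro exI[of _ "from_nat_into (F \<union> {{}})"]) auto
  qed
  then obtain B :: "nat \<Rightarrow> 'a set" where B: "range B \<subseteq> BB" "(\<Union>i. B i) = \<Omega>" by metis
  have Bo: "B i \<in> sets borel" for i
  proof -
    have "\<exists>a b. B i = box a b" using B(1) unfolding BB_def by blast
    then show ?thesis by force
  qed
  have "(\<Union>i. disjointed B i) = \<Omega>" by (simp add: UN_disjointed_eq B)
  then have "A = (\<Union>i. A \<inter> disjointed B i)" using A by blast
  moreover have "D (\<Union>i. A \<inter> disjointed B i)"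
  proof (rule D_UN)
    have dm: "disjointed B i \<in> sets borel" for i
      using Bo by (auto simp: disjointed_def)
    then show "A \<inter> disjointed B i \<in> sets borel" for i using A by auto
    show "disjoint_family (\<lambda>i. A \<inter> disjointed B i)"
      using disjoint_family_disjointed[of B] by (auto simp: disjoint_family_on_def)
    show "D (A \<inter> disjointed B i)" for i
    proof -
      have "\<exists>a b. B i = box a b \<and> cbox a b \<subseteq> \<Omega>" using B(1) unfolding BB_def by blast
      then obtain a b where "B i = box a b" "cbox a b \<subseteq> \<Omega>" by blast
      moreover have "A \<inter> disjointed B i = (A \<inter> disjointed B i) \<inter> B i"
        using disjointed_subset[of B i] by auto
      ultimately show ?thesis using sub[of a b "A \<inter> disjointed B i"] A dm by auto
    qed
  qed
  ultimately show ?thesis unfolding D_def by simp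
qed

text \<open>Linear combinations and monotone limits lead from sets to bounded Borel functions; the
  bound C supplies the integrable majorant C |\<theta>| in the limit.\<close>

lemma test_functions_determine:
  fixes \<Omega> :: "'a::euclidean_space set" and \<theta> :: "'b \<Rightarrow> real" and \<eta> :: "'c \<Rightarrow> real"
  assumes \<Omega>: "open \<Omega>" and f[measurable]: "f \<in> M \<rightarrow>\<^sub>M borel" and g[measurable]: "g \<in> N \<rightarrow>\<^sub>M borel"
    and \<theta>: "integrable M \<theta>" and \<eta>: "integrable N \<eta>"
    and eq: "\<And>\<psi>. \<psi> \<in> test_functions \<Omega> \<Longrightarrow> (\<integral>x. \<psi> (f x) * \<theta> x \<partial>M) = (\<integral>y. \<psi> (g y) * \<eta> y \<partial>N)"
    and h: "h \<in> borel_measurable borel" "\<And>x. \<bar>h x\<bar> \<le> C" "\<And>x. x \<notin> \<Omega> \<Longrightarrow> h x = 0"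
  shows "(\<integral>x. h (f x) * \<theta> x \<partial>M) = (\<integral>y. h (g y) * \<eta> y \<partial>N)"
proof -
  have [measurable]: "\<theta> \<in> borel_measurable M" "\<eta> \<in> borel_measurable N" using \<theta> \<eta> by auto
  have int: "integrable M (\<lambda>x. h (f x) * \<theta> x)"
    if "integrable M \<theta>" "f \<in> M \<rightarrow>\<^sub>M borel" "h \<in> borel_measurable borel" "\<And>x. \<bar>h x\<bar> \<le> C"
    for f :: "'d \<Rightarrow> 'a" and \<theta> :: "'d \<Rightarrow> real" and M and h :: "'a \<Rightarrow> real" and C
  proof (rule Bochner_Integration.integrable_bound)
    show "integrable M (\<lambda>x. C * \<theta> x)" using that by simp
    show "(\<lambda>x. h (f x) * \<theta> x) \<in> borel_measurable M"
      using that borel_measurable_integrable[OF that(1)] by measurable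
    show "AE x in M. norm (h (f x) * \<theta> x) \<le> norm (C * \<theta> x)"
      using that(4) by (intro AE_I2) (simp add: abs_mult, metis abs_ge_self abs_ge_zero mult_right_mono
        order_trans)
  qed
  \<comment> \<open>The bound and the vanishing off \<open>\<Omega>\<close> stand as implications in
    the conclusion because each inductive step hands them down to its pieces in altered form, for
    example with C / c for a function scaled by c. The pieces inherit both since they are
    nonnegative and lie below their sum or limit.\<close>
  have pos: "(\<forall>x. \<bar>h x\<bar> \<le> C) \<longrightarrow> (\<forall>x. x \<notin> \<Omega> \<longrightarrow> h x = 0) \<longrightarrow>
      (\<integral>x. h (f x) * \<theta> x \<partial>M) = (\<integral>y. h (g y) * \<eta> y \<partial>N)"
    if "h \<in> borel_measurable borel" "\<And>x. 0 \<le> h x" for h C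
    using that
  proof (induction arbitrary: C rule: borel_measurable_induct_real)
    case (set A)
    show ?case
    proof (intro impI, goal_cases)
      case 1
      then have "A \<subseteq> \<Omega>" by (auto simp: indicator_eq_0_iff)
      then show ?case using set
        by (intro test_functions_determine_sets[OF \<Omega> f g \<theta> \<eta> eq]) auto
    qed
  next
    case (mult u c)
    show ?case
    proof (cases "c = 0")
      case False
      show ?thesis
      proof (intro impI, goal_cases)
        case 1
        have "\<forall>x. \<bar>u x\<bar> \<le> C / c" "\<forall>x. x \<notin> \<Omega> \<longrightarrow> u x = 0"
          using 1 False mult.hyps(1) by (auto simp: abs_mult field_simps)
        then show ?case using mult.IH[of "C / c"] by (simp add: mult.assoc)
      qed
    qed simp
  next
    case (add u v)
    show ?case
    proof (intro impI, goal_cases)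
      case 1
      have b: "\<bar>u x\<bar> \<le> C" "\<bar>v x\<bar> \<le> C" for x
        using 1(1)[rule_format, of x] add.hyps(2)[of x] add.hyps(4)[of x] by auto
      have z: "u x = 0" "v x = 0" if "x \<notin> \<Omega>" for x
        using 1(2)[rule_format, of x] add.hyps(2)[of x] add.hyps(4)[of x] that by auto
      have "(\<integral>x. (v (f x) + u (f x)) * \<theta> x \<partial>M) = (\<integral>x. v (f x) * \<theta> x \<partial>M) + (\<integral>x. u (f x) * \<theta> x \<partial>M)"
        using int[OF \<theta> f add.hyps(1) b(1)] int[OF \<theta> f add.hyps(3) b(2)] by (simp add: distrib_right)
      moreover have "(\<integral>x. (v (g x) + u (g x)) * \<eta> x \<partial>N) = (\<integral>x. v (g x) * \<eta> x \<partial>N) + (\<integral>x. u (g x) * \<eta> x \<partial>N)"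
        using int[OF \<eta> g add.hyps(1) b(1)] int[OF \<eta> g add.hyps(3) b(2)] by (simp add: distrib_right)
      moreover have "(\<integral>x. v (f x) * \<theta> x \<partial>M) = (\<integral>x. v (g x) * \<eta> x \<partial>N)" "(\<integral>x. u (f x) * \<theta> x \<partial>M)
        = (\<integral>x. u (g x) * \<eta> x \<partial>N)"
        using add.IH(1)[of C] add.IH(2)[of C] b z by auto
      ultimately show ?case by simp
    qed
  next
    case (seq U)
    show ?case
    proof (intro impI, goal_cases)
      case 1
      have le: "U i x \<le> h x" for i x
        using seq.hyps(3) seq.hyps(4)[of x]
          by (intro incseq_le[of "\<lambda>i. U i x"]) (auto simp: incseq_def le_fun_def)
      have b: "\<bar>U i x\<bar> \<le> C" for i x
        using le[of i x] seq.hyps(2)[of i x] 1(1)[rule_format, of x] by auto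
      have z: "U i x = 0" if "x \<notin> \<Omega>" for i x
        using le[of i x] seq.hyps(2)[of i x] 1(2)[rule_format, of x] that by auto
      have lim: "(\<lambda>n. \<integral>x. U n (f x) * \<theta> x \<partial>M) \<longlonglongrightarrow> (\<integral>x. h (f x) * \<theta> x \<partial>M)"
        if \<theta>: "integrable M \<theta>" and f: "f \<in> M \<rightarrow>\<^sub>M borel" for f :: "'d \<Rightarrow> 'a" and \<theta> :: "'d \<Rightarrow> real" and M
      proof (rule integral_dominated_convergence[where w="\<lambda>x. norm (C * \<theta> x)"])
        have "h \<in> borel_measurable borel"
          using seq.hyps(1,4) by (auto intro: borel_measurable_LIMSEQ_real[of borel U])
        then show "(\<lambda>x. h (f x) * \<theta> x) \<in> borel_measurable M"
          using int[OF \<theta> f _ 1(1)[rule_format]] by auto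
        show "(\<lambda>x. U n (f x) * \<theta> x) \<in> borel_measurable M" for n
          using int[OF \<theta> f seq.hyps(1) b] by auto
        show "AE x in M. (\<lambda>n. U n (f x) * \<theta> x) \<longlonglongrightarrow> h (f x) * \<theta> x"
          by (intro AE_I2 tendsto_mult seq.hyps) auto
        show "AE x in M. norm (U n (f x) * \<theta> x) \<le> norm (C * \<theta> x)" for n
          by (intro AE_I2) (simp add: abs_mult, metis b abs_ge_self abs_ge_zero mult_right_mono order_trans)
        show "integrable M (\<lambda>x. norm (C * \<theta> x))" using \<theta> by auto
      qed
      have "(\<integral>x. U n (f x) * \<theta> x \<partial>M) = (\<integral>y. U n (g y) * \<eta> y \<partial>N)" for n
        using seq.IH[of n C] b z by auto
      with lim[OF \<theta> f] lim[OF \<eta> g] show ?case by (auto intro: LIMSEQ_unique)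
    qed
  qed
  let ?p = "\<lambda>x. max 0 (h x)" and ?n = "\<lambda>x. max 0 (- h x)"
  have m: "?p \<in> borel_measurable borel" "?n \<in> borel_measurable borel" using h by auto
  have b: "\<bar>?p x\<bar> \<le> C" "\<bar>?n x\<bar> \<le> C" for x using h(2)[of x] by auto
  have "(\<integral>x. ?p (f x) * \<theta> x \<partial>M) = (\<integral>x. ?p (g x) * \<eta> x \<partial>N)" "(\<integral>x. ?n (f x) * \<theta> x \<partial>M)
    = (\<integral>x. ?n (g x) * \<eta> x \<partial>N)"
    using pos[OF m(1), of C] pos[OF m(2), of C] b h(3) by auto
  moreover have "(\<integral>x. h (f x) * \<theta> x \<partial>M) = (\<integral>x. ?p (f x) * \<theta> x \<partial>M) - (\<integral>x. ?n (f x) * \<theta> x \<partial>M)"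
    if \<theta>: "integrable M \<theta>" and f: "f \<in> M \<rightarrow>\<^sub>M borel" for f :: "'d \<Rightarrow> 'a" and \<theta> :: "'d \<Rightarrow> real" and M
  proof -
    have "(\<integral>x. h (f x) * \<theta> x \<partial>M) = (\<integral>x. ?p (f x) * \<theta> x - ?n (f x) * \<theta> x \<partial>M)"
      by (intro Bochner_Integration.integral_cong) (auto simp: max_def)
    also have "\<dots> = (\<integral>x. ?p (f x) * \<theta> x \<partial>M) - (\<integral>x. ?n (f x) * \<theta> x \<partial>M)"
      using int[OF \<theta> f m(1) b(1)] int[OF \<theta> f m(2) b(2)] by (rule Bochner_Integration.integral_diff)
    finally show ?thesis .
  qed
  from this[OF \<theta> f] this[OF \<eta> g] show ?thesis using calculation by simp
qed

section \<open>Integral representation of dominated convex functionals\<close>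

text \<open>Pointwise scaling turns functions into a \<open>real_vector\<close>, so that
  \<open>subspace\<close>, \<open>convex\<close> and \<open>convex_on\<close> apply to sets of
  functions; the additive structure comes from \<open>Function_Algebras\<close>.\<close>

instantiation "fun" :: (type, real_vector) real_vector
begin
definition scaleR_fun :: "real \<Rightarrow> ('a \<Rightarrow> 'b) \<Rightarrow> 'a \<Rightarrow> 'b" where
  "scaleR_fun c f = (\<lambda>x. c *\<^sub>R f x)"
instance
  by standard (auto simp: scaleR_fun_def plus_fun_def scaleR_add_right scaleR_add_left)
end

section \<open>Sublinear functionals and the Hahn-Banach theorem\<close>

definition sublinear_on :: "'v::real_vector set \<Rightarrow> ('v \<Rightarrow> real) \<Rightarrow> bool" where
  "sublinear_on V p \<longleftrightarrow> (\<forall>f\<in>V. \<forall>g\<in>V. p (f + g) \<le> p f + p g) \<and> (\<forall>f\<in>V. \<forall>c\<ge>0. p (c *\<^sub>R f) = c * p f)"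

text \<open>One inequality for scaling is enough: used with 1 / c at the point c f it gives the
  reverse one.\<close>

lemma sublinear_onI:
  assumes "\<And>f g. f \<in> V \<Longrightarrow> g \<in> V \<Longrightarrow> p (f + g) \<le> p f + p g"
    and "\<And>f c. f \<in> V \<Longrightarrow> c > 0 \<Longrightarrow> p (c *\<^sub>R f) \<le> c * p f"
    and "p 0 = 0" and V: "subspace V"
  shows "sublinear_on V p"
proof -
  have "p (c *\<^sub>R f) = c * p f" if "f \<in> V" "c \<ge> 0" for f c
  proof (cases "c = 0")
    case False
    with that have c: "c > 0" by simp
    have "p ((1 / c) *\<^sub>R (c *\<^sub>R f)) \<le> (1 / c) * p (c *\<^sub>R f)"
      using that c V by (intro assms(2)) (auto simp: subspace_scale)
    then have "c * p f \<le> p (c *\<^sub>R f)" using c by (simp add: field_simps)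
    with assms(2)[OF that(1) c] show ?thesis by simp
  qed (simp add: assms)
  with assms show ?thesis by (auto simp: sublinear_on_def)
qed

lemma sublinear_on_0: "sublinear_on V p \<Longrightarrow> subspace V \<Longrightarrow> p 0 = 0"
  unfolding sublinear_on_def using subspace_0[of V]
  by (metis mult_zero_left order_refl scaleR_zero_left)

lemma sublinear_on_lower:
  assumes "sublinear_on V p" "subspace V" "f \<in> V" shows "- p (- f) \<le> p f"
proof -
  have "p (f + - f) \<le> p f + p (- f)"
    using assms subspace_neg[of V f] unfolding sublinear_on_def by blast
  then show ?thesis using sublinear_on_0[OF assms(1,2)] by simp
qed

text \<open>p' f is the infimum of p (f + t c) + t q c over t \<ge> 0 and c in C, the largest
  sublinear functional below p that satisfies p' (- c) \<le> q c. A linear l below p' then fulfils l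
  c + q c \<ge> 0 on C, so the inequality to be preserved is built into the sublinear bound before
  Hahn-Banach is applied. The hypothesis 0 \<le> p + q keeps the infimum finite, and convexity of q
  makes it subadditive.\<close>

lemma sublinear_on_adjoin:
  assumes V: "subspace V" and p: "sublinear_on V p"
    and C: "C \<subseteq> V" "C \<noteq> {}" and q: "convex_on C q" and pq: "\<And>c. c \<in> C \<Longrightarrow> 0 \<le> p c + q c"
  shows "\<exists>p'. sublinear_on V p' \<and> (\<forall>f\<in>V. p' f \<le> p f) \<and> (\<forall>c\<in>C. p' (- c) \<le> q c)"
proof -
  define S where "S f = {p (f + t *\<^sub>R c) + t * q c | t c. t \<ge> 0 \<and> c \<in> C}" for f
  define p' where "p' f = Inf (S f)" for f
  have sub: "p (f + g) \<le> p f + p g" if "f \<in> V" "g \<in> V" for f g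
    using p that by (auto simp: sublinear_on_def)
  have hom: "p (c *\<^sub>R f) = c * p f" if "f \<in> V" "c \<ge> 0" for f c
    using p that by (auto simp: sublinear_on_def)
  have cV: "t *\<^sub>R c \<in> V" if "c \<in> C" for c t using C V that by (auto simp: subspace_scale)
  have lower: "- p (- f) \<le> s" if fV: "f \<in> V" and sS: "s \<in> S f" for f s
  proof -
    obtain t c where tc: "t \<ge> 0" "c \<in> C" "s = p (f + t *\<^sub>R c) + t * q c"
      using sS by (auto simp: S_def)
    have "p (t *\<^sub>R c) \<le> p (f + t *\<^sub>R c) + p (- f)"
      using sub[of "f + t *\<^sub>R c" "- f"] V fV cV[OF tc(2)]
      by (auto simp: subspace_add subspace_neg)
    moreover have "0 \<le> t * (p c + q c)" using tc pq by auto
    ultimately show ?thesis using tc hom[of c t] C by (auto simp: algebra_simps)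
  qed
  have bdd: "bdd_below (S f)" if "f \<in> V" for f using lower[OF that] by (auto simp: bdd_below_def)
  have S0: "p f \<in> S f" for f
  proof -
    obtain c where "c \<in> C" using C(2) by blast
    moreover have "p f = p (f + 0 *\<^sub>R c) + 0 * q c" by simp
    ultimately show ?thesis unfolding S_def by blast
  qed
  have ne: "S f \<noteq> {}" for f using S0[of f] by blast
  have le: "p' f \<le> p f" if "f \<in> V" for f
    unfolding p'_def by (intro cInf_lower S0 bdd that)
  have p'le: "p' f \<le> p (f + t *\<^sub>R c) + t * q c" if "f \<in> V" "t \<ge> 0" "c \<in> C" for f t c
    unfolding p'_def by (intro cInf_lower bdd that) (use that in \<open>auto simp: S_def\<close>)
  have "sublinear_on V p'"
  proof (rule sublinear_onI)
    show "p' (f + g) \<le> p' f + p' g" if fg: "f \<in> V" "g \<in> V" for f g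
    proof -
      have "p' (f + g) \<le> s + r" if "s \<in> S f" "r \<in> S g" for s r
      proof -
        obtain t c where tc: "t \<ge> 0" "c \<in> C" "s = p (f + t *\<^sub>R c) + t * q c"
          using \<open>s \<in> S f\<close> by (auto simp: S_def)
        obtain t' c' where tc': "t' \<ge> 0" "c' \<in> C" "r = p (g + t' *\<^sub>R c') + t' * q c'"
          using \<open>r \<in> S g\<close> by (auto simp: S_def)
        show ?thesis
        proof (cases "t + t' = 0")
          case True
          then have "t = 0" "t' = 0" using tc tc' by auto
          then show ?thesis using sub[OF fg] le[of "f + g"] fg V tc tc' by (auto simp: subspace_add)
        next
          case False
          \<comment> \<open>The two multiples of points of C merge into one: t c + t' c' = (t + t')
            d with d in C by convexity.\<close>
          define d where "d = (t / (t + t')) *\<^sub>R c + (t' / (t + t')) *\<^sub>R c'"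
          have w: "t / (t + t') \<ge> 0" "t' / (t + t') \<ge> 0" "t / (t + t') + t' / (t + t') = 1"
            using False tc tc' by (auto simp: add_divide_distrib[symmetric])
          have d: "d \<in> C" unfolding d_def
            using convexD[OF convex_on_imp_convex[OF q] tc(2) tc'(2) w] .
          have "q d \<le> (t / (t + t')) * q c + (t' / (t + t')) * q c'"
            unfolding d_def using q w tc(2) tc'(2) unfolding convex_on_def by blast
          then have "(t + t') * q d \<le> (t + t') * ((t / (t + t')) * q c + (t' / (t + t')) * q c')"
            using tc tc' by (intro mult_left_mono) auto
          also have "\<dots> = t * q c + t' * q c'"
            using False by (simp add: distrib_left)
          finally have qd: "(t + t') * q d \<le> t * q c + t' * q c'" .
          have "(t + t') *\<^sub>R d = t *\<^sub>R c + t' *\<^sub>R c'"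
            unfolding d_def using False by (simp add: scaleR_add_right)
          then have "f + g + (t + t') *\<^sub>R d = (f + t *\<^sub>R c) + (g + t' *\<^sub>R c')" by (simp add: algebra_simps)
          then have "p (f + g + (t + t') *\<^sub>R d) = p ((f + t *\<^sub>R c) + (g + t' *\<^sub>R c'))" by (rule arg_cong)
          also have "\<dots> \<le> p (f + t *\<^sub>R c) + p (g + t' *\<^sub>R c')"
            using fg V cV tc(2) tc'(2) by (intro sub subspace_add) auto
          finally have "p (f + g + (t + t') *\<^sub>R d) \<le> p (f + t *\<^sub>R c) + p (g + t' *\<^sub>R c')" .
          moreover have "p' (f + g) \<le> p (f + g + (t + t') *\<^sub>R d) + (t + t') * q d"
            using fg V tc tc' d by (intro p'le) (auto simp: subspace_add)
          ultimately show ?thesis using qd tc tc' by auto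
        qed
      qed
      then have "p' (f + g) - r \<le> p' f" if "r \<in> S g" for r
        unfolding p'_def[of f] using that ne by (intro cInf_greatest) (auto simp: le_diff_eq diff_le_eq)
      then have "p' (f + g) - p' f \<le> p' g"
        unfolding p'_def[of g] using ne
          by (intro cInf_greatest) (auto simp: le_diff_eq diff_le_eq algebra_simps)
      then show ?thesis by simp
    qed
    show "p' (c *\<^sub>R f) \<le> c * p' f" if f: "f \<in> V" "c > 0" for f c
    proof -
      have "p' (c *\<^sub>R f) / c \<le> s" if sS: "s \<in> S f" for s
      proof -
        obtain t k where tk: "t \<ge> 0" "k \<in> C" "s = p (f + t *\<^sub>R k) + t * q k"
          using sS by (auto simp: S_def)
        have "p' (c *\<^sub>R f) \<le> p (c *\<^sub>R f + (c * t) *\<^sub>R k) + (c * t) * q k"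
          using f V tk by (intro p'le) (auto simp: subspace_scale)
        also have "c *\<^sub>R f + (c * t) *\<^sub>R k = c *\<^sub>R (f + t *\<^sub>R k)" by (simp add: scaleR_add_right)
        also have "p \<dots> = c * p (f + t *\<^sub>R k)"
          using f V cV[OF tk(2)] by (intro hom) (auto simp: subspace_add)
        finally show ?thesis using tk f by (simp add: field_simps)
      qed
      then have "p' (c *\<^sub>R f) / c \<le> p' f" unfolding p'_def[of f] using ne by (intro cInf_greatest) auto
      then show ?thesis using f by (simp add: field_simps)
    qed
    show "p' 0 = 0"
      using lower[of 0] le[of 0] V sublinear_on_0[OF p V] unfolding p'_def
      by (intro antisym cInf_greatest ne) (auto simp: subspace_0)
  qed fact
  moreover have "p' (- c) \<le> q c" if "c \<in> C" for c
    using p'le[of "- c" 1 c] that C V sublinear_on_0[OF p V] by (auto simp: subspace_neg)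
  ultimately show ?thesis using le by blast
qed

text \<open>A minimal sublinear functional m below p is linear. Adjoining C = {g} with q = - m
  yields a sublinear functional below m whose value at - g is at most - m g. By minimality it is m,
  so m (- g) \<le> - m g, and this gives the missing half of additivity.\<close>

lemma Hahn_Banach_dominated:
  assumes V: "subspace V" and p: "sublinear_on V p"
  shows "\<exists>l. (\<forall>f\<in>V. \<forall>g\<in>V. l (f + g) = l f + l g) \<and> (\<forall>f\<in>V. \<forall>c. l (c *\<^sub>R f) = c * l f) \<and> (\<forall>f\<in>V. l f \<le> p f)"
proof -
  \<comment> \<open>Values off \<open>V\<close> are normalized to 0, so that a comparison on
    \<open>V\<close> is a comparison of functions. The relation \<open>R\<close> below is the
    reversed pointwise order: the maximal element that Zorn's lemma delivers is a minimal
    functional.\<close>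
  define A where "A = {q. sublinear_on V q \<and> (\<forall>f\<in>V. q f \<le> p f) \<and> (\<forall>f. f \<notin> V \<longrightarrow> q f = 0)}"
  define R where "R q r \<longleftrightarrow> (\<forall>f. r f \<le> (q f :: real))" for q r :: "'a \<Rightarrow> real"
  have po: "partial_order_on A (relation_of R A)"
    by (rule partial_order_on_relation_ofI) (auto simp: R_def fun_eq_iff intro: order_trans antisym)
  have restr: "(\<lambda>f. if f \<in> V then r f else 0) \<in> A" if "sublinear_on V r" "\<forall>f\<in>V. r f \<le> p f" for r
    using that V unfolding A_def sublinear_on_def by (auto simp: subspace_add subspace_scale)
  have ch: "\<exists>u\<in>A. \<forall>a\<in>C. R a u" if "C \<in> Chains (relation_of R A)" for C
  proof (cases "C = {}")
    case True
    then show ?thesis using restr[OF p] by auto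
  next
    case False
    have CA: "C \<subseteq> A" using that Chains_relation_of by metis
    have cmp: "R a b \<or> R b a" if "a \<in> C" "b \<in> C" for a b
      using \<open>C \<in> Chains _\<close> that unfolding Chains_def relation_of_def by blast
    have low: "- p (- f) \<le> a f" if "f \<in> V" "a \<in> C" for a f
    proof -
      have "sublinear_on V a" "a (- f) \<le> p (- f)"
        using CA that V by (auto simp: A_def subspace_neg)
      then show ?thesis using sublinear_on_lower[of V a f] V that by auto
    qed
    define u where "u f = (INF a\<in>C. a f)" for f
    have bdd: "bdd_below ((\<lambda>a. a f) ` C)" if "f \<in> V" for f
      using low[OF that] by (auto simp: bdd_below_def)
    have ule: "u f \<le> a f" if "f \<in> V" "a \<in> C" for f a
      unfolding u_def using bdd that by (intro cINF_lower)
    have "sublinear_on V u"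
    proof (rule sublinear_onI)
      show "u (f + g) \<le> u f + u g" if fg: "f \<in> V" "g \<in> V" for f g
      proof -
        \<comment> \<open>Of two members of a chain one lies below the other, and subadditivity of
          this single one bounds the mixed sum.\<close>
        have "u (f + g) \<le> a f + b g" if ab: "a \<in> C" "b \<in> C" for a b
        proof -
          obtain c where c: "c \<in> C" "\<forall>f. c f \<le> a f" "\<forall>f. c f \<le> b f"
            using cmp[OF ab] ab unfolding R_def by blast
          have "u (f + g) \<le> c (f + g)" using c fg V by (intro ule) (auto simp: subspace_add)
          also have "\<dots> \<le> c f + c g" using c(1) CA fg unfolding A_def sublinear_on_def by blast
          finally show ?thesis using c(2,3)[rule_format, of f] c(3)[rule_format, of g] by linarith
        qed
        then have "u (f + g) - b g \<le> u f" if "b \<in> C" for b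
          unfolding u_def[of f] using that False by (intro cINF_greatest) (auto simp: diff_le_eq)
        then have "u (f + g) - u f \<le> u g"
          unfolding u_def[of g] using False by (intro cINF_greatest) (auto simp: diff_le_eq algebra_simps)
        then show ?thesis by simp
      qed
      show "u (c *\<^sub>R f) \<le> c * u f" if f: "f \<in> V" "c > 0" for f c
      proof -
        have "u (c *\<^sub>R f) / c \<le> a f" if "a \<in> C" for a
        proof -
          have "u (c *\<^sub>R f) \<le> a (c *\<^sub>R f)" using f V that by (intro ule) (auto simp: subspace_scale)
          also have "\<dots> = c * a f" using CA that f unfolding A_def sublinear_on_def by auto
          finally show ?thesis using f by (simp add: field_simps)
        qed
        then have "u (c *\<^sub>R f) / c \<le> u f" unfolding u_def[of f] using False by (intro cINF_greatest)
        then show ?thesis using f by (simp add: field_simps)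
      qed
      have "a 0 = 0" if "a \<in> C" for a
        using CA that V sublinear_on_0[of V a] by (auto simp: A_def)
      then have "(\<lambda>a. a 0) ` C = {0}" using False by force
      then show "u 0 = 0" by (simp add: u_def)
    qed fact
    moreover have "\<forall>f\<in>V. u f \<le> p f"
    proof
      fix f assume f: "f \<in> V"
      obtain a where a: "a \<in> C" using False by blast
      have "a f \<le> p f" using a CA f by (auto simp: A_def)
      then show "u f \<le> p f" using ule[OF f a] by simp
    qed
    ultimately have "(\<lambda>f. if f \<in> V then u f else 0) \<in> A" by (rule restr)
    moreover have "R a (\<lambda>f. if f \<in> V then u f else 0)" if "a \<in> C" for a
      using CA that ule unfolding R_def A_def by auto
    ultimately show ?thesis by blast
  qed
  obtain m where m: "m \<in> A" and min: "\<And>a. a \<in> A \<Longrightarrow> R m a \<Longrightarrow> a = m"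
    using predicate_Zorn[OF po ch] by blast
  have ms: "sublinear_on V m" and mp: "\<forall>f\<in>V. m f \<le> p f" using m by (auto simp: A_def)
  have add: "m (f + g) = m f + m g" if fg: "f \<in> V" "g \<in> V" for f g
  proof -
    have "\<exists>p'. sublinear_on V p' \<and> (\<forall>f\<in>V. p' f \<le> m f) \<and> (\<forall>c\<in>{g}. p' (- c) \<le> - m c)"
    proof (rule sublinear_on_adjoin[OF V ms])
      show "convex_on {g} (\<lambda>c. - m c)"
        unfolding convex_on_def
      proof (intro conjI ballI allI impI)
        fix x y and u v :: real
        assume *: "x \<in> {g}" "y \<in> {g}" "u + v = 1"
        have "u * - m g + v * - m g = (u + v) * - m g" by (simp only: distrib_right)
        with * show "- m (u *\<^sub>R x + v *\<^sub>R y) \<le> u * - m x + v * - m y"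
          by (simp add: scaleR_add_left[symmetric])
      qed simp
    qed (use fg in auto)
    then obtain p' where p': "sublinear_on V p'" "\<forall>f\<in>V. p' f \<le> m f" "p' (- g) \<le> - m g" by auto
    have eq: "(\<lambda>f. if f \<in> V then p' f else 0) = m"
    proof (rule min)
      show "(\<lambda>f. if f \<in> V then p' f else 0) \<in> A" using p' mp by (intro restr) force+
      show "R m (\<lambda>f. if f \<in> V then p' f else 0)" using p' m by (auto simp: R_def A_def)
    qed
    then have pm: "p' f = m f" if "f \<in> V" for f using fun_cong[OF eq, of f] that by simp
    have "m f \<le> m (f + g) + m (- g)"
      using ms[unfolded sublinear_on_def, THEN conjunct1, rule_format, of "f + g" "- g"] fg V
      by (simp add: subspace_add subspace_neg)
    then have "m f + m g \<le> m (f + g)"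
      using p'(3) pm[of "- g"] fg V by (auto simp: subspace_neg)
    then show ?thesis using ms fg unfolding sublinear_on_def by force
  qed
  have "m (c *\<^sub>R f) = c * m f" if f: "f \<in> V" for c f
  proof (cases "c \<ge> 0")
    case True
    then show ?thesis using ms f by (auto simp: sublinear_on_def)
  next
    case False
    have "m (c *\<^sub>R f + (- c) *\<^sub>R f) = m (c *\<^sub>R f) + m ((- c) *\<^sub>R f)"
      using f V by (intro add subspace_scale)
    moreover have "m ((- c) *\<^sub>R f) = (- c) * m f"
      using ms f False unfolding sublinear_on_def by (metis linear neg_0_le_iff_le)
    ultimately show ?thesis using sublinear_on_0[OF ms V] by (simp add: scaleR_add_left[symmetric])
  qed
  with add mp show ?thesis by blast
qed

section \<open>Radon-Nikodym densities of dominated functionals\<close>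

lemma finite_measure_real_density:
  assumes "finite_measure \<sigma>" "finite_measure N" "sets N = sets \<sigma>" "absolutely_continuous \<sigma> N"
  shows "\<exists>D\<in>borel_measurable \<sigma>. (\<forall>x. 0 \<le> D x) \<and> integrable \<sigma> D \<and> N = density \<sigma> (\<lambda>x. ennreal (D x))"
proof -
  interpret finite_measure \<sigma> by fact
  interpret N: finite_measure N by fact
  obtain f where f[measurable]: "f \<in> borel_measurable \<sigma>" and fN: "density \<sigma> f = N"
    using Radon_Nikodym_finite_measure[OF assms(2-4)] by blast
  have "emeasure N (space \<sigma>) = (\<integral>\<^sup>+x. f x * indicator (space \<sigma>) x \<partial>\<sigma>)"
    unfolding fN[symmetric] by (rule emeasure_density) auto
  also have "\<dots> = (\<integral>\<^sup>+x. f x \<partial>\<sigma>)" by (intro nn_integral_cong) simp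
  finally have "(\<integral>\<^sup>+x. f x \<partial>\<sigma>) = emeasure N (space \<sigma>)" by simp
  then have finf: "(\<integral>\<^sup>+x. f x \<partial>\<sigma>) \<noteq> \<infinity>" by simp
  have aef: "AE x in \<sigma>. f x = ennreal (enn2real (f x))"
    using nn_integral_PInf_AE[OF f finf] by eventually_elim (simp add: less_top[symmetric])
  have "(\<integral>\<^sup>+x. ennreal (enn2real (f x)) \<partial>\<sigma>) = (\<integral>\<^sup>+x. f x \<partial>\<sigma>)"
    using aef by (intro nn_integral_cong_AE) (auto elim: eventually_mono)
  then have "integrable \<sigma> (\<lambda>x. enn2real (f x))"
    using finf by (intro integrableI_nonneg) (auto simp: less_top)
  moreover have "N = density \<sigma> (\<lambda>x. ennreal (enn2real (f x)))"
    unfolding fN[symmetric] using aef by (intro density_cong) auto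
  ultimately show ?thesis by (intro bexI[of _ "\<lambda>x. enn2real (f x)"]) auto
qed

text \<open>\<open>h \<mapsto> \<integral> max (a h) (b h)\<close> is sublinear, so Hahn-Banach yields a linear functional below it that
  still satisfies the inequality on \<open>C\<close>; Radon-Nikodym represents this functional by \<open>\<xi>\<close>.\<close>

lemma dominated_convex_representation:
  fixes M :: "'b measure" and a b :: "'b \<Rightarrow> real"
  assumes M: "finite_measure M"
    and ab[measurable]: "a \<in> borel_measurable M" "b \<in> borel_measurable M"
    and bnd: "\<And>x. \<bar>a x\<bar> \<le> K" "\<And>x. \<bar>b x\<bar> \<le> K" "\<And>x. a x \<le> b x"
    and C: "\<And>h. h \<in> C \<Longrightarrow> integrable M h" "C \<noteq> {}" and q: "convex_on C q"
    and nonneg: "\<And>h. h \<in> C \<Longrightarrow> 0 \<le> (\<integral>x. max (a x * h x) (b x * h x) \<partial>M) + q h"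
  shows "\<exists>\<xi>\<in>borel_measurable M. (\<forall>x. a x \<le> \<xi> x \<and> \<xi> x \<le> b x) \<and> (\<forall>h\<in>C. 0 \<le> (\<integral>x. \<xi> x * h x \<partial>M) + q h)"
proof -
  interpret finite_measure M by fact
  define V where "V = {h. integrable M (h :: 'b \<Rightarrow> real)}"
  define p where "p h = (\<integral>x. max (a x * h x) (b x * h x) \<partial>M)" for h
  have V: "subspace V" unfolding subspace_def V_def
    by (auto simp: plus_fun_def scaleR_fun_def zero_fun_def)
  have K: "0 \<le> K" using bnd(1) by (metis abs_ge_zero order_trans)
  have bound: "\<bar>max (a x * r) (b x * r)\<bar> \<le> K * \<bar>r\<bar>" for x r
  proof -
    have "\<bar>a x * r\<bar> \<le> K * \<bar>r\<bar>" "\<bar>b x * r\<bar> \<le> K * \<bar>r\<bar>"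
      using bnd by (auto simp: abs_mult intro: mult_right_mono)
    then show ?thesis by linarith
  qed
  have int_mult: "integrable M (\<lambda>x. u x * h x)"
    if "integrable M h" "u \<in> borel_measurable M" "\<And>x. \<bar>u x\<bar> \<le> K" for u h :: "'b \<Rightarrow> real"
  proof (rule Bochner_Integration.integrable_bound)
    show "integrable M (\<lambda>x. K * h x)" using that by simp
    show "AE x in M. norm (u x * h x) \<le> norm (K * h x)"
      using that(3) K by (auto simp: abs_mult intro!: mult_right_mono)
  qed (use that in measurable)
  have int_max: "integrable M (\<lambda>x. max (a x * h x) (b x * h x))" if "integrable M h" for h
    using int_mult[OF that ab(1)] int_mult[OF that ab(2)] bnd by (intro integrable_max) auto
  have p_bound: "p h \<le> K * (\<integral>x. \<bar>h x\<bar> \<partial>M)" if "integrable M h" for h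
  proof -
    have "p h \<le> (\<integral>x. K * \<bar>h x\<bar> \<partial>M)"
      unfolding p_def using bound that by (intro integral_mono int_max) (auto simp: abs_le_iff)
    then show ?thesis by simp
  qed
  have "sublinear_on V p"
  proof (rule sublinear_onI[OF _ _ _ V])
    fix f g assume fg: "f \<in> V" "g \<in> V"
    have "p (f + g) \<le> (\<integral>x. max (a x * f x) (b x * f x) + max (a x * g x) (b x * g x) \<partial>M)"
      unfolding p_def using fg
      by (intro integral_mono int_max Bochner_Integration.integrable_add)
        (auto simp: V_def plus_fun_def distrib_left)
    also have "\<dots> = p f + p g" unfolding p_def
      using fg by (intro Bochner_Integration.integral_add int_max) (auto simp: V_def)
    finally show "p (f + g) \<le> p f + p g" .
  next
    fix f :: "'b \<Rightarrow> real" and c :: real assume "f \<in> V" "c > 0"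
    have "p (c *\<^sub>R f) = (\<integral>x. c * max (a x * f x) (b x * f x) \<partial>M)"
      unfolding p_def using \<open>c > 0\<close>
      by (intro Bochner_Integration.integral_cong) (auto simp: scaleR_fun_def max_mult_distrib_left
        mult.left_commute)
    then show "p (c *\<^sub>R f) \<le> c * p f" by (simp add: p_def)
  next
    show "p 0 = 0" by (simp add: p_def)
  qed
  from sublinear_on_adjoin[OF V this _ C(2) q]
  have "\<exists>p'. sublinear_on V p' \<and> (\<forall>f\<in>V. p' f \<le> p f) \<and> (\<forall>c\<in>C. p' (- c) \<le> q c)"
    using C(1) nonneg by (auto simp: V_def p_def)
  then obtain p' where p': "sublinear_on V p'" "\<And>f. f \<in> V \<Longrightarrow> p' f \<le> p f" "\<And>c. c \<in> C \<Longrightarrow> p' (- c) \<le> q c"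
    by blast
  from Hahn_Banach_dominated[OF V p'(1)] obtain l where
    l_add: "\<And>f g. f \<in> V \<Longrightarrow> g \<in> V \<Longrightarrow> l (f + g) = l f + l g" and
    l_scale: "\<And>f c. f \<in> V \<Longrightarrow> l (c *\<^sub>R f) = c * l f" and l_le: "\<And>f. f \<in> V \<Longrightarrow> l f \<le> p' f"
    by blast
  have ladd: "l (\<lambda>x. f x + g x) = l f + l g" if "integrable M f" "integrable M g" for f g
    using l_add[of f g] that by (simp add: V_def plus_fun_def)
  have lscale: "l (\<lambda>x. c * f x) = c * l f" if "integrable M f" for f c
    using l_scale[of f c] that by (simp add: V_def scaleR_fun_def)
  have lminus: "l (\<lambda>x. - f x) = - l f" if "integrable M f" for f
    using lscale[OF that, of "-1"] by simp
  have ldiff: "l (\<lambda>x. f x - g x) = l f - l g" if "integrable M f" "integrable M g" for f g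
    using ladd[of f "\<lambda>x. - g x"] lminus[of g] that by simp
  have lp: "l f \<le> p f" if "integrable M f" for f
    using l_le[of f] p'(2)[of f] that by (auto simp: V_def)
  have lC: "0 \<le> l h + q h" if "h \<in> C" for h
  proof -
    have "l (\<lambda>x. - h x) \<le> p' (- h)" using l_le[of "- h"] C(1)[OF that]
      by (simp add: V_def fun_Compl_def)
    then show ?thesis using p'(3)[OF that] lminus[OF C(1)[OF that]] by simp
  qed
  have labs: "\<bar>l h\<bar> \<le> K * (\<integral>x. \<bar>h x\<bar> \<partial>M)" if "integrable M h" for h
    using lp[OF that] p_bound[OF that] lp[of "\<lambda>x. - h x"] p_bound[of "\<lambda>x. - h x"] lminus[OF that] that
    by (auto simp: abs_le_iff)
  \<comment> \<open>Continuity under dominated convergence, a consequence of the L^1 bound on l. It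
    serves twice: for countable additivity of the set function below and for the passage from simple
    to integrable functions.\<close>
  have lcont: "(\<lambda>n. l (s n)) \<longlonglongrightarrow> l h"
    if s: "\<And>n. integrable M (s n)" and lim: "\<And>x. x \<in> space M \<Longrightarrow> (\<lambda>n. s n x) \<longlonglongrightarrow> h x"
      and dom: "\<And>n x. x \<in> space M \<Longrightarrow> \<bar>s n x\<bar> \<le> w x" and w: "integrable M w" and h: "integrable M h"
    for s h w
  proof -
    have "(\<lambda>n. \<integral>x. \<bar>s n x - h x\<bar> \<partial>M) \<longlonglongrightarrow> (\<integral>x. 0 \<partial>M)"
    proof (rule integral_dominated_convergence[where w="\<lambda>x. w x + \<bar>h x\<bar>"])
      show "AE x in M. (\<lambda>n. \<bar>s n x - h x\<bar>) \<longlonglongrightarrow> 0"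
        using lim by (intro AE_I2) (auto intro!: tendsto_rabs_zero simp: LIM_zero_iff)
      show "AE x in M. norm \<bar>s n x - h x\<bar> \<le> w x + \<bar>h x\<bar>" for n
        using dom[of _ n] by (intro AE_I2) (auto intro: order_trans[OF abs_triangle_ineq4])
    qed (use s h w in auto)
    then have *: "(\<lambda>n. K * (\<integral>x. \<bar>s n x - h x\<bar> \<partial>M)) \<longlonglongrightarrow> 0" by (auto intro: tendsto_mult_right_zero)
    have "\<bar>l (s n) - l h\<bar> \<le> K * (\<integral>x. \<bar>s n x - h x\<bar> \<partial>M)" for n
      using labs[of "\<lambda>x. s n x - h x"] ldiff[OF s h, of n] s[of n] h by simp
    then have "\<forall>\<^sub>F n in sequentially. norm (l (s n) - l h) \<le> K * (\<integral>x. \<bar>s n x - h x\<bar> \<partial>M)"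
      by (auto intro!: always_eventually)
    from Lim_null_comparison[OF this *] have "(\<lambda>n. l (s n) - l h) \<longlonglongrightarrow> 0" .
    then show ?thesis by (simp add: LIM_zero_iff)
  qed
  have inti: "integrable M (indicator A :: 'b \<Rightarrow> real)" if "A \<in> sets M" for A
    using that by (simp add: emeasure_eq_measure)
  have inta: "integrable M (\<lambda>x. a x * indicator A x)" "integrable M (\<lambda>x. b x * indicator A x)"
    if "A \<in> sets M" for A
    using int_mult[OF inti[OF that]] ab bnd by auto
  \<comment> \<open>Subtracting the lower density makes the set function nonnegative: on - indicator
    A the sublinear bound p is minus the integral of a over A, so l (indicator A) is at least the
    integral of a.\<close>
  define r where "r A = l (indicator A) - (\<integral>x. a x * indicator A x \<partial>M)" for A
  have r_nonneg: "0 \<le> r A" if A: "A \<in> sets M" for A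
  proof -
    have "l (\<lambda>x. - indicator A x) \<le> p (\<lambda>x. - indicator A x)" using inti[OF A] by (intro lp) auto
    also have "\<dots> = (\<integral>x. - (a x * indicator A x) \<partial>M)"
      unfolding p_def by (intro Bochner_Integration.integral_cong) (use bnd(3) in \<open>auto split:
        split_indicator\<close>)
    finally show ?thesis using lminus[OF inti[OF A]] by (simp add: r_def)
  qed
  have l_up: "l (indicator A) \<le> (\<integral>x. b x * indicator A x \<partial>M)" if A: "A \<in> sets M" for A
  proof -
    have "l (indicator A) \<le> p (indicator A)" using inti[OF A] by (intro lp) auto
    also have "\<dots> = (\<integral>x. b x * indicator A x \<partial>M)"
      unfolding p_def by (intro Bochner_Integration.integral_cong) (use bnd(3) in \<open>auto split:
        split_indicator\<close>)
    finally show ?thesis .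
  qed
  have r_sums: "(\<lambda>i. r (A i)) sums r (\<Union>i. A i)" if A: "range A \<subseteq> sets M" "disjoint_family A" for A ::
    "nat \<Rightarrow> 'b set"
  proof -
    have Am: "A i \<in> sets M" for i using A by auto
    have ind: "indicator (\<Union>i<n. A i) = (\<lambda>x. \<Sum>i<n. indicator (A i) x :: real)" for n
      by (intro ext indicator_UN_disjoint) (use A in \<open>auto simp: disjoint_family_on_def\<close>)
    have step: "r (\<Union>i<n. A i) = (\<Sum>i<n. r (A i))" for n
    proof (induction n)
      case 0
      have "l (indicator {}) = 0" using labs[of "indicator {}"] by simp
      then show ?case by (simp add: r_def)
    next
      case (Suc n)
      have Un: "(\<Union>i<n. A i) \<in> sets M" using Am by auto
      have e: "indicator (\<Union>i<Suc n. A i) = (\<lambda>x. indicator (\<Union>i<n. A i) x + indicator (A n) x :: real)"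
        unfolding ind by (simp add: fun_eq_iff)
      have "l (indicator (\<Union>i<Suc n. A i)) = l (indicator (\<Union>i<n. A i)) + l (indicator (A n))"
        unfolding e by (rule ladd[OF inti[OF Un] inti[OF Am]])
      moreover have "(\<integral>x. a x * indicator (\<Union>i<Suc n. A i) x \<partial>M) =
          (\<integral>x. a x * indicator (\<Union>i<n. A i) x \<partial>M) + (\<integral>x. a x * indicator (A n) x \<partial>M)"
        unfolding e using inta(1)[OF Un] inta(1)[OF Am] by (simp add: distrib_left)
      ultimately show ?case using Suc by (simp add: r_def)
    qed
    have "(\<lambda>n. l (indicator (\<Union>i<n. A i))) \<longlonglongrightarrow> l (indicator (\<Union>i. A i))"
    proof (rule lcont[where w="\<lambda>x. 1"])
      show "(\<lambda>n. indicator (\<Union>i<n. A i) x :: real) \<longlonglongrightarrow> indicator (\<Union>i. A i) x" for x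
        by (rule LIMSEQ_indicator_UN)
    qed (use Am in \<open>auto intro!: inti sets.countable_UN split: split_indicator\<close>)
    moreover have "(\<lambda>n. \<integral>x. a x * indicator (\<Union>i<n. A i) x \<partial>M) \<longlonglongrightarrow> (\<integral>x. a x * indicator (\<Union>i. A i) x \<partial>M)"
    proof (rule integral_dominated_convergence[where w="\<lambda>x. K"])
      show "AE x in M. (\<lambda>n. a x * indicator (\<Union>i<n. A i) x) \<longlonglongrightarrow> a x * indicator (\<Union>i. A i) x"
        by (intro AE_I2 tendsto_mult tendsto_const LIMSEQ_indicator_UN)
      show "AE x in M. norm (a x * indicator (\<Union>i<n. A i) x) \<le> K" for n
        using bnd K by (intro AE_I2) (auto split: split_indicator)
    qed (use Am in measurable)
    ultimately have "(\<lambda>n. r (\<Union>i<n. A i)) \<longlonglongrightarrow> r (\<Union>i. A i)"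
      unfolding r_def by (rule tendsto_diff)
    then show ?thesis by (simp add: sums_def step)
  qed
  define N where "N = measure_of (space M) (sets M) (\<lambda>A. ennreal (r A))"
  have setsN: "sets N = sets M" by (simp add: N_def sets.sigma_sets_eq)
  have N: "emeasure N A = ennreal (r A)" if "A \<in> sets M" for A
    unfolding N_def
  proof (rule emeasure_measure_of_sigma)
    show "sigma_algebra (space M) (sets M)" ..
    \<comment> \<open>r {} = 0 because the constant series with terms r {} converges.\<close>
    show "positive (sets M) (\<lambda>A. ennreal (r A))"
      using r_sums[of "\<lambda>_. {}"]
        by (auto simp: positive_def disjoint_family_on_def r_def summable_const_iff dest!: sums_summable)
    show "countably_additive (sets M) (\<lambda>A. ennreal (r A))"
    proof (rule countably_additiveI)
      fix A :: "nat \<Rightarrow> 'b set" assume A: "range A \<subseteq> sets M" "disjoint_family A"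
      have "(\<Sum>i. ennreal (r (A i))) = ennreal (\<Sum>i. r (A i))"
        using r_sums[OF A] A r_nonneg by (intro suminf_ennreal2) (auto simp: sums_iff)
      also have "(\<Sum>i. r (A i)) = r (\<Union>i. A i)" using r_sums[OF A] by (simp add: sums_iff)
      finally show "(\<Sum>i. ennreal (r (A i))) = ennreal (r (\<Union>i. A i))" .
    qed
  qed fact
  have finN: "finite_measure N"
    using N[OF sets.top] setsN sets_eq_imp_space_eq[OF setsN] by (intro finite_measureI) auto
  have ac: "absolutely_continuous M N"
    unfolding absolutely_continuous_def
  proof
    fix A assume A: "A \<in> null_sets M"
    have "AE x in M. indicator A x = (0::real)" using A by (auto dest!: AE_not_in simp: indicator_def)
    then have "(\<integral>x. \<bar>indicator A x\<bar> \<partial>M) = (0::real)" by (intro integral_eq_zero_AE) auto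
    moreover have "(\<integral>x. a x * indicator A x \<partial>M) = 0"
      using \<open>AE x in M. indicator A x = (0::real)\<close> by (intro integral_eq_zero_AE) auto
    ultimately have "r A = 0" using labs[OF inti, of A] A unfolding r_def by auto
    then show "A \<in> null_sets N" using A N[of A] setsN by (auto simp: null_sets_def)
  qed
  from finite_measure_real_density[OF M finN setsN ac] obtain f where
    f[measurable]: "f \<in> borel_measurable M" and f0: "\<And>x. 0 \<le> f x" and intf: "integrable M f"
    and fN: "N = density M (\<lambda>x. ennreal (f x))" by blast
  define \<zeta> where "\<zeta> x = f x + a x" for x
  have inta': "integrable M a" using int_mult[of "\<lambda>x. 1" a] bnd by simp
  have int\<zeta>: "integrable M \<zeta>" unfolding \<zeta>_def using intf inta' by simp
  have l_ind: "l (indicator A) = (\<integral>x. \<zeta> x * indicator A x \<partial>M)" if A: "A \<in> sets M" for A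
  proof -
    have "(\<integral>\<^sup>+x. ennreal (f x * indicator A x) \<partial>M) = (\<integral>\<^sup>+x. ennreal (f x) * indicator A x \<partial>M)"
      by (intro nn_integral_cong) (auto split: split_indicator)
    also have "\<dots> = ennreal (r A)" using emeasure_density[of "\<lambda>x. ennreal (f x)" M A] A N[OF A] fN by simp
    finally have *: "(\<integral>\<^sup>+x. ennreal (f x * indicator A x) \<partial>M) = ennreal (r A)" .
    have "(\<integral>x. f x * indicator A x \<partial>M) = enn2real (\<integral>\<^sup>+x. ennreal (f x * indicator A x) \<partial>M)"
      using A f0 by (intro integral_eq_nn_integral) auto
    then have "(\<integral>x. f x * indicator A x \<partial>M) = r A"
      unfolding * using r_nonneg[OF A] by simp
    moreover have "(\<integral>x. \<zeta> x * indicator A x \<partial>M) = (\<integral>x. f x * indicator A x \<partial>M)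
      + (\<integral>x. a x * indicator A x \<partial>M)"
      unfolding \<zeta>_def distrib_right
      using integrable_real_mult_indicator[OF A intf] inta[OF A]
      by (intro Bochner_Integration.integral_add) auto
    ultimately show ?thesis by (simp add: r_def)
  qed
  \<comment> \<open>The density \<zeta> = f + a is at least a everywhere but at most b only almost
    everywhere. Clipping changes it on a null set and makes both bounds pointwise.\<close>
  define \<xi> where "\<xi> x = max (a x) (min (b x) (\<zeta> x))" for x
  have \<zeta>m[measurable]: "\<zeta> \<in> borel_measurable M" using int\<zeta> by auto
  have \<xi>m[measurable]: "\<xi> \<in> borel_measurable M" unfolding \<xi>_def by measurable
  have intb': "integrable M b" using int_mult[of "\<lambda>x. 1" b] bnd by simp
  have "AE x in M. \<zeta> x \<le> b x"
  proof -
    let ?A = "{x \<in> space M. b x < \<zeta> x}"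
    have A: "?A \<in> sets M" by measurable
    have i: "integrable M (\<lambda>x. (\<zeta> x - b x) * indicator ?A x)"
      using int\<zeta> intb' by (intro integrable_real_mult_indicator[OF A]) auto
    have "(\<integral>x. (\<zeta> x - b x) * indicator ?A x \<partial>M) = (\<integral>x. \<zeta> x * indicator ?A x \<partial>M)
      - (\<integral>x. b x * indicator ?A x \<partial>M)"
      unfolding left_diff_distrib using integrable_real_mult_indicator[OF A int\<zeta>] inta[OF A]
      by (intro Bochner_Integration.integral_diff) auto
    also have "\<dots> \<le> 0" using l_up[OF A] l_ind[OF A] by simp
    finally have "(\<integral>x. (\<zeta> x - b x) * indicator ?A x \<partial>M) \<le> 0" .
    moreover have "0 \<le> (\<integral>x. (\<zeta> x - b x) * indicator ?A x \<partial>M)"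
      by (intro integral_nonneg_AE AE_I2) (auto split: split_indicator)
    ultimately have "AE x in M. (\<zeta> x - b x) * indicator ?A x = 0"
      using integral_nonneg_eq_0_iff_AE[OF i] by (auto split: split_indicator)
    then show ?thesis using AE_space by eventually_elim (auto split: split_indicator_asm)
  qed
  then have \<xi>\<zeta>: "AE x in M. \<xi> x = \<zeta> x"
    by eventually_elim (use f0 in \<open>auto simp: \<xi>_def \<zeta>_def max_def\<close>)
  have \<xi>b: "a x \<le> \<xi> x" "\<xi> x \<le> b x" for x using bnd(3)[of x] by (auto simp: \<xi>_def)
  have \<xi>K: "\<bar>\<xi> x\<bar> \<le> K" for x using \<xi>b[of x] bnd(1,2)[of x] by linarith
  have l_rep: "l h = (\<integral>x. \<xi> x * h x \<partial>M)" if "integrable M h" for h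
    using that
  proof (induction rule: integrable_induct)
    case (base A c)
    have "l (\<lambda>x. c * indicator A x) = c * (\<integral>x. \<zeta> x * indicator A x \<partial>M)"
      using lscale[OF inti[OF base(1)]] l_ind[OF base(1)] by simp
    also have "(\<integral>x. \<zeta> x * indicator A x \<partial>M) = (\<integral>x. \<xi> x * indicator A x \<partial>M)"
      using \<xi>\<zeta> base by (intro integral_cong_AE) auto
    finally show ?case by (simp add: mult.commute mult.left_commute)
  next
    case (add f g)
    then show ?case using int_mult[OF add(1) \<xi>m \<xi>K] int_mult[OF add(2) \<xi>m \<xi>K] ladd[of f g]
      by (simp add: distrib_left)
  next
    case (lim h s)
    have "(\<lambda>n. l (s n)) \<longlonglongrightarrow> l h"
      by (rule lcont[where w="\<lambda>x. 2 * \<bar>h x\<bar>"]) (use lim in auto)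
    moreover have "(\<lambda>n. \<integral>x. \<xi> x * s n x \<partial>M) \<longlonglongrightarrow> (\<integral>x. \<xi> x * h x \<partial>M)"
    proof (rule integral_dominated_convergence[where w="\<lambda>x. K * (2 * \<bar>h x\<bar>)"])
      show "AE x in M. (\<lambda>n. \<xi> x * s n x) \<longlonglongrightarrow> \<xi> x * h x"
        using lim by (intro AE_I2 tendsto_mult) auto
      show "AE x in M. norm (\<xi> x * s n x) \<le> K * (2 * \<bar>h x\<bar>)" for n
        using lim \<xi>K K by (intro AE_I2) (auto simp: abs_mult intro!: mult_mono)
    qed (use lim in \<open>auto intro!: borel_measurable_times\<close>)
    ultimately show ?case using lim by (auto intro: LIMSEQ_unique)
  qed
  have "\<forall>h\<in>C. 0 \<le> (\<integral>x. \<xi> x * h x \<partial>M) + q h" using lC l_rep C(1) by metis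
  then show ?thesis using \<xi>b \<xi>m by (intro bexI[of _ \<xi>]) auto
qed

section \<open>Functions of bounded variation\<close>

text \<open>The sum of the family dominates each of its members, and Radon-Nikodym gives real
  densities. Finitely many measures can thus be handled as functions over one measure.\<close>

lemma dominating_finite_measure:
  fixes M :: "'i \<Rightarrow> 'x measure"
  assumes I: "finite I" and M: "\<And>i. i \<in> I \<Longrightarrow> finite_measure (M i)" "\<And>i. i \<in> I \<Longrightarrow> sets (M i) = sets S"
  shows "\<exists>\<sigma> D. finite_measure \<sigma> \<and> sets \<sigma> = sets S \<and>
    (\<forall>i\<in>I. D i \<in> borel_measurable \<sigma> \<and> (\<forall>x. 0 \<le> D i x) \<and> integrable \<sigma> (D i) \<and> M i = density \<sigma> (\<lambda>x. ennreal
      (D i x)))"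
proof -
  define \<sigma> where "\<sigma> = measure_of (space S) (sets S) (\<lambda>A. \<Sum>i\<in>I. emeasure (M i) A)"
  have sets: "sets \<sigma> = sets S" by (simp add: \<sigma>_def sets.sigma_sets_eq)
  have em: "emeasure \<sigma> A = (\<Sum>i\<in>I. emeasure (M i) A)" if "A \<in> sets S" for A
    unfolding \<sigma>_def
  proof (rule emeasure_measure_of_sigma)
    show "countably_additive (sets S) (\<lambda>A. \<Sum>i\<in>I. emeasure (M i) A)"
    proof (rule countably_additiveI)
      fix A :: "nat \<Rightarrow> 'x set" assume A: "range A \<subseteq> sets S" "disjoint_family A"
      have "(\<Sum>n. \<Sum>i\<in>I. emeasure (M i) (A n)) = (\<Sum>i\<in>I. \<Sum>n. emeasure (M i) (A n))"
        by (intro suminf_sum summableI)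
      also have "\<dots> = (\<Sum>i\<in>I. emeasure (M i) (\<Union>n. A n))"
        using A M by (intro sum.cong suminf_emeasure) auto
      finally show "(\<Sum>n. \<Sum>i\<in>I. emeasure (M i) (A n)) = (\<Sum>i\<in>I. emeasure (M i) (\<Union>n. A n))" .
    qed
  qed (use that in \<open>auto simp: positive_def sets.sigma_algebra_axioms\<close>)
  have fin: "finite_measure \<sigma>"
  proof (rule finite_measureI)
    have "emeasure \<sigma> (space \<sigma>) = (\<Sum>i\<in>I. emeasure (M i) (space \<sigma>))"
      using em[of "space \<sigma>"] sets sets.top[of \<sigma>] by auto
    also have "\<dots> \<noteq> \<infinity>"
    proof -
      have "emeasure (M i) (space \<sigma>) \<noteq> top" if "i \<in> I" for i
        using finite_measure.emeasure_finite[OF M(1)[OF that]] by simp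
      then show ?thesis using I by simp
    qed
    finally show "emeasure \<sigma> (space \<sigma>) \<noteq> \<infinity>" .
  qed
  have "absolutely_continuous \<sigma> (M i)" if "i \<in> I" for i
    unfolding absolutely_continuous_def
  proof
    fix A assume "A \<in> null_sets \<sigma>"
    then show "A \<in> null_sets (M i)" using em[of A] sets M(2)[OF that] I that by (auto simp: null_sets_def)
  qed
  then have "\<forall>i\<in>I. \<exists>D\<in>borel_measurable \<sigma>. (\<forall>x. 0 \<le> D x) \<and> integrable \<sigma> D \<and> M i
    = density \<sigma> (\<lambda>x. ennreal (D x))"
    using M sets fin by (intro ballI finite_measure_real_density) auto
  then obtain D where "\<forall>i\<in>I. D i \<in> borel_measurable \<sigma> \<and> (\<forall>x. 0 \<le> D i x) \<and> integrable \<sigma> (D i) \<and> M i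
    = density \<sigma> (\<lambda>x. ennreal (D i x))"
    by (auto simp: Bex_def dest!: bchoice)
  with fin sets show ?thesis by blast
qed

definition deriv_rep :: "'a::euclidean_space set \<Rightarrow> ('a \<Rightarrow> real) \<Rightarrow> 'a measure \<Rightarrow> ('a \<Rightarrow> 'a) \<Rightarrow> bool" where
  "deriv_rep \<Omega> v \<sigma> \<Theta> \<longleftrightarrow> finite_measure \<sigma> \<and> sets \<sigma> = sets (restrict_space borel \<Omega>) \<and> integrable \<sigma> \<Theta> \<and>
     (\<forall>b\<in>Basis. \<forall>\<psi>\<in>test_functions \<Omega>.
        (\<integral>x. v x * partial_deriv b \<psi> x \<partial>lebesgue_on \<Omega>) = - (\<integral>x. \<psi> x * (\<Theta> x \<bullet> b) \<partial>\<sigma>))"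

lemma measurable_restrict_borel:
  "sets \<sigma> = sets (restrict_space borel \<Omega>) \<Longrightarrow> f \<in> borel \<rightarrow>\<^sub>M N \<Longrightarrow> f \<in> \<sigma> \<rightarrow>\<^sub>M N"
  by (subst measurable_cong_sets[of _ "restrict_space borel \<Omega>" _ N]) (auto intro:
    measurable_restrict_space1)

lemma sets_restrict_borel:
  fixes \<Omega> :: "'a::topological_space set"
  assumes "open \<Omega>" shows "A \<in> sets (restrict_space borel \<Omega>) \<longleftrightarrow> A \<in> sets borel \<and> A \<subseteq> \<Omega>"
  using assms by (subst sets_restrict_space_iff) auto

lemma space_restrict_borel: "sets \<sigma> = sets (restrict_space borel \<Omega>) \<Longrightarrow> space \<sigma> = \<Omega>"
  by (drule sets_eq_imp_space_eq) (simp add: space_restrict_space)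

lemma is_distr_deriv_imp_rep:
  assumes "is_distr_deriv \<Omega> v \<nu>"
  shows "\<exists>\<sigma> \<Theta>. deriv_rep \<Omega> v \<sigma> \<Theta> \<and>
    (\<forall>A\<in>sets (restrict_space borel \<Omega>). \<nu> A = (\<integral>x. indicator A x *\<^sub>R \<Theta> x \<partial>\<sigma>))"
proof -
  let ?S = "restrict_space borel \<Omega>"
  obtain P N :: "'a \<Rightarrow> 'a measure" where
    PN: "\<And>b. b \<in> Basis \<Longrightarrow> finite_measure (P b) \<and> sets (P b) = sets ?S"
      "\<And>b. b \<in> Basis \<Longrightarrow> finite_measure (N b) \<and> sets (N b) = sets ?S"
    and \<nu>: "\<And>b A. b \<in> Basis \<Longrightarrow> A \<in> sets ?S \<Longrightarrow> \<nu> A \<bullet> b = measure (P b) A - measure (N b) A"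
    and ibp: "\<And>b \<psi>. b \<in> Basis \<Longrightarrow> \<psi> \<in> test_functions \<Omega> \<Longrightarrow>
       (\<integral>x. v x * partial_deriv b \<psi> x \<partial>lebesgue_on \<Omega>) = - ((\<integral>x. \<psi> x \<partial>P b) - (\<integral>x. \<psi> x \<partial>N b))"
    using assms unfolding is_distr_deriv_def by blast
  \<comment> \<open>The positive and negative parts of all components form one finite family, to be
    dominated by one measure; the Boolean tells the two parts apart.\<close>
  define M where "M i = (if snd i then P (fst i) else N (fst i))" for i :: "'a \<times> bool"
  have "\<exists>\<sigma> D. finite_measure \<sigma> \<and> sets \<sigma> = sets ?S \<and>
    (\<forall>i\<in>Basis \<times> UNIV. D i \<in> borel_measurable \<sigma> \<and> (\<forall>x. 0 \<le> D i x) \<and> integrable \<sigma> (D i) \<and> M i = density \<sigma>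
      (\<lambda>x. ennreal (D i x)))"
    by (rule dominating_finite_measure) (use PN in \<open>auto simp: M_def\<close>)
  then obtain \<sigma> D where fin: "finite_measure \<sigma>" and sets: "sets \<sigma> = sets ?S" and
    D: "\<forall>i\<in>Basis \<times> UNIV. D i \<in> borel_measurable \<sigma> \<and> (\<forall>x. 0 \<le> D i x) \<and> integrable \<sigma> (D i) \<and> M i
      = density \<sigma> (\<lambda>x. ennreal (D i x))"
    by blast
  have DP: "P b = density \<sigma> (\<lambda>x. ennreal (D (b, True) x))" and DN: "N b
    = density \<sigma> (\<lambda>x. ennreal (D (b, False) x))"
    and Di: "integrable \<sigma> (D (b, i))" and D0: "\<And>x. 0 \<le> D (b, i) x" if "b \<in> Basis" for b i
    using D[rule_format, of "(b, True)"] D[rule_format, of "(b, False)"] D[rule_format, of "(b, i)"] that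
    by (auto simp: M_def)
  define \<Theta> where "\<Theta> x = (\<Sum>b\<in>Basis. (D (b, True) x - D (b, False) x) *\<^sub>R b)" for x
  have \<Theta>b: "\<Theta> x \<bullet> b = D (b, True) x - D (b, False) x" if "b \<in> Basis" for x b
    unfolding \<Theta>_def using that
      by (simp add: inner_sum_left inner_Basis if_distrib sum.If_cases cong: if_cong)
  have \<Theta>i: "integrable \<sigma> \<Theta>" unfolding \<Theta>_def using Di
    by (intro Bochner_Integration.integrable_sum integrable_scaleR_left
      Bochner_Integration.integrable_diff) auto
  have "deriv_rep \<Omega> v \<sigma> \<Theta>"
    unfolding deriv_rep_def
  proof (intro conjI ballI fin sets \<Theta>i)
    fix b :: 'a and \<psi> assume b: "b \<in> Basis" and \<psi>: "\<psi> \<in> test_functions \<Omega>"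
    have m: "(\<lambda>x. x) \<in> \<sigma> \<rightarrow>\<^sub>M borel" "\<psi> \<in> borel_measurable \<sigma>"
      using measurable_restrict_borel[OF sets, of "\<lambda>x. x" borel] measurable_restrict_borel[OF sets
        test_measurable[OF \<psi>]]
      by simp_all
    have "(\<integral>x. \<psi> x \<partial>P b) = (\<integral>x. \<psi> x * D (b, True) x \<partial>\<sigma>)" "(\<integral>x. \<psi> x \<partial>N b) = (\<integral>x. \<psi> x * D (b, False) x \<partial>\<sigma>)"
      unfolding DP[OF b] DN[OF b] using m Di[OF b] D0[OF b]
      by (auto simp: integral_density mult.commute borel_measurable_integrable)
    moreover have "(\<integral>x. \<psi> x * (\<Theta> x \<bullet> b) \<partial>\<sigma>) = (\<integral>x. \<psi> x * D (b, True) x \<partial>\<sigma>) - (\<integral>x. \<psi> x * D (b, False) x \<partial>\<sigma>)"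
      using test_integrable[OF \<psi> Di[OF b] m(1)] by (simp add: \<Theta>b[OF b] right_diff_distrib)
    ultimately show "(\<integral>x. v x * partial_deriv b \<psi> x \<partial>lebesgue_on \<Omega>) = - (\<integral>x. \<psi> x * (\<Theta> x \<bullet> b) \<partial>\<sigma>)"
      using ibp[OF b \<psi>] by simp
  qed
  moreover have "\<nu> A = (\<integral>x. indicator A x *\<^sub>R \<Theta> x \<partial>\<sigma>)" if A: "A \<in> sets ?S" for A
  proof (rule euclidean_eqI)
    fix b :: 'a assume b: "b \<in> Basis"
    have A': "A \<in> sets \<sigma>" using A sets by simp
    have meas: "measure (density \<sigma> (\<lambda>x. ennreal (D (b, i) x))) A = (\<integral>x. indicator A x * D (b, i) x \<partial>\<sigma>)" for
      i
    proof -
      have "measure (density \<sigma> (\<lambda>x. ennreal (D (b, i) x))) A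
        = (\<integral>x. indicator A x \<partial>density \<sigma> (\<lambda>x. ennreal (D (b, i) x)))"
        using A' by simp
      also have "\<dots> = (\<integral>x. D (b, i) x *\<^sub>R indicator A x \<partial>\<sigma>)"
        using A' Di[OF b] D0[OF b] by (intro integral_density) auto
      finally show ?thesis by (simp add: mult.commute)
    qed
    have int: "integrable \<sigma> (\<lambda>x. indicator A x * D (b, i) x)" for i
      using integrable_mult_indicator[OF A' Di[OF b]] by simp
    have "(\<integral>x. indicator A x *\<^sub>R \<Theta> x \<partial>\<sigma>) \<bullet> b = (\<integral>x. (indicator A x *\<^sub>R \<Theta> x) \<bullet> b \<partial>\<sigma>)"
      by (subst integral_inner_left) (auto intro: integrable_mult_indicator[OF A' \<Theta>i])
    also have "\<dots> = (\<integral>x. indicator A x * D (b, True) x \<partial>\<sigma>) - (\<integral>x. indicator A x * D (b, False) x \<partial>\<sigma>)"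
      using int by (simp add: \<Theta>b[OF b] right_diff_distrib)
    also have "\<dots> = \<nu> A \<bullet> b" using \<nu>[OF b A] meas DP[OF b] DN[OF b] by simp
    finally show "\<nu> A \<bullet> b = (\<integral>x. indicator A x *\<^sub>R \<Theta> x \<partial>\<sigma>) \<bullet> b" by simp
  qed
  ultimately show ?thesis by blast
qed

lemma rep_imp_is_distr_deriv:
  assumes "deriv_rep \<Omega> v \<sigma> \<Theta>"
  shows "is_distr_deriv \<Omega> v (\<lambda>A. \<integral>x. indicator A x *\<^sub>R \<Theta> x \<partial>\<sigma>)"
proof -
  let ?S = "restrict_space borel \<Omega>"
  have fin: "finite_measure \<sigma>" and sets: "sets \<sigma> = sets ?S" and \<Theta>: "integrable \<sigma> \<Theta>"
    and ibp: "\<And>b \<psi>. b \<in> Basis \<Longrightarrow> \<psi> \<in> test_functions \<Omega> \<Longrightarrow>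
       (\<integral>x. v x * partial_deriv b \<psi> x \<partial>lebesgue_on \<Omega>) = - (\<integral>x. \<psi> x * (\<Theta> x \<bullet> b) \<partial>\<sigma>)"
    using assms by (auto simp: deriv_rep_def)
  define D where "D b i x = max 0 (if i then \<Theta> x \<bullet> b else - (\<Theta> x \<bullet> b))" for b i x
  have Di: "integrable \<sigma> (D b i)" for b i
    unfolding D_def using \<Theta> by (intro integrable_max) (cases i; auto)+
  have D0: "0 \<le> D b i x" for b i x by (auto simp: D_def)
  have D\<Theta>: "\<Theta> x \<bullet> b = D b True x - D b False x" for x b by (auto simp: D_def)
  have int: "integrable \<sigma> (\<lambda>x. indicator A x * D b i x)" if "A \<in> sets \<sigma>" for A b i
    using integrable_mult_indicator[OF that Di] by simp
  define P where "P b = density \<sigma> (\<lambda>x. ennreal (D b True x))" for b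
  define N where "N b = density \<sigma> (\<lambda>x. ennreal (D b False x))" for b
  have fm: "finite_measure (density \<sigma> (\<lambda>x. ennreal (D b i x)))" for b i
  proof (rule finite_measureI)
    have "emeasure (density \<sigma> (\<lambda>x. ennreal (D b i x))) (space \<sigma>) = (\<integral>\<^sup>+x. ennreal (D b i x) \<partial>\<sigma>)"
      using Di[of b i] by (subst emeasure_density) (auto intro!: nn_integral_cong simp: indicator_def)
    also have "\<dots> = ennreal (\<integral>x. D b i x \<partial>\<sigma>)" using Di D0 by (intro nn_integral_eq_integral) auto
    finally show "emeasure (density \<sigma> (\<lambda>x. ennreal (D b i x))) (space (density \<sigma> (\<lambda>x. ennreal (D b i x))))
      \<noteq> \<infinity>" by simp
  qed
  have meas: "measure (density \<sigma> (\<lambda>x. ennreal (D b i x))) A = (\<integral>x. indicator A x * D b i x \<partial>\<sigma>)"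
    if A': "A \<in> sets \<sigma>" for A b i
  proof -
    have "measure (density \<sigma> (\<lambda>x. ennreal (D b i x))) A
      = (\<integral>x. indicator A x \<partial>density \<sigma> (\<lambda>x. ennreal (D b i x)))"
      using A' by simp
    also have "\<dots> = (\<integral>x. D b i x *\<^sub>R indicator A x \<partial>\<sigma>)"
      using A' Di D0 by (intro integral_density) auto
    finally show ?thesis by (simp add: mult.commute)
  qed
  show ?thesis
    unfolding is_distr_deriv_def
  proof (rule exI[of _ P], rule exI[of _ N], intro ballI conjI)
    fix b :: 'a assume b: "b \<in> Basis"
    show "finite_measure (P b)" "finite_measure (N b)" using fm by (auto simp: P_def N_def)
    show "sets (P b) = sets ?S" "sets (N b) = sets ?S" by (auto simp: P_def N_def sets)
    show "(\<integral>x. indicator A x *\<^sub>R \<Theta> x \<partial>\<sigma>) \<bullet> b = measure (P b) A - measure (N b) A" if A: "A \<in> sets ?S" for A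
    proof -
      have A': "A \<in> sets \<sigma>" using A sets by simp
      have "(\<integral>x. indicator A x *\<^sub>R \<Theta> x \<partial>\<sigma>) \<bullet> b = (\<integral>x. (indicator A x *\<^sub>R \<Theta> x) \<bullet> b \<partial>\<sigma>)"
        by (subst integral_inner_left) (auto intro: integrable_mult_indicator[OF A' \<Theta>])
      also have "\<dots> = (\<integral>x. indicator A x * D b True x \<partial>\<sigma>) - (\<integral>x. indicator A x * D b False x \<partial>\<sigma>)"
        using int[OF A'] by (simp add: D\<Theta> right_diff_distrib)
      finally show ?thesis by (simp add: P_def N_def meas[OF A'])
    qed
    fix \<psi> assume \<psi>: "\<psi> \<in> test_functions \<Omega>"
    have m: "(\<lambda>x. x) \<in> \<sigma> \<rightarrow>\<^sub>M borel" "\<psi> \<in> borel_measurable \<sigma>"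
      using measurable_restrict_borel[OF sets, of "\<lambda>x. x" borel] measurable_restrict_borel[OF sets
        test_measurable[OF \<psi>]]
      by simp_all
    have "(\<integral>x. \<psi> x \<partial>P b) = (\<integral>x. \<psi> x * D b True x \<partial>\<sigma>)" "(\<integral>x. \<psi> x \<partial>N b) = (\<integral>x. \<psi> x * D b False x \<partial>\<sigma>)"
      unfolding P_def N_def using m Di D0
      by (auto simp: integral_density mult.commute borel_measurable_integrable)
    moreover have "(\<integral>x. \<psi> x * (\<Theta> x \<bullet> b) \<partial>\<sigma>) = (\<integral>x. \<psi> x * D b True x \<partial>\<sigma>) - (\<integral>x. \<psi> x * D b False x \<partial>\<sigma>)"
      using test_integrable[OF \<psi> Di m(1)] by (simp add: D\<Theta> right_diff_distrib)
    ultimately show "(\<integral>x. v x * partial_deriv b \<psi> x \<partial>lebesgue_on \<Omega>) = - ((\<integral>x. \<psi> x \<partial>P b) - (\<integral>x. \<psi> x \<partial>N b))"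
      using ibp[OF b \<psi>] by simp
  qed
qed

text \<open>Each component is a signed measure determined by its action on test functions. This
  removes the \<open>SOME\<close> in \<open>distr_deriv\<close>: whichever measure was picked agrees
  on Borel subsets of \<open>\<Omega>\<close> with the representation at hand.\<close>

lemma deriv_rep_unique:
  assumes \<Omega>: "open \<Omega>" and r: "deriv_rep \<Omega> v \<sigma> \<Theta>" "deriv_rep \<Omega> v \<sigma>' \<Theta>'"
    and A: "A \<in> sets (restrict_space borel \<Omega>)"
  shows "(\<integral>x. indicator A x *\<^sub>R \<Theta> x \<partial>\<sigma>) = (\<integral>x. indicator A x *\<^sub>R \<Theta>' x \<partial>\<sigma>')"
proof (rule euclidean_eqI)
  fix b :: 'a assume b: "b \<in> Basis"
  have inner: "(\<integral>x. indicator A x *\<^sub>R \<Theta> x \<partial>\<sigma>) \<bullet> b = (\<integral>x. indicator A x * (\<Theta> x \<bullet> b) \<partial>\<sigma>)"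
    if "deriv_rep \<Omega> v \<sigma> \<Theta>" for \<sigma> \<Theta>
    using that A by (subst integral_inner_left[symmetric])
      (auto simp: deriv_rep_def intro!: integrable_mult_indicator)
  have "(\<integral>x. indicator A x * (\<Theta> x \<bullet> b) \<partial>\<sigma>) = (\<integral>x. indicator A x * (\<Theta>' x \<bullet> b) \<partial>\<sigma>')"
  proof (rule test_functions_determine_sets[OF \<Omega>, where f="\<lambda>x. x" and g="\<lambda>x. x"])
    show "(\<lambda>x. x) \<in> \<sigma> \<rightarrow>\<^sub>M borel" "(\<lambda>x. x) \<in> \<sigma>' \<rightarrow>\<^sub>M borel"
      using r by (auto simp: deriv_rep_def intro: measurable_restrict_borel)
    show "A \<in> sets borel" "A \<subseteq> \<Omega>" using A \<Omega> by (auto simp: sets_restrict_borel)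
    show "integrable \<sigma> (\<lambda>x. \<Theta> x \<bullet> b)" "integrable \<sigma>' (\<lambda>x. \<Theta>' x \<bullet> b)" using r by (auto simp: deriv_rep_def)
    show "(\<integral>x. \<psi> x * (\<Theta> x \<bullet> b) \<partial>\<sigma>) = (\<integral>y. \<psi> y * (\<Theta>' y \<bullet> b) \<partial>\<sigma>')" if "\<psi> \<in> test_functions \<Omega>" for \<psi>
      using r b that unfolding deriv_rep_def by (metis minus_equation_iff)
  qed
  then show "(\<integral>x. indicator A x *\<^sub>R \<Theta> x \<partial>\<sigma>) \<bullet> b = (\<integral>x. indicator A x *\<^sub>R \<Theta>' x \<partial>\<sigma>') \<bullet> b"
    using inner[OF r(1)] inner[OF r(2)] by simp
qed

text \<open>The variation of \<Theta> \<sigma> is |\<Theta>| \<sigma>. One bound is the triangle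
  inequality for integrals. For the other, \<open>\<Omega>\<close> is partitioned into countably
  many sets on which \<Theta> stays within e of a fixed vector d n from a dense sequence; there both
  |\<integral> \<Theta>| and \<integral> |\<Theta>| differ from |d n| times the measure by at most e
  times the measure, a total loss of 2 e \<sigma>(\<Omega>).\<close>

lemma variation_on_density:
  fixes \<Theta> :: "'a::euclidean_space \<Rightarrow> 'a"
  assumes \<Omega>: "open \<Omega>" and fin: "finite_measure \<sigma>" and sets: "sets \<sigma> = sets (restrict_space borel \<Omega>)"
    and \<Theta>: "integrable \<sigma> \<Theta>"
  shows "variation_on \<Omega> (\<lambda>A. \<integral>x. indicator A x *\<^sub>R \<Theta> x \<partial>\<sigma>) = ereal (\<integral>x. norm (\<Theta> x) \<partial>\<sigma>)" (is
    "variation_on \<Omega> ?\<nu> = _")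
proof -
  interpret finite_measure \<sigma> by fact
  let ?S = "restrict_space borel \<Omega>"
  let ?P = "{A :: nat \<Rightarrow> 'a set. range A \<subseteq> sets ?S \<and> disjoint_family A \<and> (\<Union>i. A i) = \<Omega>}"
  have sp: "space \<sigma> = \<Omega>" by (rule space_restrict_borel[OF sets])
  have id: "(\<lambda>x. x) \<in> \<sigma> \<rightarrow>\<^sub>M borel" using measurable_restrict_borel[OF sets, of "\<lambda>x. x" borel] by simp
  have sums: "(\<lambda>i. \<integral>x. indicator (A i) x * \<theta> x \<partial>\<sigma>) sums (\<integral>x. \<theta> x \<partial>\<sigma>)"
    if "A \<in> ?P" "integrable \<sigma> \<theta>" for A and \<theta> :: "'a \<Rightarrow> real"
  proof -
    have "(\<lambda>i. \<integral>x. indicator (A i) x * \<theta> x \<partial>\<sigma>) sums (\<integral>x. indicator (\<Union>i. A i) x * \<theta> x \<partial>\<sigma>)"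
      by (rule integral_indicator_sums[OF that(2) id])
        (use that \<Omega> in \<open>auto simp: sets_restrict_borel image_subset_iff\<close>)
    moreover have "(\<integral>x. indicator (\<Union>i. A i) x * \<theta> x \<partial>\<sigma>) = (\<integral>x. \<theta> x \<partial>\<sigma>)"
      using that by (intro Bochner_Integration.integral_cong) (auto simp: sp)
    ultimately show ?thesis by simp
  qed
  have meas: "A i \<in> sets \<sigma>" if "A \<in> ?P" for A i using that sets by auto
  have \<nu>le: "norm (?\<nu> (A i)) \<le> (\<integral>x. indicator (A i) x * norm (\<Theta> x) \<partial>\<sigma>)" if "A \<in> ?P" for A i
    by (rule order_trans[OF integral_norm_bound]) simp
  have summ: "summable (\<lambda>i. norm (?\<nu> (A i)))" if "A \<in> ?P" for A
  proof (rule summable_comparison_test'[where N=0])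
    show "summable (\<lambda>i. \<integral>x. indicator (A i) x * norm (\<Theta> x) \<partial>\<sigma>)"
      using sums[OF that integrable_norm[OF \<Theta>]] by (simp add: sums_iff)
  qed (use \<nu>le[OF that] in simp)
  have eq: "(\<Sum>i. ereal (norm (?\<nu> (A i)))) = ereal (\<Sum>i. norm (?\<nu> (A i)))" if "A \<in> ?P" for A
    using summ[OF that] by (intro sums_unique[symmetric]) (simp add: sums_ereal summable_sums)
  have upper: "(\<Sum>i. norm (?\<nu> (A i))) \<le> (\<integral>x. norm (\<Theta> x) \<partial>\<sigma>)" if "A \<in> ?P" for A
    by (rule sums_le[OF _ summable_sums[OF summ[OF that]] sums[OF that integrable_norm[OF \<Theta>]]]) (rule
      \<nu>le[OF that])
  have lower: "\<exists>A\<in>?P. (\<integral>x. norm (\<Theta> x) \<partial>\<sigma>) - 2 * e * measure \<sigma> \<Omega> \<le> (\<Sum>i. norm (?\<nu> (A i)))" if e: "e > 0" for e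
  proof -
    obtain D :: "'a set" where D: "countable D" "\<And>X. open X \<Longrightarrow> X \<noteq> {} \<Longrightarrow> \<exists>d\<in>D. d \<in> X"
      using countable_dense_setE by metis
    have Dne: "D \<noteq> {}" using D(2)[of UNIV] by auto
    define d where "d = from_nat_into D"
    have rd: "range d = D" unfolding d_def using Dne D(1) by (rule range_from_nat_into)
    define B where "B = disjointed (\<lambda>n. ball (d n) e)"
    have UB: "(\<Union>n. B n) = UNIV"
    proof -
      have "\<exists>n. y \<in> ball (d n) e" for y
      proof -
        obtain x where "x \<in> D" "x \<in> ball y e" using D(2)[of "ball y e"] e by auto
        then show ?thesis using rd by (metis dist_commute mem_ball rangeE)
      qed
      then show ?thesis unfolding B_def UN_disjointed_eq by blast
    qed
    define A where "A n = \<Theta> -` B n \<inter> \<Omega>" for n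
    have "A n \<in> sets \<sigma>" for n
      unfolding A_def sp[symmetric]
      by (rule measurable_sets[OF borel_measurable_integrable[OF \<Theta>]])
        (auto simp: B_def disjointed_def)
    moreover have "disjoint_family A"
      using disjoint_family_disjointed[of "\<lambda>n. ball (d n) e"]
      by (auto simp: A_def B_def disjoint_family_on_def)
    moreover have "(\<Union>n. A n) = \<Omega>"
    proof -
      have "\<exists>n. \<Theta> x \<in> B n" for x using UB by blast
      then show ?thesis by (auto simp: A_def)
    qed
    ultimately have AP: "A \<in> ?P" using sets by auto
    note mA = meas[OF AP]
    have near: "norm (\<Theta> x - d n) \<le> e" if "x \<in> A n" for x n
      using that disjointed_subset[of "\<lambda>n. ball (d n) e" n]
      by (auto simp: A_def B_def dist_norm norm_minus_commute intro: less_imp_le)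
    have est: "(\<integral>x. indicator (A n) x * norm (\<Theta> x) \<partial>\<sigma>) - 2 * e * measure \<sigma> (A n) \<le> norm (?\<nu> (A n))" for n
    proof -
      have i1: "integrable \<sigma> (\<lambda>x. indicator (A n) x *\<^sub>R \<Theta> x)" by (intro integrable_mult_indicator mA \<Theta>)
      have i2: "integrable \<sigma> (\<lambda>x. indicator (A n) x *\<^sub>R d n)" by (intro integrable_mult_indicator mA) auto
      have i3: "integrable \<sigma> (\<lambda>x. indicator (A n) x * norm (\<Theta> x))"
        using integrable_norm[OF i1] by simp
      have i4: "integrable \<sigma> (\<lambda>x. indicator (A n) x :: real)" using mA by (simp add: emeasure_eq_measure)
      have "(\<integral>x. indicator (A n) x * norm (\<Theta> x) \<partial>\<sigma>) \<le> (\<integral>x. indicator (A n) x * (norm (d n) + e) \<partial>\<sigma>)"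
      proof (rule integral_mono[OF i3])
        show "integrable \<sigma> (\<lambda>x. indicator (A n) x * (norm (d n) + e))" using i4
          by (rule integrable_mult_left)
        show "indicator (A n) x * norm (\<Theta> x) \<le> indicator (A n) x * (norm (d n) + e)" for x
          using near[of x n] norm_triangle_ineq2[of "\<Theta> x" "d n"] by (auto split: split_indicator)
      qed
      also have "\<dots> = (\<integral>x. indicator (A n) x \<partial>\<sigma>) * (norm (d n) + e)" by (rule integral_mult_left_zero)
      also have "\<dots> = measure \<sigma> (A n) * norm (d n) + e * measure \<sigma> (A n)"
        using mA by (simp add: algebra_simps)
      finally have 1: "(\<integral>x. indicator (A n) x * norm (\<Theta> x) \<partial>\<sigma>) \<le> measure \<sigma> (A n) * norm (d n)
        + e * measure \<sigma> (A n)" .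
      have "norm ((\<integral>x. indicator (A n) x *\<^sub>R d n \<partial>\<sigma>) - ?\<nu> (A n)) = norm (\<integral>x. indicator (A n) x *\<^sub>R (d n
        - \<Theta> x) \<partial>\<sigma>)"
        using i1 i2 by (simp add: scaleR_diff_right)
      also have "\<dots> \<le> (\<integral>x. norm (indicator (A n) x *\<^sub>R (d n - \<Theta> x)) \<partial>\<sigma>)" by (rule integral_norm_bound)
      also have "\<dots> \<le> (\<integral>x. indicator (A n) x * e \<partial>\<sigma>)"
      proof (rule integral_mono)
        show "integrable \<sigma> (\<lambda>x. norm (indicator (A n) x *\<^sub>R (d n - \<Theta> x)))"
          using i1 i2 by (simp add: scaleR_diff_right)
        show "norm (indicator (A n) x *\<^sub>R (d n - \<Theta> x)) \<le> indicator (A n) x * e" for x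
          using near[of x n] by (auto simp: norm_minus_commute split: split_indicator)
      qed (use i4 in auto)
      also have "\<dots> = e * measure \<sigma> (A n)" using mA by simp
      finally have 2: "norm ((\<integral>x. indicator (A n) x *\<^sub>R d n \<partial>\<sigma>) - ?\<nu> (A n)) \<le> e * measure \<sigma> (A n)" .
      have "(\<integral>x. indicator (A n) x *\<^sub>R d n \<partial>\<sigma>) = measure \<sigma> (A n) *\<^sub>R d n"
        using mA i4 by simp
      then have "norm (\<integral>x. indicator (A n) x *\<^sub>R d n \<partial>\<sigma>) = measure \<sigma> (A n) * norm (d n)" by simp
      with 1 2 norm_triangle_ineq2[of "\<integral>x. indicator (A n) x *\<^sub>R d n \<partial>\<sigma>" "?\<nu> (A n)"] show ?thesis
        by linarith
    qed
    have "(\<lambda>n. measure \<sigma> (A n)) sums measure \<sigma> \<Omega>"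
      using sums[OF AP, of "\<lambda>_. 1"] mA by (simp add: sp A_def Int_assoc)
    then have "(\<lambda>n. (\<integral>x. indicator (A n) x * norm (\<Theta> x) \<partial>\<sigma>) - 2 * e * measure \<sigma> (A n)) sums
       ((\<integral>x. norm (\<Theta> x) \<partial>\<sigma>) - 2 * e * measure \<sigma> \<Omega>)"
      by (intro sums_diff sums[OF AP integrable_norm[OF \<Theta>]] sums_mult)
    then have "(\<integral>x. norm (\<Theta> x) \<partial>\<sigma>) - 2 * e * measure \<sigma> \<Omega> \<le> (\<Sum>i. norm (?\<nu> (A i)))"
      by (rule sums_le[OF est _ summable_sums[OF summ[OF AP]]])
    with AP show ?thesis by blast
  qed
  show ?thesis
    unfolding variation_on_def
  proof (rule antisym)
    show "(SUP A\<in>?P. \<Sum>i. ereal (norm (?\<nu> (A i)))) \<le> ereal (\<integral>x. norm (\<Theta> x) \<partial>\<sigma>)"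
      using upper eq by (intro SUP_least) simp
    show "ereal (\<integral>x. norm (\<Theta> x) \<partial>\<sigma>) \<le> (SUP A\<in>?P. \<Sum>i. ereal (norm (?\<nu> (A i))))"
    proof (rule ereal_le_epsilon2)
      fix \<delta> :: real assume \<delta>: "\<delta> > 0"
      \<comment> \<open>Chosen to keep the loss 2 e \<sigma>(\<Omega>) below \<delta>; the summand 1
        covers the case of zero mass.\<close>
      define e where "e = \<delta> / (2 * (measure \<sigma> \<Omega> + 1))"
      have m: "0 \<le> measure \<sigma> \<Omega>" "0 < measure \<sigma> \<Omega> + 1"
        using measure_nonneg[of \<sigma> \<Omega>] by linarith+
      have e: "e > 0" using \<delta> m unfolding e_def by simp
      have "2 * e * measure \<sigma> \<Omega> = \<delta> * (measure \<sigma> \<Omega> / (measure \<sigma> \<Omega> + 1))"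
      proof -
        have "2 * (\<delta> / (2 * k)) * m = \<delta> * (m / k)" for k m :: real by simp
        then show ?thesis unfolding e_def .
      qed
      also have "\<dots> \<le> \<delta>" using \<delta> m by (intro mult_left_le) auto
      finally have "2 * e * measure \<sigma> \<Omega> \<le> \<delta>" .
      with lower[OF e] obtain A where A: "A \<in> ?P" "(\<integral>x. norm (\<Theta> x) \<partial>\<sigma>) \<le> (\<Sum>i. norm (?\<nu> (A i))) + \<delta>" by force
      have "ereal (\<integral>x. norm (\<Theta> x) \<partial>\<sigma>) \<le> (\<Sum>i. ereal (norm (?\<nu> (A i)))) + ereal \<delta>"
        using A by (simp add: eq)
      also have "\<dots> \<le> (SUP A\<in>?P. \<Sum>i. ereal (norm (?\<nu> (A i)))) + ereal \<delta>"
        using A by (intro add_right_mono SUP_upper)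
      finally show "ereal (\<integral>x. norm (\<Theta> x) \<partial>\<sigma>) \<le> (SUP A\<in>?P. \<Sum>i. ereal (norm (?\<nu> (A i)))) + ereal \<delta>" .
    qed
  qed
qed

lemma variation_on_cong:
  assumes "\<And>A. A \<in> sets (restrict_space borel \<Omega>) \<Longrightarrow> \<nu> A = \<nu>' A"
  shows "variation_on \<Omega> \<nu> = variation_on \<Omega> \<nu>'"
  unfolding variation_on_def by (intro SUP_cong refl suminf_cong) (auto simp: assms image_subset_iff)

lemma BV_iff_rep: "v \<in> BV \<Omega> \<longleftrightarrow> integrable (lebesgue_on \<Omega>) v \<and> (\<exists>\<sigma> \<Theta>. deriv_rep \<Omega> v \<sigma> \<Theta>)"
  unfolding BV_def using is_distr_deriv_imp_rep rep_imp_is_distr_deriv by blast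

lemma TV_eq_rep:
  assumes \<Omega>: "open \<Omega>" and v: "integrable (lebesgue_on \<Omega>) v" and r: "deriv_rep \<Omega> v \<sigma> \<Theta>"
  shows "TV \<Omega> v = ereal (\<integral>x. norm (\<Theta> x) \<partial>\<sigma>)"
proof -
  have BV: "v \<in> BV \<Omega>" using v r BV_iff_rep by blast
  have "is_distr_deriv \<Omega> v (distr_deriv \<Omega> v)"
    unfolding distr_deriv_def by (rule someI[of "is_distr_deriv \<Omega> v", OF rep_imp_is_distr_deriv[OF r]])
  then obtain \<sigma>' \<Theta>' where r': "deriv_rep \<Omega> v \<sigma>' \<Theta>'"
    and "\<forall>A\<in>sets (restrict_space borel \<Omega>). distr_deriv \<Omega> v A = (\<integral>x. indicator A x *\<^sub>R \<Theta>' x \<partial>\<sigma>')"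
    using is_distr_deriv_imp_rep by blast
  then have "variation_on \<Omega> (distr_deriv \<Omega> v) = variation_on \<Omega> (\<lambda>A. \<integral>x. indicator A x *\<^sub>R \<Theta> x \<partial>\<sigma>)"
    using deriv_rep_unique[OF \<Omega> r r'] by (intro variation_on_cong) simp
  then show ?thesis using variation_on_density[OF \<Omega>] r BV by (simp add: TV_def deriv_rep_def)
qed

text \<open>Over a common dominating measure the derivative of a linear combination is the pointwise
  combination of the densities. The triangle inequality for them is later the convexity of
  TV.\<close>

lemma deriv_rep_lincomb:
  assumes ru: "deriv_rep \<Omega> u \<sigma>1 \<Theta>1" and rv: "deriv_rep \<Omega> v \<sigma>2 \<Theta>2" and \<Omega>: "open \<Omega>"
    and u: "integrable (lebesgue_on \<Omega>) u" and v: "integrable (lebesgue_on \<Omega>) v"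
  shows "\<exists>\<sigma> \<Theta>. deriv_rep \<Omega> (\<lambda>x. c * u x + d * v x) \<sigma> \<Theta> \<and>
    (\<integral>x. norm (\<Theta> x) \<partial>\<sigma>) \<le> \<bar>c\<bar> * (\<integral>x. norm (\<Theta>1 x) \<partial>\<sigma>1) + \<bar>d\<bar> * (\<integral>x. norm (\<Theta>2 x) \<partial>\<sigma>2)"
proof -
  let ?S = "restrict_space borel \<Omega>"
  have "\<exists>\<sigma> D. finite_measure \<sigma> \<and> sets \<sigma> = sets ?S \<and>
    (\<forall>i\<in>(UNIV::bool set). D i \<in> borel_measurable \<sigma> \<and> (\<forall>x. 0 \<le> D i x) \<and> integrable \<sigma> (D i) \<and>
       (if i then \<sigma>1 else \<sigma>2) = density \<sigma> (\<lambda>x. ennreal (D i x)))"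
    by (rule dominating_finite_measure) (use ru rv in \<open>auto simp: deriv_rep_def\<close>)
  then obtain \<sigma> D where fin: "finite_measure \<sigma>" and sets: "sets \<sigma> = sets ?S" and
    D: "\<forall>i\<in>(UNIV::bool set). D i \<in> borel_measurable \<sigma> \<and> (\<forall>x. 0 \<le> D i x) \<and> integrable \<sigma> (D i) \<and>
       (if i then \<sigma>1 else \<sigma>2) = density \<sigma> (\<lambda>x. ennreal (D i x))"
    by blast
  have Dm[measurable]: "D i \<in> borel_measurable \<sigma>" and D0: "0 \<le> D i x" for i x
    using D by auto
  have s1: "\<sigma>1 = density \<sigma> (\<lambda>x. ennreal (D True x))" and s2: "\<sigma>2 = density \<sigma> (\<lambda>x. ennreal (D False x))"
    using D[rule_format, of True] D[rule_format, of False] by auto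
  have ss: "sets \<sigma>1 = sets \<sigma>" "sets \<sigma>2 = sets \<sigma>" using ru rv sets by (auto simp: deriv_rep_def)
  have \<Theta>1: "integrable \<sigma>1 \<Theta>1" and \<Theta>2: "integrable \<sigma>2 \<Theta>2" using ru rv by (auto simp: deriv_rep_def)
  have m1[measurable]: "\<Theta>1 \<in> borel_measurable \<sigma>" and m2[measurable]: "\<Theta>2 \<in> borel_measurable \<sigma>"
    using borel_measurable_integrable[OF \<Theta>1] borel_measurable_integrable[OF \<Theta>2]
    by (auto simp: measurable_cong_sets[OF ss(1) refl] measurable_cong_sets[OF ss(2) refl])
  have i1: "integrable \<sigma> (\<lambda>x. D True x *\<^sub>R \<Theta>1 x)" and i2: "integrable \<sigma> (\<lambda>x. D False x *\<^sub>R \<Theta>2 x)"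
    using \<Theta>1 \<Theta>2 D0 unfolding s1 s2 by (auto simp: integrable_density)
  define \<Theta> where "\<Theta> x = c *\<^sub>R (D True x *\<^sub>R \<Theta>1 x) + d *\<^sub>R (D False x *\<^sub>R \<Theta>2 x)" for x
  have i\<Theta>: "integrable \<sigma> \<Theta>" unfolding \<Theta>_def
    by (intro Bochner_Integration.integrable_add integrable_scaleR_right i1 i2)
  have id: "(\<lambda>x. x) \<in> \<sigma> \<rightarrow>\<^sub>M borel" using measurable_restrict_borel[OF sets, of "\<lambda>x. x" borel] by simp
  have idl: "(\<lambda>x. x) \<in> lebesgue_on \<Omega> \<rightarrow>\<^sub>M borel"
    by (intro measurable_restrict_space1 measurable_completion) simp
  have "deriv_rep \<Omega> (\<lambda>x. c * u x + d * v x) \<sigma> \<Theta>"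
    unfolding deriv_rep_def
  proof (intro conjI ballI fin sets i\<Theta>)
    fix b :: 'a and \<psi> assume b: "b \<in> Basis" and \<psi>: "\<psi> \<in> test_functions \<Omega>"
    have [measurable]: "\<psi> \<in> borel_measurable \<sigma>"
      using measurable_restrict_borel[OF sets test_measurable[OF \<psi>]] .
    have e1: "(\<integral>x. \<psi> x * (\<Theta>1 x \<bullet> b) \<partial>\<sigma>1) = (\<integral>x. \<psi> x * ((D True x *\<^sub>R \<Theta>1 x) \<bullet> b) \<partial>\<sigma>)"
      unfolding s1 using D0 by (subst integral_density) (auto simp: mult.commute mult.left_commute)
    have e2: "(\<integral>x. \<psi> x * (\<Theta>2 x \<bullet> b) \<partial>\<sigma>2) = (\<integral>x. \<psi> x * ((D False x *\<^sub>R \<Theta>2 x) \<bullet> b) \<partial>\<sigma>)"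
      unfolding s2 using D0 by (subst integral_density) (auto simp: mult.commute mult.left_commute)
    have j1: "integrable \<sigma> (\<lambda>x. \<psi> x * ((D True x *\<^sub>R \<Theta>1 x) \<bullet> b))"
      and j2: "integrable \<sigma> (\<lambda>x. \<psi> x * ((D False x *\<^sub>R \<Theta>2 x) \<bullet> b))"
      by (intro test_integrable[OF \<psi> _ id] integrable_inner_left i1 i2)+
    have k1: "integrable (lebesgue_on \<Omega>) (\<lambda>x. partial_deriv b \<psi> x * u x)"
      and k2: "integrable (lebesgue_on \<Omega>) (\<lambda>x. partial_deriv b \<psi> x * v x)"
      by (intro test_integrable[OF test_partial_deriv[OF \<psi>] _ idl] u v)+
    have "(\<integral>x. (c * u x + d * v x) * partial_deriv b \<psi> x \<partial>lebesgue_on \<Omega>) =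
      (\<integral>x. c * (partial_deriv b \<psi> x * u x) + d * (partial_deriv b \<psi> x * v x) \<partial>lebesgue_on \<Omega>)"
      by (intro Bochner_Integration.integral_cong) (auto simp: algebra_simps)
    also have "\<dots> = c * (\<integral>x. u x * partial_deriv b \<psi> x \<partial>lebesgue_on \<Omega>)
      + d * (\<integral>x. v x * partial_deriv b \<psi> x \<partial>lebesgue_on \<Omega>)"
      using k1 k2 by (simp add: mult.commute)
    also have "\<dots> = - (c * (\<integral>x. \<psi> x * (\<Theta>1 x \<bullet> b) \<partial>\<sigma>1) + d * (\<integral>x. \<psi> x * (\<Theta>2 x \<bullet> b) \<partial>\<sigma>2))"
      using ru rv b \<psi> by (simp add: deriv_rep_def)
    also have "c * (\<integral>x. \<psi> x * (\<Theta>1 x \<bullet> b) \<partial>\<sigma>1) + d * (\<integral>x. \<psi> x * (\<Theta>2 x \<bullet> b) \<partial>\<sigma>2)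
        = (\<integral>x. c * (\<psi> x * ((D True x *\<^sub>R \<Theta>1 x) \<bullet> b)) + d * (\<psi> x * ((D False x *\<^sub>R \<Theta>2 x) \<bullet> b)) \<partial>\<sigma>)"
      unfolding e1 e2 using j1 j2 by (subst Bochner_Integration.integral_add) auto
    also have "\<dots> = (\<integral>x. \<psi> x * (\<Theta> x \<bullet> b) \<partial>\<sigma>)"
      by (intro Bochner_Integration.integral_cong) (auto simp: \<Theta>_def inner_add_left algebra_simps)
    finally show "(\<integral>x. (c * u x + d * v x) * partial_deriv b \<psi> x \<partial>lebesgue_on \<Omega>)
      = - (\<integral>x. \<psi> x * (\<Theta> x \<bullet> b) \<partial>\<sigma>)" .
  qed
  moreover have "(\<integral>x. norm (\<Theta> x) \<partial>\<sigma>) \<le> \<bar>c\<bar> * (\<integral>x. norm (\<Theta>1 x) \<partial>\<sigma>1) + \<bar>d\<bar> * (\<integral>x. norm (\<Theta>2 x) \<partial>\<sigma>2)"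
  proof -
    have "(\<integral>x. norm (\<Theta> x) \<partial>\<sigma>) \<le> (\<integral>x. \<bar>c\<bar> * norm (D True x *\<^sub>R \<Theta>1 x) + \<bar>d\<bar> * norm (D False x *\<^sub>R \<Theta>2 x) \<partial>\<sigma>)"
    proof (rule integral_mono)
      show "norm (\<Theta> x) \<le> \<bar>c\<bar> * norm (D True x *\<^sub>R \<Theta>1 x) + \<bar>d\<bar> * norm (D False x *\<^sub>R \<Theta>2 x)" for x
        unfolding \<Theta>_def by (rule order_trans[OF norm_triangle_ineq]) (simp add: abs_mult mult.assoc)
      show "integrable \<sigma> (\<lambda>x. \<bar>c\<bar> * norm (D True x *\<^sub>R \<Theta>1 x) + \<bar>d\<bar> * norm (D False x *\<^sub>R \<Theta>2 x))"
        using i1 i2 by (intro Bochner_Integration.integrable_add integrable_mult_right integrable_norm)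
    qed (use i\<Theta> in auto)
    also have "\<dots> = \<bar>c\<bar> * (\<integral>x. norm (D True x *\<^sub>R \<Theta>1 x) \<partial>\<sigma>) + \<bar>d\<bar> * (\<integral>x. norm (D False x *\<^sub>R \<Theta>2 x) \<partial>\<sigma>)"
      using integrable_norm[OF i1] integrable_norm[OF i2] by (subst Bochner_Integration.integral_add) auto
    also have "(\<integral>x. norm (D True x *\<^sub>R \<Theta>1 x) \<partial>\<sigma>) = (\<integral>x. norm (\<Theta>1 x) \<partial>\<sigma>1)"
      unfolding s1 using D0 by (subst integral_density) auto
    also have "(\<integral>x. norm (D False x *\<^sub>R \<Theta>2 x) \<partial>\<sigma>) = (\<integral>x. norm (\<Theta>2 x) \<partial>\<sigma>2)"
      unfolding s2 using D0 by (subst integral_density) auto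
    finally show ?thesis .
  qed
  ultimately show ?thesis by blast
qed

text \<open>Meaningful on \<open>BV \<Omega>\<close> only; where TV is infinite, the value is the
  default 0 of \<open>real_of_ereal\<close>.\<close>

definition tv :: "'a::euclidean_space set \<Rightarrow> ('a \<Rightarrow> real) \<Rightarrow> real" where
  "tv \<Omega> v = real_of_ereal (TV \<Omega> v)"

lemma tv_eq_rep:
  "open \<Omega> \<Longrightarrow> integrable (lebesgue_on \<Omega>) v \<Longrightarrow> deriv_rep \<Omega> v \<sigma> \<Theta> \<Longrightarrow> tv \<Omega> v = (\<integral>x. norm (\<Theta> x) \<partial>\<sigma>)"
  by (simp add: tv_def TV_eq_rep)

lemma TV_eq_tv: "open \<Omega> \<Longrightarrow> v \<in> BV \<Omega> \<Longrightarrow> TV \<Omega> v = ereal (tv \<Omega> v)"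
  by (auto simp: BV_iff_rep TV_eq_rep tv_eq_rep)

lemma tv_nonneg: "open \<Omega> \<Longrightarrow> v \<in> BV \<Omega> \<Longrightarrow> 0 \<le> tv \<Omega> v"
  by (auto simp: BV_iff_rep tv_eq_rep)

lemma BV_lincomb:
  assumes \<Omega>: "open \<Omega>" and "u \<in> BV \<Omega>" "v \<in> BV \<Omega>"
  shows "(\<lambda>x. c * u x + d * v x) \<in> BV \<Omega>"
    and "tv \<Omega> (\<lambda>x. c * u x + d * v x) \<le> \<bar>c\<bar> * tv \<Omega> u + \<bar>d\<bar> * tv \<Omega> v"
proof -
  obtain \<sigma>1 \<Theta>1 \<sigma>2 \<Theta>2 where r: "integrable (lebesgue_on \<Omega>) u" "deriv_rep \<Omega> u \<sigma>1 \<Theta>1"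
    "integrable (lebesgue_on \<Omega>) v" "deriv_rep \<Omega> v \<sigma>2 \<Theta>2"
    using assms by (auto simp: BV_iff_rep)
  obtain \<sigma> \<Theta> where l: "deriv_rep \<Omega> (\<lambda>x. c * u x + d * v x) \<sigma> \<Theta>"
    "(\<integral>x. norm (\<Theta> x) \<partial>\<sigma>) \<le> \<bar>c\<bar> * (\<integral>x. norm (\<Theta>1 x) \<partial>\<sigma>1) + \<bar>d\<bar> * (\<integral>x. norm (\<Theta>2 x) \<partial>\<sigma>2)"
    using deriv_rep_lincomb[OF r(2,4) \<Omega> r(1,3), of c d] by blast
  have i: "integrable (lebesgue_on \<Omega>) (\<lambda>x. c * u x + d * v x)" using r by auto
  show "(\<lambda>x. c * u x + d * v x) \<in> BV \<Omega>" using i l(1) BV_iff_rep by blast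
  show "tv \<Omega> (\<lambda>x. c * u x + d * v x) \<le> \<bar>c\<bar> * tv \<Omega> u + \<bar>d\<bar> * tv \<Omega> v"
    using l(2) by (simp add: tv_eq_rep[OF \<Omega> i l(1)] tv_eq_rep[OF \<Omega> r(1,2)] tv_eq_rep[OF \<Omega> r(3,4)])
qed

section \<open>Composition with Lipschitz functions\<close>

abbreviation unit_interval :: "real measure" where
  "unit_interval \<equiv> restrict_space lborel {0..1}"

lemma finite_unit_interval: "finite_measure unit_interval"
  by (rule finite_measureI) (simp add: space_restrict_space emeasure_restrict_space)

lemma measurable_unit_interval: "(\<lambda>s. s) \<in> unit_interval \<rightarrow>\<^sub>M borel"
  by (intro measurable_restrict_space1) simp

text \<open>The parameter integral is taken over the measure \<open>unit_interval\<close>, so that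
  Fubini can exchange it with the integral over x.\<close>

lemma test_FTC:
  assumes \<psi>: "\<psi> \<in> test_functions W"
  shows "\<psi> (x - v) - \<psi> x = - (\<integral>s. partial_deriv v \<psi> (x - s *\<^sub>R v) \<partial>unit_interval)"
proof -
  have "(\<integral>s. indicator {0..1} s *\<^sub>R (- partial_deriv v \<psi> (x - s *\<^sub>R v)) \<partial>lborel) =
     \<psi> (x - 1 *\<^sub>R v) - \<psi> (x - 0 *\<^sub>R v)"
  proof (rule integral_FTC_atLeastAtMost)
    show "((\<lambda>s. \<psi> (x - s *\<^sub>R v)) has_vector_derivative - partial_deriv v \<psi> (x
      - s *\<^sub>R v)) (at s within {0..1})" for s
    proof -
      have "((\<lambda>s. x - s *\<^sub>R v) has_derivative (\<lambda>h. - (h *\<^sub>R v))) (at s within {0..1})"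
        by (auto intro!: derivative_eq_intros)
      from has_derivative_compose[OF this test_has_derivative[OF \<psi>]]
      have "((\<lambda>s. \<psi> (x - s *\<^sub>R v)) has_derivative (\<lambda>h. partial_deriv (- (h *\<^sub>R v)) \<psi> (x
        - s *\<^sub>R v))) (at s within {0..1})" .
      moreover have "partial_deriv (- (h *\<^sub>R v)) \<psi> y = h *\<^sub>R (- partial_deriv v \<psi> y)" for h y
      proof -
        interpret linear "\<lambda>h. partial_deriv h \<psi> y"
          using test_has_derivative[OF \<psi>] by (rule has_derivative_linear)
        show ?thesis by (simp add: neg scale)
      qed
      ultimately show ?thesis by (simp add: has_vector_derivative_def)
    qed
    show "continuous_on {0..1} (\<lambda>s. - partial_deriv v \<psi> (x - s *\<^sub>R v))"
      by (intro continuous_intros continuous_on_compose2[OF test_continuous[OF test_partial_deriv[OF \<psi>], of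
        UNIV v]]) auto
  qed simp
  then show ?thesis by (simp add: integral_restrict_space)
qed

lemma lborel_translate:
  fixes f :: "'a::euclidean_space \<Rightarrow> real"
  assumes [measurable]: "f \<in> borel_measurable borel"
  shows "(\<integral>x. f (x + v) \<partial>lborel) = (\<integral>x. f x \<partial>lborel)"
    and "integrable lborel (\<lambda>x. f (x + v)) \<longleftrightarrow> integrable lborel f"
proof -
  have eq: "lborel = distr lborel borel (\<lambda>x. x + v)"
  proof -
    have "(+) v = (\<lambda>x. x + v)" by (auto simp: add.commute)
    then show ?thesis using lborel_distr_plus[of v] by simp
  qed
  show "(\<integral>x. f (x + v) \<partial>lborel) = (\<integral>x. f x \<partial>lborel)"
    by (subst (2) eq) (simp add: integral_distr)
  show "integrable lborel (\<lambda>x. f (x + v)) \<longleftrightarrow> integrable lborel f"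
    by (subst (2) eq) (simp add: integrable_distr_eq)
qed

lemma unit_interval_const: "(\<integral>s. c \<partial>unit_interval) = (c::real)"
  by (simp add: measure_restrict_space space_restrict_space)

text \<open>For test functions this is the fundamental theorem of calculus along \<open>v\<close>; as an identity
  between measures it extends to bounded Borel functions.\<close>

lemma difference_eq_average:
  fixes g :: "'a::euclidean_space \<Rightarrow> real"
  assumes W: "open W" and g: "integrable lborel g" and fin: "finite_measure \<sigma>"
    and sets: "sets \<sigma> = sets (restrict_space borel \<Omega>)" and \<Theta>: "integrable \<sigma> \<Theta>"
    and ibp: "\<And>\<psi>. \<psi> \<in> test_functions \<Omega> \<Longrightarrow> (\<integral>x. g x * partial_deriv v \<psi> x \<partial>lborel) = - (\<integral>x. \<psi> x * \<Theta> x \<partial>\<sigma>)"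
    and sub: "\<And>x s. x \<in> W \<Longrightarrow> 0 \<le> s \<Longrightarrow> s \<le> 1 \<Longrightarrow> x + s *\<^sub>R v \<in> \<Omega>"
    and h: "h \<in> borel_measurable borel" "\<And>x. \<bar>h x\<bar> \<le> C" "\<And>x. x \<notin> W \<Longrightarrow> h x = 0"
  shows "(\<integral>x. h x * (g (x + v) - g x) \<partial>lborel) = (\<integral>z. h (fst z
    - snd z *\<^sub>R v) * \<Theta> (fst z) \<partial>(\<sigma> \<Otimes>\<^sub>M unit_interval))"
proof -
  interpret finite_measure \<sigma> by fact
  interpret U: finite_measure unit_interval by (rule finite_unit_interval)
  interpret P: pair_sigma_finite \<sigma> unit_interval ..
  interpret Q: pair_sigma_finite lborel unit_interval ..
  have gm[measurable]: "g \<in> borel_measurable borel" using borel_measurable_integrable[OF g] by simp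
  have \<Theta>m[measurable]: "\<Theta> \<in> borel_measurable \<sigma>" using \<Theta> by auto
  have id[measurable]: "(\<lambda>x. x) \<in> \<sigma> \<rightarrow>\<^sub>M borel"
    using measurable_restrict_borel[OF sets, of "\<lambda>x. x" borel] by simp
  have snd[measurable]: "snd \<in> M \<Otimes>\<^sub>M unit_interval \<rightarrow>\<^sub>M borel" for M :: "'a measure"
    by (rule measurable_compose[OF measurable_snd measurable_unit_interval])
  have fst[measurable]: "fst \<in> \<sigma> \<Otimes>\<^sub>M M \<rightarrow>\<^sub>M borel" for M :: "real measure"
    by (rule measurable_compose[OF measurable_fst id])
  have map[measurable]: "(\<lambda>z. fst z - snd z *\<^sub>R v) \<in> \<sigma> \<Otimes>\<^sub>M unit_interval \<rightarrow>\<^sub>M borel"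
    by measurable
  have i\<Theta>: "integrable (\<sigma> \<Otimes>\<^sub>M unit_interval) (\<lambda>z. \<Theta> (fst z))"
  proof (rule P.Fubini_integrable)
    show "(\<lambda>z. \<Theta> (fst z)) \<in> borel_measurable (\<sigma> \<Otimes>\<^sub>M unit_interval)" by measurable
    show "integrable \<sigma> (\<lambda>x. \<integral>y. norm (\<Theta> (fst (x, y))) \<partial>unit_interval)"
      using \<Theta> by (simp add: unit_interval_const)
  qed simp
  \<comment> \<open>The two source spaces are \<open>lborel\<close> with the identity and the
    product of \<sigma> and the unit interval with the shear (x, s) -> x - s v. Verifying the claim
    for test functions on \<open>W\<close> is therefore enough.\<close>
  show ?thesis
  proof (rule test_functions_determine[where \<Omega>=W and f="\<lambda>x. x"])
    show "open W" by fact
    show "(\<lambda>x. x) \<in> lborel \<rightarrow>\<^sub>M borel" by simp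
    show "(\<lambda>z. fst z - snd z *\<^sub>R v) \<in> \<sigma> \<Otimes>\<^sub>M unit_interval \<rightarrow>\<^sub>M borel" by (rule map)
    have gv: "integrable lborel (\<lambda>x. g (x + v))" using lborel_translate(2)[OF gm] g by simp
    then show "integrable lborel (\<lambda>x. g (x + v) - g x)" using g by simp
    show "integrable (\<sigma> \<Otimes>\<^sub>M unit_interval) (\<lambda>z. \<Theta> (fst z))" by (rule i\<Theta>)
    fix \<psi> assume \<psi>: "\<psi> \<in> test_functions W"
    have [measurable]: "\<psi> \<in> borel_measurable borel" using test_measurable[OF \<psi>] .
    have \<psi>': "partial_deriv v \<psi> \<in> test_functions W" by (rule test_partial_deriv[OF \<psi>])
    have [measurable]: "partial_deriv v \<psi> \<in> borel_measurable borel" using test_measurable[OF \<psi>'] .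
    have j1: "integrable lborel (\<lambda>x. \<psi> (x - v) * g x)"
    proof -
      have "integrable lborel (\<lambda>x. \<psi> (x + v - v) * g (x + v))" using test_integrable[OF \<psi> gv, of "\<lambda>x. x"]
        by simp
      then show ?thesis by (subst (asm) lborel_translate(2)) auto
    qed
    have j2: "integrable lborel (\<lambda>x. \<psi> x * g x)" using test_integrable[OF \<psi> g, of "\<lambda>x. x"] by simp
    have "(\<integral>x. \<psi> x * (g (x + v) - g x) \<partial>lborel) = (\<integral>x. \<psi> (x + v - v) * g (x + v) \<partial>lborel)
      - (\<integral>x. \<psi> x * g x \<partial>lborel)"
      using test_integrable[OF \<psi> gv, of "\<lambda>x. x"] j2 by (simp add: right_diff_distrib)
    also have "(\<integral>x. \<psi> (x + v - v) * g (x + v) \<partial>lborel) = (\<integral>x. \<psi> (x - v) * g x \<partial>lborel)"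
      by (rule lborel_translate(1)) measurable
    also have "\<dots> - (\<integral>x. \<psi> x * g x \<partial>lborel) = (\<integral>x. g x * (\<psi> (x - v) - \<psi> x) \<partial>lborel)"
      using j1 j2 by (simp add: right_diff_distrib mult.commute)
    also have "\<dots> = - (\<integral>x. (\<integral>s. g x * partial_deriv v \<psi> (x - s *\<^sub>R v) \<partial>unit_interval) \<partial>lborel)"
      unfolding test_FTC[OF \<psi>] by simp
    also have "(\<integral>x. (\<integral>s. g x * partial_deriv v \<psi> (x - s *\<^sub>R v) \<partial>unit_interval) \<partial>lborel) =
       (\<integral>s. (\<integral>x. g x * partial_deriv v \<psi> (x - s *\<^sub>R v) \<partial>lborel) \<partial>unit_interval)"
    proof (rule Q.Fubini_integral[symmetric])
      have ig: "integrable (lborel \<Otimes>\<^sub>M unit_interval) (\<lambda>z. g (fst z))"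
      proof (rule Q.Fubini_integrable)
        show "integrable lborel (\<lambda>x. \<integral>y. norm (g (fst (x, y))) \<partial>unit_interval)"
          using g by (simp add: unit_interval_const)
      qed auto
      have "(\<lambda>z. fst z - snd z *\<^sub>R v) \<in> (lborel \<Otimes>\<^sub>M unit_interval) \<rightarrow>\<^sub>M borel" by measurable
      from test_integrable[OF \<psi>' ig this]
      show "integrable (lborel \<Otimes>\<^sub>M unit_interval) (\<lambda>(x, s). g x * partial_deriv v \<psi> (x - s *\<^sub>R v))"
        by (simp add: case_prod_beta' mult.commute)
    qed
    \<comment> \<open>For each s the shifted \<psi> is a test function of \<open>\<Omega>\<close>,
      because W + s v stays inside \<open>\<Omega>\<close>; this is the only place where the
      integration by parts for g enters.\<close>
    also have "\<dots> = (\<integral>s. - (\<integral>x. \<psi> (x - s *\<^sub>R v) * \<Theta> x \<partial>\<sigma>) \<partial>unit_interval)"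
    proof (rule Bochner_Integration.integral_cong[OF refl])
      fix s assume "s \<in> space unit_interval"
      then have s: "0 \<le> s" "s \<le> 1" by (auto simp: space_restrict_space)
      have \<psi>s: "(\<lambda>x. \<psi> (x - s *\<^sub>R v)) \<in> test_functions \<Omega>"
        by (rule test_shift[OF \<psi>]) (use sub s in auto)
      have "partial_deriv v (\<lambda>x. \<psi> (x - s *\<^sub>R v)) x = partial_deriv v \<psi> (x - s *\<^sub>R v)" for x
        by (intro partial_deriv_shift test_differentiable[OF \<psi>])
      then show "(\<integral>x. g x * partial_deriv v \<psi> (x - s *\<^sub>R v) \<partial>lborel) = - (\<integral>x. \<psi> (x - s *\<^sub>R v) * \<Theta> x \<partial>\<sigma>)"
        using ibp[OF \<psi>s] by simp
    qed
    also have "- \<dots> = (\<integral>s. (\<integral>x. \<psi> (x - s *\<^sub>R v) * \<Theta> x \<partial>\<sigma>) \<partial>unit_interval)" by simp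
    also have "\<dots> = (\<integral>z. \<psi> (fst z - snd z *\<^sub>R v) * \<Theta> (fst z) \<partial>(\<sigma> \<Otimes>\<^sub>M unit_interval))"
      using test_integrable[OF \<psi> i\<Theta> map] by (subst P.integral_snd) (auto simp: case_prod_beta')
    finally show "(\<integral>x. \<psi> x * (g (x + v) - g x) \<partial>lborel) = (\<integral>z. \<psi> (fst z
      - snd z *\<^sub>R v) * \<Theta> (fst z) \<partial>(\<sigma> \<Otimes>\<^sub>M unit_interval))" .
  qed (use h in auto)
qed

lemma partial_deriv_scale:
  assumes "\<psi> \<in> test_functions \<Omega>"
  shows "partial_deriv (c *\<^sub>R e) \<psi> x = c * partial_deriv e \<psi> x"
proof -
  interpret linear "\<lambda>h. partial_deriv h \<psi> x"
    using test_has_derivative[OF assms] by (rule has_derivative_linear)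
  show ?thesis by (simp add: scale)
qed

lemma test_line_deriv:
  assumes "\<psi> \<in> test_functions \<Omega>"
  shows "((\<lambda>s. \<psi> (x - s *\<^sub>R e)) has_real_derivative - partial_deriv e \<psi> (x - s *\<^sub>R e)) (at s)"
proof -
  have "((\<lambda>s. x - s *\<^sub>R e) has_derivative (\<lambda>h. (- h) *\<^sub>R e)) (at s)"
    by (auto intro!: derivative_eq_intros)
  from has_derivative_compose[OF this test_has_derivative[OF assms]]
  have "((\<lambda>s. \<psi> (x - s *\<^sub>R e)) has_derivative (\<lambda>h. partial_deriv ((- h) *\<^sub>R e) \<psi> (x - s *\<^sub>R e))) (at s)" .
  moreover have "(\<lambda>h. partial_deriv ((- h) *\<^sub>R e) \<psi> y) = (*) (- partial_deriv e \<psi> y)" for y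
    unfolding partial_deriv_scale[OF assms] by (auto simp: fun_eq_iff)
  ultimately show ?thesis by (simp only: has_field_derivative_def)
qed

text \<open>Translations and product measures are handled for Borel functions on the whole space.
  Extending u by zero and changing it on a null set brings it into this form.\<close>

lemma borel_representative:
  fixes u :: "'a::euclidean_space \<Rightarrow> real"
  assumes \<Omega>: "open \<Omega>" and u: "integrable (lebesgue_on \<Omega>) u"
  obtains g where "g \<in> borel_measurable borel" "integrable lborel g" "AE x in lebesgue. x \<in> \<Omega> \<longrightarrow> u x = g x"
proof -
  have L: "\<Omega> \<inter> space lebesgue \<in> sets lebesgue" using \<Omega> by simp
  have iu: "integrable lebesgue (\<lambda>x. indicator \<Omega> x *\<^sub>R u x)"
    using u L by (simp add: integrable_restrict_space)
  then obtain g where g: "g \<in> borel_measurable lborel" "AE x in lborel. indicator \<Omega> x *\<^sub>R u x = g x"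
    using completion_ex_borel_measurable_real[of "\<lambda>x. indicator \<Omega> x *\<^sub>R u x" lborel] by blast
  have ae: "AE x in lebesgue. indicator \<Omega> x *\<^sub>R u x = g x" using g(2) by (rule AE_completion)
  have "integrable lebesgue g"
    by (rule Bochner_Integration.integrable_cong_AE_imp[OF iu _ ae])
       (use g(1) in \<open>auto intro: measurable_completion\<close>)
  then have "integrable lborel g" using g(1) by (simp add: integrable_completion)
  moreover have "AE x in lebesgue. x \<in> \<Omega> \<longrightarrow> u x = g x" using ae by eventually_elim auto
  ultimately show ?thesis using g(1) that by simp
qed

lemma integral_representative:
  fixes F :: "'a::euclidean_space \<Rightarrow> real"
  assumes \<Omega>: "open \<Omega>" and F: "F \<in> borel_measurable (lebesgue_on \<Omega>)" and G: "G \<in> borel_measurable borel"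
    and FG: "AE x in lebesgue. x \<in> \<Omega> \<longrightarrow> F x = G x"
    and \<psi>: "\<psi> \<in> borel_measurable borel" "\<And>x. x \<notin> \<Omega> \<Longrightarrow> \<psi> x = 0"
  shows "(\<integral>x. F x * \<psi> x \<partial>lebesgue_on \<Omega>) = (\<integral>x. G x * \<psi> x \<partial>lborel)"
proof -
  have L: "\<Omega> \<inter> space lebesgue \<in> sets lebesgue" using \<Omega> by simp
  have \<psi>l: "\<psi> \<in> borel_measurable (lebesgue_on \<Omega>)"
    by (intro measurable_restrict_space1 measurable_completion) (use \<psi>(1) in simp)
  have "(\<lambda>x. F x * \<psi> x) \<in> borel_measurable (lebesgue_on \<Omega>)" using F \<psi>l by measurable
  then have m: "(\<lambda>x. indicator \<Omega> x *\<^sub>R (F x * \<psi> x)) \<in> borel_measurable lebesgue"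
    using L by (simp add: borel_measurable_restrict_space_iff)
  have "(\<integral>x. F x * \<psi> x \<partial>lebesgue_on \<Omega>) = (\<integral>x. indicator \<Omega> x *\<^sub>R (F x * \<psi> x) \<partial>lebesgue)"
    using L by (rule integral_restrict_space)
  also have "\<dots> = (\<integral>x. G x * \<psi> x \<partial>lebesgue)"
  proof (rule integral_cong_AE[OF m])
    show "(\<lambda>x. G x * \<psi> x) \<in> borel_measurable lebesgue"
      using G \<psi>(1) by (intro measurable_completion) simp
    show "AE x in lebesgue. indicator \<Omega> x *\<^sub>R (F x * \<psi> x) = G x * \<psi> x"
      using FG by eventually_elim (auto simp: \<psi>(2) split: split_indicator)
  qed
  also have "\<dots> = (\<integral>x. G x * \<psi> x \<partial>lborel)"
    using G \<psi>(1) by (intro integral_completion) simp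
  finally show ?thesis .
qed

lemma deriv_rep_direction:
  assumes r: "deriv_rep \<Omega> u \<sigma> \<Theta>" and \<Omega>: "open \<Omega>" and u: "integrable (lebesgue_on \<Omega>) u"
    and \<psi>: "\<psi> \<in> test_functions \<Omega>"
  shows "(\<integral>x. u x * partial_deriv e \<psi> x \<partial>lebesgue_on \<Omega>) = - (\<integral>x. \<psi> x * (\<Theta> x \<bullet> e) \<partial>\<sigma>)"
proof -
  have sets: "sets \<sigma> = sets (restrict_space borel \<Omega>)" and \<Theta>: "integrable \<sigma> \<Theta>" using r
    by (auto simp: deriv_rep_def)
  have id: "(\<lambda>x. x) \<in> \<sigma> \<rightarrow>\<^sub>M borel" using measurable_restrict_borel[OF sets, of "\<lambda>x. x" borel] by simp
  have idl: "(\<lambda>x. x) \<in> lebesgue_on \<Omega> \<rightarrow>\<^sub>M borel"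
    by (intro measurable_restrict_space1 measurable_completion) simp
  have k: "integrable (lebesgue_on \<Omega>) (\<lambda>x. u x * partial_deriv b \<psi> x)" for b
    using test_integrable[OF test_partial_deriv[OF \<psi>] u idl] by (simp add: mult.commute)
  have j: "integrable \<sigma> (\<lambda>x. \<psi> x * (\<Theta> x \<bullet> b))" for b
    by (intro test_integrable[OF \<psi> _ id] integrable_inner_left \<Theta>)
  have "(\<integral>x. u x * partial_deriv e \<psi> x \<partial>lebesgue_on \<Omega>) =
     (\<integral>x. (\<Sum>b\<in>Basis. (e \<bullet> b) * (u x * partial_deriv b \<psi> x)) \<partial>lebesgue_on \<Omega>)"
    by (intro Bochner_Integration.integral_cong refl)
      (simp add: partial_deriv_basis[OF test_differentiable[OF \<psi>], of e] sum_distrib_left mult.left_commute)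
  also have "\<dots> = (\<Sum>b\<in>Basis. (e \<bullet> b) * (\<integral>x. u x * partial_deriv b \<psi> x \<partial>lebesgue_on \<Omega>))"
    using k by (subst Bochner_Integration.integral_sum) auto
  also have "\<dots> = (\<Sum>b\<in>Basis. - ((e \<bullet> b) * (\<integral>x. \<psi> x * (\<Theta> x \<bullet> b) \<partial>\<sigma>)))"
    using r \<psi> by (intro sum.cong) (auto simp: deriv_rep_def)
  also have "\<dots> = - (\<integral>x. (\<Sum>b\<in>Basis. (e \<bullet> b) * (\<psi> x * (\<Theta> x \<bullet> b))) \<partial>\<sigma>)"
    using j by (subst Bochner_Integration.integral_sum) (auto simp: sum_negf)
  also have "(\<integral>x. (\<Sum>b\<in>Basis. (e \<bullet> b) * (\<psi> x * (\<Theta> x \<bullet> b))) \<partial>\<sigma>) = (\<integral>x. \<psi> x * (\<Theta> x \<bullet> e) \<partial>\<sigma>)"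
    by (intro Bochner_Integration.integral_cong refl)
      (simp add: euclidean_inner[of _ e] sum_distrib_left mult.commute mult.left_commute)
  finally show ?thesis .
qed

text \<open>The difference quotient in direction \<open>e\<close> is moved from \<open>\<phi>\<close> to \<open>T \<circ> u\<close>, where \<open>T\<close> can be dropped;
  then \<open>difference_eq_average\<close> applies with \<open>h = \<bar>\<phi>\<bar> sgn (u(x + v) - u(x))\<close>.\<close>

lemma Lipschitz_comp_bound:
  fixes u :: "'a::euclidean_space \<Rightarrow> real"
  assumes \<Omega>: "open \<Omega>" and u: "integrable (lebesgue_on \<Omega>) u" and r: "deriv_rep \<Omega> u \<sigma> \<Theta>"
    and T: "1-lipschitz_on UNIV T" "T 0 = 0" and \<phi>: "\<phi> \<in> test_functions \<Omega>"
  shows "- (\<integral>x. T (u x) * partial_deriv e \<phi> x \<partial>lebesgue_on \<Omega>) \<le> (\<integral>x. \<bar>\<phi> x\<bar> * \<bar>\<Theta> x \<bullet> e\<bar> \<partial>\<sigma>)"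
proof -
  have fin: "finite_measure \<sigma>" and sets: "sets \<sigma> = sets (restrict_space borel \<Omega>)" and \<Theta>: "integrable \<sigma> \<Theta>"
    using r by (auto simp: deriv_rep_def)
  interpret finite_measure \<sigma> by fact
  interpret U: finite_measure unit_interval by (rule finite_unit_interval)
  interpret P: pair_sigma_finite \<sigma> unit_interval ..
  have id[measurable]: "(\<lambda>x. x) \<in> \<sigma> \<rightarrow>\<^sub>M borel"
    using measurable_restrict_borel[OF sets, of "\<lambda>x. x" borel] by simp
  have sndm[measurable]: "snd \<in> \<sigma> \<Otimes>\<^sub>M unit_interval \<rightarrow>\<^sub>M borel"
    by (rule measurable_compose[OF measurable_snd measurable_unit_interval])
  have fstm[measurable]: "fst \<in> \<sigma> \<Otimes>\<^sub>M unit_interval \<rightarrow>\<^sub>M borel"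
    by (rule measurable_compose[OF measurable_fst id])
  have \<Theta>m[measurable]: "\<Theta> \<in> borel_measurable \<sigma>" using \<Theta> by auto
  have \<phi>m[measurable]: "\<phi> \<in> borel_measurable borel" by (rule test_measurable[OF \<phi>])
  have d\<phi>: "partial_deriv e \<phi> \<in> test_functions \<Omega>" by (rule test_partial_deriv[OF \<phi>])
  have d\<phi>m[measurable]: "partial_deriv e \<phi> \<in> borel_measurable borel" by (rule test_measurable[OF d\<phi>])
  have Tm[measurable]: "T \<in> borel_measurable borel"
    using lipschitz_on_continuous_on[OF T(1)] by (rule borel_measurable_continuous_onI)
  have TL: "\<bar>T x - T y\<bar> \<le> \<bar>x - y\<bar>" for x y using lipschitz_onD[OF T(1), of x y] by (simp add: dist_real_def)
  have T0: "\<bar>T x\<bar> \<le> \<bar>x\<bar>" for x using TL[of x 0] T(2) by simp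
  obtain g where gm[measurable]: "g \<in> borel_measurable borel" and g: "integrable lborel g"
    and ug: "AE x in lebesgue. x \<in> \<Omega> \<longrightarrow> u x = g x"
    using borel_representative[OF \<Omega> u] .
  have iTg: "integrable lborel (\<lambda>x. T (g x))"
    by (rule Bochner_Integration.integrable_bound[OF g]) (use T0 in auto)
  have conv: "(\<integral>x. T (u x) * partial_deriv e \<phi> x \<partial>lebesgue_on \<Omega>)
    = (\<integral>x. T (g x) * partial_deriv e \<phi> x \<partial>lborel)"
  proof (rule integral_representative[OF \<Omega>])
    show "(\<lambda>x. T (u x)) \<in> borel_measurable (lebesgue_on \<Omega>)"
      using borel_measurable_integrable[OF u] by measurable
    show "AE x in lebesgue. x \<in> \<Omega> \<longrightarrow> T (u x) = T (g x)" using ug by eventually_elim auto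
  qed (use test_outside[OF d\<phi>] in auto)
  obtain K where K: "compact K" "K \<subseteq> \<Omega>" "\<And>x. x \<notin> K \<Longrightarrow> \<phi> x = 0" using test_functionsE[OF \<phi>] by metis
  obtain \<rho> where \<rho>: "\<rho> > 0" "(\<Union>x\<in>K. ball x \<rho>) \<subseteq> \<Omega>"
    using compact_subset_open_imp_ball_epsilon_subset[OF K(1) \<Omega> K(2)] by blast
  \<comment> \<open>Balls of radius \<rho> around K lie in \<open>\<Omega>\<close>; half of the
    radius goes into the neighbourhood and the other half is left for the shift.\<close>
  define W where "W = (\<Union>x\<in>K. ball x (\<rho> / 2))"
  have W: "open W" by (auto simp: W_def)
  have KW: "K \<subseteq> W" using \<rho> by (force simp: W_def)
  have W\<Omega>: "x + y \<in> \<Omega>" if "x \<in> W" "norm y < \<rho> / 2" for x y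
  proof -
    obtain k where k: "k \<in> K" "dist k x < \<rho> / 2" using \<open>x \<in> W\<close> by (auto simp: W_def)
    have "dist k (x + y) \<le> dist k x + norm y" using dist_triangle[of k "x + y" x] by (simp add: dist_norm)
    then have "x + y \<in> ball k \<rho>" using k that by simp
    then show ?thesis using k \<rho> by blast
  qed
  \<comment> \<open>Step lengths tending to 0 for which every shift t n e is shorter than \<rho> /
    2. The summand 1 in the denominator covers e = 0.\<close>
  define t where "t n = (\<rho> / 2) / (norm e + 1) * inverse (real (Suc n))" for n
  have tpos: "t n > 0" for n unfolding t_def using \<rho> norm_ge_zero[of e]
    by (intro mult_pos_pos divide_pos_pos) (auto intro: add_nonneg_pos)
  have tlim: "t \<longlonglongrightarrow> 0"
    unfolding t_def by (rule tendsto_mult_right_zero[OF LIMSEQ_inverse_real_of_nat])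
  have tsmall: "t n * norm e < \<rho> / 2" for n
  proof -
    have "t n \<le> (\<rho> / 2) / (norm e + 1)"
      unfolding t_def using \<rho> norm_ge_zero[of e]
        by (intro mult_left_le) (auto simp: inverse_eq_divide simp del: of_nat_Suc)
    then have "t n * (norm e + 1) \<le> (\<rho> / 2) / (norm e + 1) * (norm e + 1)" by (intro mult_right_mono) auto
    also have "\<dots> = \<rho> / 2" using norm_ge_zero[of e]
      by (intro nonzero_divide_eq_eq[THEN iffD1, symmetric]) (auto simp: add_nonneg_eq_0_iff)
    finally have "t n * (norm e + 1) \<le> \<rho> / 2" .
    moreover have "t n * norm e < t n * (norm e + 1)" using tpos[of n] by simp
    ultimately show ?thesis by simp
  qed
  obtain B where B: "\<And>x. \<bar>partial_deriv e \<phi> x\<bar> \<le> B" "B > 0" using test_bounded[OF d\<phi>] by metis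
  obtain C where C: "\<And>x. \<bar>\<phi> x\<bar> \<le> C" "C > 0" using test_bounded[OF \<phi>] by metis
  let ?L = "\<lambda>n. \<integral>x. T (g x) * ((\<phi> (x - t n *\<^sub>R e) - \<phi> x) / t n) \<partial>lborel"
  let ?R = "\<lambda>n. \<integral>z. \<bar>\<phi> (fst z - snd z *\<^sub>R (t n *\<^sub>R e))\<bar> * \<bar>\<Theta> (fst z) \<bullet> e\<bar> \<partial>(\<sigma> \<Otimes>\<^sub>M unit_interval)"
  have i\<Theta>: "integrable (\<sigma> \<Otimes>\<^sub>M unit_interval) (\<lambda>z. \<bar>\<Theta> (fst z) \<bullet> e\<bar>)"
  proof (rule P.Fubini_integrable)
    show "(\<lambda>z. \<bar>\<Theta> (fst z) \<bullet> e\<bar>) \<in> borel_measurable (\<sigma> \<Otimes>\<^sub>M unit_interval)" by measurable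
    show "integrable \<sigma> (\<lambda>x. \<integral>y. norm \<bar>\<Theta> (fst (x, y)) \<bullet> e\<bar> \<partial>unit_interval)"
      using \<Theta> by (simp add: unit_interval_const)
  qed simp
  have i\<phi>\<Theta>: "integrable (\<sigma> \<Otimes>\<^sub>M unit_interval) (\<lambda>z. \<bar>\<phi> (fst z - snd z *\<^sub>R v)\<bar> * \<bar>\<Theta> (fst z) \<bullet> e\<bar>)" for v
  proof (rule Bochner_Integration.integrable_bound)
    show "integrable (\<sigma> \<Otimes>\<^sub>M unit_interval) (\<lambda>z. C * \<bar>\<Theta> (fst z) \<bullet> e\<bar>)" using i\<Theta> by simp
    show "AE z in \<sigma> \<Otimes>\<^sub>M unit_interval. norm (\<bar>\<phi> (fst z - snd z *\<^sub>R v)\<bar> * \<bar>\<Theta> (fst z) \<bullet> e\<bar>)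
      \<le> norm (C * \<bar>\<Theta> (fst z) \<bullet> e\<bar>)"
      using C by (intro AE_I2) (auto simp: abs_mult intro!: mult_right_mono)
  qed measurable
  have LR: "?L n \<le> ?R n" for n
  proof -
    define v where "v = t n *\<^sub>R e"
    define h where "h x = sgn (g (x + v) - g x) * \<bar>\<phi> x\<bar>" for x
    have ih: "(\<integral>x. h x * (g (x + v) - g x) \<partial>lborel) = (\<integral>z. h (fst z
      - snd z *\<^sub>R v) * (\<Theta> (fst z) \<bullet> v) \<partial>(\<sigma> \<Otimes>\<^sub>M unit_interval))"
    proof (rule difference_eq_average[OF W g fin sets])
      show "integrable \<sigma> (\<lambda>x. \<Theta> x \<bullet> v)" using \<Theta> by simp
      show "(\<integral>x. g x * partial_deriv v \<psi> x \<partial>lborel) = - (\<integral>x. \<psi> x * (\<Theta> x \<bullet> v) \<partial>\<sigma>)"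
        if \<psi>: "\<psi> \<in> test_functions \<Omega>" for \<psi>
        unfolding deriv_rep_direction[OF r \<Omega> u \<psi>, symmetric]
        using test_partial_deriv[OF \<psi>]
        by (intro integral_representative[OF \<Omega> _ gm ug, symmetric] borel_measurable_integrable[OF u])
          (auto intro: test_measurable test_outside)
      show "x + s *\<^sub>R v \<in> \<Omega>" if "x \<in> W" "0 \<le> s" "s \<le> 1" for x s
      proof (rule W\<Omega>[OF that(1)])
        have "norm (s *\<^sub>R v) = s * (t n * norm e)" using that tpos[of n] by (simp add: v_def)
        also have "\<dots> \<le> 1 * (t n * norm e)" using that tpos[of n] by (intro mult_right_mono) auto
        finally show "norm (s *\<^sub>R v) < \<rho> / 2" using tsmall[of n] by simp
      qed
      show "h \<in> borel_measurable borel" unfolding h_def by measurable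
      show "\<bar>h x\<bar> \<le> C" for x using C by (auto simp: h_def abs_mult sgn_if)
      show "h x = 0" if "x \<notin> W" for x using that KW K(3) by (auto simp: h_def)
    qed
    have igv: "integrable lborel (\<lambda>x. g (x + v) - g x)" using lborel_translate(2)[OF gm] g by simp
    have iw: "integrable lborel (\<lambda>x. \<bar>\<phi> x\<bar> * \<bar>g (x + v) - g x\<bar>)"
      using integrable_norm[OF test_integrable[OF \<phi> igv, of "\<lambda>x. x"]] by (simp add: abs_mult)
    have iTgv: "integrable lborel (\<lambda>x. T (g (x + v)))" using lborel_translate(2)[of "\<lambda>x. T (g x)" v] iTg
      by simp
    have j2: "integrable lborel (\<lambda>x. \<phi> x * T (g x))" using test_integrable[OF \<phi> iTg, of "\<lambda>x. x"] by simp
    have j3: "integrable lborel (\<lambda>x. \<phi> x * T (g (x + v)))" using test_integrable[OF \<phi> iTgv, of "\<lambda>x. x"]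
      by simp
    have j1: "integrable lborel (\<lambda>x. \<phi> (x - v) * T (g x))"
    proof -
      have "integrable lborel (\<lambda>x. \<phi> (x + v - v) * T (g (x + v)))" using j3 by simp
      then show ?thesis by (subst (asm) lborel_translate(2)) auto
    qed
    have "?L n * t n = (\<integral>x. \<phi> (x - v) * T (g x) - \<phi> x * T (g x) \<partial>lborel)"
      using tpos[of n] by (subst integral_mult_left_zero[symmetric], intro
        Bochner_Integration.integral_cong)
        (auto simp: v_def field_simps)
    also have "\<dots> = (\<integral>x. \<phi> (x - v) * T (g x) \<partial>lborel) - (\<integral>x. \<phi> x * T (g x) \<partial>lborel)"
      using j1 j2 by simp
    also have "(\<integral>x. \<phi> (x - v) * T (g x) \<partial>lborel) = (\<integral>x. \<phi> (x + v - v) * T (g (x + v)) \<partial>lborel)"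
      by (rule lborel_translate(1)[symmetric]) measurable
    also have "\<dots> - (\<integral>x. \<phi> x * T (g x) \<partial>lborel) = (\<integral>x. \<phi> x * T (g (x + v)) - \<phi> x * T (g x) \<partial>lborel)"
      using j3 j2 by simp
    also have "\<dots> \<le> (\<integral>x. \<bar>\<phi> x\<bar> * \<bar>g (x + v) - g x\<bar> \<partial>lborel)"
    proof (rule integral_mono[OF _ iw])
      show "integrable lborel (\<lambda>x. \<phi> x * T (g (x + v)) - \<phi> x * T (g x))" using j2 j3 by simp
      fix x
      have "\<phi> x * (T (g (x + v)) - T (g x)) \<le> \<bar>\<phi> x\<bar> * \<bar>T (g (x + v)) - T (g x)\<bar>"
        by (metis abs_ge_self abs_mult)
      also have "\<dots> \<le> \<bar>\<phi> x\<bar> * \<bar>g (x + v) - g x\<bar>" by (intro mult_left_mono TL) auto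
      finally show "\<phi> x * T (g (x + v)) - \<phi> x * T (g x) \<le> \<bar>\<phi> x\<bar> * \<bar>g (x + v) - g x\<bar>"
        by (simp add: right_diff_distrib)
    qed
    also have "\<dots> = (\<integral>x. h x * (g (x + v) - g x) \<partial>lborel)"
      by (intro Bochner_Integration.integral_cong) (auto simp: h_def sgn_if)
    also have "\<dots> \<le> (\<integral>z. t n * (\<bar>\<phi> (fst z - snd z *\<^sub>R v)\<bar> * \<bar>\<Theta> (fst z) \<bullet> e\<bar>) \<partial>(\<sigma> \<Otimes>\<^sub>M unit_interval))"
      unfolding ih
    proof (rule integral_mono_AE')
      show "integrable (\<sigma> \<Otimes>\<^sub>M unit_interval) (\<lambda>z. t n * (\<bar>\<phi> (fst z - snd z *\<^sub>R v)\<bar> * \<bar>\<Theta> (fst z) \<bullet> e\<bar>))"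
        using i\<phi>\<Theta> by simp
      have "h y * (w \<bullet> v) \<le> t n * (\<bar>\<phi> y\<bar> * \<bar>w \<bullet> e\<bar>)" for y w
      proof -
        have "h y * (w \<bullet> v) \<le> \<bar>h y\<bar> * \<bar>w \<bullet> v\<bar>" by (metis abs_ge_self abs_mult)
        also have "\<dots> \<le> \<bar>\<phi> y\<bar> * (t n * \<bar>w \<bullet> e\<bar>)"
          using tpos[of n] by (intro mult_mono) (auto simp: h_def v_def abs_mult sgn_if)
        finally show ?thesis by (simp add: mult.left_commute)
      qed
      then show "AE z in \<sigma> \<Otimes>\<^sub>M unit_interval. h (fst z - snd z *\<^sub>R v) * (\<Theta> (fst z) \<bullet> v) \<le> t n * (\<bar>\<phi> (fst z
        - snd z *\<^sub>R v)\<bar> * \<bar>\<Theta> (fst z) \<bullet> e\<bar>)"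
        by simp
      show "AE z in \<sigma> \<Otimes>\<^sub>M unit_interval. 0 \<le> t n * (\<bar>\<phi> (fst z - snd z *\<^sub>R v)\<bar> * \<bar>\<Theta> (fst z) \<bullet> e\<bar>)"
        using tpos[of n] by (auto intro!: mult_nonneg_nonneg)
    qed
    also have "\<dots> = ?R n * t n" by (simp add: v_def mult.commute)
    finally show ?thesis using tpos[of n] by (rule mult_right_le_imp_le)
  qed
  have Llim: "?L \<longlonglongrightarrow> (\<integral>x. T (g x) * (- partial_deriv e \<phi> x) \<partial>lborel)"
  proof (rule integral_dominated_convergence[where w="\<lambda>x. B * \<bar>T (g x)\<bar>"])
    show "AE x in lborel. (\<lambda>n. T (g x) * ((\<phi> (x - t n *\<^sub>R e) - \<phi> x) / t n)) \<longlonglongrightarrow> T (g x) *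
      - partial_deriv e \<phi> x"
    proof (intro AE_I2 tendsto_mult tendsto_const)
      fix x
      have "((\<lambda>h. (\<phi> (x - h *\<^sub>R e) - \<phi> x) / h) \<longlongrightarrow> - partial_deriv e \<phi> x) (at 0)"
        using test_line_deriv[OF \<phi>, of x e 0] by (simp add: has_field_derivative_iff)
      moreover have "filterlim t (at 0) sequentially"
        using tlim tpos by (auto simp: filterlim_at intro!: always_eventually) (metis less_irrefl)
      ultimately show "(\<lambda>n. (\<phi> (x - t n *\<^sub>R e) - \<phi> x) / t n) \<longlonglongrightarrow> - partial_deriv e \<phi> x"
        by (rule filterlim_compose)
    qed
    show "AE x in lborel. norm (T (g x) * ((\<phi> (x - t n *\<^sub>R e) - \<phi> x) / t n)) \<le> B * \<bar>T (g x)\<bar>" for n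
    proof (rule AE_I2)
      fix x
      \<comment> \<open>The mean value theorem bounds all difference quotients by the supremum B of
        the derivative, which yields the majorant.\<close>
      have "\<exists>z>0. z < t n \<and> \<phi> (x - t n *\<^sub>R e) - \<phi> (x - 0 *\<^sub>R e) = (t n - 0) * (- partial_deriv e \<phi> (x
        - z *\<^sub>R e))"
        by (rule MVT2[OF tpos]) (rule test_line_deriv[OF \<phi>])
      then obtain z where "\<phi> (x - t n *\<^sub>R e) - \<phi> x = t n * (- partial_deriv e \<phi> (x - z *\<^sub>R e))" by auto
      then have "\<bar>(\<phi> (x - t n *\<^sub>R e) - \<phi> x) / t n\<bar> \<le> B" using tpos[of n] B by simp
      then have "\<bar>T (g x)\<bar> * \<bar>(\<phi> (x - t n *\<^sub>R e) - \<phi> x) / t n\<bar> \<le> \<bar>T (g x)\<bar> * B"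
        by (intro mult_left_mono) auto
      then show "norm (T (g x) * ((\<phi> (x - t n *\<^sub>R e) - \<phi> x) / t n)) \<le> B * \<bar>T (g x)\<bar>"
        by (simp add: abs_mult mult.commute)
    qed
    show "integrable lborel (\<lambda>x. B * \<bar>T (g x)\<bar>)" using iTg by simp
    have Tg: "(\<lambda>x. T (g x)) \<in> borel_measurable borel" by (rule measurable_compose[OF gm Tm])
    show "(\<lambda>x. T (g x) * - partial_deriv e \<phi> x) \<in> borel_measurable lborel"
      using Tg d\<phi>m by (simp add: borel_measurable_times)
    have "(\<lambda>x. \<phi> (x - t n *\<^sub>R e)) \<in> borel_measurable borel" for n
      by (rule measurable_compose[OF _ \<phi>m]) simp
    then show "(\<lambda>x. T (g x) * ((\<phi> (x - t n *\<^sub>R e) - \<phi> x) / t n)) \<in> borel_measurable lborel" for n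
      using Tg \<phi>m by (simp add: borel_measurable_times borel_measurable_diff borel_measurable_divide)
  qed
  have Rlim: "?R \<longlonglongrightarrow> (\<integral>z. \<bar>\<phi> (fst z)\<bar> * \<bar>\<Theta> (fst z) \<bullet> e\<bar> \<partial>(\<sigma> \<Otimes>\<^sub>M unit_interval))"
  proof (rule integral_dominated_convergence[where w="\<lambda>z. C * \<bar>\<Theta> (fst z) \<bullet> e\<bar>"])
    show "AE z in \<sigma> \<Otimes>\<^sub>M unit_interval. (\<lambda>n. \<bar>\<phi> (fst z
      - snd z *\<^sub>R (t n *\<^sub>R e))\<bar> * \<bar>\<Theta> (fst z) \<bullet> e\<bar>) \<longlonglongrightarrow> \<bar>\<phi> (fst z)\<bar> * \<bar>\<Theta> (fst z) \<bullet> e\<bar>"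
    proof (intro AE_I2 tendsto_mult tendsto_const tendsto_rabs)
      fix z :: "'a \<times> real"
      have "(\<lambda>n. fst z - snd z *\<^sub>R (t n *\<^sub>R e)) \<longlonglongrightarrow> fst z - snd z *\<^sub>R (0 *\<^sub>R e)"
        by (intro tendsto_intros tlim)
      moreover have "isCont \<phi> (fst z)" using test_continuous[OF \<phi>, of UNIV]
        by (simp add: continuous_on_eq_continuous_at)
      ultimately show "(\<lambda>n. \<phi> (fst z - snd z *\<^sub>R (t n *\<^sub>R e))) \<longlonglongrightarrow> \<phi> (fst z)"
        using isCont_tendsto_compose[of "fst z" \<phi> "\<lambda>n. fst z - snd z *\<^sub>R (t n *\<^sub>R e)" sequentially] by simp
    qed
    show "AE z in \<sigma> \<Otimes>\<^sub>M unit_interval. norm (\<bar>\<phi> (fst z - snd z *\<^sub>R (t n *\<^sub>R e))\<bar> * \<bar>\<Theta> (fst z) \<bullet> e\<bar>)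
      \<le> C * \<bar>\<Theta> (fst z) \<bullet> e\<bar>" for n
      using C by (intro AE_I2) (auto simp: abs_mult intro!: mult_right_mono)
    show "integrable (\<sigma> \<Otimes>\<^sub>M unit_interval) (\<lambda>z. C * \<bar>\<Theta> (fst z) \<bullet> e\<bar>)" using i\<Theta> by simp
  qed measurable
  \<comment> \<open>The limit integrand does not depend on the shift parameter, and the unit
    interval has mass one.\<close>
  have "(\<integral>z. \<bar>\<phi> (fst z)\<bar> * \<bar>\<Theta> (fst z) \<bullet> e\<bar> \<partial>(\<sigma> \<Otimes>\<^sub>M unit_interval))
    = (\<integral>x. (\<integral>s. \<bar>\<phi> x\<bar> * \<bar>\<Theta> x \<bullet> e\<bar> \<partial>unit_interval) \<partial>\<sigma>)"
    using i\<phi>\<Theta>[of 0] by (subst P.integral_fst) (auto simp: case_prod_beta')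
  also have "\<dots> = (\<integral>x. \<bar>\<phi> x\<bar> * \<bar>\<Theta> x \<bullet> e\<bar> \<partial>\<sigma>)" by (simp only: unit_interval_const)
  finally have "(\<integral>x. T (g x) * (- partial_deriv e \<phi> x) \<partial>lborel) \<le> (\<integral>x. \<bar>\<phi> x\<bar> * \<bar>\<Theta> x \<bullet> e\<bar> \<partial>\<sigma>)"
    using LIMSEQ_le[OF Llim Rlim] LR by auto
  then show ?thesis by (simp add: conv)
qed

lemma convex_test_functions: "convex (test_functions \<Omega>)"
  unfolding convex_def
proof (intro ballI allI impI)
  fix \<phi> \<psi> :: "'a \<Rightarrow> real" and a b :: real assume "\<phi> \<in> test_functions \<Omega>" "\<psi> \<in> test_functions \<Omega>"
  then have "(\<lambda>x. a * \<phi> x + b * \<psi> x) \<in> test_functions \<Omega>" by (intro test_add test_cmult)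
  then show "a *\<^sub>R \<phi> + b *\<^sub>R \<psi> \<in> test_functions \<Omega>" by (simp add: plus_fun_def scaleR_fun_def)
qed

text \<open>\<open>dominated_convex_representation\<close> with the constant bounds -1 and 1 over
  the measure |\<Theta> \<bullet> e| \<sigma>, whose domination hypothesis is
  \<open>Lipschitz_comp_bound\<close>. The functional is linear and the test functions are closed
  under negation, so the resulting inequality is an equality.\<close>

lemma Lipschitz_comp_density:
  fixes u :: "'a::euclidean_space \<Rightarrow> real"
  assumes \<Omega>: "open \<Omega>" and u: "integrable (lebesgue_on \<Omega>) u" and r: "deriv_rep \<Omega> u \<sigma> \<Theta>"
    and T: "1-lipschitz_on UNIV T" "T 0 = 0" and Tu: "integrable (lebesgue_on \<Omega>) (\<lambda>x. T (u x))"
  shows "\<exists>\<xi>\<in>borel_measurable \<sigma>. (\<forall>x. \<bar>\<xi> x\<bar> \<le> 1) \<and>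
     (\<forall>\<phi>\<in>test_functions \<Omega>. (\<integral>x. T (u x) * partial_deriv e \<phi> x \<partial>lebesgue_on \<Omega>) = - (\<integral>x. \<phi> x * (\<xi> x * \<bar>\<Theta> x \<bullet>
       e\<bar>) \<partial>\<sigma>))"
proof -
  have fin: "finite_measure \<sigma>" and sets: "sets \<sigma> = sets (restrict_space borel \<Omega>)" and \<Theta>: "integrable \<sigma> \<Theta>"
    using r by (auto simp: deriv_rep_def)
  have \<Theta>m[measurable]: "\<Theta> \<in> borel_measurable \<sigma>" using \<Theta> by auto
  have idl: "(\<lambda>x. x) \<in> lebesgue_on \<Omega> \<rightarrow>\<^sub>M borel"
    by (intro measurable_restrict_space1 measurable_completion) simp
  define M where "M = density \<sigma> (\<lambda>x. ennreal \<bar>\<Theta> x \<bullet> e\<bar>)"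
  define q where "q \<phi> = (\<integral>x. T (u x) * partial_deriv e \<phi> x \<partial>lebesgue_on \<Omega>)" for \<phi>
  have finM: "finite_measure M"
  proof (rule finite_measureI)
    have "emeasure M (space \<sigma>) = (\<integral>\<^sup>+x. ennreal \<bar>\<Theta> x \<bullet> e\<bar> * indicator (space \<sigma>) x \<partial>\<sigma>)"
      unfolding M_def by (rule emeasure_density) auto
    also have "\<dots> = (\<integral>\<^sup>+x. ennreal \<bar>\<Theta> x \<bullet> e\<bar> \<partial>\<sigma>)" by (intro nn_integral_cong) simp
    also have "\<dots> = ennreal (\<integral>x. \<bar>\<Theta> x \<bullet> e\<bar> \<partial>\<sigma>)" using \<Theta> by (intro nn_integral_eq_integral) auto
    finally show "emeasure M (space M) \<noteq> \<infinity>" by (simp add: M_def)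
  qed
  have \<phi>\<sigma>: "\<phi> \<in> borel_measurable \<sigma>" if "\<phi> \<in> test_functions \<Omega>" for \<phi>
    using measurable_restrict_borel[OF sets test_measurable[OF that]] .
  have id: "(\<lambda>x. x) \<in> \<sigma> \<rightarrow>\<^sub>M borel" using measurable_restrict_borel[OF sets, of "\<lambda>x. x" borel] by simp
  have iM: "integrable M \<phi>" if \<phi>: "\<phi> \<in> test_functions \<Omega>" for \<phi>
    unfolding M_def using \<phi>\<sigma>[OF \<phi>] \<Theta> test_integrable[OF \<phi> _ id, of "\<lambda>x. \<bar>\<Theta> x \<bullet> e\<bar>"]
    by (subst integrable_density) (auto simp: mult.commute)
  have IM: "(\<integral>x. h x \<partial>M) = (\<integral>x. \<bar>\<Theta> x \<bullet> e\<bar> * h x \<partial>\<sigma>)" if "h \<in> borel_measurable \<sigma>" for h :: "'a \<Rightarrow> real"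
    unfolding M_def using that by (subst integral_density) auto
  have iq: "integrable (lebesgue_on \<Omega>) (\<lambda>x. T (u x) * partial_deriv e \<phi> x)" if "\<phi> \<in> test_functions \<Omega>" for \<phi>
    using test_integrable[OF test_partial_deriv[OF that] Tu idl] by (simp add: mult.commute)
  have q_lin: "q (a *\<^sub>R \<phi> + b *\<^sub>R \<psi>) = a * q \<phi> + b * q \<psi>"
    if \<phi>: "\<phi> \<in> test_functions \<Omega>" and \<psi>: "\<psi> \<in> test_functions \<Omega>" for a b \<phi> \<psi>
  proof -
    have "partial_deriv e (\<lambda>x. a * \<phi> x + b * \<psi> x) x = a * partial_deriv e \<phi> x + b * partial_deriv e \<psi> x"
      for x
      using test_differentiable[OF \<phi>] test_differentiable[OF \<psi>]
      by (simp add: partial_deriv_add partial_deriv_cmult)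
    then have "q (a *\<^sub>R \<phi> + b *\<^sub>R \<psi>) = (\<integral>x. a * (T (u x) * partial_deriv e \<phi> x)
      + b * (T (u x) * partial_deriv e \<psi> x) \<partial>lebesgue_on \<Omega>)"
      unfolding q_def plus_fun_def scaleR_fun_def by (simp add: algebra_simps)
    then show ?thesis using iq[OF \<phi>] iq[OF \<psi>] by (simp add: q_def)
  qed
  have "\<exists>\<xi>\<in>borel_measurable M. (\<forall>x. - 1 \<le> \<xi> x \<and> \<xi> x \<le> 1) \<and> (\<forall>h\<in>test_functions \<Omega>. 0 \<le> (\<integral>x. \<xi> x * h x \<partial>M)
    + q h)"
  proof (rule dominated_convex_representation[OF finM, where K=1])
    show "convex_on (test_functions \<Omega>) q"
      unfolding convex_on_def using convex_test_functions q_lin by auto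
    show "0 \<le> (\<integral>x. max (- 1 * h x) (1 * h x) \<partial>M) + q h" if h: "h \<in> test_functions \<Omega>" for h
    proof -
      have "(\<integral>x. max (- 1 * h x) (1 * h x) \<partial>M) = (\<integral>x. \<bar>h x\<bar> \<partial>M)"
        by (intro Bochner_Integration.integral_cong) auto
      also have "\<dots> = (\<integral>x. \<bar>h x\<bar> * \<bar>\<Theta> x \<bullet> e\<bar> \<partial>\<sigma>)" using \<phi>\<sigma>[OF h] by (subst IM) (auto simp: mult.commute)
      finally show ?thesis using Lipschitz_comp_bound[OF \<Omega> u r T h, of e] by (simp add: q_def)
    qed
    show "test_functions \<Omega> \<noteq> {}" using test_zero by blast
  qed (use iM in auto)
  then obtain \<xi> where \<xi>: "\<xi> \<in> borel_measurable M" "\<And>x. \<bar>\<xi> x\<bar> \<le> 1" "\<And>h. h \<in> test_functions \<Omega>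
    \<Longrightarrow> 0 \<le> (\<integral>x. \<xi> x * h x \<partial>M) + q h"
    by (auto simp: abs_le_iff)
  have \<xi>m[measurable]: "\<xi> \<in> borel_measurable \<sigma>" using \<xi>(1) by (simp add: M_def)
  have "q h = - (\<integral>x. h x * (\<xi> x * \<bar>\<Theta> x \<bullet> e\<bar>) \<partial>\<sigma>)" if h: "h \<in> test_functions \<Omega>" for h
  proof -
    have "q (\<lambda>x. - h x) = - q h"
      using q_lin[OF h h, of "-1" 0] by (simp add: scaleR_fun_def plus_fun_def)
    then have "q h = - (\<integral>x. \<xi> x * h x \<partial>M)"
      using \<xi>(3)[OF h] \<xi>(3)[OF test_minus[OF h]] by simp
    then show ?thesis using \<phi>\<sigma>[OF h] by (simp add: IM mult.commute mult.left_commute)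
  qed
  with \<xi>(2) \<xi>m show ?thesis unfolding q_def by blast
qed

text \<open>The densities for the coordinate directions assemble to a vector density of the
  derivative of T \<circ> u. Its vector measure of a set A is at most the integral of |\<Theta>|
  over A, and summing over a partition bounds the variation.\<close>

lemma Lipschitz_comp_BV:
  fixes u :: "'a::euclidean_space \<Rightarrow> real"
  assumes \<Omega>: "open \<Omega>" and uBV: "u \<in> BV \<Omega>" and T: "1-lipschitz_on UNIV T" "T 0 = 0"
  shows "(\<lambda>x. T (u x)) \<in> BV \<Omega>" and "tv \<Omega> (\<lambda>x. T (u x)) \<le> tv \<Omega> u"
proof -
  obtain \<sigma> \<Theta> where u: "integrable (lebesgue_on \<Omega>) u" and r: "deriv_rep \<Omega> u \<sigma> \<Theta>"
    using uBV by (auto simp: BV_iff_rep)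
  have fin: "finite_measure \<sigma>" and sets: "sets \<sigma> = sets (restrict_space borel \<Omega>)" and \<Theta>: "integrable \<sigma> \<Theta>"
    using r by (auto simp: deriv_rep_def)
  have \<Theta>m[measurable]: "\<Theta> \<in> borel_measurable \<sigma>" using \<Theta> by auto
  have Tm: "T \<in> borel_measurable borel"
    using lipschitz_on_continuous_on[OF T(1)] by (rule borel_measurable_continuous_onI)
  have Tu: "integrable (lebesgue_on \<Omega>) (\<lambda>x. T (u x))"
  proof (rule Bochner_Integration.integrable_bound[OF u])
    show "(\<lambda>x. T (u x)) \<in> borel_measurable (lebesgue_on \<Omega>)"
      by (rule measurable_compose[OF borel_measurable_integrable[OF u] Tm])
    show "AE x in lebesgue_on \<Omega>. norm (T (u x)) \<le> norm (u x)"
      using lipschitz_onD[OF T(1), of _ 0] T(2) by (simp add: dist_real_def)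
  qed
  have "\<forall>e. \<exists>\<xi>. \<xi> \<in> borel_measurable \<sigma> \<and> (\<forall>x. \<bar>\<xi> x\<bar> \<le> 1) \<and>
     (\<forall>\<phi>\<in>test_functions \<Omega>. (\<integral>x. T (u x) * partial_deriv e \<phi> x \<partial>lebesgue_on \<Omega>) = - (\<integral>x. \<phi> x * (\<xi> x * \<bar>\<Theta> x \<bullet>
       e\<bar>) \<partial>\<sigma>))"
    using Lipschitz_comp_density[OF \<Omega> u r T Tu] by blast
  from choice[OF this] obtain \<xi> where *: "\<forall>e. \<xi> e \<in> borel_measurable \<sigma> \<and> (\<forall>x. \<bar>\<xi> e x\<bar> \<le> 1) \<and>
     (\<forall>\<phi>\<in>test_functions \<Omega>. (\<integral>x. T (u x) * partial_deriv e \<phi> x \<partial>lebesgue_on \<Omega>) = - (\<integral>x. \<phi> x * (\<xi> e x * \<bar>\<Theta> x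
       \<bullet> e\<bar>) \<partial>\<sigma>))"
    by blast
  have \<xi>m[measurable]: "\<xi> e \<in> borel_measurable \<sigma>" and \<xi>1: "\<bar>\<xi> e x\<bar> \<le> 1" for e x
    using * by auto
  have \<xi>: "(\<integral>x. T (u x) * partial_deriv e \<phi> x \<partial>lebesgue_on \<Omega>) = - (\<integral>x. \<phi> x * (\<xi> e x * \<bar>\<Theta> x \<bullet> e\<bar>) \<partial>\<sigma>)"
    if "\<phi> \<in> test_functions \<Omega>" for e \<phi>
    using * that by blast
  have i\<xi>: "integrable \<sigma> (\<lambda>x. \<xi> e x * \<bar>\<Theta> x \<bullet> e\<bar>)" for e
  proof (rule Bochner_Integration.integrable_bound)
    show "integrable \<sigma> (\<lambda>x. \<bar>\<Theta> x \<bullet> e\<bar>)" using \<Theta> by simp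
    show "AE x in \<sigma>. norm (\<xi> e x * \<bar>\<Theta> x \<bullet> e\<bar>) \<le> norm \<bar>\<Theta> x \<bullet> e\<bar>"
      using \<xi>1 by (auto simp: abs_mult intro!: mult_left_le_one_le)
  qed measurable
  define \<Theta>' where "\<Theta>' x = (\<Sum>b\<in>Basis. (\<xi> b x * \<bar>\<Theta> x \<bullet> b\<bar>) *\<^sub>R b)" for x
  have \<Theta>'b: "\<Theta>' x \<bullet> b = \<xi> b x * \<bar>\<Theta> x \<bullet> b\<bar>" if "b \<in> Basis" for x b
    unfolding \<Theta>'_def using that
      by (simp add: inner_sum_left inner_Basis if_distrib sum.If_cases cong: if_cong)
  have i\<Theta>': "integrable \<sigma> \<Theta>'" unfolding \<Theta>'_def using i\<xi>
    by (intro Bochner_Integration.integrable_sum integrable_scaleR_left) auto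
  have r': "deriv_rep \<Omega> (\<lambda>x. T (u x)) \<sigma> \<Theta>'"
    unfolding deriv_rep_def using fin sets i\<Theta>' \<xi> by (auto simp: \<Theta>'b)
  show BV: "(\<lambda>x. T (u x)) \<in> BV \<Omega>" using r' Tu BV_iff_rep by blast
  have id: "(\<lambda>x. x) \<in> \<sigma> \<rightarrow>\<^sub>M borel" using measurable_restrict_borel[OF sets, of "\<lambda>x. x" borel] by simp
  let ?\<nu> = "\<lambda>A. \<integral>x. indicator A x *\<^sub>R \<Theta>' x \<partial>\<sigma>"
  have \<nu>_le: "norm (?\<nu> A) \<le> (\<integral>x. indicator A x * norm (\<Theta> x) \<partial>\<sigma>)"
    if A: "A \<in> sets borel" "A \<subseteq> \<Omega>" for A
  proof -
    \<comment> \<open>The vector measure of A is tested in its own direction: its squared norm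
      becomes the integral over A of the scalar density in direction e, and this density is at most
      |\<Theta>| |e|.\<close>
    define e where "e = ?\<nu> A"
    have As: "A \<in> sets \<sigma>" using A sets \<Omega> by (simp add: sets_restrict_borel)
    have i1: "integrable \<sigma> (\<lambda>x. indicator A x * norm (\<Theta> x))"
      using integrable_mult_indicator[OF As integrable_norm[OF \<Theta>]] by simp
    have "?\<nu> A \<bullet> e = (\<integral>x. (indicator A x *\<^sub>R \<Theta>' x) \<bullet> e \<partial>\<sigma>)"
      using integrable_mult_indicator[OF As i\<Theta>'] by (subst integral_inner_left) auto
    also have "\<dots> = (\<integral>x. indicator A x * (\<Theta>' x \<bullet> e) \<partial>\<sigma>)" by simp
    \<comment> \<open>Both integrands represent the derivative of T \<circ> u in direction e, the
      first assembled from coordinates and the second obtained for e directly, so they have the same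
      integral over A.\<close>
    also have "\<dots> = (\<integral>x. indicator A x * (\<xi> e x * \<bar>\<Theta> x \<bullet> e\<bar>) \<partial>\<sigma>)"
    proof (rule test_functions_determine_sets[OF \<Omega> id id _ i\<xi> _ A])
      show "integrable \<sigma> (\<lambda>x. \<Theta>' x \<bullet> e)" using i\<Theta>' by simp
      show "(\<integral>x. \<psi> x * (\<Theta>' x \<bullet> e) \<partial>\<sigma>) = (\<integral>y. \<psi> y * (\<xi> e y * \<bar>\<Theta> y \<bullet> e\<bar>) \<partial>\<sigma>)" if "\<psi> \<in> test_functions \<Omega>" for \<psi>
        using deriv_rep_direction[OF r' \<Omega> Tu that, of e] \<xi>[OF that, of e] by simp
    qed
    also have "\<dots> \<le> (\<integral>x. norm e * (indicator A x * norm (\<Theta> x)) \<partial>\<sigma>)"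
    proof (rule integral_mono)
      show "integrable \<sigma> (\<lambda>x. indicator A x * (\<xi> e x * \<bar>\<Theta> x \<bullet> e\<bar>))"
        using integrable_mult_indicator[OF As i\<xi>] by simp
      show "integrable \<sigma> (\<lambda>x. norm e * (indicator A x * norm (\<Theta> x)))" using i1 by simp
      fix x
      have "\<xi> e x * \<bar>\<Theta> x \<bullet> e\<bar> \<le> 1 * \<bar>\<Theta> x \<bullet> e\<bar>" using \<xi>1[of e x] by (intro mult_right_mono) auto
      also have "\<dots> \<le> norm (\<Theta> x) * norm e" using Cauchy_Schwarz_ineq2[of "\<Theta> x" e] by simp
      finally show "indicator A x * (\<xi> e x * \<bar>\<Theta> x \<bullet> e\<bar>) \<le> norm e * (indicator A x * norm (\<Theta> x))"
        by (auto simp: mult.commute split: split_indicator)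
    qed
    also have "\<dots> = norm e * (\<integral>x. indicator A x * norm (\<Theta> x) \<partial>\<sigma>)" by simp
    finally have *: "norm e * norm e \<le> norm e * (\<integral>x. indicator A x * norm (\<Theta> x) \<partial>\<sigma>)"
      by (simp add: e_def power2_norm_eq_inner[symmetric] power2_eq_square)
    show ?thesis
    proof (cases "norm e = 0")
      case True
      then show ?thesis unfolding e_def[symmetric] by (simp add: integral_nonneg_AE)
    next
      case False
      then show ?thesis using * unfolding e_def[symmetric] by (simp add: mult_le_cancel_left)
    qed
  qed
  have "ereal (tv \<Omega> (\<lambda>x. T (u x))) = variation_on \<Omega> ?\<nu>"
    using variation_on_density[OF \<Omega> fin sets i\<Theta>'] tv_eq_rep[OF \<Omega> Tu r'] by simp
  also have "\<dots> \<le> ereal (\<integral>x. norm (\<Theta> x) \<partial>\<sigma>)"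
    unfolding variation_on_def
  proof (rule SUP_least)
    fix A :: "nat \<Rightarrow> 'a set"
    assume "A \<in> {A. range A \<subseteq> sets (restrict_space borel \<Omega>) \<and> disjoint_family A \<and> (\<Union>i. A i) = \<Omega>}"
    then have A: "\<And>i. A i \<in> sets borel" "\<And>i. A i \<subseteq> \<Omega>" "disjoint_family A" "(\<Union>i. A i) = \<Omega>"
      using \<Omega> by (auto simp: sets_restrict_borel image_subset_iff)
    have "(\<lambda>i. \<integral>x. indicator (A i) x * norm (\<Theta> x) \<partial>\<sigma>) sums (\<integral>x. indicator (\<Union>i. A i) x * norm (\<Theta> x) \<partial>\<sigma>)"
      by (rule integral_indicator_sums[OF integrable_norm[OF \<Theta>] id A(1,3)])
    moreover have "(\<integral>x. indicator (\<Union>i. A i) x * norm (\<Theta> x) \<partial>\<sigma>) = (\<integral>x. norm (\<Theta> x) \<partial>\<sigma>)"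
      using A space_restrict_borel[OF sets] by (intro Bochner_Integration.integral_cong) auto
    ultimately have "(\<lambda>i. ereal (\<integral>x. indicator (A i) x * norm (\<Theta> x) \<partial>\<sigma>)) sums ereal (\<integral>x. norm (\<Theta> x) \<partial>\<sigma>)"
      by (simp add: sums_ereal)
    then have "(\<Sum>i. ereal (\<integral>x. indicator (A i) x * norm (\<Theta> x) \<partial>\<sigma>)) = ereal (\<integral>x. norm (\<Theta> x) \<partial>\<sigma>)"
      by (simp add: sums_iff)
    moreover have "(\<Sum>i. ereal (norm (?\<nu> (A i)))) \<le> (\<Sum>i. ereal (\<integral>x. indicator (A i) x * norm (\<Theta> x) \<partial>\<sigma>))"
      using \<nu>_le A(1,2) by (intro suminf_le_pos) auto
    ultimately show "(\<Sum>i. ereal (norm (?\<nu> (A i)))) \<le> ereal (\<integral>x. norm (\<Theta> x) \<partial>\<sigma>)" by simp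
  qed
  finally show "tv \<Omega> (\<lambda>x. T (u x)) \<le> tv \<Omega> u" by (simp add: tv_eq_rep[OF \<Omega> u r])
qed

section \<open>Square-integrable functions\<close>

lemma Lp2_iff:
  "v \<in> Lp 2 \<Omega> \<longleftrightarrow> v \<in> borel_measurable (lebesgue_on \<Omega>) \<and> integrable (lebesgue_on \<Omega>) (\<lambda>x. (norm (v x))\<^sup>2)"
  by (simp add: Lp_def)

text \<open>\<open>Lp 2\<close> over an arbitrary measure, with a square in place of
  \<open>powr\<close> and vector values, so that functions, gradients and pairs of both are treated
  alike.\<close>

definition L2 :: "'b measure \<Rightarrow> ('b \<Rightarrow> 'c::euclidean_space) set" where
  "L2 M = {f \<in> borel_measurable M. integrable M (\<lambda>x. (norm (f x))\<^sup>2)}"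

lemma L2_measurable: "f \<in> L2 M \<Longrightarrow> f \<in> borel_measurable M"
  and L2_integrable: "f \<in> L2 M \<Longrightarrow> integrable M (\<lambda>x. (norm (f x))\<^sup>2)"
  by (auto simp: L2_def)

lemma Lp2_eq_L2: "Lp 2 \<Omega> = L2 (lebesgue_on \<Omega>)"
  by (auto simp: L2_def Lp2_iff)

lemma L2_inner_integrable:
  assumes "f \<in> L2 M" "g \<in> L2 M"
  shows "integrable M (\<lambda>x. f x \<bullet> g x)"
proof (rule Bochner_Integration.integrable_bound)
  have [measurable]: "f \<in> borel_measurable M" "g \<in> borel_measurable M" using assms by (auto simp: L2_def)
  show "integrable M (\<lambda>x. (norm (f x))\<^sup>2 + (norm (g x))\<^sup>2)" using assms by (auto simp: L2_def)
  show "(\<lambda>x. f x \<bullet> g x) \<in> borel_measurable M" by measurable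
  show "AE x in M. norm (f x \<bullet> g x) \<le> norm ((norm (f x))\<^sup>2 + (norm (g x))\<^sup>2)"
  proof (rule AE_I2)
    fix x
    have "\<bar>f x \<bullet> g x\<bar> \<le> norm (f x) * norm (g x)" by (rule Cauchy_Schwarz_ineq2)
    also have "\<dots> \<le> (norm (f x))\<^sup>2 + (norm (g x))\<^sup>2"
    proof -
      have "2 * (norm (f x) * norm (g x)) \<le> (norm (f x))\<^sup>2 + (norm (g x))\<^sup>2"
        using sum_squares_bound[of "norm (f x)" "norm (g x)"] by (simp add: mult.assoc)
      moreover have "0 \<le> norm (f x) * norm (g x)" by simp
      ultimately show ?thesis by linarith
    qed
    finally show "norm (f x \<bullet> g x) \<le> norm ((norm (f x))\<^sup>2 + (norm (g x))\<^sup>2)" by simp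
  qed
qed

lemma L2_add:
  assumes "f \<in> L2 M" "g \<in> L2 M" shows "(\<lambda>x. f x + g x) \<in> L2 M"
proof -
  have [measurable]: "f \<in> borel_measurable M" "g \<in> borel_measurable M" using assms by (auto simp: L2_def)
  have "(\<lambda>x. (norm (f x + g x))\<^sup>2) = (\<lambda>x. (norm (f x))\<^sup>2 + (norm (g x))\<^sup>2 + 2 * (f x \<bullet> g x))"
    by (auto simp: power2_norm_eq_inner inner_add_left inner_add_right inner_commute)
  then have "integrable M (\<lambda>x. (norm (f x + g x))\<^sup>2)"
    using assms L2_inner_integrable[OF assms] by (auto simp: L2_def)
  then show ?thesis by (simp add: L2_def)
qed

lemma L2_scaleR: "f \<in> L2 M \<Longrightarrow> (\<lambda>x. c *\<^sub>R f x) \<in> L2 M"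
  by (auto simp: L2_def power_mult_distrib)

lemma L2_cmult: "f \<in> L2 M \<Longrightarrow> (\<lambda>x. c * f x :: real) \<in> L2 M"
  using L2_scaleR[of f M c] by simp

lemma L2_diff: "f \<in> L2 M \<Longrightarrow> g \<in> L2 M \<Longrightarrow> (\<lambda>x. f x - g x) \<in> L2 M"
  using L2_add[of f M "\<lambda>x. (-1) *\<^sub>R g x"] L2_scaleR[of g M "-1"] by simp

lemma L2_bounded_mult:
  assumes "f \<in> L2 M" "w \<in> borel_measurable M" "AE x in M. \<bar>w x\<bar> \<le> K"
  shows "(\<lambda>x. w x *\<^sub>R f x) \<in> L2 M"
proof -
  have [measurable]: "f \<in> borel_measurable M" "w \<in> borel_measurable M" using assms by (auto simp: L2_def)
  have "integrable M (\<lambda>x. (norm (w x *\<^sub>R f x))\<^sup>2)"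
  proof (rule Bochner_Integration.integrable_bound)
    show "integrable M (\<lambda>x. K\<^sup>2 * (norm (f x))\<^sup>2)" using assms by (auto simp: L2_def)
    show "AE x in M. norm ((norm (w x *\<^sub>R f x))\<^sup>2) \<le> norm (K\<^sup>2 * (norm (f x))\<^sup>2)"
      using assms(3)
    proof eventually_elim
      case (elim x)
      then have "\<bar>w x\<bar>\<^sup>2 \<le> K\<^sup>2" by (intro power_mono) auto
      then show ?case by (auto simp: power_mult_distrib intro!: mult_right_mono)
    qed
  qed measurable
  then show ?thesis by (simp add: L2_def)
qed

text \<open>The free parameter permits absorbing one of the two terms on the other side of an
  estimate, which is how the energy bounds below are obtained.\<close>

lemma L2_Young:
  assumes "f \<in> L2 M" "g \<in> L2 M" "\<delta> > 0"
  shows "\<bar>\<integral>x. f x \<bullet> g x \<partial>M\<bar> \<le> \<delta> / 2 * (\<integral>x. (norm (f x))\<^sup>2 \<partial>M) + 1 / (2 * \<delta>) * (\<integral>x. (norm (g x))\<^sup>2 \<partial>M)"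
proof -
  have "\<bar>\<integral>x. f x \<bullet> g x \<partial>M\<bar> \<le> (\<integral>x. \<bar>f x \<bullet> g x\<bar> \<partial>M)" by (rule integral_abs_bound)
  also have "\<dots> \<le> (\<integral>x. \<delta> / 2 * (norm (f x))\<^sup>2 + 1 / (2 * \<delta>) * (norm (g x))\<^sup>2 \<partial>M)"
  proof (rule integral_mono)
    show "integrable M (\<lambda>x. \<bar>f x \<bullet> g x\<bar>)" using L2_inner_integrable[OF assms(1,2)] by simp
    show "integrable M (\<lambda>x. \<delta> / 2 * (norm (f x))\<^sup>2 + 1 / (2 * \<delta>) * (norm (g x))\<^sup>2)"
      using assms L2_integrable by (intro Bochner_Integration.integrable_add integrable_mult_right) auto
    fix x
    have "\<bar>f x \<bullet> g x\<bar> \<le> norm (f x) * norm (g x)" by (rule Cauchy_Schwarz_ineq2)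
    also have "\<dots> \<le> \<delta> / 2 * (norm (f x))\<^sup>2 + 1 / (2 * \<delta>) * (norm (g x))\<^sup>2"
    proof -
      have "0 \<le> (\<delta> * norm (f x) - norm (g x))\<^sup>2" by simp
      then have "2 * \<delta> * (norm (f x) * norm (g x)) \<le> \<delta>\<^sup>2 * (norm (f x))\<^sup>2 + (norm (g x))\<^sup>2"
        by (simp add: power2_diff power_mult_distrib algebra_simps)
      then have "2 * \<delta> * (norm (f x) * norm (g x)) / (2 * \<delta>) \<le> (\<delta>\<^sup>2 * (norm (f x))\<^sup>2
        + (norm (g x))\<^sup>2) / (2 * \<delta>)"
        using assms(3) by (intro divide_right_mono) auto
      then show ?thesis using assms(3) by (simp add: add_divide_distrib power2_eq_square)
    qed
    finally show "\<bar>f x \<bullet> g x\<bar> \<le> \<delta> / 2 * (norm (f x))\<^sup>2 + 1 / (2 * \<delta>) * (norm (g x))\<^sup>2" .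
  qed
  also have "\<dots> = \<delta> / 2 * (\<integral>x. (norm (f x))\<^sup>2 \<partial>M) + 1 / (2 * \<delta>) * (\<integral>x. (norm (g x))\<^sup>2 \<partial>M)"
    using L2_integrable[OF assms(1)] L2_integrable[OF assms(2)]
      by (subst Bochner_Integration.integral_add) auto
  finally show ?thesis .
qed

lemma L2_inner_tendsto_0:
  assumes f: "\<And>n. f n \<in> L2 M" and g: "g \<in> L2 M" and lim: "(\<lambda>n. \<integral>x. (norm (f n x))\<^sup>2 \<partial>M) \<longlonglongrightarrow> 0"
  shows "(\<lambda>n. \<integral>x. f n x \<bullet> g x \<partial>M) \<longlonglongrightarrow> 0"
proof (rule LIMSEQ_I)
  fix e :: real assume e: "e > 0"
  define G where "G = (\<integral>x. (norm (g x))\<^sup>2 \<partial>M)"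
  have G: "G \<ge> 0" unfolding G_def by (simp add: integral_nonneg_AE)
  \<comment> \<open>With this value G / (2 \<delta>) is at most e / 2 for every n; G + 1 keeps
    \<delta> positive when G = 0.\<close>
  define \<delta> where "\<delta> = (G + 1) / e"
  have \<delta>: "\<delta> > 0" using e G by (simp add: \<delta>_def)
  obtain N where N: "\<And>n. n \<ge> N \<Longrightarrow> norm ((\<integral>x. (norm (f n x))\<^sup>2 \<partial>M) - 0) < e / \<delta>"
    using LIMSEQ_D[OF lim, of "e / \<delta>"] e \<delta> by auto
  show "\<exists>N. \<forall>n\<ge>N. norm ((\<integral>x. f n x \<bullet> g x \<partial>M) - 0) < e"
  proof (intro exI[of _ N] allI impI)
    fix n assume n: "n \<ge> N"
    have "\<bar>\<integral>x. f n x \<bullet> g x \<partial>M\<bar> \<le> \<delta> / 2 * (\<integral>x. (norm (f n x))\<^sup>2 \<partial>M) + 1 / (2 * \<delta>) * G"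
      unfolding G_def by (rule L2_Young[OF f g \<delta>])
    also have "\<delta> / 2 * (\<integral>x. (norm (f n x))\<^sup>2 \<partial>M) < \<delta> / 2 * (e / \<delta>)"
      using N[OF n] \<delta> by (intro mult_strict_left_mono) auto
    also have "\<delta> / 2 * (e / \<delta>) = e / 2" using \<delta> by simp
    also have "1 / (2 * \<delta>) * G \<le> e / 2"
      using e G by (simp add: \<delta>_def field_simps)
    finally show "norm ((\<integral>x. f n x \<bullet> g x \<partial>M) - 0) < e" by simp
  qed
qed

text \<open>Riesz-Fischer for a geometric Cauchy rate. Since a \<le> 2^(-n) + 2^n a^2, the rate
  4^(-n) for squares makes the increments summable in L^1, so the whole sequence converges almost
  everywhere. Fatou's lemma carries the rate over to the limit.\<close>

lemma L2_complete_fast: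
  fixes f :: "nat \<Rightarrow> 'b \<Rightarrow> 'c::euclidean_space"
  assumes fin: "finite_measure M" and f: "\<And>n. f n \<in> L2 M"
    and cauchy: "\<And>n k. n \<le> k \<Longrightarrow> (\<integral>x. (norm (f k x - f n x))\<^sup>2 \<partial>M) \<le> C * (1/4)^n"
  shows "\<exists>g\<in>L2 M. \<forall>n. (\<integral>x. (norm (g x - f n x))\<^sup>2 \<partial>M) \<le> C * (1/4)^n"
proof -
  interpret finite_measure M by fact
  have [measurable]: "f n \<in> borel_measurable M" for n using f by (auto simp: L2_def)
  define d where "d n x = f (Suc n) x - f n x" for n x
  have [measurable]: "d n \<in> borel_measurable M" for n unfolding d_def by measurable
  have dL: "d n \<in> L2 M" for n unfolding d_def by (intro L2_diff f)
  have d_int: "integrable M (\<lambda>x. norm (d n x))" and d_le: "(\<integral>x. norm (d n x) \<partial>M) \<le> (measure M (space M)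
    + C) * (1/2)^n" for n
  proof -
    have pt: "norm (d n x) \<le> (1/2)^n + 2^n * (norm (d n x))\<^sup>2" for x
    proof -
      have "2 * a \<le> a\<^sup>2 + 1" for a :: real using zero_le_power2[of "a - 1"] by (simp add: power2_diff)
      from this[of "2^n * norm (d n x)"]
      have "2 * (2^n * norm (d n x)) \<le> 2^n * 2^n * (norm (d n x))\<^sup>2 + 1"
        by (simp add: power_mult_distrib power2_eq_square mult.assoc mult.left_commute)
      then have "2^n * norm (d n x) \<le> 2^n * 2^n * (norm (d n x))\<^sup>2 + 1"
        by (smt (verit) mult_nonneg_nonneg norm_ge_zero zero_le_power)
      then have "2^n * norm (d n x) \<le> 2^n * (2^n * (norm (d n x))\<^sup>2 + (1/2)^n)"
        by (simp add: algebra_simps power_one_over)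
      then show ?thesis by (simp add: mult_le_cancel_left add.commute)
    qed
    have ib: "integrable M (\<lambda>x. (1/2)^n + 2^n * (norm (d n x))\<^sup>2)" using L2_integrable[OF dL] by auto
    show i: "integrable M (\<lambda>x. norm (d n x))"
      by (rule Bochner_Integration.integrable_bound[OF ib]) (use pt in \<open>auto intro: order_trans[OF _
        abs_ge_self]\<close>)
    have "(\<integral>x. norm (d n x) \<partial>M) \<le> (\<integral>x. (1/2)^n + 2^n * (norm (d n x))\<^sup>2 \<partial>M)"
      by (rule integral_mono[OF i ib]) (rule pt)
    also have "\<dots> = measure M (space M) * (1/2)^n + 2^n * (\<integral>x. (norm (d n x))\<^sup>2 \<partial>M)"
      using L2_integrable[OF dL] by simp
    also have "(\<integral>x. (norm (d n x))\<^sup>2 \<partial>M) \<le> C * (1/4)^n" unfolding d_def by (rule cauchy) simp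
    also have "2^n * (C * (1/4)^n) = C * (1/2)^n"
    proof -
      have "(2::real)^n * (1/4)^n = (1/2)^n" by (simp flip: power_mult_distrib)
      then show ?thesis by (simp add: mult.left_commute)
    qed
    finally show "(\<integral>x. norm (d n x) \<partial>M) \<le> (measure M (space M) + C) * (1/2)^n" by (simp add: algebra_simps)
  qed
  have summ: "summable (\<lambda>n. \<integral>x. norm (d n x) \<partial>M)"
  proof (rule summable_comparison_test'[where N=0])
    show "summable (\<lambda>n. (measure M (space M) + C) * (1/2)^n)"
      by (intro summable_mult summable_geometric) auto
  qed (use d_le in simp)
  have "(\<integral>\<^sup>+x. (\<Sum>n. ennreal (norm (d n x))) \<partial>M) = (\<Sum>n. ennreal (\<integral>x. norm (d n x) \<partial>M))"
    using d_int by (subst nn_integral_suminf) (auto intro!: suminf_cong nn_integral_eq_integral)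
  also have "\<dots> \<noteq> \<infinity>" using summ by (simp add: ennreal_suminf_neq_top)
  finally have "AE x in M. (\<Sum>n. ennreal (norm (d n x))) \<noteq> \<infinity>"
    by (intro nn_integral_PInf_AE) auto
  then have ae: "AE x in M. convergent (\<lambda>n. f n x)"
  proof eventually_elim
    case (elim x)
    have "summable (\<lambda>n. norm (d n x))" using elim by (intro summable_suminf_not_top) auto
    then have "summable (\<lambda>n. d n x)" by (rule summable_norm_cancel)
    then have "convergent (\<lambda>n. \<Sum>i<n. d i x)" by (simp add: summable_iff_convergent)
    moreover have "(\<Sum>i<n. d i x) = f n x - f 0 x" for n unfolding d_def by (rule sum_lessThan_telescope)
    ultimately have "convergent (\<lambda>n. f n x - f 0 x)" by simp
    then have "convergent (\<lambda>n. f n x - f 0 x + f 0 x)" by (intro convergent_add convergent_const)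
    then show ?case by simp
  qed
  define g where "g x = lim (\<lambda>n. f n x)" for x
  have gm[measurable]: "g \<in> borel_measurable M" unfolding g_def by (rule borel_measurable_lim_metric) auto
  have lim: "AE x in M. (\<lambda>n. f n x) \<longlonglongrightarrow> g x" using ae
    by eventually_elim (simp add: g_def convergent_LIMSEQ_iff)
  have fatou: "(\<integral>\<^sup>+x. ennreal ((norm (g x - f n x))\<^sup>2) \<partial>M) \<le> ennreal (C * (1/4)^n)" for n
  proof -
    have "(\<integral>\<^sup>+x. ennreal ((norm (g x - f n x))\<^sup>2) \<partial>M) = (\<integral>\<^sup>+x. liminf (\<lambda>k. ennreal ((norm (f k x
      - f n x))\<^sup>2)) \<partial>M)"
    proof (rule nn_integral_cong_AE)
      show "AE x in M. ennreal ((norm (g x - f n x))\<^sup>2) = liminf (\<lambda>k. ennreal ((norm (f k x - f n x))\<^sup>2))"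
        using lim
      proof eventually_elim
        case (elim x)
        have "(\<lambda>k. ennreal ((norm (f k x - f n x))\<^sup>2)) \<longlonglongrightarrow> ennreal ((norm (g x - f n x))\<^sup>2)"
          by (intro tendsto_ennrealI tendsto_intros elim)
        then show ?case by (rule lim_imp_Liminf[symmetric, OF sequentially_bot])
      qed
    qed
    also have "\<dots> \<le> liminf (\<lambda>k. \<integral>\<^sup>+x. ennreal ((norm (f k x - f n x))\<^sup>2) \<partial>M)"
      by (rule nn_integral_liminf) measurable
    also have "\<dots> \<le> liminf (\<lambda>k. ennreal (C * (1/4)^n))"
    proof (rule Liminf_mono, rule eventually_sequentiallyI[of n])
      fix k assume "n \<le> k"
      have "(\<integral>\<^sup>+x. ennreal ((norm (f k x - f n x))\<^sup>2) \<partial>M) = ennreal (\<integral>x. (norm (f k x - f n x))\<^sup>2 \<partial>M)"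
        using L2_integrable[OF L2_diff[OF f f]] by (intro nn_integral_eq_integral) auto
      also have "\<dots> \<le> ennreal (C * (1/4)^n)" using cauchy[OF \<open>n \<le> k\<close>] by (rule ennreal_leI)
      finally show "(\<integral>\<^sup>+x. ennreal ((norm (f k x - f n x))\<^sup>2) \<partial>M) \<le> ennreal (C * (1/4)^n)" .
    qed
    also have "\<dots> = ennreal (C * (1/4)^n)" by (rule Liminf_const) simp
    finally show ?thesis .
  qed
  have C0: "0 \<le> C * (1/4)^n" for n using cauchy[of n n] by simp
  have gf: "(\<lambda>x. g x - f n x) \<in> L2 M" for n
  proof -
    have "integrable M (\<lambda>x. (norm (g x - f n x))\<^sup>2)"
      using fatou[of n] by (intro integrableI_nonneg) (auto simp: less_top[symmetric] top_unique)
    then show ?thesis by (simp add: L2_def)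
  qed
  have "(\<lambda>x. (g x - f 0 x) + f 0 x) \<in> L2 M" by (intro L2_add gf f)
  then have "g \<in> L2 M" by simp
  moreover have "(\<integral>x. (norm (g x - f n x))\<^sup>2 \<partial>M) \<le> C * (1/4)^n" for n
    using fatou[of n] C0[of n] L2_integrable[OF gf[of n]]
    by (subst (asm) nn_integral_eq_integral) auto
  ultimately show ?thesis by blast
qed

section \<open>Weak gradients and Sobolev functions\<close>

definition grad :: "('a::euclidean_space \<Rightarrow> real) \<Rightarrow> 'a \<Rightarrow> 'a" where
  "grad \<psi> x = (\<Sum>b\<in>Basis. partial_deriv b \<psi> x *\<^sub>R b)"

lemma grad_inner:
  assumes "\<psi> \<in> test_functions \<Omega>" shows "grad \<psi> x \<bullet> e = partial_deriv e \<psi> x"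
proof -
  have "grad \<psi> x \<bullet> e = (\<Sum>b\<in>Basis. (e \<bullet> b) * partial_deriv b \<psi> x)"
    unfolding grad_def inner_sum_left by (intro sum.cong refl) (simp add: inner_commute mult.commute)
  then show ?thesis using partial_deriv_basis[OF test_differentiable[OF assms], of e] by simp
qed

lemma grad_lincomb:
  assumes "\<phi> \<in> test_functions \<Omega>" "\<psi> \<in> test_functions \<Omega>"
  shows "grad (\<lambda>x. a * \<phi> x + b * \<psi> x) x = a *\<^sub>R grad \<phi> x + b *\<^sub>R grad \<psi> x"
proof (rule euclidean_eqI)
  fix i :: 'a assume "i \<in> Basis"
  have "(\<lambda>x. a * \<phi> x + b * \<psi> x) \<in> test_functions \<Omega>" using assms by (intro test_add test_cmult)
  then have "grad (\<lambda>x. a * \<phi> x + b * \<psi> x) x \<bullet> i = partial_deriv i (\<lambda>x. a * \<phi> x + b * \<psi> x) x"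
    by (rule grad_inner)
  also have "\<dots> = a * partial_deriv i \<phi> x + b * partial_deriv i \<psi> x"
    using test_differentiable[OF assms(1)] test_differentiable[OF assms(2)]
    by (simp add: partial_deriv_add partial_deriv_cmult)
  finally show "grad (\<lambda>x. a * \<phi> x + b * \<psi> x) x \<bullet> i = (a *\<^sub>R grad \<phi> x + b *\<^sub>R grad \<psi> x) \<bullet> i"
    by (simp add: inner_add_left grad_inner[OF assms(1)] grad_inner[OF assms(2)])
qed

lemma grad_measurable: "\<psi> \<in> test_functions \<Omega> \<Longrightarrow> grad \<psi> \<in> borel_measurable borel"
  unfolding grad_def[abs_def]
  by (intro borel_measurable_sum borel_measurable_scaleR test_measurable[of _ \<Omega>] test_partial_deriv) auto

lemma grad_bounded:
  assumes "\<psi> \<in> test_functions \<Omega>" shows "\<exists>B. \<forall>x. norm (grad \<psi> x) \<le> B"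
proof -
  have "\<forall>b. \<exists>B. \<forall>x. \<bar>partial_deriv b \<psi> x\<bar> \<le> B"
    using test_bounded[OF test_partial_deriv[OF assms]] by metis
  then obtain B where B: "\<And>b x. \<bar>partial_deriv b \<psi> x\<bar> \<le> B b" by metis
  have "norm (grad \<psi> x) \<le> (\<Sum>b\<in>Basis. B b)" for x
    unfolding grad_def using B by (intro sum_norm_le) simp
  then show ?thesis by blast
qed

lemma borel_imp_lebesgue_on: "f \<in> borel_measurable borel \<Longrightarrow> f \<in> borel_measurable (lebesgue_on \<Omega>)"
  by (intro measurable_restrict_space1 measurable_completion) simp

lemma finite_measure_domain:
  fixes \<Omega> :: "'a::euclidean_space set"
  shows "open \<Omega> \<Longrightarrow> bounded \<Omega> \<Longrightarrow> finite_measure (lebesgue_on \<Omega>)"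
  by (intro finite_measure_lebesgue_on lmeasurable_open)

lemma bounded_in_L2:
  assumes "finite_measure M" "f \<in> borel_measurable M" "\<And>x. norm (f x) \<le> B"
  shows "f \<in> L2 M"
proof -
  interpret finite_measure M by fact
  have "integrable M (\<lambda>x. (norm (f x))\<^sup>2)"
    by (rule integrable_const_bound[of _ "B\<^sup>2"]) (use assms in \<open>auto intro!: AE_I2 power_mono\<close>)
  then show ?thesis using assms by (simp add: L2_def)
qed

lemma test_L2:
  fixes \<Omega> :: "'a::euclidean_space set"
  assumes "open \<Omega>" "bounded \<Omega>" "\<psi> \<in> test_functions W"
  shows "\<psi> \<in> L2 (lebesgue_on \<Omega>)" "grad \<psi> \<in> L2 (lebesgue_on \<Omega>)"
proof -
  obtain B where "\<And>x. \<bar>\<psi> x\<bar> \<le> B" using test_bounded[OF assms(3)] by metis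
  then show "\<psi> \<in> L2 (lebesgue_on \<Omega>)"
    using assms by (intro bounded_in_L2[of _ _ B] finite_measure_domain borel_imp_lebesgue_on
      test_measurable) auto
  obtain B where "\<forall>x. norm (grad \<psi> x) \<le> B" using grad_bounded[OF assms(3)] by blast
  then show "grad \<psi> \<in> L2 (lebesgue_on \<Omega>)"
    using assms by (intro bounded_in_L2[of _ _ B] finite_measure_domain borel_imp_lebesgue_on
      grad_measurable) auto
qed

lemma L2_imp_integrable:
  assumes "finite_measure M" "f \<in> L2 M" shows "integrable M f"
proof -
  interpret finite_measure M by fact
  have m: "f \<in> borel_measurable M" using assms(2) by (rule L2_measurable)
  show ?thesis
  proof (rule Bochner_Integration.integrable_bound[OF _ m])
    show "integrable M (\<lambda>x. 1 + (norm (f x))\<^sup>2)" using L2_integrable[OF assms(2)] by simp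
    have "a \<le> 1 + a\<^sup>2" for a :: real
      using zero_le_power2[of "a - 1"] zero_le_power2[of a]
        by (simp add: power2_diff) (smt (verit) zero_le_power2)
    then show "AE x in M. norm (f x) \<le> norm (1 + (norm (f x))\<^sup>2)" by (auto intro!: AE_I2)
  qed
qed

lemma integral_lebesgue_on_subset:
  fixes F :: "'a::euclidean_space \<Rightarrow> 'b::euclidean_space"
  assumes "K \<in> sets lebesgue" "\<Omega> \<in> sets lebesgue" "K \<subseteq> \<Omega>" "\<And>x. x \<notin> K \<Longrightarrow> F x = 0"
  shows "(\<integral>x. F x \<partial>lebesgue_on K) = (\<integral>x. F x \<partial>lebesgue_on \<Omega>)"
    and "integrable (lebesgue_on K) F \<longleftrightarrow> integrable (lebesgue_on \<Omega>) F"
proof -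
  have "(\<lambda>x. indicator K x *\<^sub>R F x) = (\<lambda>x. indicator \<Omega> x *\<^sub>R F x)"
    using assms by (auto simp: fun_eq_iff split: split_indicator)
  then show "(\<integral>x. F x \<partial>lebesgue_on K) = (\<integral>x. F x \<partial>lebesgue_on \<Omega>)"
    and "integrable (lebesgue_on K) F \<longleftrightarrow> integrable (lebesgue_on \<Omega>) F"
    using assms by (auto simp: integral_restrict_space integrable_restrict_space)
qed

lemma integrable_lebesgue_on_mono:
  fixes F :: "'a::euclidean_space \<Rightarrow> 'b::euclidean_space"
  assumes "integrable (lebesgue_on \<Omega>) F" "K \<in> sets lebesgue" "\<Omega> \<in> sets lebesgue" "K \<subseteq> \<Omega>"
  shows "integrable (lebesgue_on K) F"
proof -
  have "integrable lebesgue (\<lambda>x. indicator \<Omega> x *\<^sub>R F x)" using assms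
    by (simp add: integrable_restrict_space)
  from integrable_mult_indicator[OF assms(2) this]
  have "integrable lebesgue (\<lambda>x. indicator K x *\<^sub>R F x)"
    using assms(4) by (auto elim!: Bochner_Integration.integrable_cong[THEN iffD1, rotated 2] split:
      split_indicator)
  then show ?thesis using assms by (simp add: integrable_restrict_space)
qed

lemma locally_integrableI:
  assumes "open \<Omega>" "integrable (lebesgue_on \<Omega>) v" shows "locally_integrable \<Omega> v"
  unfolding locally_integrable_def using assms
  by (auto intro!: integrable_lebesgue_on_mono[OF assms(2)] simp: compact_imp_closed)

lemma locally_integrable_test:
  fixes v :: "'a::euclidean_space \<Rightarrow> 'b::euclidean_space"
  assumes \<Omega>: "open \<Omega>" and v: "locally_integrable \<Omega> v" and \<phi>: "\<phi> \<in> test_functions \<Omega>"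
  shows "integrable (lebesgue_on \<Omega>) (\<lambda>x. \<phi> x *\<^sub>R v x)"
proof -
  obtain K where K: "compact K" "K \<subseteq> \<Omega>" "\<And>x. x \<notin> K \<Longrightarrow> \<phi> x = 0" using test_functionsE[OF \<phi>] by metis
  obtain B where B: "\<And>x. \<bar>\<phi> x\<bar> \<le> B" "B > 0" using test_bounded[OF \<phi>] by metis
  have iv: "integrable (lebesgue_on K) v" using v K by (simp add: locally_integrable_def)
  have "integrable (lebesgue_on K) (\<lambda>x. \<phi> x *\<^sub>R v x)"
  proof (rule Bochner_Integration.integrable_bound)
    show "integrable (lebesgue_on K) (\<lambda>x. B *\<^sub>R v x)" using iv by simp
    show "(\<lambda>x. \<phi> x *\<^sub>R v x) \<in> borel_measurable (lebesgue_on K)"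
      using borel_measurable_integrable[OF iv] borel_imp_lebesgue_on[OF test_measurable[OF \<phi>]] by measurable
    show "AE x in lebesgue_on K. norm (\<phi> x *\<^sub>R v x) \<le> norm (B *\<^sub>R v x)"
      using B by (auto intro!: AE_I2 mult_right_mono)
  qed
  moreover have "integrable (lebesgue_on K) (\<lambda>x. \<phi> x *\<^sub>R v x)
    \<longleftrightarrow> integrable (lebesgue_on \<Omega>) (\<lambda>x. \<phi> x *\<^sub>R v x)"
    using K \<Omega> by (intro integral_lebesgue_on_subset) (auto simp: compact_imp_closed)
  ultimately show ?thesis by simp
qed

lemma test_integrable_lborel:
  assumes "\<psi> \<in> test_functions W" shows "integrable lborel \<psi>"
proof -
  obtain K where K: "compact K" "\<And>x. x \<notin> K \<Longrightarrow> \<psi> x = 0" using test_functionsE[OF assms] by metis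
  have "(\<lambda>x. indicator K x *\<^sub>R \<psi> x) = \<psi>" using K(2) by (auto simp: fun_eq_iff split: split_indicator)
  then show ?thesis using borel_integrable_compact[OF K(1) test_continuous[OF assms]] by simp
qed

text \<open>Translation invariance: \<psi> (x - v) - \<psi> x integrates to 0, and by the
  fundamental theorem of calculus and Fubini its integral is also minus that of the directional
  derivative.\<close>

lemma integral_partial_deriv_zero_lborel:
  assumes \<psi>: "\<psi> \<in> test_functions W"
  shows "(\<integral>x. partial_deriv v \<psi> x \<partial>lborel) = 0"
proof -
  interpret U: finite_measure unit_interval by (rule finite_unit_interval)
  interpret Q: pair_sigma_finite unit_interval lborel ..
  have \<psi>': "partial_deriv v \<psi> \<in> test_functions W" by (rule test_partial_deriv[OF \<psi>])
  have [measurable]: "\<psi> \<in> borel_measurable borel" "partial_deriv v \<psi> \<in> borel_measurable borel"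
    using test_measurable[OF \<psi>] test_measurable[OF \<psi>'] by auto
  have i: "integrable lborel \<psi>" "integrable lborel (partial_deriv v \<psi>)"
    using test_integrable_lborel[OF \<psi>] test_integrable_lborel[OF \<psi>'] by auto
  have tr: "(\<lambda>x. \<psi> (x - v)) \<in> borel_measurable borel" by measurable
  have shift: "(\<integral>x. f (x - w) \<partial>lborel) = (\<integral>x. f x \<partial>lborel)" "integrable lborel (\<lambda>x. f (x - w))
    \<longleftrightarrow> integrable lborel f"
    if "f \<in> borel_measurable borel" for f :: "'a \<Rightarrow> real" and w
    using lborel_translate[OF that, of "- w"] by simp_all
  have fst[measurable]: "fst \<in> unit_interval \<Otimes>\<^sub>M lborel \<rightarrow>\<^sub>M borel"
    by (rule measurable_compose[OF measurable_fst measurable_unit_interval])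
  have "0 = (\<integral>x. \<psi> (x - v) \<partial>lborel) - (\<integral>x. \<psi> x \<partial>lborel)" using shift(1)[of \<psi> v] by simp
  also have "\<dots> = (\<integral>x. \<psi> (x - v) - \<psi> x \<partial>lborel)"
    using i(1) shift(2)[of \<psi> v] by simp
  also have "\<dots> = - (\<integral>x. (\<integral>s. partial_deriv v \<psi> (x - s *\<^sub>R v) \<partial>unit_interval) \<partial>lborel)"
    unfolding test_FTC[OF \<psi>] by simp
  also have "(\<integral>x. (\<integral>s. partial_deriv v \<psi> (x - s *\<^sub>R v) \<partial>unit_interval) \<partial>lborel)
      = (\<integral>s. (\<integral>x. partial_deriv v \<psi> (x - s *\<^sub>R v) \<partial>lborel) \<partial>unit_interval)"
  proof (rule Q.Fubini_integral)
    show "integrable (unit_interval \<Otimes>\<^sub>M lborel) (\<lambda>(s, x). partial_deriv v \<psi> (x - s *\<^sub>R v))"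
    proof (rule Q.Fubini_integrable)
      have "(\<lambda>z. partial_deriv v \<psi> (snd z - fst z *\<^sub>R v)) \<in> borel_measurable (unit_interval \<Otimes>\<^sub>M lborel)"
        by measurable
      then show "(\<lambda>(s, x). partial_deriv v \<psi> (x - s *\<^sub>R v)) \<in> borel_measurable (unit_interval \<Otimes>\<^sub>M lborel)"
        by (simp add: case_prod_beta')
      have "(\<integral>y. norm (case (s, y) of (s, x) \<Rightarrow> partial_deriv v \<psi> (x - s *\<^sub>R v)) \<partial>lborel)
        = (\<integral>y. \<bar>partial_deriv v \<psi> y\<bar> \<partial>lborel)" for s
        using shift(1)[of "\<lambda>y. \<bar>partial_deriv v \<psi> y\<bar>" "s *\<^sub>R v"] by simp
      then show "integrable unit_interval (\<lambda>s. \<integral>y. norm (case (s, y) of (s, x) \<Rightarrow> partial_deriv v \<psi> (x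
        - s *\<^sub>R v)) \<partial>lborel)"
        by simp
      show "AE s in unit_interval. integrable lborel (\<lambda>y. case (s, y) of (s, x) \<Rightarrow> partial_deriv v \<psi> (x
        - s *\<^sub>R v))"
        using shift(2)[of "partial_deriv v \<psi>"] i(2) by simp
    qed
  qed
  also have "\<dots> = (\<integral>s. (\<integral>x. partial_deriv v \<psi> x \<partial>lborel) \<partial>unit_interval)"
    using shift(1)[of "partial_deriv v \<psi>"] by simp
  also have "\<dots> = (\<integral>x. partial_deriv v \<psi> x \<partial>lborel)" by (rule unit_interval_const)
  finally show ?thesis by simp
qed

lemma integral_partial_deriv_zero:
  fixes \<Omega> :: "'a::euclidean_space set"
  assumes \<Omega>: "open \<Omega>" and \<psi>: "\<psi> \<in> test_functions \<Omega>"
  shows "(\<integral>x. partial_deriv v \<psi> x \<partial>lebesgue_on \<Omega>) = 0"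
proof -
  have \<psi>': "partial_deriv v \<psi> \<in> test_functions \<Omega>" by (rule test_partial_deriv[OF \<psi>])
  have "(\<integral>x. 1 * partial_deriv v \<psi> x \<partial>lebesgue_on \<Omega>) = (\<integral>x. 1 * partial_deriv v \<psi> x \<partial>lborel)"
    by (rule integral_representative[OF \<Omega>]) (use test_measurable[OF \<psi>'] test_outside[OF \<psi>'] in auto)
  then show ?thesis using integral_partial_deriv_zero_lborel[OF \<psi>] by simp
qed

text \<open>The product rule, together with the vanishing integral of the derivative of \<psi>
  \<phi>.\<close>

lemma test_is_weak_grad:
  fixes \<Omega> :: "'a::euclidean_space set"
  assumes \<Omega>: "open \<Omega>" "bounded \<Omega>" and \<psi>: "\<psi> \<in> test_functions \<Omega>"
  shows "is_weak_grad \<Omega> \<psi> (grad \<psi>)"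
  unfolding is_weak_grad_def
proof (intro conjI ballI)
  show "locally_integrable \<Omega> \<psi>" "locally_integrable \<Omega> (grad \<psi>)"
    using L2_imp_integrable[OF finite_measure_domain[OF \<Omega>]] test_L2[OF \<Omega> \<psi>] \<Omega>(1)
    by (auto intro!: locally_integrableI)
  fix b :: 'a and \<phi> assume b: "b \<in> Basis" and \<phi>: "\<phi> \<in> test_functions \<Omega>"
  have p: "(\<lambda>x. \<psi> x * \<phi> x) \<in> test_functions \<Omega>" by (rule test_mult[OF \<phi>]) (rule test_Ck[OF \<psi>])
  have i: "integrable (lebesgue_on \<Omega>) (\<lambda>x. \<psi> x * partial_deriv b \<phi> x)"
    "integrable (lebesgue_on \<Omega>) (\<lambda>x. partial_deriv b \<psi> x * \<phi> x)"
    using L2_inner_integrable[OF test_L2(1)[OF \<Omega> \<psi>] test_L2(1)[OF \<Omega> test_partial_deriv[OF \<phi>]]]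
      L2_inner_integrable[OF test_L2(1)[OF \<Omega> test_partial_deriv[OF \<psi>]] test_L2(1)[OF \<Omega> \<phi>]] by auto
  have "0 = (\<integral>x. \<psi> x * partial_deriv b \<phi> x + partial_deriv b \<psi> x * \<phi> x \<partial>lebesgue_on \<Omega>)"
    using integral_partial_deriv_zero[OF \<Omega>(1) p, of b]
    by (simp add: partial_deriv_mult test_differentiable[OF \<phi>] test_differentiable[OF \<psi>])
  also have "\<dots> = (\<integral>x. \<psi> x * partial_deriv b \<phi> x \<partial>lebesgue_on \<Omega>)
    + (\<integral>x. partial_deriv b \<psi> x * \<phi> x \<partial>lebesgue_on \<Omega>)"
    using i by simp
  finally show "(\<integral>x. \<psi> x * partial_deriv b \<phi> x \<partial>lebesgue_on \<Omega>) = - (\<integral>x. grad \<psi> x \<bullet> b * \<phi> x \<partial>lebesgue_on \<Omega>)"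
    by (simp add: grad_inner[OF \<psi>])
qed

lemma is_weak_grad_lincomb:
  assumes \<Omega>: "open \<Omega>" and v: "is_weak_grad \<Omega> v V" and w: "is_weak_grad \<Omega> w W"
  shows "is_weak_grad \<Omega> (\<lambda>x. a * v x + b * w x) (\<lambda>x. a *\<^sub>R V x + b *\<^sub>R W x)"
proof -
  have li: "locally_integrable \<Omega> v" "locally_integrable \<Omega> V" "locally_integrable \<Omega> w"
    "locally_integrable \<Omega> W"
    using v w by (auto simp: is_weak_grad_def)
  show ?thesis
    unfolding is_weak_grad_def
  proof (intro conjI ballI)
    show "locally_integrable \<Omega> (\<lambda>x. a * v x + b * w x)" "locally_integrable \<Omega> (\<lambda>x. a *\<^sub>R V x + b *\<^sub>R W x)"
      using li unfolding locally_integrable_def by auto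
    fix i :: 'a and \<phi> assume i: "i \<in> Basis" and \<phi>: "\<phi> \<in> test_functions \<Omega>"
    have 1: "integrable (lebesgue_on \<Omega>) (\<lambda>x. v x * partial_deriv i \<phi> x)"
      "integrable (lebesgue_on \<Omega>) (\<lambda>x. w x * partial_deriv i \<phi> x)"
      using locally_integrable_test[OF \<Omega> li(1) test_partial_deriv[OF \<phi>]] locally_integrable_test[OF \<Omega> li(3)
        test_partial_deriv[OF \<phi>]]
      by (auto simp: mult.commute)
    have 2: "integrable (lebesgue_on \<Omega>) (\<lambda>x. V x \<bullet> i * \<phi> x)"
      "integrable (lebesgue_on \<Omega>) (\<lambda>x. W x \<bullet> i * \<phi> x)"
      using integrable_inner_left[OF locally_integrable_test[OF \<Omega> li(2) \<phi>], of i] integrable_inner_left[OF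
        locally_integrable_test[OF \<Omega> li(4) \<phi>], of i]
      by (auto simp: mult.commute)
    have "(\<integral>x. (a * v x + b * w x) * partial_deriv i \<phi> x \<partial>lebesgue_on \<Omega>) =
      (\<integral>x. a * (v x * partial_deriv i \<phi> x) + b * (w x * partial_deriv i \<phi> x) \<partial>lebesgue_on \<Omega>)"
      by (simp add: algebra_simps)
    also have "\<dots> = a * (\<integral>x. v x * partial_deriv i \<phi> x \<partial>lebesgue_on \<Omega>)
      + b * (\<integral>x. w x * partial_deriv i \<phi> x \<partial>lebesgue_on \<Omega>)"
      using 1 by simp
    also have "\<dots> = - (a * (\<integral>x. V x \<bullet> i * \<phi> x \<partial>lebesgue_on \<Omega>) + b * (\<integral>x. W x \<bullet> i * \<phi> x \<partial>lebesgue_on \<Omega>))"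
      using v w i \<phi> by (simp add: is_weak_grad_def)
    also have "a * (\<integral>x. V x \<bullet> i * \<phi> x \<partial>lebesgue_on \<Omega>) + b * (\<integral>x. W x \<bullet> i * \<phi> x \<partial>lebesgue_on \<Omega>) =
      (\<integral>x. a * (V x \<bullet> i * \<phi> x) + b * (W x \<bullet> i * \<phi> x) \<partial>lebesgue_on \<Omega>)"
      using 2 by simp
    also have "\<dots> = (\<integral>x. (a *\<^sub>R V x + b *\<^sub>R W x) \<bullet> i * \<phi> x \<partial>lebesgue_on \<Omega>)"
      by (simp add: inner_add_left algebra_simps)
    finally show "(\<integral>x. (a * v x + b * w x) * partial_deriv i \<phi> x \<partial>lebesgue_on \<Omega>) = - (\<integral>x. (a *\<^sub>R V x
      + b *\<^sub>R W x) \<bullet> i * \<phi> x \<partial>lebesgue_on \<Omega>)" .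
  qed
qed

section \<open>Uniqueness of weak gradients\<close>

lemma AE_lebesgue_on_iff_negligible:
  fixes \<Omega> :: "'a::euclidean_space set"
  assumes "\<Omega> \<in> sets lebesgue"
  shows "(AE x in lebesgue_on \<Omega>. P x) \<longleftrightarrow> negligible {x\<in>\<Omega>. \<not> P x}"
proof -
  have "(AE x in lebesgue_on \<Omega>. P x) \<longleftrightarrow> (AE x in lebesgue. x \<in> \<Omega> \<longrightarrow> P x)"
    using assms by (intro AE_restrict_space_iff) simp
  also have "\<dots> \<longleftrightarrow> (\<exists>N. negligible N \<and> {x. \<not> (x \<in> \<Omega> \<longrightarrow> P x)} \<subseteq> N)"
    by (rule eventually_ae_filter_negligible)
  also have "\<dots> \<longleftrightarrow> negligible {x\<in>\<Omega>. \<not> P x}"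
    by (auto intro: negligible_subset)
  finally show ?thesis .
qed

text \<open>The fundamental lemma of the calculus of variations. Gradients are only locally
  integrable, so the argument is carried out in boxes with closure in \<open>\<Omega>\<close>:
  testing with the sign of V - V' makes the integral of the modulus vanish there. Being negligible
  is a local property, which extends the result to \<open>\<Omega>\<close>.\<close>

lemma is_weak_grad_unique:
  fixes \<Omega> :: "'a::euclidean_space set"
  assumes \<Omega>: "open \<Omega>" and V: "is_weak_grad \<Omega> v V" and V': "is_weak_grad \<Omega> v V'"
  shows "AE x in lebesgue_on \<Omega>. V x = V' x"
proof -
  have "AE x in lebesgue_on \<Omega>. V x \<bullet> b = V' x \<bullet> b" if b: "b \<in> Basis" for b
  proof -
    have local: "negligible {x\<in>box c d. V x \<bullet> b \<noteq> V' x \<bullet> b}" if cd: "cbox c d \<subseteq> \<Omega>" for c d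
    proof -
      let ?W = "box c d"
      have W\<Omega>: "?W \<subseteq> \<Omega>" using cd box_subset_cbox by blast
      have int: "integrable (lebesgue_on ?W) (\<lambda>x. V x \<bullet> b)" if "is_weak_grad \<Omega> v V" for V
      proof -
        have "integrable (lebesgue_on (cbox c d)) V"
          using that cd by (auto simp: is_weak_grad_def locally_integrable_def)
        then have "integrable (lebesgue_on ?W) V"
          by (rule integrable_lebesgue_on_mono) (auto dest: subsetD[OF box_subset_cbox])
        then show ?thesis by simp
      qed
      let ?\<delta> = "\<lambda>x. V x \<bullet> b - V' x \<bullet> b"
      have i\<delta>: "integrable (lebesgue_on ?W) ?\<delta>" using int[OF V] int[OF V'] by simp
      obtain g where g: "g \<in> borel_measurable borel" and "integrable lborel g"
        and g': "AE x in lebesgue. x \<in> ?W \<longrightarrow> ?\<delta> x = g x"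
        using borel_representative[OF open_box i\<delta>] .
      \<comment> \<open>The sign is taken of a Borel representative, because only Borel functions
        may be inserted; almost everywhere it is the sign of the difference itself.\<close>
      define h where "h x = sgn (g x) * indicator ?W x" for x
      have "(\<integral>x. h x * (V x \<bullet> b) \<partial>lebesgue_on ?W) = (\<integral>x. h x * (V' x \<bullet> b) \<partial>lebesgue_on ?W)"
      proof (rule test_functions_determine[where \<Omega>="?W" and f="\<lambda>x. x" and g="\<lambda>x. x" and C=1])
        show "(\<lambda>x. x) \<in> lebesgue_on ?W \<rightarrow>\<^sub>M borel" by (intro borel_imp_lebesgue_on) simp
        then show "(\<lambda>x. x) \<in> lebesgue_on ?W \<rightarrow>\<^sub>M borel" .
        show "integrable (lebesgue_on ?W) (\<lambda>x. V x \<bullet> b)" "integrable (lebesgue_on ?W) (\<lambda>x. V' x \<bullet> b)"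
          by (rule int[OF V], rule int[OF V'])
        fix \<psi> assume \<psi>: "\<psi> \<in> test_functions ?W"
        have \<psi>\<Omega>: "\<psi> \<in> test_functions \<Omega>" using test_mono[OF \<psi> W\<Omega>] .
        have "(\<integral>x. \<psi> x * (V x \<bullet> b) \<partial>lebesgue_on ?W) = - (\<integral>x. v x * partial_deriv b \<psi> x \<partial>lebesgue_on \<Omega>)"
          if "is_weak_grad \<Omega> v V" for V
        proof -
          have "(\<integral>x. \<psi> x * (V x \<bullet> b) \<partial>lebesgue_on ?W) = (\<integral>x. \<psi> x * (V x \<bullet> b) \<partial>lebesgue_on \<Omega>)"
            using W\<Omega> \<Omega> test_outside[OF \<psi>] by (intro integral_lebesgue_on_subset) auto
          then show ?thesis using that b \<psi>\<Omega> by (simp add: is_weak_grad_def mult.commute)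
        qed
        from this[OF V] this[OF V']
        show "(\<integral>x. \<psi> x * (V x \<bullet> b) \<partial>lebesgue_on ?W) = (\<integral>x. \<psi> x * (V' x \<bullet> b) \<partial>lebesgue_on ?W)" by simp
      next
        show "h \<in> borel_measurable borel" using g unfolding h_def by measurable
      qed (auto simp: h_def sgn_if split: split_indicator)
      moreover have ih: "integrable (lebesgue_on ?W) (\<lambda>x. h x * (V x \<bullet> b))" if "is_weak_grad \<Omega> v V" for V
      proof (rule Bochner_Integration.integrable_bound[OF int[OF that]])
        have "h \<in> borel_measurable borel" using g unfolding h_def by measurable
        then show "(\<lambda>x. h x * (V x \<bullet> b)) \<in> borel_measurable (lebesgue_on ?W)"
          using borel_measurable_times[OF borel_imp_lebesgue_on borel_measurable_integrable[OF int[OF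
            that]]] by simp
        show "AE x in lebesgue_on ?W. norm (h x * (V x \<bullet> b)) \<le> norm (V x \<bullet> b)"
          by (auto simp: h_def abs_mult sgn_if split: split_indicator)
      qed
      ultimately have "(\<integral>x. h x * ?\<delta> x \<partial>lebesgue_on ?W) = 0"
        using ih[OF V] ih[OF V'] by (simp add: right_diff_distrib)
      moreover have ae: "AE x in lebesgue_on ?W. h x * ?\<delta> x = \<bar>?\<delta> x\<bar>"
      proof -
        have "AE x in lebesgue_on ?W. x \<in> ?W \<longrightarrow> ?\<delta> x = g x"
          using g' by (subst AE_restrict_space_iff) auto
        then show ?thesis using AE_space
          by eventually_elim (auto simp: h_def sgn_if space_restrict_space)
      qed
      moreover have "(\<integral>x. h x * ?\<delta> x \<partial>lebesgue_on ?W) = (\<integral>x. \<bar>?\<delta> x\<bar> \<partial>lebesgue_on ?W)"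
      proof (rule integral_cong_AE[OF _ _ ae])
        show "(\<lambda>x. h x * ?\<delta> x) \<in> borel_measurable (lebesgue_on ?W)"
          using borel_measurable_integrable[OF Bochner_Integration.integrable_diff[OF ih[OF V] ih[OF V']]]
          by (simp add: right_diff_distrib)
      qed (use i\<delta> in auto)
      ultimately have "(\<integral>x. \<bar>?\<delta> x\<bar> \<partial>lebesgue_on ?W) = 0" by simp
      then have "AE x in lebesgue_on ?W. \<bar>?\<delta> x\<bar> = 0"
        using integral_nonneg_eq_0_iff_AE[of "lebesgue_on ?W" "\<lambda>x. \<bar>?\<delta> x\<bar>"] i\<delta> by auto
      then have "AE x in lebesgue_on ?W. V x \<bullet> b = V' x \<bullet> b" by eventually_elim simp
      then show ?thesis by (subst (asm) AE_lebesgue_on_iff_negligible) auto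
    qed
    have "negligible {x\<in>\<Omega>. V x \<bullet> b \<noteq> V' x \<bullet> b}"
      unfolding locally_negligible_alt[of "{x\<in>\<Omega>. V x \<bullet> b \<noteq> V' x \<bullet> b}"]
    proof
      fix x assume x: "x \<in> {x\<in>\<Omega>. V x \<bullet> b \<noteq> V' x \<bullet> b}"
      then have "x \<in> \<Omega>" by simp
      then obtain c d where cd: "cbox c d \<subseteq> \<Omega>" "x \<in> box c d" using open_contains_cbox[OF \<Omega>] by metis
      let ?S = "{x\<in>\<Omega>. V x \<bullet> b \<noteq> V' x \<bullet> b}"
      have "?S \<inter> box c d = {x\<in>box c d. V x \<bullet> b \<noteq> V' x \<bullet> b}" using cd box_subset_cbox by blast
      then have "negligible (?S \<inter> box c d)" using local[OF cd(1)] by simp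
      moreover have "openin (top_of_set ?S) (?S \<inter> box c d)" by (auto intro: openin_open_Int)
      ultimately show "\<exists>U. openin (top_of_set ?S) U \<and> x \<in> U \<and> negligible U" using x cd by blast
    qed
    then show ?thesis using \<Omega> by (subst AE_lebesgue_on_iff_negligible) auto
  qed
  then have "AE x in lebesgue_on \<Omega>. \<forall>b\<in>Basis. V x \<bullet> b = V' x \<bullet> b" by (intro AE_finite_allI) auto
  then show ?thesis by eventually_elim (auto intro: euclidean_eqI)
qed

lemma borel_measurable_lebesgue_on_AE:
  fixes f g :: "'a::euclidean_space \<Rightarrow> 'b::euclidean_space"
  assumes S: "S \<in> sets lebesgue" and f: "f \<in> borel_measurable (lebesgue_on S)"
    and ae: "AE x in lebesgue_on S. f x = g x"
  shows "g \<in> borel_measurable (lebesgue_on S)"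
proof -
  have "AE x in lebesgue. x \<in> S \<longrightarrow> f x = g x" using ae S by (subst (asm) AE_restrict_space_iff) auto
  then have "AE x in lebesgue. (if x \<in> S then f x else 0) = (if x \<in> S then g x else 0)"
    by eventually_elim auto
  from borel_measurable_AE[OF borel_measurable_if_I[OF f S] this]
  show ?thesis by (rule borel_measurable_if_D)
qed

text \<open>The gradient picked by \<open>SOME\<close> need not be the one that witnesses membership
  in the Sobolev space, and its definition gives only local integrability. Uniqueness almost
  everywhere transfers measurability and integrability to it.\<close>

lemma W1p_weak_grad:
  fixes \<Omega> :: "'a::euclidean_space set"
  assumes \<Omega>: "open \<Omega>" and v: "v \<in> W1p p \<Omega>"
  shows "is_weak_grad \<Omega> v (weak_grad \<Omega> v)" "weak_grad \<Omega> v \<in> Lp p \<Omega>"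
proof -
  obtain V where V: "V \<in> Lp p \<Omega>" "is_weak_grad \<Omega> v V" using v by (auto simp: W1p_def)
  show w: "is_weak_grad \<Omega> v (weak_grad \<Omega> v)"
    unfolding weak_grad_def by (rule someI[of "is_weak_grad \<Omega> v", OF V(2)])
  have ae: "AE x in lebesgue_on \<Omega>. V x = weak_grad \<Omega> v x" by (rule is_weak_grad_unique[OF \<Omega> V(2) w])
  have Vm: "V \<in> borel_measurable (lebesgue_on \<Omega>)"
    and Vi: "integrable (lebesgue_on \<Omega>) (\<lambda>x. norm (V x) powr p)"
    using V by (auto simp: Lp_def)
  have m: "weak_grad \<Omega> v \<in> borel_measurable (lebesgue_on \<Omega>)"
    using \<Omega> by (intro borel_measurable_lebesgue_on_AE[OF _ Vm ae]) auto
  have "integrable (lebesgue_on \<Omega>) (\<lambda>x. norm (weak_grad \<Omega> v x) powr p)"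
    by (rule Bochner_Integration.integrable_cong_AE_imp[OF Vi]) (use m ae in \<open>auto elim!: eventually_mono\<close>)
  then show "weak_grad \<Omega> v \<in> Lp p \<Omega>" using m by (simp add: Lp_def)
qed

lemma W12_L2:
  assumes "open \<Omega>" "v \<in> W1p 2 \<Omega>"
  shows "v \<in> L2 (lebesgue_on \<Omega>)" "weak_grad \<Omega> v \<in> L2 (lebesgue_on \<Omega>)"
  using W1p_weak_grad[OF assms] assms(2) by (auto simp: W1p_def Lp2_eq_L2)

section \<open>Zero boundary values as L^2 limits of test functions and their gradients\<close>

lemma W1p_norm_2:
  "W1p_norm 2 \<Omega> u = sqrt ((\<integral>x. (u x)\<^sup>2 \<partial>lebesgue_on \<Omega>) + (\<integral>x. (norm (weak_grad \<Omega> u x))\<^sup>2 \<partial>lebesgue_on \<Omega>))"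
proof -
  have p: "(I powr (1/2)) powr 2 = I" if "I \<ge> 0" for I :: real
    using that by (simp add: powr_powr)
  have a: "0 \<le> (\<integral>x. (u x)\<^sup>2 \<partial>lebesgue_on \<Omega>)" and b: "0 \<le> (\<integral>x. (norm (weak_grad \<Omega> u x))\<^sup>2 \<partial>lebesgue_on \<Omega>)"
    by (auto intro!: integral_nonneg_AE)
  have 1: "(\<lambda>x. norm (u x) powr 2) = (\<lambda>x. (u x)\<^sup>2)" and 2: "(\<lambda>x. norm (weak_grad \<Omega> u x) powr 2)
    = (\<lambda>x. (norm (weak_grad \<Omega> u x))\<^sup>2)"
    by auto
  show ?thesis
    unfolding W1p_norm_def Lp_norm_def 1 2 p[OF a] p[OF b] using a b by (subst powr_half_sqrt) auto
qed

text \<open>\<open>V\<close> is the weak gradient of \<open>v\<close> up to a null set; carrying it along removes the \<open>SOME\<close> in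
  \<open>weak_grad\<close> from the analysis.\<close>

definition H10_pair :: "'a::euclidean_space set \<Rightarrow> ('a \<Rightarrow> real) \<Rightarrow> ('a \<Rightarrow> 'a) \<Rightarrow> bool" where
  "H10_pair \<Omega> v V \<longleftrightarrow> v \<in> L2 (lebesgue_on \<Omega>) \<and> V \<in> L2 (lebesgue_on \<Omega>) \<and>
     (\<forall>\<delta>>0. \<exists>\<psi>\<in>test_functions \<Omega>.
        (\<integral>x. (v x - \<psi> x)\<^sup>2 \<partial>lebesgue_on \<Omega>) + (\<integral>x. (norm (V x - grad \<psi> x))\<^sup>2 \<partial>lebesgue_on \<Omega>) < \<delta>)"

lemma H10_pair_sequence:
  assumes "H10_pair \<Omega> v V"
  shows "\<exists>\<psi>. (\<forall>n. \<psi> n \<in> test_functions \<Omega>) \<and>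
    (\<lambda>n. \<integral>x. (norm (\<psi> n x - v x))\<^sup>2 \<partial>lebesgue_on \<Omega>) \<longlonglongrightarrow> 0 \<and>
    (\<lambda>n. \<integral>x. (norm (grad (\<psi> n) x - V x))\<^sup>2 \<partial>lebesgue_on \<Omega>) \<longlonglongrightarrow> 0"
proof -
  have "\<forall>n. \<exists>\<psi>. \<psi> \<in> test_functions \<Omega> \<and>
      (\<integral>x. (v x - \<psi> x)\<^sup>2 \<partial>lebesgue_on \<Omega>) + (\<integral>x. (norm (V x - grad \<psi> x))\<^sup>2 \<partial>lebesgue_on \<Omega>) < inverse (real
        (Suc n))"
  proof
    fix n
    have "inverse (real (Suc n)) > 0" by simp
    then show "\<exists>\<psi>. \<psi> \<in> test_functions \<Omega> \<and>
      (\<integral>x. (v x - \<psi> x)\<^sup>2 \<partial>lebesgue_on \<Omega>) + (\<integral>x. (norm (V x - grad \<psi> x))\<^sup>2 \<partial>lebesgue_on \<Omega>) < inverse (real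
        (Suc n))"
      using assms unfolding H10_pair_def by blast
  qed
  from choice[OF this] obtain \<psi> where \<psi>: "\<And>n. \<psi> n \<in> test_functions \<Omega>"
    and lt: "\<And>n. (\<integral>x. (v x - \<psi> n x)\<^sup>2 \<partial>lebesgue_on \<Omega>) + (\<integral>x. (norm (V x - grad (\<psi> n) x))\<^sup>2 \<partial>lebesgue_on \<Omega>)
      < inverse (real (Suc n))"
    by blast
  have nn: "0 \<le> (\<integral>x. (v x - \<psi> n x)\<^sup>2 \<partial>lebesgue_on \<Omega>)" "0 \<le> (\<integral>x. (norm (V x
    - grad (\<psi> n) x))\<^sup>2 \<partial>lebesgue_on \<Omega>)" for n
    by (auto intro!: integral_nonneg_AE)
  have e: "(norm (\<psi> n x - v x))\<^sup>2 = (v x - \<psi> n x)\<^sup>2" for n x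
    by (simp add: power2_commute)
  have le: "(\<integral>x. (v x - \<psi> n x)\<^sup>2 \<partial>lebesgue_on \<Omega>) \<le> inverse (real (Suc n))"
    "(\<integral>x. (norm (V x - grad (\<psi> n) x))\<^sup>2 \<partial>lebesgue_on \<Omega>) \<le> inverse (real (Suc n))" for n
    using lt[of n] nn[of n] by linarith+
  have "(\<lambda>n. \<integral>x. (v x - \<psi> n x)\<^sup>2 \<partial>lebesgue_on \<Omega>) \<longlonglongrightarrow> 0"
    by (rule tendsto_sandwich[OF always_eventually always_eventually tendsto_const
      LIMSEQ_inverse_real_of_nat])
      (use le nn in blast)+
  moreover have "(\<lambda>n. \<integral>x. (norm (V x - grad (\<psi> n) x))\<^sup>2 \<partial>lebesgue_on \<Omega>) \<longlonglongrightarrow> 0"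
    by (rule tendsto_sandwich[OF always_eventually always_eventually tendsto_const
      LIMSEQ_inverse_real_of_nat])
      (use le nn in blast)+
  ultimately show ?thesis using \<psi> e norm_minus_commute[of "V _"] by (intro exI[of _ \<psi>]) simp
qed

text \<open>Integration by parts for the approximating test functions passes to the limit, since
  both sides are L^2 pairings with a fixed function.\<close>

lemma H10_pair_weak_grad:
  fixes \<Omega> :: "'a::euclidean_space set"
  assumes \<Omega>: "open \<Omega>" "bounded \<Omega>" and p: "H10_pair \<Omega> v V"
  shows "is_weak_grad \<Omega> v V"
  unfolding is_weak_grad_def
proof (intro conjI ballI)
  have L: "v \<in> L2 (lebesgue_on \<Omega>)" "V \<in> L2 (lebesgue_on \<Omega>)" using p by (auto simp: H10_pair_def)
  show "locally_integrable \<Omega> v" "locally_integrable \<Omega> V"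
    using L2_imp_integrable[OF finite_measure_domain[OF \<Omega>]] L \<Omega>(1) by (auto intro!: locally_integrableI)
  fix b :: 'a and \<phi> assume b: "b \<in> Basis" and \<phi>: "\<phi> \<in> test_functions \<Omega>"
  obtain \<psi> where \<psi>: "\<And>n. \<psi> n \<in> test_functions \<Omega>"
    and l1: "(\<lambda>n. \<integral>x. (norm (\<psi> n x - v x))\<^sup>2 \<partial>lebesgue_on \<Omega>) \<longlonglongrightarrow> 0"
    and l2: "(\<lambda>n. \<integral>x. (norm (grad (\<psi> n) x - V x))\<^sup>2 \<partial>lebesgue_on \<Omega>) \<longlonglongrightarrow> 0"
    using H10_pair_sequence[OF p] by blast
  have d: "partial_deriv b \<phi> \<in> L2 (lebesgue_on \<Omega>)" by (rule test_L2(1)[OF \<Omega> test_partial_deriv[OF \<phi>]])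
  have f: "(\<lambda>x. \<phi> x *\<^sub>R b) \<in> L2 (lebesgue_on \<Omega>)"
  proof -
    have "(\<lambda>x. \<phi> x *\<^sub>R b) \<in> borel_measurable (lebesgue_on \<Omega>)"
      using L2_measurable[OF test_L2(1)[OF \<Omega> \<phi>]] by measurable
    then show ?thesis using L2_integrable[OF test_L2(1)[OF \<Omega> \<phi>]] b by (simp add: L2_def power_mult_distrib)
  qed
  have 1: "(\<lambda>n. \<integral>x. (\<psi> n x - v x) \<bullet> partial_deriv b \<phi> x \<partial>lebesgue_on \<Omega>) \<longlonglongrightarrow> 0"
    by (rule L2_inner_tendsto_0[OF L2_diff[OF test_L2(1)[OF \<Omega> \<psi>] L(1)] d l1])
  have 2: "(\<lambda>n. \<integral>x. (grad (\<psi> n) x - V x) \<bullet> (\<phi> x *\<^sub>R b) \<partial>lebesgue_on \<Omega>) \<longlonglongrightarrow> 0"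
    by (rule L2_inner_tendsto_0[OF L2_diff[OF test_L2(2)[OF \<Omega> \<psi>] L(2)] f l2])
  have e1: "(\<integral>x. (\<psi> n x - v x) \<bullet> partial_deriv b \<phi> x \<partial>lebesgue_on \<Omega>) =
    (\<integral>x. \<psi> n x * partial_deriv b \<phi> x \<partial>lebesgue_on \<Omega>) - (\<integral>x. v x * partial_deriv b \<phi> x \<partial>lebesgue_on \<Omega>)" for n
    using L2_inner_integrable[OF test_L2(1)[OF \<Omega> \<psi>] d] L2_inner_integrable[OF L(1) d]
      by (simp add: left_diff_distrib)
  have e2: "(\<integral>x. (grad (\<psi> n) x - V x) \<bullet> (\<phi> x *\<^sub>R b) \<partial>lebesgue_on \<Omega>) =
    (\<integral>x. grad (\<psi> n) x \<bullet> b * \<phi> x \<partial>lebesgue_on \<Omega>) - (\<integral>x. V x \<bullet> b * \<phi> x \<partial>lebesgue_on \<Omega>)" for n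
  proof -
    have "(\<integral>x. (grad (\<psi> n) x - V x) \<bullet> (\<phi> x *\<^sub>R b) \<partial>lebesgue_on \<Omega>) =
       (\<integral>x. grad (\<psi> n) x \<bullet> (\<phi> x *\<^sub>R b) - V x \<bullet> (\<phi> x *\<^sub>R b) \<partial>lebesgue_on \<Omega>)"
      by (simp add: inner_diff_left right_diff_distrib)
    also have "\<dots> = (\<integral>x. grad (\<psi> n) x \<bullet> (\<phi> x *\<^sub>R b) \<partial>lebesgue_on \<Omega>) - (\<integral>x. V x \<bullet> (\<phi> x *\<^sub>R b) \<partial>lebesgue_on \<Omega>)"
      by (rule Bochner_Integration.integral_diff[OF L2_inner_integrable[OF test_L2(2)[OF \<Omega> \<psi>] f]
        L2_inner_integrable[OF L(2) f]])
    finally show ?thesis by (simp add: mult.commute)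
  qed
  have ibp: "(\<integral>x. \<psi> n x * partial_deriv b \<phi> x \<partial>lebesgue_on \<Omega>)
    = - (\<integral>x. grad (\<psi> n) x \<bullet> b * \<phi> x \<partial>lebesgue_on \<Omega>)" for n
    using test_is_weak_grad[OF \<Omega> \<psi>, of n] b \<phi> by (simp add: is_weak_grad_def)
  have "(\<lambda>n. - (\<integral>x. V x \<bullet> b * \<phi> x \<partial>lebesgue_on \<Omega>) - (\<integral>x. v x * partial_deriv b \<phi> x \<partial>lebesgue_on \<Omega>)) \<longlonglongrightarrow> 0"
    using tendsto_add[OF 1 2] unfolding e1 e2 ibp by (simp add: algebra_simps)
  then have "- (\<integral>x. V x \<bullet> b * \<phi> x \<partial>lebesgue_on \<Omega>) - (\<integral>x. v x * partial_deriv b \<phi> x \<partial>lebesgue_on \<Omega>) = 0"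
    using LIMSEQ_const_iff by blast
  then show "(\<integral>x. v x * partial_deriv b \<phi> x \<partial>lebesgue_on \<Omega>) = - (\<integral>x. V x \<bullet> b * \<phi> x \<partial>lebesgue_on \<Omega>)" by simp
qed

text \<open>The norm in \<open>W1p0\<close> involves the gradient that \<open>SOME\<close> picks for
  v - \<psi>, which has no a priori relation to the one for v. Uniqueness identifies it with V -
  grad \<psi> almost everywhere.\<close>

lemma H10_pair_imp_H10:
  fixes \<Omega> :: "'a::euclidean_space set"
  assumes \<Omega>: "open \<Omega>" "bounded \<Omega>" and p: "H10_pair \<Omega> v V"
  shows "v \<in> H10 \<Omega>" "AE x in lebesgue_on \<Omega>. weak_grad \<Omega> v x = V x"
proof -
  have wg: "is_weak_grad \<Omega> v V" by (rule H10_pair_weak_grad[OF assms])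
  have L: "v \<in> L2 (lebesgue_on \<Omega>)" "V \<in> L2 (lebesgue_on \<Omega>)" using p by (auto simp: H10_pair_def)
  have W: "v \<in> W1p 2 \<Omega>" using L wg by (auto simp: W1p_def Lp2_eq_L2)
  show ae: "AE x in lebesgue_on \<Omega>. weak_grad \<Omega> v x = V x"
    by (rule is_weak_grad_unique[OF \<Omega>(1) W1p_weak_grad(1)[OF \<Omega>(1) W] wg])
  have "\<exists>\<psi>\<in>test_functions \<Omega>. W1p_norm 2 \<Omega> (\<lambda>x. v x - \<psi> x) < \<delta>" if "\<delta> > 0" for \<delta>
  proof -
    obtain \<psi> where \<psi>: "\<psi> \<in> test_functions \<Omega>"
      and lt: "(\<integral>x. (v x - \<psi> x)\<^sup>2 \<partial>lebesgue_on \<Omega>) + (\<integral>x. (norm (V x - grad \<psi> x))\<^sup>2 \<partial>lebesgue_on \<Omega>) < \<delta>\<^sup>2"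
    proof -
      have "\<delta>\<^sup>2 > 0" using \<open>\<delta> > 0\<close> by simp
      then show ?thesis using p that unfolding H10_pair_def by blast
    qed
    have d: "is_weak_grad \<Omega> (\<lambda>x. v x - \<psi> x) (\<lambda>x. V x - grad \<psi> x)"
      using is_weak_grad_lincomb[OF \<Omega>(1) wg test_is_weak_grad[OF \<Omega> \<psi>], of 1 "-1"] by simp
    have "(\<lambda>x. v x - \<psi> x) \<in> W1p 2 \<Omega>"
      using d L2_diff[OF L(1) test_L2(1)[OF \<Omega> \<psi>]] L2_diff[OF L(2) test_L2(2)[OF \<Omega> \<psi>]]
      by (auto simp: W1p_def Lp2_eq_L2)
    note dW = this
    have "AE x in lebesgue_on \<Omega>. weak_grad \<Omega> (\<lambda>x. v x - \<psi> x) x = V x - grad \<psi> x"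
      by (rule is_weak_grad_unique[OF \<Omega>(1) W1p_weak_grad(1)[OF \<Omega>(1) dW] d])
    then have "(\<integral>x. (norm (weak_grad \<Omega> (\<lambda>x. v x - \<psi> x) x))\<^sup>2 \<partial>lebesgue_on \<Omega>) = (\<integral>x. (norm (V x
      - grad \<psi> x))\<^sup>2 \<partial>lebesgue_on \<Omega>)"
      using L2_measurable[OF W12_L2(2)[OF \<Omega>(1) dW]] L2_measurable[OF L2_diff[OF L(2) test_L2(2)[OF \<Omega> \<psi>]]]
      by (intro integral_cong_AE) (auto elim!: eventually_mono)
    then have "W1p_norm 2 \<Omega> (\<lambda>x. v x - \<psi> x) < sqrt (\<delta>\<^sup>2)"
      unfolding W1p_norm_2 using lt by (intro real_sqrt_less_mono) simp
    then show ?thesis using \<psi> \<open>\<delta> > 0\<close> by auto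
  qed
  then show "v \<in> H10 \<Omega>" using W by (simp add: W1p0_def)
qed

lemma H10_imp_pair:
  fixes \<Omega> :: "'a::euclidean_space set"
  assumes \<Omega>: "open \<Omega>" "bounded \<Omega>" and v: "v \<in> H10 \<Omega>"
  shows "H10_pair \<Omega> v (weak_grad \<Omega> v)"
proof -
  have W: "v \<in> W1p 2 \<Omega>" using v by (simp add: W1p0_def)
  have L: "v \<in> L2 (lebesgue_on \<Omega>)" "weak_grad \<Omega> v \<in> L2 (lebesgue_on \<Omega>)" using W12_L2[OF \<Omega>(1) W] by auto
  have wg: "is_weak_grad \<Omega> v (weak_grad \<Omega> v)" by (rule W1p_weak_grad(1)[OF \<Omega>(1) W])
  have "\<exists>\<psi>\<in>test_functions \<Omega>. (\<integral>x. (v x - \<psi> x)\<^sup>2 \<partial>lebesgue_on \<Omega>) + (\<integral>x. (norm (weak_grad \<Omega> v x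
    - grad \<psi> x))\<^sup>2 \<partial>lebesgue_on \<Omega>) < \<delta>"
    if "\<delta> > 0" for \<delta>
  proof -
    have "sqrt \<delta> > 0" using that by simp
    then obtain \<psi> where \<psi>: "\<psi> \<in> test_functions \<Omega>" and lt: "W1p_norm 2 \<Omega> (\<lambda>x. v x - \<psi> x) < sqrt \<delta>"
      using v unfolding W1p0_def by blast
    have d: "is_weak_grad \<Omega> (\<lambda>x. v x - \<psi> x) (\<lambda>x. weak_grad \<Omega> v x - grad \<psi> x)"
      using is_weak_grad_lincomb[OF \<Omega>(1) wg test_is_weak_grad[OF \<Omega> \<psi>], of 1 "-1"] by simp
    have dW: "(\<lambda>x. v x - \<psi> x) \<in> W1p 2 \<Omega>"
      using d L2_diff[OF L(1) test_L2(1)[OF \<Omega> \<psi>]] L2_diff[OF L(2) test_L2(2)[OF \<Omega> \<psi>]]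
      by (auto simp: W1p_def Lp2_eq_L2)
    have "AE x in lebesgue_on \<Omega>. weak_grad \<Omega> (\<lambda>x. v x - \<psi> x) x = weak_grad \<Omega> v x - grad \<psi> x"
      by (rule is_weak_grad_unique[OF \<Omega>(1) W1p_weak_grad(1)[OF \<Omega>(1) dW] d])
    then have "(\<integral>x. (norm (weak_grad \<Omega> (\<lambda>x. v x - \<psi> x) x))\<^sup>2 \<partial>lebesgue_on \<Omega>) = (\<integral>x. (norm (weak_grad \<Omega> v x
      - grad \<psi> x))\<^sup>2 \<partial>lebesgue_on \<Omega>)"
      using L2_measurable[OF W12_L2(2)[OF \<Omega>(1) dW]] L2_measurable[OF L2_diff[OF L(2) test_L2(2)[OF \<Omega> \<psi>]]]
      by (intro integral_cong_AE) (auto elim!: eventually_mono)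
    then show ?thesis using lt \<psi> unfolding W1p_norm_2 real_sqrt_less_iff by auto
  qed
  then show ?thesis using L by (simp add: H10_pair_def)
qed

lemma H10_pair_lincomb:
  fixes \<Omega> :: "'a::euclidean_space set"
  assumes \<Omega>: "open \<Omega>" "bounded \<Omega>" and v: "H10_pair \<Omega> v V" and w: "H10_pair \<Omega> w W"
  shows "H10_pair \<Omega> (\<lambda>x. a * v x + b * w x) (\<lambda>x. a *\<^sub>R V x + b *\<^sub>R W x)"
proof -
  have L: "v \<in> L2 (lebesgue_on \<Omega>)" "V \<in> L2 (lebesgue_on \<Omega>)" "w \<in> L2 (lebesgue_on \<Omega>)"
    "W \<in> L2 (lebesgue_on \<Omega>)"
    using v w by (auto simp: H10_pair_def)
  \<comment> \<open>A constant with |a p + b q|^2 \<le> k (|p|^2 + |q|^2); the summand 1 makes it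
    positive, since it will be divided by.\<close>
  define k where "k = 2 * (a\<^sup>2 + b\<^sup>2) + 1"
  have k: "k > 0" unfolding k_def by (intro add_nonneg_pos mult_nonneg_nonneg add_nonneg_nonneg) auto
  have sq: "(norm (a *\<^sub>R p + b *\<^sub>R q))\<^sup>2 \<le> k * ((norm p)\<^sup>2 + (norm q)\<^sup>2)" for p q :: "'c::euclidean_space"
  proof -
    have "norm (a *\<^sub>R p + b *\<^sub>R q) \<le> \<bar>a\<bar> * norm p + \<bar>b\<bar> * norm q"
      by (rule order_trans[OF norm_triangle_ineq]) simp
    then have "(norm (a *\<^sub>R p + b *\<^sub>R q))\<^sup>2 \<le> (\<bar>a\<bar> * norm p + \<bar>b\<bar> * norm q)\<^sup>2" by (intro power_mono) auto
    also have "\<dots> \<le> 2 * (\<bar>a\<bar> * norm p)\<^sup>2 + 2 * (\<bar>b\<bar> * norm q)\<^sup>2"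
      using sum_squares_bound[of "\<bar>a\<bar> * norm p" "\<bar>b\<bar> * norm q"] by (simp add: power2_sum)
    also have "\<dots> = 2 * a\<^sup>2 * (norm p)\<^sup>2 + 2 * b\<^sup>2 * (norm q)\<^sup>2" by (simp add: power_mult_distrib)
    also have "\<dots> \<le> k * (norm p)\<^sup>2 + k * (norm q)\<^sup>2"
      unfolding k_def by (intro add_mono mult_right_mono) auto
    finally show ?thesis by (simp add: distrib_left)
  qed
  have "\<exists>\<psi>\<in>test_functions \<Omega>. (\<integral>x. (a * v x + b * w x - \<psi> x)\<^sup>2 \<partial>lebesgue_on \<Omega>) + (\<integral>x. (norm (a *\<^sub>R V x
    + b *\<^sub>R W x - grad \<psi> x))\<^sup>2 \<partial>lebesgue_on \<Omega>) < \<delta>"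
    if "\<delta> > 0" for \<delta>
  proof -
    have \<delta>: "\<delta> / (2 * k) > 0" using that k by simp
    obtain \<phi> where \<phi>: "\<phi> \<in> test_functions \<Omega>"
      and lt1: "(\<integral>x. (v x - \<phi> x)\<^sup>2 \<partial>lebesgue_on \<Omega>) + (\<integral>x. (norm (V x - grad \<phi> x))\<^sup>2 \<partial>lebesgue_on \<Omega>)
        < \<delta> / (2 * k)"
      using v \<delta> unfolding H10_pair_def by blast
    obtain \<psi> where \<psi>: "\<psi> \<in> test_functions \<Omega>"
      and lt2: "(\<integral>x. (w x - \<psi> x)\<^sup>2 \<partial>lebesgue_on \<Omega>) + (\<integral>x. (norm (W x - grad \<psi> x))\<^sup>2 \<partial>lebesgue_on \<Omega>)
        < \<delta> / (2 * k)"
      using w \<delta> unfolding H10_pair_def by blast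
    let ?\<zeta> = "\<lambda>x. a * \<phi> x + b * \<psi> x"
    have \<zeta>: "?\<zeta> \<in> test_functions \<Omega>" using \<phi> \<psi> by (intro test_add test_cmult)
    have est: "(\<integral>x. (norm (a *\<^sub>R p x + b *\<^sub>R q x))\<^sup>2 \<partial>lebesgue_on \<Omega>)
      \<le> k * ((\<integral>x. (norm (p x))\<^sup>2 \<partial>lebesgue_on \<Omega>) + (\<integral>x. (norm (q x))\<^sup>2 \<partial>lebesgue_on \<Omega>))"
      if pq: "p \<in> L2 (lebesgue_on \<Omega>)" "q \<in> L2 (lebesgue_on \<Omega>)" for p q :: "'a \<Rightarrow> 'c::euclidean_space"
    proof -
      have "(\<integral>x. (norm (a *\<^sub>R p x + b *\<^sub>R q x))\<^sup>2 \<partial>lebesgue_on \<Omega>) \<le> (\<integral>x. k * ((norm (p x))\<^sup>2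
        + (norm (q x))\<^sup>2) \<partial>lebesgue_on \<Omega>)"
        using L2_integrable[OF L2_add[OF L2_scaleR[OF pq(1)] L2_scaleR[OF pq(2)]]] L2_integrable[OF pq(1)]
          L2_integrable[OF pq(2)] sq
        by (intro integral_mono) auto
      also have "\<dots> = k * ((\<integral>x. (norm (p x))\<^sup>2 \<partial>lebesgue_on \<Omega>) + (\<integral>x. (norm (q x))\<^sup>2 \<partial>lebesgue_on \<Omega>))"
        using L2_integrable[OF pq(1)] L2_integrable[OF pq(2)] by simp
      finally show ?thesis .
    qed
    have "(\<integral>x. (a * v x + b * w x - ?\<zeta> x)\<^sup>2 \<partial>lebesgue_on \<Omega>) = (\<integral>x. (norm (a *\<^sub>R (v x - \<phi> x) + b *\<^sub>R (w x
      - \<psi> x)))\<^sup>2 \<partial>lebesgue_on \<Omega>)"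
      by (intro Bochner_Integration.integral_cong) (auto simp: algebra_simps)
    also have "\<dots> \<le> k * ((\<integral>x. (norm (v x - \<phi> x))\<^sup>2 \<partial>lebesgue_on \<Omega>) + (\<integral>x. (norm (w x
      - \<psi> x))\<^sup>2 \<partial>lebesgue_on \<Omega>))"
      by (intro est L2_diff L test_L2[OF \<Omega> \<phi>] test_L2[OF \<Omega> \<psi>])
    finally have 1: "(\<integral>x. (a * v x + b * w x - ?\<zeta> x)\<^sup>2 \<partial>lebesgue_on \<Omega>) \<le> k * ((\<integral>x. (v x
      - \<phi> x)\<^sup>2 \<partial>lebesgue_on \<Omega>) + (\<integral>x. (w x - \<psi> x)\<^sup>2 \<partial>lebesgue_on \<Omega>))"
      by simp
    have "(\<integral>x. (norm (a *\<^sub>R V x + b *\<^sub>R W x - grad ?\<zeta> x))\<^sup>2 \<partial>lebesgue_on \<Omega>) = (\<integral>x. (norm (a *\<^sub>R (V x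
      - grad \<phi> x) + b *\<^sub>R (W x - grad \<psi> x)))\<^sup>2 \<partial>lebesgue_on \<Omega>)"
      by (intro Bochner_Integration.integral_cong) (auto simp: algebra_simps grad_lincomb[OF \<phi> \<psi>])
    also have "\<dots> \<le> k * ((\<integral>x. (norm (V x - grad \<phi> x))\<^sup>2 \<partial>lebesgue_on \<Omega>) + (\<integral>x. (norm (W x
      - grad \<psi> x))\<^sup>2 \<partial>lebesgue_on \<Omega>))"
      by (intro est L2_diff L test_L2[OF \<Omega> \<phi>] test_L2[OF \<Omega> \<psi>])
    finally have 2: "(\<integral>x. (norm (a *\<^sub>R V x + b *\<^sub>R W x - grad ?\<zeta> x))\<^sup>2 \<partial>lebesgue_on \<Omega>)
      \<le> k * ((\<integral>x. (norm (V x - grad \<phi> x))\<^sup>2 \<partial>lebesgue_on \<Omega>) + (\<integral>x. (norm (W x - grad \<psi> x))\<^sup>2 \<partial>lebesgue_on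
      \<Omega>))" .
    have "k * (A1 + A2 + (A3 + A4)) < \<delta>" if "A1 + A3 < \<delta> / (2 * k)" "A2 + A4 < \<delta> / (2 * k)" for A1 A2 A3 A4
      :: real
    proof -
      have "A1 + A2 + (A3 + A4) < \<delta> / k" using that by (simp add: field_simps)
      then show ?thesis using k by (simp add: pos_less_divide_eq mult.commute)
    qed
    from this[OF lt1 lt2] 1 2 show ?thesis using \<zeta> by (intro bexI[of _ ?\<zeta>]) (auto simp: distrib_left)
  qed
  then show ?thesis
    using L L2_add[OF L2_cmult[OF L(1)] L2_cmult[OF L(3)]] L2_add[OF L2_scaleR[OF L(2)] L2_scaleR[OF L(4)]]
    by (simp add: H10_pair_def)
qed

section \<open>Weak solutions and the tracking functional\<close>

text \<open>Integrating the derivative of x_b \<psi>^2 in a coordinate direction b gives 0 =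
  \<integral> \<psi>^2 + 2 x_b \<psi> \<partial>_b \<psi>. As |x_b| \<le> R, the mixed term is at
  most half of \<psi>^2 plus 2 R^2 |grad \<psi>|^2, whence the constant 4 R^2.\<close>

lemma Poincare_test:
  fixes \<Omega> :: "'a::euclidean_space set"
  assumes \<Omega>: "open \<Omega>" "bounded \<Omega>"
  shows "\<exists>C>0. \<forall>\<psi>\<in>test_functions \<Omega>. (\<integral>x. (\<psi> x)\<^sup>2 \<partial>lebesgue_on \<Omega>)
    \<le> C * (\<integral>x. (norm (grad \<psi> x))\<^sup>2 \<partial>lebesgue_on \<Omega>)"
proof -
  obtain b :: 'a where b: "b \<in> Basis" using nonempty_Basis by blast
  obtain R where R: "R > 0" "\<And>x. x \<in> \<Omega> \<Longrightarrow> norm x \<le> R" using \<Omega>(2) by (auto simp: bounded_pos)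
  have "(\<integral>x. (\<psi> x)\<^sup>2 \<partial>lebesgue_on \<Omega>) \<le> 4 * R\<^sup>2 * (\<integral>x. (norm (grad \<psi> x))\<^sup>2 \<partial>lebesgue_on \<Omega>)"
    if \<psi>: "\<psi> \<in> test_functions \<Omega>" for \<psi>
  proof -
    let ?d = "partial_deriv b \<psi>"
    have p1: "(\<lambda>x. \<psi> x * \<psi> x) \<in> test_functions \<Omega>" by (rule test_mult[OF \<psi>]) (rule test_Ck[OF \<psi>])
    have p2: "(\<lambda>x. x \<bullet> b * (\<psi> x * \<psi> x)) \<in> test_functions \<Omega>" by (rule test_mult[OF p1]) (rule Ck_inner)
    have pd: "partial_deriv b (\<lambda>x. x \<bullet> b * (\<psi> x * \<psi> x)) x = (\<psi> x)\<^sup>2 + 2 * ((x \<bullet> b) * \<psi> x * ?d x)" for x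
    proof -
      have "((\<lambda>x. x \<bullet> b * (\<psi> x * \<psi> x)) has_derivative
         (\<lambda>h. (x \<bullet> b) * (\<psi> x * partial_deriv h \<psi> x + partial_deriv h \<psi> x * \<psi> x) + (h \<bullet> b) * (\<psi> x * \<psi> x)))
           (at x)"
        by (intro has_derivative_mult test_has_derivative[OF \<psi>] has_derivative_inner_left
          has_derivative_ident)
      from partial_deriv_eq[OF this, of b] show ?thesis using b
        by (simp add: power2_eq_square algebra_simps)
    qed
    have m[measurable]: "\<psi> \<in> borel_measurable (lebesgue_on \<Omega>)" "?d \<in> borel_measurable (lebesgue_on \<Omega>)"
      using L2_measurable[OF test_L2(1)[OF \<Omega> \<psi>]] L2_measurable[OF test_L2(1)[OF \<Omega> test_partial_deriv[OF
        \<psi>]]] by auto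
    have i1: "integrable (lebesgue_on \<Omega>) (\<lambda>x. (\<psi> x)\<^sup>2)" using L2_integrable[OF test_L2(1)[OF \<Omega> \<psi>]] by simp
    have i3: "integrable (lebesgue_on \<Omega>) (\<lambda>x. (norm (grad \<psi> x))\<^sup>2)"
      using L2_integrable[OF test_L2(2)[OF \<Omega> \<psi>]] by simp
    have i2: "integrable (lebesgue_on \<Omega>) (\<lambda>x. (\<psi> x)\<^sup>2 + 2 * ((x \<bullet> b) * \<psi> x * ?d x))"
      using L2_imp_integrable[OF finite_measure_domain[OF \<Omega>] test_L2(1)[OF \<Omega> test_partial_deriv[OF p2, of
        b]]]
      by (simp add: pd[abs_def] cong: Bochner_Integration.integrable_cong)
    have "0 = (\<integral>x. (\<psi> x)\<^sup>2 + 2 * ((x \<bullet> b) * \<psi> x * ?d x) \<partial>lebesgue_on \<Omega>)"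
      using integral_partial_deriv_zero[OF \<Omega>(1) p2, of b] by (simp add: pd)
    also have "\<dots> \<ge> (\<integral>x. (1/2) * (\<psi> x)\<^sup>2 - 2 * R\<^sup>2 * (norm (grad \<psi> x))\<^sup>2 \<partial>lebesgue_on \<Omega>)"
    proof (rule integral_mono[OF _ i2])
      show "integrable (lebesgue_on \<Omega>) (\<lambda>x. (1/2) * (\<psi> x)\<^sup>2 - 2 * R\<^sup>2 * (norm (grad \<psi> x))\<^sup>2)"
        by (intro Bochner_Integration.integrable_diff integrable_mult_right i1 i3)
      fix x assume "x \<in> space (lebesgue_on \<Omega>)"
      then have x: "norm x \<le> R" using R by (auto simp: space_restrict_space)
      have "\<bar>?d x\<bar> \<le> norm (grad \<psi> x)"
        using Basis_le_norm[OF b, of "grad \<psi> x"] by (simp add: grad_inner[OF \<psi>])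
      moreover have "\<bar>x \<bullet> b\<bar> \<le> R" using Basis_le_norm[OF b, of x] x by simp
      ultimately have "\<bar>(x \<bullet> b) * ?d x\<bar> \<le> R * norm (grad \<psi> x)"
        unfolding abs_mult by (intro mult_mono) (use R in auto)
      then have "\<bar>\<psi> x\<bar> * \<bar>(x \<bullet> b) * ?d x\<bar> \<le> \<bar>\<psi> x\<bar> * (R * norm (grad \<psi> x))" by (intro mult_left_mono) auto
      moreover have "4 * (\<bar>\<psi> x\<bar> * (R * norm (grad \<psi> x))) \<le> (\<psi> x)\<^sup>2 + 4 * (R\<^sup>2 * (norm (grad \<psi> x))\<^sup>2)"
        using sum_squares_bound[of "\<bar>\<psi> x\<bar>" "2 * (R * norm (grad \<psi> x))"] by (simp add: power_mult_distrib)
      moreover have "- (\<bar>\<psi> x\<bar> * \<bar>(x \<bullet> b) * ?d x\<bar>) \<le> (x \<bullet> b) * \<psi> x * ?d x"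
      proof -
        have "\<bar>\<psi> x\<bar> * \<bar>(x \<bullet> b) * ?d x\<bar> = \<bar>(x \<bullet> b) * \<psi> x * ?d x\<bar>"
          by (simp add: abs_mult mult.commute mult.left_commute)
        then show ?thesis using abs_ge_minus_self[of "(x \<bullet> b) * \<psi> x * ?d x"] by linarith
      qed
      ultimately show "(1/2) * (\<psi> x)\<^sup>2 - 2 * R\<^sup>2 * (norm (grad \<psi> x))\<^sup>2 \<le> (\<psi> x)\<^sup>2
        + 2 * ((x \<bullet> b) * \<psi> x * ?d x)" by linarith
    qed
    also have "(\<integral>x. (1/2) * (\<psi> x)\<^sup>2 - 2 * R\<^sup>2 * (norm (grad \<psi> x))\<^sup>2 \<partial>lebesgue_on \<Omega>) =
       (1/2) * (\<integral>x. (\<psi> x)\<^sup>2 \<partial>lebesgue_on \<Omega>) - 2 * R\<^sup>2 * (\<integral>x. (norm (grad \<psi> x))\<^sup>2 \<partial>lebesgue_on \<Omega>)"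
      using i1 i3 by simp
    finally show ?thesis by simp
  qed
  then show ?thesis using R by (intro exI[of _ "4 * R\<^sup>2"]) auto
qed

lemma L2_norm_tendsto:
  assumes f: "\<And>n. f n \<in> L2 M" and g: "g \<in> L2 M" and lim: "(\<lambda>n. \<integral>x. (norm (f n x - g x))\<^sup>2 \<partial>M) \<longlonglongrightarrow> 0"
  shows "(\<lambda>n. \<integral>x. (norm (f n x))\<^sup>2 \<partial>M) \<longlonglongrightarrow> (\<integral>x. (norm (g x))\<^sup>2 \<partial>M)"
proof -
  have d: "(\<lambda>x. f n x - g x) \<in> L2 M" for n by (rule L2_diff[OF f g])
  have "(\<integral>x. (norm (f n x))\<^sup>2 \<partial>M) = (\<integral>x. (norm (f n x - g x))\<^sup>2 \<partial>M) + 2 * (\<integral>x. (f n x - g x) \<bullet> g x \<partial>M)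
    + (\<integral>x. (norm (g x))\<^sup>2 \<partial>M)" for n
  proof -
    have "(\<integral>x. (norm (f n x))\<^sup>2 \<partial>M) = (\<integral>x. (norm (f n x - g x))\<^sup>2 + 2 * ((f n x - g x) \<bullet> g x)
      + (norm (g x))\<^sup>2 \<partial>M)"
      by (intro Bochner_Integration.integral_cong) (auto simp: power2_norm_eq_inner inner_diff_left
        inner_diff_right inner_commute)
    then show ?thesis using L2_integrable[OF d] L2_integrable[OF g] L2_inner_integrable[OF d g] by simp
  qed
  moreover have "(\<lambda>n. (\<integral>x. (norm (f n x - g x))\<^sup>2 \<partial>M) + 2 * (\<integral>x. (f n x - g x) \<bullet> g x \<partial>M)
    + (\<integral>x. (norm (g x))\<^sup>2 \<partial>M))
      \<longlonglongrightarrow> 0 + 2 * 0 + (\<integral>x. (norm (g x))\<^sup>2 \<partial>M)"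
    by (intro tendsto_intros lim L2_inner_tendsto_0[OF d g lim])
  ultimately show ?thesis by simp
qed

lemma Poincare_H10_pair:
  fixes \<Omega> :: "'a::euclidean_space set"
  assumes \<Omega>: "open \<Omega>" "bounded \<Omega>"
  shows "\<exists>C>0. \<forall>v V. H10_pair \<Omega> v V \<longrightarrow> (\<integral>x. (v x)\<^sup>2 \<partial>lebesgue_on \<Omega>)
    \<le> C * (\<integral>x. (norm (V x))\<^sup>2 \<partial>lebesgue_on \<Omega>)"
proof -
  obtain C where C: "C > 0" "\<And>\<psi>. \<psi> \<in> test_functions \<Omega> \<Longrightarrow> (\<integral>x. (\<psi> x)\<^sup>2 \<partial>lebesgue_on \<Omega>)
    \<le> C * (\<integral>x. (norm (grad \<psi> x))\<^sup>2 \<partial>lebesgue_on \<Omega>)"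
    using Poincare_test[OF \<Omega>] by blast
  have "(\<integral>x. (v x)\<^sup>2 \<partial>lebesgue_on \<Omega>) \<le> C * (\<integral>x. (norm (V x))\<^sup>2 \<partial>lebesgue_on \<Omega>)"
    if p: "H10_pair \<Omega> v V" for v V
  proof -
    have L: "v \<in> L2 (lebesgue_on \<Omega>)" "V \<in> L2 (lebesgue_on \<Omega>)" using p by (auto simp: H10_pair_def)
    obtain \<psi> where \<psi>: "\<And>n. \<psi> n \<in> test_functions \<Omega>"
      and l1: "(\<lambda>n. \<integral>x. (norm (\<psi> n x - v x))\<^sup>2 \<partial>lebesgue_on \<Omega>) \<longlonglongrightarrow> 0"
      and l2: "(\<lambda>n. \<integral>x. (norm (grad (\<psi> n) x - V x))\<^sup>2 \<partial>lebesgue_on \<Omega>) \<longlonglongrightarrow> 0"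
      using H10_pair_sequence[OF p] by blast
    have 1: "(\<lambda>n. \<integral>x. (norm (\<psi> n x))\<^sup>2 \<partial>lebesgue_on \<Omega>) \<longlonglongrightarrow> (\<integral>x. (norm (v x))\<^sup>2 \<partial>lebesgue_on \<Omega>)"
      by (rule L2_norm_tendsto[OF test_L2(1)[OF \<Omega> \<psi>] L(1) l1])
    have 2: "(\<lambda>n. C * (\<integral>x. (norm (grad (\<psi> n) x))\<^sup>2 \<partial>lebesgue_on \<Omega>)) \<longlonglongrightarrow> C * (\<integral>x. (norm (V x))\<^sup>2
      \<partial>lebesgue_on \<Omega>)"
      by (intro tendsto_mult tendsto_const L2_norm_tendsto[OF test_L2(2)[OF \<Omega> \<psi>] L(2) l2])
    have "(\<integral>x. (norm (v x))\<^sup>2 \<partial>lebesgue_on \<Omega>) \<le> C * (\<integral>x. (norm (V x))\<^sup>2 \<partial>lebesgue_on \<Omega>)"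
      by (rule LIMSEQ_le[OF 1 2]) (use C(2)[OF \<psi>] in auto)
    then show ?thesis by simp
  qed
  then show ?thesis using C(1) by blast
qed

section \<open>Existence of weak solutions\<close>

lemma weak_form_extend:
  fixes \<Omega> :: "'a::euclidean_space set"
  assumes \<Omega>: "open \<Omega>" "bounded \<Omega>" and wm: "w \<in> borel_measurable (lebesgue_on \<Omega>)"
    and wb: "AE x in lebesgue_on \<Omega>. \<bar>w x\<bar> \<le> K"
    and Y: "Y \<in> L2 (lebesgue_on \<Omega>)" and r: "r \<in> L2 (lebesgue_on \<Omega>)"
    and eq: "\<And>\<psi>. \<psi> \<in> test_functions \<Omega> \<Longrightarrow> (\<integral>x. w x * (Y x \<bullet> grad \<psi> x) \<partial>lebesgue_on \<Omega>)
      = (\<integral>x. r x * \<psi> x \<partial>lebesgue_on \<Omega>)"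
    and p: "H10_pair \<Omega> v V"
  shows "(\<integral>x. w x * (Y x \<bullet> V x) \<partial>lebesgue_on \<Omega>) = (\<integral>x. r x * v x \<partial>lebesgue_on \<Omega>)"
proof -
  have L: "v \<in> L2 (lebesgue_on \<Omega>)" "V \<in> L2 (lebesgue_on \<Omega>)" using p by (auto simp: H10_pair_def)
  have wY: "(\<lambda>x. w x *\<^sub>R Y x) \<in> L2 (lebesgue_on \<Omega>)" by (rule L2_bounded_mult[OF Y wm wb])
  obtain \<psi> where \<psi>: "\<And>n. \<psi> n \<in> test_functions \<Omega>"
    and l1: "(\<lambda>n. \<integral>x. (norm (\<psi> n x - v x))\<^sup>2 \<partial>lebesgue_on \<Omega>) \<longlonglongrightarrow> 0"
    and l2: "(\<lambda>n. \<integral>x. (norm (grad (\<psi> n) x - V x))\<^sup>2 \<partial>lebesgue_on \<Omega>) \<longlonglongrightarrow> 0"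
    using H10_pair_sequence[OF p] by blast
  have 1: "(\<lambda>n. \<integral>x. (\<psi> n x - v x) \<bullet> r x \<partial>lebesgue_on \<Omega>) \<longlonglongrightarrow> 0"
    by (rule L2_inner_tendsto_0[OF L2_diff[OF test_L2(1)[OF \<Omega> \<psi>] L(1)] r l1])
  have 2: "(\<lambda>n. \<integral>x. (grad (\<psi> n) x - V x) \<bullet> (w x *\<^sub>R Y x) \<partial>lebesgue_on \<Omega>) \<longlonglongrightarrow> 0"
    by (rule L2_inner_tendsto_0[OF L2_diff[OF test_L2(2)[OF \<Omega> \<psi>] L(2)] wY l2])
  have e1: "(\<integral>x. (\<psi> n x - v x) \<bullet> r x \<partial>lebesgue_on \<Omega>) = (\<integral>x. r x * \<psi> n x \<partial>lebesgue_on \<Omega>)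
    - (\<integral>x. r x * v x \<partial>lebesgue_on \<Omega>)" for n
    using L2_inner_integrable[OF r test_L2(1)[OF \<Omega> \<psi>]] L2_inner_integrable[OF r L(1)]
    by (simp add: right_diff_distrib mult.commute)
  have e2: "(\<integral>x. (grad (\<psi> n) x - V x) \<bullet> (w x *\<^sub>R Y x) \<partial>lebesgue_on \<Omega>) =
      (\<integral>x. w x * (Y x \<bullet> grad (\<psi> n) x) \<partial>lebesgue_on \<Omega>) - (\<integral>x. w x * (Y x \<bullet> V x) \<partial>lebesgue_on \<Omega>)" for n
  proof -
    have "(\<integral>x. (grad (\<psi> n) x - V x) \<bullet> (w x *\<^sub>R Y x) \<partial>lebesgue_on \<Omega>) =
       (\<integral>x. (w x *\<^sub>R Y x) \<bullet> grad (\<psi> n) x - (w x *\<^sub>R Y x) \<bullet> V x \<partial>lebesgue_on \<Omega>)"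
    proof -
      have p: "(G - V') \<bullet> Z = Z \<bullet> G - Z \<bullet> V'" for G V' Z :: 'a
        by (simp add: inner_commute[of _ Z] inner_diff_right)
      show ?thesis by (simp only: p)
    qed
    also have "\<dots> = (\<integral>x. (w x *\<^sub>R Y x) \<bullet> grad (\<psi> n) x \<partial>lebesgue_on \<Omega>)
      - (\<integral>x. (w x *\<^sub>R Y x) \<bullet> V x \<partial>lebesgue_on \<Omega>)"
      by (rule Bochner_Integration.integral_diff[OF L2_inner_integrable[OF wY test_L2(2)[OF \<Omega> \<psi>]]
        L2_inner_integrable[OF wY L(2)]])
    finally show ?thesis by simp
  qed
  have "(\<lambda>n. (\<integral>x. r x * v x \<partial>lebesgue_on \<Omega>) - (\<integral>x. w x * (Y x \<bullet> V x) \<partial>lebesgue_on \<Omega>)) \<longlonglongrightarrow> 0 - 0"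
    using tendsto_diff[OF 2 1] unfolding e1 e2 eq[OF \<psi>] by simp
  then have "(\<integral>x. r x * v x \<partial>lebesgue_on \<Omega>) - (\<integral>x. w x * (Y x \<bullet> V x) \<partial>lebesgue_on \<Omega>) = 0"
    by (simp add: LIMSEQ_const_iff)
  then show ?thesis by simp
qed

lemma quadratic_nonneg_imp_0:
  fixes A B :: real
  assumes "\<And>t. 0 \<le> t * A + t\<^sup>2 / 2 * B" "0 \<le> B" shows "A = 0"
proof (rule ccontr)
  assume "A \<noteq> 0"
  \<comment> \<open>Up to the shift of B by 1, which covers B = 0, this is the minimizer of the
    quadratic; a nonzero A makes the value there negative.\<close>
  define t where "t = - A / (B + 1)"
  have B: "B + 1 > 0" using assms(2) by simp
  define X where "X = A\<^sup>2 / (B + 1)"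
  have 1: "t * A = - X" by (simp add: t_def X_def power2_eq_square)
  have 2: "t\<^sup>2 / 2 * B \<le> t\<^sup>2 / 2 * (B + 1)" by (intro mult_left_mono) auto
  have 3: "t\<^sup>2 / 2 * (B + 1) = X / 2"
    using B by (simp add: t_def X_def power_divide power2_eq_square)
  have "X > 0" using B \<open>A \<noteq> 0\<close> by (simp add: X_def)
  then have "t * A + t\<^sup>2 / 2 * B < 0" using 1 2 unfolding 3 by linarith
  then show False using assms(1)[of t] by simp
qed

text \<open>Minimizing the energy \<open>\<integral> w |\<nabla>\<phi>|\<^sup>2 / 2 - r \<phi>\<close> over test functions: by the parallelogram
  identity a fast minimizing sequence is Cauchy, and its limit solves the equation.\<close>

lemma weak_solution_exists:
  fixes \<Omega> :: "'a::euclidean_space set"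
  assumes \<Omega>: "open \<Omega>" "bounded \<Omega>" and wm: "w \<in> borel_measurable (lebesgue_on \<Omega>)"
    and c: "c > 0" and wb: "AE x in lebesgue_on \<Omega>. c \<le> w x \<and> w x \<le> K" and r: "r \<in> L2 (lebesgue_on \<Omega>)"
  shows "\<exists>y. weak_solution \<Omega> w r y"
proof -
  let ?D = "lebesgue_on \<Omega>" and ?T = "test_functions \<Omega>"
  have fin: "finite_measure ?D" by (rule finite_measure_domain[OF \<Omega>])
  have wabs: "AE x in ?D. \<bar>w x\<bar> \<le> K" using wb by eventually_elim (use c in auto)
  obtain C where C: "C > 0" "\<And>\<psi>. \<psi> \<in> ?T \<Longrightarrow> (\<integral>x. (\<psi> x)\<^sup>2 \<partial>?D) \<le> C * (\<integral>x. (norm (grad \<psi> x))\<^sup>2 \<partial>?D)"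
    using Poincare_test[OF \<Omega>] by blast
  define b where "b \<phi> \<psi> = (\<integral>x. w x * (grad \<phi> x \<bullet> grad \<psi> x) \<partial>?D)" for \<phi> \<psi>
  define l where "l \<phi> = (\<integral>x. r x * \<phi> x \<partial>?D)" for \<phi>
  define E where "E \<phi> = b \<phi> \<phi> / 2 - l \<phi>" for \<phi>
  have wL: "(\<lambda>x. w x *\<^sub>R grad \<phi> x) \<in> L2 ?D" if "\<phi> \<in> ?T" for \<phi>
    by (rule L2_bounded_mult[OF test_L2(2)[OF \<Omega> that] wm wabs])
  have ib: "integrable ?D (\<lambda>x. w x * (grad \<phi> x \<bullet> grad \<psi> x))" if "\<phi> \<in> ?T" "\<psi> \<in> ?T" for \<phi> \<psi>
    using L2_inner_integrable[OF wL[OF that(1)] test_L2(2)[OF \<Omega> that(2)]] by simp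
  have il: "integrable ?D (\<lambda>x. r x * \<phi> x)" if "\<phi> \<in> ?T" for \<phi>
    using L2_inner_integrable[OF r test_L2(1)[OF \<Omega> that]] by simp
  have b_expand: "b (\<lambda>x. s * \<phi> x + t * \<psi> x) (\<lambda>x. s * \<phi> x + t * \<psi> x) = s\<^sup>2 * b \<phi> \<phi> + 2 * s * t * b \<phi> \<psi>
    + t\<^sup>2 * b \<psi> \<psi>"
    if "\<phi> \<in> ?T" "\<psi> \<in> ?T" for \<phi> \<psi> s t
  proof -
    have "b (\<lambda>x. s * \<phi> x + t * \<psi> x) (\<lambda>x. s * \<phi> x + t * \<psi> x) =
      (\<integral>x. s\<^sup>2 * (w x * (grad \<phi> x \<bullet> grad \<phi> x)) + 2 * s * t * (w x * (grad \<phi> x \<bullet> grad \<psi> x)) + t\<^sup>2 * (w x *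
        (grad \<psi> x \<bullet> grad \<psi> x)) \<partial>?D)"
      unfolding b_def grad_lincomb[OF that]
      by (intro Bochner_Integration.integral_cong) (auto simp: inner_add_left inner_add_right inner_commute
        power2_eq_square algebra_simps)
    then show ?thesis using ib[OF that(1,1)] ib[OF that] ib[OF that(2,2)] by (simp add: b_def)
  qed
  have l_expand: "l (\<lambda>x. s * \<phi> x + t * \<psi> x) = s * l \<phi> + t * l \<psi>" if "\<phi> \<in> ?T" "\<psi> \<in> ?T" for \<phi> \<psi> s t
  proof -
    have "l (\<lambda>x. s * \<phi> x + t * \<psi> x) = (\<integral>x. s * (r x * \<phi> x) + t * (r x * \<psi> x) \<partial>?D)"
      unfolding l_def by (intro Bochner_Integration.integral_cong) (auto simp: algebra_simps)
    then show ?thesis using il[OF that(1)] il[OF that(2)] by (simp add: l_def)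
  qed
  have comb: "(\<lambda>x. s * \<phi> x + t * \<psi> x) \<in> ?T" if "\<phi> \<in> ?T" "\<psi> \<in> ?T" for \<phi> \<psi> s t
    using that by (intro test_add test_cmult)
  have coercive: "c * (\<integral>x. (norm (grad \<phi> x))\<^sup>2 \<partial>?D) \<le> b \<phi> \<phi>" if "\<phi> \<in> ?T" for \<phi>
  proof -
    have "(\<integral>x. c * (norm (grad \<phi> x))\<^sup>2 \<partial>?D) \<le> b \<phi> \<phi>"
      unfolding b_def
    proof (rule integral_mono_AE[OF _ ib[OF that that]])
      show "integrable ?D (\<lambda>x. c * (norm (grad \<phi> x))\<^sup>2)" using L2_integrable[OF test_L2(2)[OF \<Omega> that]]
        by simp
      show "AE x in ?D. c * (norm (grad \<phi> x))\<^sup>2 \<le> w x * (grad \<phi> x \<bullet> grad \<phi> x)"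
        using wb by eventually_elim (auto simp: power2_norm_eq_inner intro!: mult_right_mono)
    qed
    then show ?thesis by simp
  qed
  have bnn: "0 \<le> b \<phi> \<phi>" if "\<phi> \<in> ?T" for \<phi>
  proof -
    have "0 \<le> c * (\<integral>x. (norm (grad \<phi> x))\<^sup>2 \<partial>?D)"
      by (intro mult_nonneg_nonneg integral_nonneg_AE) (use c in auto)
    also have "\<dots> \<le> b \<phi> \<phi>" by (rule coercive[OF that])
    finally show ?thesis .
  qed
  \<comment> \<open>Young's inequality with parameter 2 C / c leaves the factor c / (4 C) in front
    of \<integral> \<phi>^2, which the Poincare and coercivity estimates turn into a quarter of b
    \<phi> \<phi>. This is absorbed by the half in the energy; the rest is Q.\<close>
  define Q where "Q = C / c * (\<integral>x. (r x)\<^sup>2 \<partial>?D)"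
  have E_lower: "- Q \<le> E \<phi>" if "\<phi> \<in> ?T" for \<phi>
  proof -
    have "\<bar>\<integral>x. r x \<bullet> \<phi> x \<partial>?D\<bar> \<le> (2 * C / c) / 2 * (\<integral>x. (norm (r x))\<^sup>2 \<partial>?D)
      + 1 / (2 * (2 * C / c)) * (\<integral>x. (norm (\<phi> x))\<^sup>2 \<partial>?D)"
      by (rule L2_Young[OF r test_L2(1)[OF \<Omega> that]]) (use C c in auto)
    then have "l \<phi> \<le> Q + c / (4 * C) * (\<integral>x. (\<phi> x)\<^sup>2 \<partial>?D)" by (simp add: l_def Q_def)
    also have "c / (4 * C) * (\<integral>x. (\<phi> x)\<^sup>2 \<partial>?D) \<le> c / (4 * C) * (C * (\<integral>x. (norm (grad \<phi> x))\<^sup>2 \<partial>?D))"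
      using C(2)[OF that] C(1) c by (intro mult_left_mono) auto
    also have "\<dots> = (c * (\<integral>x. (norm (grad \<phi> x))\<^sup>2 \<partial>?D)) / 4" using C(1) by simp
    also have "\<dots> \<le> b \<phi> \<phi> / 4" using coercive[OF that] by simp
    finally show ?thesis using bnn[OF that] by (simp add: E_def)
  qed
  define m where "m = Inf (E ` ?T)"
  have bdd: "bdd_below (E ` ?T)" using E_lower by (auto simp: bdd_below_def)
  have m_le: "m \<le> E \<phi>" if "\<phi> \<in> ?T" for \<phi> unfolding m_def using bdd that by (intro cInf_lower) auto
  \<comment> \<open>The gap 4^(-n) to the infimum is what produces the Cauchy rate that
    \<open>L2_complete_fast\<close> expects.\<close>
  have "\<forall>n. \<exists>\<phi>. \<phi> \<in> ?T \<and> E \<phi> < m + (1/4)^n"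
  proof
    fix n :: nat
    have "Inf (E ` ?T) < m + (1/4)^n" by (simp add: m_def)
    then obtain e where "e \<in> E ` ?T" "e < m + (1/4)^n"
      using cInf_lessD[of "E ` ?T"] test_zero by blast
    then show "\<exists>\<phi>. \<phi> \<in> ?T \<and> E \<phi> < m + (1/4)^n" by blast
  qed
  from choice[OF this] obtain \<phi> where \<phi>: "\<And>n. \<phi> n \<in> ?T" and E\<phi>: "\<And>n. E (\<phi> n) < m + (1/4)^n" by blast
  have cauchy: "c * (\<integral>x. (norm (grad (\<lambda>x. 1 * \<phi> k x + (-1) * \<phi> n x) x))\<^sup>2 \<partial>?D) \<le> 8 * (1/4)^n"
    if "n \<le> k" for n k
  proof -
    let ?d = "\<lambda>x. 1 * \<phi> k x + (-1) * \<phi> n x" and ?h = "\<lambda>x. (1/2) * \<phi> k x + (1/2) * \<phi> n x"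
    \<comment> \<open>The midpoint is itself a test function, so its energy is at least m, and the
      energies of the two outer points exceed m by at most 4^(-k) and 4^(-n).\<close>
    have "b ?d ?d = 4 * (E (\<phi> k) + E (\<phi> n) - 2 * E ?h)"
      unfolding E_def b_expand[OF \<phi> \<phi>] l_expand[OF \<phi> \<phi>] by (simp add: power2_eq_square field_simps)
    also have "\<dots> \<le> 4 * ((1/4)^k + (1/4)^n)"
      using E\<phi>[of k] E\<phi>[of n] m_le[OF comb[OF \<phi> \<phi>], of "1/2" k "1/2" n] by simp
    also have "\<dots> \<le> 8 * (1/4)^n" using power_decreasing[OF that, of "1/4::real"] by simp
    finally show ?thesis using coercive[OF comb[OF \<phi> \<phi>], of 1 k "-1" n] by simp
  qed
  \<comment> \<open>Function and gradient are bundled into one sequence with values in a product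
    space, so that one appeal to completeness provides both limits.\<close>
  define F where "F n x = (\<phi> n x, grad (\<phi> n) x)" for n x
  have sq: "(norm (p :: real \<times> 'a))\<^sup>2 = (fst p)\<^sup>2 + (norm (snd p))\<^sup>2" for p
    by (cases p) (simp add: norm_Pair)
  have FL: "F n \<in> L2 ?D" for n
  proof -
    have [measurable]: "\<phi> n \<in> borel_measurable ?D" "grad (\<phi> n) \<in> borel_measurable ?D"
      using L2_measurable[OF test_L2(1)[OF \<Omega> \<phi>]] L2_measurable[OF test_L2(2)[OF \<Omega> \<phi>]] by auto
    have "F n \<in> borel_measurable ?D" unfolding F_def by measurable
    then show ?thesis
      using L2_integrable[OF test_L2(1)[OF \<Omega> \<phi>, of n]] L2_integrable[OF test_L2(2)[OF \<Omega> \<phi>, of n]]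
      by (simp add: L2_def sq) (simp add: F_def)
  qed
  define M where "M = 8 * (C + 1) / c"
  have Fc: "(\<integral>x. (norm (F k x - F n x))\<^sup>2 \<partial>?D) \<le> M * (1/4)^n" if "n \<le> k" for n k
  proof -
    let ?d = "\<lambda>x. 1 * \<phi> k x + (-1) * \<phi> n x"
    have d: "?d \<in> ?T" by (rule comb[OF \<phi> \<phi>])
    have "(\<integral>x. (norm (F k x - F n x))\<^sup>2 \<partial>?D) = (\<integral>x. (?d x)\<^sup>2 + (norm (grad ?d x))\<^sup>2 \<partial>?D)"
      unfolding sq grad_lincomb[OF \<phi> \<phi>] by (simp add: F_def)
    also have "\<dots> = (\<integral>x. (?d x)\<^sup>2 \<partial>?D) + (\<integral>x. (norm (grad ?d x))\<^sup>2 \<partial>?D)"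
      using L2_integrable[OF test_L2(1)[OF \<Omega> d]] L2_integrable[OF test_L2(2)[OF \<Omega> d]]
      by (intro Bochner_Integration.integral_add) auto
    also have "\<dots> \<le> (C + 1) * (\<integral>x. (norm (grad ?d x))\<^sup>2 \<partial>?D)" using C(2)[OF d] by (simp add: distrib_right)
    also have "\<dots> \<le> (C + 1) * (8 * (1/4)^n / c)"
      using cauchy[OF that] c C(1) by (intro mult_left_mono) (auto simp: pos_le_divide_eq mult.commute)
    finally show ?thesis by (simp add: M_def algebra_simps)
  qed
  obtain g where g: "g \<in> L2 ?D" "\<And>n. (\<integral>x. (norm (g x - F n x))\<^sup>2 \<partial>?D) \<le> M * (1/4)^n"
    using L2_complete_fast[OF fin FL Fc] by blast
  define y where "y x = fst (g x)" for x
  define Y where "Y x = snd (g x)" for x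
  have [measurable]: "g \<in> borel_measurable ?D" using g(1) by (rule L2_measurable)
  have ym[measurable]: "y \<in> borel_measurable ?D" unfolding y_def
    by (rule measurable_compose[OF L2_measurable[OF g(1)]]) (intro borel_measurable_continuous_onI
      continuous_intros)
  have Ym[measurable]: "Y \<in> borel_measurable ?D" unfolding Y_def
    by (rule measurable_compose[OF L2_measurable[OF g(1)]]) (intro borel_measurable_continuous_onI
      continuous_intros)
  have yL: "y \<in> L2 ?D"
  proof -
    have "integrable ?D (\<lambda>x. (norm (y x))\<^sup>2)"
    proof (rule Bochner_Integration.integrable_bound[OF L2_integrable[OF g(1)]])
      show "(\<lambda>x. (norm (y x))\<^sup>2) \<in> borel_measurable ?D" using ym by measurable
    qed (auto simp: sq y_def)
    then show ?thesis using ym by (simp add: L2_def)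
  qed
  have YL: "Y \<in> L2 ?D"
  proof -
    have "integrable ?D (\<lambda>x. (norm (Y x))\<^sup>2)"
    proof (rule Bochner_Integration.integrable_bound[OF L2_integrable[OF g(1)]])
      show "(\<lambda>x. (norm (Y x))\<^sup>2) \<in> borel_measurable ?D" using Ym by measurable
    qed (auto simp: sq Y_def)
    then show ?thesis using Ym by (simp add: L2_def)
  qed
  have split: "(\<integral>x. (y x - \<phi> n x)\<^sup>2 \<partial>?D) + (\<integral>x. (norm (Y x - grad (\<phi> n) x))\<^sup>2 \<partial>?D) \<le> M * (1/4)^n" for n
  proof -
    have "(\<integral>x. (norm (g x - F n x))\<^sup>2 \<partial>?D) = (\<integral>x. (y x - \<phi> n x)\<^sup>2 + (norm (Y x - grad (\<phi> n) x))\<^sup>2 \<partial>?D)"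
      unfolding sq by (simp add: F_def y_def Y_def)
    also have "\<dots> = (\<integral>x. (y x - \<phi> n x)\<^sup>2 \<partial>?D) + (\<integral>x. (norm (Y x - grad (\<phi> n) x))\<^sup>2 \<partial>?D)"
      using L2_integrable[OF L2_diff[OF yL test_L2(1)[OF \<Omega> \<phi>]], of n] L2_integrable[OF L2_diff[OF YL
        test_L2(2)[OF \<Omega> \<phi>]], of n]
      by (intro Bochner_Integration.integral_add) auto
    finally show ?thesis using g(2)[of n] by simp
  qed
  have lim0: "(\<lambda>n. M * (1/4)^n) \<longlonglongrightarrow> 0" by (intro tendsto_mult_right_zero LIMSEQ_realpow_zero) auto
  have pair: "H10_pair \<Omega> y Y"
    unfolding H10_pair_def
  proof (intro conjI yL YL allI impI)
    fix \<delta> :: real assume "\<delta> > 0"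
    then have "\<forall>\<^sub>F n in sequentially. M * (1/4)^n < \<delta>" using lim0 by (rule order_tendstoD(2)[rotated])
    then obtain n where "M * (1/4)^n < \<delta>" by (auto simp: eventually_sequentially)
    then show "\<exists>\<psi>\<in>?T. (\<integral>x. (y x - \<psi> x)\<^sup>2 \<partial>?D) + (\<integral>x. (norm (Y x - grad \<psi> x))\<^sup>2 \<partial>?D) < \<delta>"
      using split[of n] \<phi>[of n] by (intro bexI[of _ "\<phi> n"]) auto
  qed
  have gl: "(\<lambda>n. \<integral>x. (norm (grad (\<phi> n) x - Y x))\<^sup>2 \<partial>?D) \<longlonglongrightarrow> 0"
  proof (rule tendsto_sandwich[OF always_eventually always_eventually tendsto_const lim0]; intro allI)
    fix n
    have aux: "a \<ge> 0 \<Longrightarrow> a + b \<le> c \<Longrightarrow> b \<le> c" for a b c :: real by linarith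
    have "0 \<le> (\<integral>x. (y x - \<phi> n x)\<^sup>2 \<partial>?D)" by simp
    then have "(\<integral>x. (norm (Y x - grad (\<phi> n) x))\<^sup>2 \<partial>?D) \<le> M * (1/4)^n"
      using split[of n] aux[of "\<integral>x. (y x - \<phi> n x)\<^sup>2 \<partial>?D"] by blast
    moreover have "norm (grad (\<phi> n) x - Y x) = norm (Y x - grad (\<phi> n) x)" for x by (rule norm_minus_commute)
    ultimately show "(\<integral>x. (norm (grad (\<phi> n) x - Y x))\<^sup>2 \<partial>?D) \<le> M * (1/4)^n"
      by (simp only:)
  qed simp
  have eq: "(\<integral>x. w x * (Y x \<bullet> grad \<psi> x) \<partial>?D) = (\<integral>x. r x * \<psi> x \<partial>?D)" if \<psi>: "\<psi> \<in> ?T" for \<psi>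
  proof -
    define X where "X = (\<integral>x. w x * (Y x \<bullet> grad \<psi> x) \<partial>?D)"
    have "(\<lambda>n. \<integral>x. (grad (\<phi> n) x - Y x) \<bullet> (w x *\<^sub>R grad \<psi> x) \<partial>?D) \<longlonglongrightarrow> 0"
      by (rule L2_inner_tendsto_0[OF L2_diff[OF test_L2(2)[OF \<Omega> \<phi>] YL] wL[OF \<psi>] gl])
    moreover have "(\<integral>x. (grad (\<phi> n) x - Y x) \<bullet> (w x *\<^sub>R grad \<psi> x) \<partial>?D) = b (\<phi> n) \<psi> - X" for n
    proof -
      have "(\<integral>x. (grad (\<phi> n) x - Y x) \<bullet> (w x *\<^sub>R grad \<psi> x) \<partial>?D) = (\<integral>x. grad (\<phi> n) x \<bullet> (w x *\<^sub>R grad \<psi> x)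
        - Y x \<bullet> (w x *\<^sub>R grad \<psi> x) \<partial>?D)"
        by (simp add: inner_diff_left right_diff_distrib)
      also have "\<dots> = (\<integral>x. grad (\<phi> n) x \<bullet> (w x *\<^sub>R grad \<psi> x) \<partial>?D) - (\<integral>x. Y x \<bullet> (w x *\<^sub>R grad \<psi> x) \<partial>?D)"
        by (rule Bochner_Integration.integral_diff[OF L2_inner_integrable[OF test_L2(2)[OF \<Omega> \<phi>] wL[OF \<psi>]]
          L2_inner_integrable[OF YL wL[OF \<psi>]]])
      finally show ?thesis by (simp add: b_def X_def)
    qed
    ultimately have bl: "(\<lambda>n. b (\<phi> n) \<psi>) \<longlonglongrightarrow> X" by (simp add: LIM_zero_iff)
    \<comment> \<open>The first variation: moving from \<phi> n to \<phi> n + t \<psi> lowers the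
      energy by at most 4^(-n), and this defect disappears in the limit.\<close>
    have "0 \<le> t * (X - l \<psi>) + t\<^sup>2 / 2 * b \<psi> \<psi>" for t
    proof -
      have "- ((1/4)^n) \<le> t * (b (\<phi> n) \<psi> - l \<psi>) + t\<^sup>2 / 2 * b \<psi> \<psi>" for n
      proof -
        have "E (\<phi> n) - (1/4)^n \<le> E (\<lambda>x. 1 * \<phi> n x + t * \<psi> x)"
          using E\<phi>[of n] m_le[OF comb[OF \<phi> \<psi>], of 1 n t] by simp
        then show ?thesis unfolding E_def b_expand[OF \<phi> \<psi>] l_expand[OF \<phi> \<psi>] by (simp add: field_simps)
      qed
      moreover have "(\<lambda>n. - ((1/4)^n) :: real) \<longlonglongrightarrow> - 0" by (intro tendsto_minus LIMSEQ_realpow_zero) auto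
      moreover have "(\<lambda>n. t * (b (\<phi> n) \<psi> - l \<psi>) + t\<^sup>2 / 2 * b \<psi> \<psi>) \<longlonglongrightarrow> t * (X - l \<psi>) + t\<^sup>2 / 2 * b \<psi> \<psi>"
        by (intro tendsto_intros bl)
      ultimately have "- 0 \<le> t * (X - l \<psi>) + t\<^sup>2 / 2 * b \<psi> \<psi>"
        by (intro LIMSEQ_le[of "\<lambda>n. - ((1/4)^n)"]) auto
      then show ?thesis by simp
    qed
    then have "X - l \<psi> = 0" using bnn[OF \<psi>] by (rule quadratic_nonneg_imp_0)
    then show ?thesis by (simp add: X_def l_def)
  qed
  have "y \<in> H10 \<Omega>" and ae: "AE x in ?D. weak_grad \<Omega> y x = Y x"
    using H10_pair_imp_H10[OF \<Omega> pair] by auto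
  moreover have "(\<integral>x. w x * (weak_grad \<Omega> y x \<bullet> weak_grad \<Omega> v x) \<partial>?D) = (\<integral>x. r x * v x \<partial>?D)"
    if v: "v \<in> H10 \<Omega>" for v
  proof -
    have pv: "H10_pair \<Omega> v (weak_grad \<Omega> v)" by (rule H10_imp_pair[OF \<Omega> v])
    have py: "H10_pair \<Omega> y (weak_grad \<Omega> y)" by (rule H10_imp_pair[OF \<Omega> \<open>y \<in> H10 \<Omega>\<close>])
    have [measurable]: "weak_grad \<Omega> v \<in> borel_measurable ?D" "weak_grad \<Omega> y \<in> borel_measurable ?D"
      "w \<in> borel_measurable ?D"
      using pv py wm L2_measurable by (auto simp: H10_pair_def)
    have "(\<integral>x. w x * (weak_grad \<Omega> y x \<bullet> weak_grad \<Omega> v x) \<partial>?D) = (\<integral>x. w x * (Y x \<bullet> weak_grad \<Omega> v x) \<partial>?D)"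
      by (rule integral_cong_AE) (use ae in \<open>auto elim!: eventually_mono\<close>)
    also have "\<dots> = (\<integral>x. r x * v x \<partial>?D)"
      by (rule weak_form_extend[OF \<Omega> wm wabs YL r eq pv])
    finally show ?thesis .
  qed
  ultimately have "weak_solution \<Omega> w r y" by (simp add: weak_solution_def)
  then show ?thesis by blast
qed

text \<open>The gradient of the test function may be any representative V. This is needed for
  differences of states, whose gradient is known as a difference of gradients but not as the choice
  made by \<open>weak_grad\<close>.\<close>

lemma weak_solution_pair:
  fixes \<Omega> :: "'a::euclidean_space set"
  assumes \<Omega>: "open \<Omega>" "bounded \<Omega>" and wm: "w \<in> borel_measurable (lebesgue_on \<Omega>)"
    and s: "weak_solution \<Omega> w r y" and p: "H10_pair \<Omega> v V"
  shows "(\<integral>x. w x * (weak_grad \<Omega> y x \<bullet> V x) \<partial>lebesgue_on \<Omega>) = (\<integral>x. r x * v x \<partial>lebesgue_on \<Omega>)"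
proof -
  have v: "v \<in> H10 \<Omega>" and ae: "AE x in lebesgue_on \<Omega>. weak_grad \<Omega> v x = V x" using H10_pair_imp_H10[OF \<Omega> p]
    by auto
  have y: "H10_pair \<Omega> y (weak_grad \<Omega> y)" using s H10_imp_pair[OF \<Omega>] by (simp add: weak_solution_def)
  have v': "H10_pair \<Omega> v (weak_grad \<Omega> v)" by (rule H10_imp_pair[OF \<Omega> v])
  have [measurable]: "weak_grad \<Omega> y \<in> borel_measurable (lebesgue_on \<Omega>)"
    "V \<in> borel_measurable (lebesgue_on \<Omega>)"
    "weak_grad \<Omega> v \<in> borel_measurable (lebesgue_on \<Omega>)" "w \<in> borel_measurable (lebesgue_on \<Omega>)"
    using y p v' wm L2_measurable by (auto simp: H10_pair_def)
  have "(\<integral>x. w x * (weak_grad \<Omega> y x \<bullet> V x) \<partial>lebesgue_on \<Omega>)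
    = (\<integral>x. w x * (weak_grad \<Omega> y x \<bullet> weak_grad \<Omega> v x) \<partial>lebesgue_on \<Omega>)"
    by (rule integral_cong_AE) (use ae in \<open>auto elim!: eventually_mono\<close>)
  then show ?thesis using s v by (simp add: weak_solution_def)
qed

section \<open>Differentiating the tracking term\<close>

lemma Lp_norm_2_sq: "(Lp_norm 2 \<Omega> u)\<^sup>2 = (\<integral>x. (norm (u x))\<^sup>2 \<partial>lebesgue_on \<Omega>)"
proof -
  have "Lp_norm 2 \<Omega> u = sqrt (\<integral>x. (norm (u x))\<^sup>2 \<partial>lebesgue_on \<Omega>)"
    unfolding Lp_norm_def by (simp add: powr_half_sqrt)
  then show ?thesis by simp
qed

text \<open>With the adjoint state \<open>p\<close> the increment of the tracking term along \<open>w\<^sub>n\<close> is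
  \<open>\<integral> (w\<^sub>n - w) \<nabla>y\<^sub>n \<bullet> \<nabla>p + \<parallel>y\<^sub>n - y\<parallel>\<^sup>2 / 2\<close>, and \<open>y\<^sub>n - y\<close> is of the order of \<open>w\<^sub>n - w\<close>.\<close>

lemma tracking_directional_derivative:
  fixes \<Omega> :: "'a::euclidean_space set" and w :: "nat \<Rightarrow> 'a \<Rightarrow> real" and t :: "nat \<Rightarrow> real"
  assumes \<Omega>: "open \<Omega>" "bounded \<Omega>" and f: "f \<in> Lp 2 \<Omega>" and z: "z \<in> Lp 2 \<Omega>" and c: "c > 0"
    and w0m: "w0 \<in> borel_measurable (lebesgue_on \<Omega>)" and w0b: "AE x in lebesgue_on \<Omega>. c \<le> w0 x \<and> w0 x \<le> K"
    and wm: "\<And>n. w n \<in> borel_measurable (lebesgue_on \<Omega>)" and wb: "\<And>n. AE x in lebesgue_on \<Omega>. c \<le> w n x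
      \<and> w n x \<le> K"
    and t: "\<And>n. t n > 0" "t \<longlonglongrightarrow> 0"
    and d: "\<And>n. AE x in lebesgue_on \<Omega>. \<bar>w n x - w0 x\<bar> \<le> t n * M"
    and hm: "h \<in> borel_measurable (lebesgue_on \<Omega>)"
    and lim: "AE x in lebesgue_on \<Omega>. (\<lambda>n. (w n x - w0 x) / t n) \<longlonglongrightarrow> h x"
  shows "(\<lambda>n. (tracking \<Omega> f z (w n) - tracking \<Omega> f z w0) / t n) \<longlonglongrightarrow> (\<integral>x. h x * tracking_deriv \<Omega> f z w0 x
    \<partial>lebesgue_on \<Omega>)"
proof -
  let ?D = "lebesgue_on \<Omega>"
  have fL: "f \<in> L2 ?D" and zL: "z \<in> L2 ?D" using f z by (auto simp: Lp2_eq_L2)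
  \<comment> \<open>\<open>state\<close> is a \<open>SOME\<close> choice; existence of a solution is
    what makes it one.\<close>
  have solve: "weak_solution \<Omega> v f (state \<Omega> f v)"
    if "v \<in> borel_measurable ?D" "AE x in ?D. c \<le> v x \<and> v x \<le> K" for v
    unfolding state_def using weak_solution_exists[OF \<Omega> that(1) c that(2) fL] by (rule someI_ex)
  define y where "y = state \<Omega> f w0"
  define yn where "yn n = state \<Omega> f (w n)" for n
  have sy: "weak_solution \<Omega> w0 f y" unfolding y_def by (rule solve[OF w0m w0b])
  have syn: "weak_solution \<Omega> (w n) f (yn n)" for n unfolding yn_def by (rule solve[OF wm wb])
  define A where "A = weak_grad \<Omega> y"
  define An where "An n = weak_grad \<Omega> (yn n)" for n
  have py: "H10_pair \<Omega> y A" using sy H10_imp_pair[OF \<Omega>] by (simp add: weak_solution_def A_def)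
  have pyn: "H10_pair \<Omega> (yn n) (An n)" for n using syn[of n] H10_imp_pair[OF \<Omega>]
    by (simp add: weak_solution_def An_def)
  have yL: "y \<in> L2 ?D" and AL: "A \<in> L2 ?D" and ynL: "yn n \<in> L2 ?D" and AnL: "An n \<in> L2 ?D" for n
    using py pyn by (auto simp: H10_pair_def)
  have yzL: "(\<lambda>x. y x - z x) \<in> L2 ?D" by (rule L2_diff[OF yL zL])
  have rL: "(\<lambda>x. - (y x - z x)) \<in> L2 ?D" using L2_cmult[OF yzL, of "-1"] by simp
  define p where "p = adjoint_state \<Omega> f z w0"
  have sp: "weak_solution \<Omega> w0 (\<lambda>x. - (y x - z x)) p"
    unfolding p_def adjoint_state_def y_def[symmetric]
    using weak_solution_exists[OF \<Omega> w0m c w0b rL] by (rule someI_ex)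
  define P where "P = weak_grad \<Omega> p"
  have pp: "H10_pair \<Omega> p P" using sp H10_imp_pair[OF \<Omega>] by (simp add: weak_solution_def P_def)
  have PL: "P \<in> L2 ?D" using pp by (simp add: H10_pair_def)
  have pd: "H10_pair \<Omega> (\<lambda>x. yn n x - y x) (\<lambda>x. An n x - A x)" for n
    using H10_pair_lincomb[OF \<Omega> pyn py, of 1 n "-1"] by simp
  have dL: "(\<lambda>x. yn n x - y x) \<in> L2 ?D" and DL: "(\<lambda>x. An n x - A x) \<in> L2 ?D" for n
    using pd[of n] by (auto simp: H10_pair_def)
  have wabs: "AE x in ?D. \<bar>w n x\<bar> \<le> K" for n using wb[of n] by eventually_elim (use c in auto)
  have w0abs: "AE x in ?D. \<bar>w0 x\<bar> \<le> K" using w0b by eventually_elim (use c in auto)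
  have im: "integrable ?D (\<lambda>x. v x * (a x \<bullet> b x))"
    if "a \<in> L2 ?D" "b \<in> L2 ?D" "v \<in> borel_measurable ?D" "AE x in ?D. \<bar>v x\<bar> \<le> k" for a b :: "'a \<Rightarrow> 'a"
      and v k
    using L2_inner_integrable[OF L2_bounded_mult[OF that(1,3,4)] that(2)] by simp
  have dm: "(\<lambda>x. w n x - w0 x) \<in> borel_measurable ?D" for n using wm[of n] w0m by measurable
  define G where "G n = (\<integral>x. (norm (An n x - A x))\<^sup>2 \<partial>?D)" for n
  define S where "S = (\<integral>x. (norm (A x))\<^sup>2 \<partial>?D)"
  \<comment> \<open>Both state equations have the right-hand side f. Testing them with y n - y and
    subtracting shows that the energy of the difference is driven by (w n - w0) A. Young's
    inequality with parameter 1 / c moves half of c G n to the left.\<close>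
  have G_le: "G n \<le> (t n)\<^sup>2 * (M\<^sup>2 / c\<^sup>2 * S)" for n
  proof -
    have "(\<integral>x. w n x * (An n x \<bullet> (An n x - A x)) \<partial>?D) = (\<integral>x. w0 x * (A x \<bullet> (An n x - A x)) \<partial>?D)"
      using weak_solution_pair[OF \<Omega> wm syn pd, of n] weak_solution_pair[OF \<Omega> w0m sy pd, of n]
        by (simp add: A_def An_def)
    moreover have "(\<integral>x. w n x * ((An n x - A x) \<bullet> (An n x - A x)) \<partial>?D) =
       (\<integral>x. w n x * (An n x \<bullet> (An n x - A x)) \<partial>?D) - (\<integral>x. w n x * (A x \<bullet> (An n x - A x)) \<partial>?D)"
      unfolding inner_diff_left right_diff_distrib
      using im[OF AnL DL wm wabs, of n n n] im[OF AL DL wm wabs, of n n]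
      by (intro Bochner_Integration.integral_diff) auto
    moreover have "(\<integral>x. (w n x - w0 x) * (A x \<bullet> (An n x - A x)) \<partial>?D) =
       (\<integral>x. w n x * (A x \<bullet> (An n x - A x)) \<partial>?D) - (\<integral>x. w0 x * (A x \<bullet> (An n x - A x)) \<partial>?D)"
      unfolding left_diff_distrib
      using im[OF AL DL wm wabs, of n n] im[OF AL DL w0m w0abs, of n]
      by (intro Bochner_Integration.integral_diff) auto
    ultimately have eq: "(\<integral>x. w n x * ((An n x - A x) \<bullet> (An n x - A x)) \<partial>?D) = - (\<integral>x. (w n x
      - w0 x) * (A x \<bullet> (An n x - A x)) \<partial>?D)"
      by simp
    have "c * G n = (\<integral>x. c * ((An n x - A x) \<bullet> (An n x - A x)) \<partial>?D)"
      by (simp add: G_def power2_norm_eq_inner)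
    also have "\<dots> \<le> (\<integral>x. w n x * ((An n x - A x) \<bullet> (An n x - A x)) \<partial>?D)"
    proof (rule integral_mono_AE[OF _ im[OF DL DL wm wabs]])
      show "integrable ?D (\<lambda>x. c * ((An n x - A x) \<bullet> (An n x - A x)))"
        using L2_inner_integrable[OF DL DL, of n n] by simp
      show "AE x in ?D. c * ((An n x - A x) \<bullet> (An n x - A x)) \<le> w n x * ((An n x - A x) \<bullet> (An n x - A x))"
        using wb[of n] by eventually_elim (auto intro!: mult_right_mono)
    qed
    also have "\<dots> \<le> \<bar>\<integral>x. ((w n x - w0 x) *\<^sub>R A x) \<bullet> (An n x - A x) \<partial>?D\<bar>" unfolding eq by simp
    also have "\<dots> \<le> (1/c) / 2 * (\<integral>x. (norm ((w n x - w0 x) *\<^sub>R A x))\<^sup>2 \<partial>?D) + 1 / (2 * (1/c)) * G n"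
      unfolding G_def using c by (intro L2_Young L2_bounded_mult[OF AL dm d] DL) auto
    also have "(\<integral>x. (norm ((w n x - w0 x) *\<^sub>R A x))\<^sup>2 \<partial>?D) \<le> (\<integral>x. (t n * M)\<^sup>2 * (norm (A x))\<^sup>2 \<partial>?D)"
    proof (rule integral_mono_AE[OF L2_integrable[OF L2_bounded_mult[OF AL dm d]]])
      show "integrable ?D (\<lambda>x. (t n * M)\<^sup>2 * (norm (A x))\<^sup>2)" using L2_integrable[OF AL] by simp
      show "AE x in ?D. (norm ((w n x - w0 x) *\<^sub>R A x))\<^sup>2 \<le> (t n * M)\<^sup>2 * (norm (A x))\<^sup>2"
        using d[of n]
      proof eventually_elim
        case (elim x)
        then have "\<bar>w n x - w0 x\<bar>\<^sup>2 \<le> (t n * M)\<^sup>2" by (intro power_mono) auto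
        then show ?case by (simp add: power_mult_distrib mult_right_mono)
      qed
    qed
    also have "(\<integral>x. (t n * M)\<^sup>2 * (norm (A x))\<^sup>2 \<partial>?D) = (t n * M)\<^sup>2 * S" by (simp add: S_def)
    finally have "c * G n \<le> (1/c) / 2 * ((t n * M)\<^sup>2 * S) + 1 / (2 * (1/c)) * G n" using c
      by (simp add: divide_right_mono)
    then have "c * G n \<le> ((t n * M)\<^sup>2 * S) / c" by (simp add: field_simps)
    then have "G n * c \<le> ((t n * M)\<^sup>2 * S) / c" by (simp only: mult.commute)
    then have "G n \<le> ((t n * M)\<^sup>2 * S) / c / c" using c by (subst pos_le_divide_eq) auto
    then show ?thesis by (simp add: power_mult_distrib power2_eq_square mult.assoc mult.left_commute)
  qed
  obtain C where C: "C > 0" "\<And>v V. H10_pair \<Omega> v V \<Longrightarrow> (\<integral>x. (v x)\<^sup>2 \<partial>?D) \<le> C * (\<integral>x. (norm (V x))\<^sup>2 \<partial>?D)"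
    using Poincare_H10_pair[OF \<Omega>] by blast
  define Q where "Q n x = (w n x - w0 x) / t n" for n x
  have Qm: "Q n \<in> borel_measurable ?D" for n unfolding Q_def[abs_def] using dm[of n] by measurable
  have QM: "AE x in ?D. \<bar>Q n x\<bar> \<le> M" for n
    using d[of n] by eventually_elim (use t(1)[of n] in \<open>simp add: Q_def pos_divide_le_eq mult.commute\<close>)
  have F: "(tracking \<Omega> f z (w n) - tracking \<Omega> f z w0) / t n =
     (\<integral>x. (Q n x *\<^sub>R (An n x - A x)) \<bullet> P x \<partial>?D) + (\<integral>x. Q n x * (A x \<bullet> P x) \<partial>?D) + (\<integral>x. (yn n x - y x)\<^sup>2
       \<partial>?D) / 2 / t n" for n
  proof -
    have tr: "tracking \<Omega> f z v = 1/2 * (\<integral>x. (state \<Omega> f v x - z x)\<^sup>2 \<partial>?D)" for v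
      unfolding tracking_def Lp_norm_2_sq by simp
    have "(\<integral>x. (yn n x - z x)\<^sup>2 \<partial>?D) = (\<integral>x. (y x - z x)\<^sup>2 + 2 * ((y x - z x) * (yn n x - y x)) + (yn n x
      - y x)\<^sup>2 \<partial>?D)"
      by (intro Bochner_Integration.integral_cong) (auto simp: power2_eq_square algebra_simps)
    also have "\<dots> = (\<integral>x. (y x - z x)\<^sup>2 \<partial>?D) + 2 * (\<integral>x. (y x - z x) * (yn n x - y x) \<partial>?D) + (\<integral>x. (yn n x
      - y x)\<^sup>2 \<partial>?D)"
      using L2_integrable[OF yzL] L2_integrable[OF dL, of n] L2_inner_integrable[OF yzL dL, of n] by simp
    finally have 1: "tracking \<Omega> f z (w n) - tracking \<Omega> f z w0 = (\<integral>x. (y x - z x) * (yn n x - y x) \<partial>?D)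
      + (\<integral>x. (yn n x - y x)\<^sup>2 \<partial>?D) / 2"
      unfolding tr y_def[symmetric] yn_def[symmetric] by (simp add: field_simps)
    \<comment> \<open>The adjoint equation tested with the difference of the states.\<close>
    have "(\<integral>x. w0 x * (P x \<bullet> (An n x - A x)) \<partial>?D) = - (\<integral>x. (y x - z x) * (yn n x - y x) \<partial>?D)"
    proof -
      have "(\<integral>x. w0 x * (P x \<bullet> (An n x - A x)) \<partial>?D) = (\<integral>x. - (y x - z x) * (yn n x - y x) \<partial>?D)"
        using weak_solution_pair[OF \<Omega> w0m sp pd, of n] unfolding P_def .
      also have "\<dots> = - (\<integral>x. (y x - z x) * (yn n x - y x) \<partial>?D)"
        by (simp only: mult_minus_left Bochner_Integration.integral_minus)
      finally show ?thesis .
    qed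
    moreover have "(\<integral>x. w0 x * (P x \<bullet> (An n x - A x)) \<partial>?D) = (\<integral>x. w0 x * (An n x \<bullet> P x) \<partial>?D)
      - (\<integral>x. w0 x * (A x \<bullet> P x) \<partial>?D)"
      using im[OF AnL PL w0m w0abs, of n] im[OF AL PL w0m w0abs]
      by (simp add: inner_diff_right right_diff_distrib inner_commute[of "P _"])
    \<comment> \<open>Tested with the adjoint state, the equations for w0 and w n have the same
      right-hand side.\<close>
    moreover have "(\<integral>x. w0 x * (A x \<bullet> P x) \<partial>?D) = (\<integral>x. w n x * (An n x \<bullet> P x) \<partial>?D)"
      using weak_solution_pair[OF \<Omega> wm syn pp, of n] weak_solution_pair[OF \<Omega> w0m sy pp]
        by (simp add: A_def An_def)
    moreover have "(\<integral>x. (w n x - w0 x) * (An n x \<bullet> P x) \<partial>?D) = (\<integral>x. w n x * (An n x \<bullet> P x) \<partial>?D)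
      - (\<integral>x. w0 x * (An n x \<bullet> P x) \<partial>?D)"
      using im[OF AnL PL w0m w0abs, of n] im[OF AnL PL wm wabs, of n n] by (simp add: left_diff_distrib)
    ultimately have 2: "(\<integral>x. (y x - z x) * (yn n x - y x) \<partial>?D) = (\<integral>x. (w n x - w0 x) * (An n x \<bullet> P x) \<partial>?D)"
      by simp
    have "(\<integral>x. (w n x - w0 x) * (An n x \<bullet> P x) \<partial>?D) / t n = (\<integral>x. Q n x * (An n x \<bullet> P x) \<partial>?D)"
      by (simp add: Q_def)
    also have "\<dots> = (\<integral>x. Q n x * ((An n x - A x) \<bullet> P x) + Q n x * (A x \<bullet> P x) \<partial>?D)"
      by (intro Bochner_Integration.integral_cong) (auto simp: inner_diff_left algebra_simps)
    also have "\<dots> = (\<integral>x. Q n x * ((An n x - A x) \<bullet> P x) \<partial>?D) + (\<integral>x. Q n x * (A x \<bullet> P x) \<partial>?D)"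
      by (intro Bochner_Integration.integral_add im[OF DL PL Qm QM] im[OF AL PL Qm QM])
    finally show ?thesis unfolding 1 2 by (simp add: add_divide_distrib)
  qed
  have tsq: "(\<lambda>n. (t n)\<^sup>2 * k) \<longlonglongrightarrow> 0" for k
  proof -
    have "(\<lambda>n. (t n)\<^sup>2 * k) \<longlonglongrightarrow> 0\<^sup>2 * k" by (intro tendsto_intros t(2))
    then show ?thesis by simp
  qed
  have "(\<lambda>n. \<integral>x. (Q n x *\<^sub>R (An n x - A x)) \<bullet> P x \<partial>?D) \<longlonglongrightarrow> 0"
  proof (rule L2_inner_tendsto_0[OF L2_bounded_mult[OF DL Qm QM] PL])
    show "(\<lambda>n. \<integral>x. (norm (Q n x *\<^sub>R (An n x - A x)))\<^sup>2 \<partial>?D) \<longlonglongrightarrow> 0"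
    proof (rule tendsto_sandwich[OF always_eventually always_eventually tendsto_const]; (intro allI)?)
      show "(\<lambda>n. (t n)\<^sup>2 * (M\<^sup>2 * (M\<^sup>2 / c\<^sup>2 * S))) \<longlonglongrightarrow> 0" by (rule tsq)
      fix n
      have "(\<integral>x. (norm (Q n x *\<^sub>R (An n x - A x)))\<^sup>2 \<partial>?D) \<le> (\<integral>x. M\<^sup>2 * (norm (An n x - A x))\<^sup>2 \<partial>?D)"
      proof (rule integral_mono_AE[OF L2_integrable[OF L2_bounded_mult[OF DL Qm QM]]])
        show "integrable ?D (\<lambda>x. M\<^sup>2 * (norm (An n x - A x))\<^sup>2)" using L2_integrable[OF DL] by simp
        show "AE x in ?D. (norm (Q n x *\<^sub>R (An n x - A x)))\<^sup>2 \<le> M\<^sup>2 * (norm (An n x - A x))\<^sup>2"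
          using QM[of n]
        proof eventually_elim
          case (elim x)
          then have "\<bar>Q n x\<bar>\<^sup>2 \<le> M\<^sup>2" by (intro power_mono) auto
          then show ?case by (simp add: power_mult_distrib mult_right_mono)
        qed
      qed
      also have "\<dots> = M\<^sup>2 * G n" by (simp add: G_def)
      also have "\<dots> \<le> M\<^sup>2 * ((t n)\<^sup>2 * (M\<^sup>2 / c\<^sup>2 * S))" by (intro mult_left_mono G_le) auto
      finally show "(\<integral>x. (norm (Q n x *\<^sub>R (An n x - A x)))\<^sup>2 \<partial>?D) \<le> (t n)\<^sup>2 * (M\<^sup>2 * (M\<^sup>2 / c\<^sup>2 * S))"
        by (simp add: mult.left_commute)
    qed simp
  qed
  moreover have "(\<lambda>n. \<integral>x. Q n x * (A x \<bullet> P x) \<partial>?D) \<longlonglongrightarrow> (\<integral>x. h x * (A x \<bullet> P x) \<partial>?D)"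
  proof (rule integral_dominated_convergence[where w="\<lambda>x. M * \<bar>A x \<bullet> P x\<bar>"])
    have AP: "(\<lambda>x. A x \<bullet> P x) \<in> borel_measurable ?D" using L2_measurable[OF AL] L2_measurable[OF PL]
      by measurable
    show "(\<lambda>x. h x * (A x \<bullet> P x)) \<in> borel_measurable ?D" using hm AP by measurable
    show "(\<lambda>x. Q n x * (A x \<bullet> P x)) \<in> borel_measurable ?D" for n using Qm[of n] AP by measurable
    show "integrable ?D (\<lambda>x. M * \<bar>A x \<bullet> P x\<bar>)" using L2_inner_integrable[OF AL PL] by simp
    show "AE x in ?D. (\<lambda>n. Q n x * (A x \<bullet> P x)) \<longlonglongrightarrow> h x * (A x \<bullet> P x)"
      using lim
    proof eventually_elim
      case (elim x)
      then show ?case unfolding Q_def by (intro tendsto_mult tendsto_const)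
    qed
    show "AE x in ?D. norm (Q n x * (A x \<bullet> P x)) \<le> M * \<bar>A x \<bullet> P x\<bar>" for n
      using QM[of n] by eventually_elim (auto simp: abs_mult intro!: mult_right_mono)
  qed
  moreover have "(\<lambda>n. (\<integral>x. (yn n x - y x)\<^sup>2 \<partial>?D) / 2 / t n) \<longlonglongrightarrow> 0"
  proof (rule tendsto_sandwich[OF always_eventually always_eventually tendsto_const]; (intro allI)?)
    show "(\<lambda>n. t n * (C * (M\<^sup>2 / c\<^sup>2 * S) / 2)) \<longlonglongrightarrow> 0"
      by (rule tendsto_mult_left_zero[OF t(2)])
    fix n
    have i0: "0 \<le> (\<integral>x. (yn n x - y x)\<^sup>2 \<partial>?D)" by (simp add: integral_nonneg_AE)
    then show "0 \<le> (\<integral>x. (yn n x - y x)\<^sup>2 \<partial>?D) / 2 / t n" using t(1)[of n] by (intro divide_nonneg_pos) auto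
    have "(\<integral>x. (yn n x - y x)\<^sup>2 \<partial>?D) \<le> C * G n" using C(2)[OF pd[of n]] by (simp add: G_def)
    also have "\<dots> \<le> C * ((t n)\<^sup>2 * (M\<^sup>2 / c\<^sup>2 * S))" using C(1) by (intro mult_left_mono G_le) auto
    finally have "(\<integral>x. (yn n x - y x)\<^sup>2 \<partial>?D) / 2 / t n \<le> C * ((t n)\<^sup>2 * (M\<^sup>2 / c\<^sup>2 * S)) / 2 / t n"
      using t(1)[of n] by (intro divide_right_mono) auto
    also have "\<dots> = t n * (C * (M\<^sup>2 / c\<^sup>2 * S) / 2)" using t(1)[of n] by (simp add: power2_eq_square mult_ac)
    finally show "(\<integral>x. (yn n x - y x)\<^sup>2 \<partial>?D) / 2 / t n \<le> t n * (C * (M\<^sup>2 / c\<^sup>2 * S) / 2)" .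
  qed
  ultimately have "(\<lambda>n. (tracking \<Omega> f z (w n) - tracking \<Omega> f z w0) / t n) \<longlonglongrightarrow> 0 + (\<integral>x. h x * (A x \<bullet> P x) \<partial>?D)
    + 0"
    unfolding F by (intro tendsto_add)
  then show ?thesis by (simp add: tracking_deriv_def A_def P_def y_def p_def)
qed

section \<open>One-sided derivatives of convex functions\<close>

text \<open>For convex g the slopes increase with \<tau>, so the infimum is the right derivative. As
  an infimum it can be bounded and compared with slopes before any limit is known to exist.\<close>

definition dplus :: "(real \<Rightarrow> real) \<Rightarrow> real \<Rightarrow> real" where
  "dplus g t = (INF \<tau>\<in>{0<..}. (g (t + \<tau>) - g t) / \<tau>)"

text \<open>The left derivative, written through reflection so that facts about \<open>dplus\<close>
  carry over to it.\<close>

definition dminus :: "(real \<Rightarrow> real) \<Rightarrow> real \<Rightarrow> real" where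
  "dminus g t = - dplus (\<lambda>x. g (- x)) (- t)"

lemma convex_on_reflect: "convex_on UNIV g \<Longrightarrow> convex_on UNIV (\<lambda>x::real. g (- x) :: real)"
  unfolding convex_on_def
proof (intro conjI ballI allI impI convex_UNIV)
  fix x y u v :: real
  assume "convex UNIV \<and> (\<forall>x\<in>UNIV. \<forall>y\<in>UNIV. \<forall>u\<ge>0. \<forall>v\<ge>0. u + v = 1 \<longrightarrow> g (u *\<^sub>R x + v *\<^sub>R y) \<le> u * g x
    + v * g y)"
    and "0 \<le> u" "0 \<le> v" "u + v = 1"
  then have "g (u *\<^sub>R (- x) + v *\<^sub>R (- y)) \<le> u * g (- x) + v * g (- y)" by blast
  then show "g (- (u *\<^sub>R x + v *\<^sub>R y)) \<le> u * g (- x) + v * g (- y)" by simp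
qed

lemma Lipschitz_reflect: "L-lipschitz_on UNIV g \<Longrightarrow> L-lipschitz_on UNIV (\<lambda>x::real. g (- x) :: real)"
  unfolding lipschitz_on_def by (metis UNIV_I dist_minus)

lemma convex_slope_mono:
  fixes g :: "real \<Rightarrow> real"
  assumes g: "convex_on UNIV g" and s: "0 < \<sigma>" "\<sigma> \<le> \<tau>"
  shows "(g (t + \<sigma>) - g t) / \<sigma> \<le> (g (t + \<tau>) - g t) / \<tau>"
proof -
  have "g ((1 - \<sigma> / \<tau>) *\<^sub>R t + (\<sigma> / \<tau>) *\<^sub>R (t + \<tau>)) \<le> (1 - \<sigma> / \<tau>) * g t + (\<sigma> / \<tau>) * g (t + \<tau>)"
    using s g by (intro convex_onD[OF g]) auto
  moreover have "(1 - \<sigma> / \<tau>) *\<^sub>R t + (\<sigma> / \<tau>) *\<^sub>R (t + \<tau>) = t + \<sigma>" using s by (simp add: field_simps)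
  ultimately have "g (t + \<sigma>) - g t \<le> \<sigma> * ((g (t + \<tau>) - g t) / \<tau>)"
    by (simp add: algebra_simps diff_divide_distrib)
  then show ?thesis using s by (simp add: pos_divide_le_eq mult.commute)
qed

lemma dplus_bdd:
  assumes "L-lipschitz_on UNIV g" "\<tau> > 0"
  shows "\<bar>(g (t + \<tau>) - g t) / \<tau>\<bar> \<le> L"
  using lipschitz_onD[OF assms(1), of "t + \<tau>" t] assms(2) by (simp add: dist_real_def pos_divide_le_eq)

lemma dplus_le:
  assumes "L-lipschitz_on UNIV g" "\<tau> > 0"
  shows "dplus g t \<le> (g (t + \<tau>) - g t) / \<tau>"
  unfolding dplus_def
proof (rule cINF_lower)
  show "bdd_below ((\<lambda>\<tau>. (g (t + \<tau>) - g t) / \<tau>) ` {0<..})"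
  proof (rule bdd_belowI2[where m="- L"])
    fix \<tau> :: real assume "\<tau> \<in> {0<..}"
    then have "\<bar>(g (t + \<tau>) - g t) / \<tau>\<bar> \<le> L" by (intro dplus_bdd[OF assms(1)]) auto
    from abs_le_D2[OF this] show "- L \<le> (g (t + \<tau>) - g t) / \<tau>" by linarith
  qed
qed (use assms in auto)

lemma dplus_abs:
  assumes "L-lipschitz_on UNIV g" shows "\<bar>dplus g t\<bar> \<le> L"
proof -
  have "dplus g t \<le> L" using dplus_le[OF assms, of 1 t] dplus_bdd[OF assms, of 1 t] by simp
  moreover have "- L \<le> dplus g t" unfolding dplus_def
  proof (rule cINF_greatest)
    fix \<tau> :: real assume "\<tau> \<in> {0<..}"
    then have "\<bar>(g (t + \<tau>) - g t) / \<tau>\<bar> \<le> L" by (intro dplus_bdd[OF assms]) auto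
    from abs_le_D2[OF this] show "- L \<le> (g (t + \<tau>) - g t) / \<tau>" by linarith
  qed simp
  ultimately show ?thesis by simp
qed

lemma dminus_abs: "L-lipschitz_on UNIV g \<Longrightarrow> \<bar>dminus g t\<bar> \<le> L"
  unfolding dminus_def using dplus_abs[OF Lipschitz_reflect] by simp

text \<open>Slopes never fall below the infimum; once \<sigma> n is smaller than a nearly optimal
  \<tau>, monotonicity of slopes keeps them near it.\<close>

lemma dplus_tendsto:
  assumes g: "convex_on UNIV g" and L: "L-lipschitz_on UNIV g" and \<sigma>: "\<And>n. \<sigma> n > 0" "\<sigma> \<longlonglongrightarrow> 0"
  shows "(\<lambda>n. (g (t + \<sigma> n) - g t) / \<sigma> n) \<longlonglongrightarrow> dplus g t"
proof (rule order_tendstoI)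
  fix a assume "a < dplus g t"
  then have "a < (g (t + \<sigma> n) - g t) / \<sigma> n" for n using dplus_le[OF L \<sigma>(1), of t n] by linarith
  then show "\<forall>\<^sub>F n in sequentially. a < (g (t + \<sigma> n) - g t) / \<sigma> n" by simp
next
  fix a assume "dplus g t < a"
  then obtain \<tau> where \<tau>: "\<tau> > 0" "(g (t + \<tau>) - g t) / \<tau> < a"
    unfolding dplus_def using cInf_lessD[of "(\<lambda>\<tau>. (g (t + \<tau>) - g t) / \<tau>) ` {0<..}" a] by auto
  have "\<forall>\<^sub>F n in sequentially. \<sigma> n < \<tau>" using \<sigma>(2) \<tau>(1) by (rule order_tendstoD(2))
  then show "\<forall>\<^sub>F n in sequentially. (g (t + \<sigma> n) - g t) / \<sigma> n < a"
  proof eventually_elim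
    case (elim n)
    then have "(g (t + \<sigma> n) - g t) / \<sigma> n \<le> (g (t + \<tau>) - g t) / \<tau>" using \<sigma>(1)[of n]
      by (intro convex_slope_mono[OF g]) auto
    then show ?case using \<tau>(2) by simp
  qed
qed

lemma dminus_le_dplus:
  assumes g: "convex_on UNIV g" and L: "L-lipschitz_on UNIV g"
  shows "dminus g t \<le> dplus g t"
proof -
  define \<sigma> where "\<sigma> n = inverse (real (Suc n))" for n
  have \<sigma>: "\<And>n. \<sigma> n > 0" "\<sigma> \<longlonglongrightarrow> 0" unfolding \<sigma>_def using LIMSEQ_inverse_real_of_nat by auto
  have 1: "(\<lambda>n. (g (t + \<sigma> n) - g t) / \<sigma> n) \<longlonglongrightarrow> dplus g t" by (rule dplus_tendsto[OF g L \<sigma>])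
  have 2: "(\<lambda>n. - ((g (- (- t + \<sigma> n)) - g (- (- t))) / \<sigma> n)) \<longlonglongrightarrow> dminus g t"
    unfolding dminus_def
      by (intro tendsto_minus dplus_tendsto[OF convex_on_reflect[OF g] Lipschitz_reflect[OF L] \<sigma>])
  have "- ((g (- (- t + \<sigma> n)) - g (- (- t))) / \<sigma> n) \<le> (g (t + \<sigma> n) - g t) / \<sigma> n" for n
  proof -
    have "g ((1 - 1/2) *\<^sub>R (t + \<sigma> n) + (1/2) *\<^sub>R (t - \<sigma> n)) \<le> (1 - 1/2) * g (t + \<sigma> n) + (1/2) * g (t - \<sigma> n)"
      by (intro convex_onD[OF g]) auto
    moreover have "(1 - 1/2) *\<^sub>R (t + \<sigma> n) + (1/2) *\<^sub>R (t - \<sigma> n) = t" by (simp add: field_simps)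
    ultimately have "- (g (t - \<sigma> n) - g t) \<le> g (t + \<sigma> n) - g t" by simp
    then have "- (g (t - \<sigma> n) - g t) / \<sigma> n \<le> (g (t + \<sigma> n) - g t) / \<sigma> n" using \<sigma>(1)[of n]
      by (intro divide_right_mono) auto
    then show ?thesis by (simp add: minus_divide_left)
  qed
  then show ?thesis using LIMSEQ_le[OF 2 1] by auto
qed

lemma subgradient_ineq:
  assumes g: "convex_on UNIV g" and L: "L-lipschitz_on UNIV g" and \<xi>: "dminus g t \<le> \<xi>" "\<xi> \<le> dplus g t"
  shows "g t + \<xi> * (s - t) \<le> g s"
proof -
  consider "s = t" | "s > t" | "s < t" by linarith
  then show ?thesis
  proof cases
    case 2
    then have "\<xi> \<le> (g (t + (s - t)) - g t) / (s - t)" using dplus_le[OF L, of "s - t" t] \<xi>(2) by simp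
    then show ?thesis using 2 by (simp add: pos_le_divide_eq)
  next
    case 3
    then have "dplus (\<lambda>x. g (- x)) (- t) \<le> (g (- (- t + (t - s))) - g (- (- t))) / (t - s)"
      by (intro dplus_le[OF Lipschitz_reflect[OF L]]) auto
    then have "- \<xi> \<le> (g s - g t) / (t - s)" using \<xi>(1) by (simp add: dminus_def)
    then show ?thesis using 3 by (simp add: pos_le_divide_eq algebra_simps)
  qed simp
qed

text \<open>As \<open>dminus\<close> is at most \<open>dplus\<close>, the maximum selects the right
  derivative for h \<ge> 0 and the left one for h \<le> 0. In this form, with one formula for both
  signs, the limit is the integrand of \<open>dominated_convex_representation\<close>.\<close>

lemma directional_tendsto:
  assumes g: "convex_on UNIV g" and L: "L-lipschitz_on UNIV g" and \<sigma>: "\<And>n. \<sigma> n > 0" "\<sigma> \<longlonglongrightarrow> 0"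
  shows "(\<lambda>n. (g (t + \<sigma> n * h) - g t) / \<sigma> n) \<longlonglongrightarrow> max (dminus g t * h) (dplus g t * h)"
proof -
  note le = dminus_le_dplus[OF g L, of t]
  consider "h = 0" | "h > 0" | "h < 0" by linarith
  then show ?thesis
  proof cases
    case 2
    have "(\<lambda>n. \<sigma> n * h) \<longlonglongrightarrow> 0" using tendsto_mult_left_zero[OF \<sigma>(2)] by simp
    then have "(\<lambda>n. (g (t + \<sigma> n * h) - g t) / (\<sigma> n * h) * h) \<longlonglongrightarrow> dplus g t * h"
      using \<sigma>(1) 2 by (intro tendsto_mult dplus_tendsto[OF g L] tendsto_const) auto
    then show ?thesis using 2 le by (simp add: max_def mult_le_cancel_right)
  next
    case 3
    have "(\<lambda>n. \<sigma> n * (- h)) \<longlonglongrightarrow> 0 * (- h)" by (intro tendsto_mult tendsto_const \<sigma>(2))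
    then have "(\<lambda>n. \<sigma> n * (- h)) \<longlonglongrightarrow> 0" by (simp only: mult_zero_left)
    then have "(\<lambda>n. (g (- (- t + \<sigma> n * (- h)))
      - g (- (- t))) / (\<sigma> n * (- h)) * (- h)) \<longlonglongrightarrow> dplus (\<lambda>x. g (- x)) (- t) * (- h)"
      using \<sigma>(1) 3 by (intro tendsto_mult dplus_tendsto[OF convex_on_reflect[OF g] Lipschitz_reflect[OF L]]
        tendsto_const)
        (auto intro: mult_pos_neg)
    then have "(\<lambda>n. (g (t + \<sigma> n * h) - g t) / \<sigma> n) \<longlonglongrightarrow> dminus g t * h"
      using 3 by (simp add: dminus_def add.commute)
    then show ?thesis using 3 le by (simp add: max_def mult_le_cancel_right)
  qed simp
qed

lemma dplus_measurable:
  assumes g: "convex_on UNIV g" and L: "L-lipschitz_on UNIV g"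
  shows "dplus g \<in> borel_measurable borel" "dminus g \<in> borel_measurable borel"
proof -
  have main: "dplus g \<in> borel_measurable borel" if g: "convex_on UNIV g"
    and L: "L-lipschitz_on UNIV g" for g
  proof (rule borel_measurable_LIMSEQ_real)
    have \<sigma>: "inverse (real (Suc n)) > 0" for n by simp
    show "(\<lambda>n. (g (t + inverse (real (Suc n))) - g t) / inverse (real (Suc n))) \<longlonglongrightarrow> dplus g t" for t
      by (rule dplus_tendsto[OF g L \<sigma> LIMSEQ_inverse_real_of_nat])
    have [measurable]: "g \<in> borel_measurable borel"
      using lipschitz_on_continuous_on[OF L] by (rule borel_measurable_continuous_onI)
    show "(\<lambda>t. (g (t + inverse (real (Suc n))) - g t) / inverse (real (Suc n))) \<in> borel_measurable borel"
      for n by measurable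
  qed
  show "dplus g \<in> borel_measurable borel" by (rule main[OF g L])
  have [measurable]: "dplus (\<lambda>x. g (- x)) \<in> borel_measurable borel"
    by (rule main[OF convex_on_reflect[OF g] Lipschitz_reflect[OF L]])
  show "dminus g \<in> borel_measurable borel" unfolding dminus_def[abs_def] by measurable
qed

section \<open>The multi-bang penalty and the truncation\<close>

text \<open>On \<open>[u\<^sub>i, u\<^sub>i\<^sub>+\<^sub>1]\<close> the penalty is the chord of \<open>t\<^sup>2 / 2\<close>, whose vertical distance from
  \<open>t\<^sup>2 / 2\<close> is \<open>(t - u\<^sub>i) (t - u\<^sub>i\<^sub>+\<^sub>1) / 2\<close>; hence the penalty is the maximum of its affine pieces.\<close>

context
  fixes us :: "nat \<Rightarrow> real" and m :: nat
  assumes m: "2 \<le> m" and us1: "us 1 = 0" and mono: "\<And>i. i \<in> {1..<m} \<Longrightarrow> us i < us (Suc i)"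
begin

text \<open>The m + 1 affine pieces are numbered from left to right: 0 is the branch below
  \<open>us 1\<close>, m the one above \<open>us m\<close>, and those in between are the
  chords.\<close>

definition mb_slope :: "nat \<Rightarrow> real" where
  "mb_slope k = (if k = 0 then - us m else if k < m then (us k + us (Suc k)) / 2 else us m)"

definition mb_offset :: "nat \<Rightarrow> real" where
  "mb_offset k = (if k = 0 then 0 else if k < m then - us k * us (Suc k) / 2 else - (us m)\<^sup>2 / 2)"

lemma us_less: "1 \<le> j \<Longrightarrow> j < k \<Longrightarrow> k \<le> m \<Longrightarrow> us j < us k"
proof (induction k)
  case (Suc k)
  have "us k < us (Suc k)" using Suc.prems by (intro mono) auto
  then show ?case using Suc by (cases "j = k") auto
qed simp

lemma us_le: "1 \<le> j \<Longrightarrow> j \<le> k \<Longrightarrow> k \<le> m \<Longrightarrow> us j \<le> us k"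
  using us_less[of j k] by (cases "j = k") auto

lemma us_m_pos: "0 < us m"
  using us_less[of 1 m] m us1 by simp

lemma us_bounds: "1 \<le> k \<Longrightarrow> k \<le> m \<Longrightarrow> 0 \<le> us k \<and> us k \<le> us m"
  using us_le[of 1 k] us_le[of k m] us1 by simp

lemma mb_slope_bound: "k \<le> m \<Longrightarrow> \<bar>mb_slope k\<bar> \<le> us m"
proof (cases "k = 0 \<or> m \<le> k")
  case True
  then show ?thesis using us_m_pos by (auto simp: mb_slope_def)
next
  case False
  then have "0 \<le> us k" "us k \<le> us m" "0 \<le> us (Suc k)" "us (Suc k) \<le> us m"
    using us_bounds[of k] us_bounds[of "Suc k"] by auto
  then show ?thesis using False by (simp add: mb_slope_def abs_of_nonneg)
qed

lemma multibang_max: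
  shows "\<exists>k\<le>m. multibang us m t = mb_slope k * t + mb_offset k"
    and "k \<le> m \<Longrightarrow> mb_slope k * t + mb_offset k \<le> multibang us m t"
proof -
  have chord: "((us i + us (Suc i)) * t - us i * us (Suc i)) / 2 = t\<^sup>2 / 2 - (t - us i) * (t
    - us (Suc i)) / 2" for i
    by (simp add: power2_eq_square field_simps)
  have last: "us m * t - (us m)\<^sup>2 / 2 = t\<^sup>2 / 2 - (t - us m)\<^sup>2 / 2"
    by (simp add: power2_eq_square field_simps)
  consider (low) "t \<le> 0" | (mid) "0 < t" "t < us m" | (high) "us m \<le> t" "0 < t" by linarith
  then have "(\<exists>k\<le>m. multibang us m t = mb_slope k * t + mb_offset k) \<and>
      (\<forall>k\<le>m. mb_slope k * t + mb_offset k \<le> multibang us m t)"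
  proof cases
    case low
    have eq: "multibang us m t = - us m * t" using low us1 by (simp add: multibang_def)
    have nn: "0 \<le> - us m * t" using low us_m_pos by (simp add: mult_nonneg_nonpos)
    have "mb_slope k * t + mb_offset k \<le> - us m * t" if "k \<le> m" for k
    proof (cases "k = 0")
      case False
      have "mb_slope k \<ge> 0" "mb_offset k \<le> 0"
        using us_bounds[of k] us_bounds[of "Suc k"] False that us_m_pos
          by (auto simp: mb_slope_def mb_offset_def)
      then have "mb_slope k * t + mb_offset k \<le> 0" using low
        by (simp add: mult_nonneg_nonpos add_nonpos_nonpos)
      then show ?thesis using nn by simp
    qed (simp add: mb_slope_def mb_offset_def)
    moreover have "multibang us m t = mb_slope 0 * t + mb_offset 0"
      by (simp add: eq mb_slope_def mb_offset_def)
    ultimately show ?thesis unfolding eq by auto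
  next
    case mid
    define i where "i = Max {i \<in> {1..<m}. us i \<le> t}"
    have ne: "1 \<in> {i \<in> {1..<m}. us i \<le> t}" using m us1 mid by simp
    have iI: "i \<in> {i \<in> {1..<m}. us i \<le> t}" unfolding i_def using ne by (intro Max_in) auto
    then have i: "1 \<le> i" "i < m" "us i \<le> t" by auto
    have it: "t \<le> us (Suc i)"
    proof (rule ccontr)
      assume "\<not> t \<le> us (Suc i)"
      then have "Suc i \<in> {i \<in> {1..<m}. us i \<le> t}" using i mid by (cases "Suc i = m") auto
      then have "Suc i \<le> i" unfolding i_def by (intro Max_ge) auto
      then show False by simp
    qed
    have eq: "multibang us m t = ((us i + us (Suc i)) * t - us i * us (Suc i)) / 2"
      using mid us1 i_def by (simp add: multibang_def Let_def)
    have at: "multibang us m t = mb_slope i * t + mb_offset i"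
      unfolding eq using i by (simp add: mb_slope_def mb_offset_def field_simps)
    \<comment> \<open>The active chord lies above t^2 / 2, while the inactive pieces treated below,
      including the outer ones, lie below it at this t.\<close>
    have ge: "t\<^sup>2 / 2 \<le> multibang us m t"
      unfolding eq chord using i it by (simp add: mult_nonneg_nonpos)
    have "mb_slope k * t + mb_offset k \<le> multibang us m t" if km: "k \<le> m" for k
    proof -
      consider "k = 0" | "k = i" | "1 \<le> k" "k < m" "k \<noteq> i" | "k = m" using km by linarith
      then show ?thesis
      proof cases
        case 1
        have "- us m * t \<le> 0" using mid us_m_pos by (simp add: mult_nonneg_nonneg)
        moreover have "0 \<le> t\<^sup>2 / 2" by simp
        moreover have "mb_slope k * t + mb_offset k = - us m * t" using 1
          by (simp add: mb_slope_def mb_offset_def)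
        ultimately show ?thesis using ge by linarith
      next
        case 2 then show ?thesis using at by simp
      next
        case 3
        have "0 \<le> (t - us k) * (t - us (Suc k))"
        proof (cases "k < i")
          case True
          then have "us (Suc k) \<le> us i" "us k \<le> us i" using 3 i by (auto intro!: us_le)
          then show ?thesis using i by simp
        next
          case False
          then have "us (Suc i) \<le> us k" "us (Suc i) \<le> us (Suc k)" using 3 i by (auto intro!: us_le)
          then show ?thesis using it by (simp add: mult_nonpos_nonpos)
        qed
        then have "((us k + us (Suc k)) * t - us k * us (Suc k)) / 2 \<le> t\<^sup>2 / 2" unfolding chord by simp
        moreover have "mb_slope k * t + mb_offset k = ((us k + us (Suc k)) * t - us k * us (Suc k)) / 2"
          using 3 by (simp add: mb_slope_def mb_offset_def field_simps)
        ultimately show ?thesis using ge by simp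
      next
        case 4
        have "mb_slope k * t + mb_offset k = us m * t - (us m)\<^sup>2 / 2" using 4 m
          by (simp add: mb_slope_def mb_offset_def)
        moreover have "0 \<le> (t - us m)\<^sup>2 / 2" by simp
        ultimately show ?thesis using ge unfolding last by linarith
      qed
    qed
    then show ?thesis using at i by (intro conjI exI[of _ i]) auto
  next
    case high
    have eq: "multibang us m t = us m * t - (us m)\<^sup>2 / 2" using high us1 by (simp add: multibang_def)
    have "mb_slope k * t + mb_offset k \<le> multibang us m t" if km: "k \<le> m" for k
    proof -
      consider "k = 0" | "1 \<le> k" "k < m" | "k = m" using km by linarith
      then show ?thesis
      proof cases
        case 1
        have "(us m)\<^sup>2 \<le> us m * t" unfolding power2_eq_square using high us_m_pos
          by (intro mult_left_mono) auto
        moreover have "0 \<le> us m * t" using high us_m_pos by simp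
        ultimately have "- (us m * t) \<le> us m * t - (us m)\<^sup>2 / 2" by linarith
        then show ?thesis unfolding eq using 1 by (simp add: mb_slope_def mb_offset_def)
      next
        case 2
        have b: "0 \<le> us k" "us k \<le> us m" "us (Suc k) \<le> us m" using us_bounds[of k] us_bounds[of "Suc k"] 2
          by auto
        \<comment> \<open>This product compares the chord with the last branch at t = us m; the next
          one uses the larger slope of that branch to continue to the right.\<close>
        have "(us m - us k) * (us m - us (Suc k)) \<ge> 0" using b by simp
        moreover have "(us m - (us k + us (Suc k)) / 2) * (t - us m) \<ge> 0" using b high by simp
        ultimately have "((us k + us (Suc k)) * t - us k * us (Suc k)) / 2 \<le> us m * t - (us m)\<^sup>2 / 2"
          by (simp add: power2_eq_square field_simps)
        then show ?thesis unfolding eq using 2 by (simp add: mb_slope_def mb_offset_def field_simps)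
      next
        case 3 then show ?thesis unfolding eq using m by (simp add: mb_slope_def mb_offset_def)
      qed
    qed
    moreover have "multibang us m t = mb_slope m * t + mb_offset m" unfolding eq using m
      by (simp add: mb_slope_def mb_offset_def)
    ultimately show ?thesis by auto
  qed
  then show "\<exists>k\<le>m. multibang us m t = mb_slope k * t + mb_offset k"
    and "k \<le> m \<Longrightarrow> mb_slope k * t + mb_offset k \<le> multibang us m t" by auto
qed

lemma multibang_convex: "convex_on UNIV (multibang us m)"
  unfolding convex_on_def
proof (intro conjI ballI allI impI convex_UNIV)
  fix x y u v :: real assume uv: "0 \<le> u" "0 \<le> v" "u + v = 1"
  obtain k where k: "k \<le> m" "multibang us m (u *\<^sub>R x + v *\<^sub>R y) = mb_slope k * (u *\<^sub>R x + v *\<^sub>R y)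
    + mb_offset k"
    using multibang_max(1) by blast
  have "mb_slope k * (u *\<^sub>R x + v *\<^sub>R y) + mb_offset k = mb_slope k * (u *\<^sub>R x + v *\<^sub>R y) + (u
    + v) * mb_offset k" using uv by simp
  also have "\<dots> = u * (mb_slope k * x + mb_offset k) + v * (mb_slope k * y + mb_offset k)"
    by (simp add: algebra_simps)
  also have "\<dots> \<le> u * multibang us m x + v * multibang us m y"
    using uv by (intro add_mono mult_left_mono multibang_max(2)[OF k(1)])
  finally show "multibang us m (u *\<^sub>R x + v *\<^sub>R y) \<le> u * multibang us m x + v * multibang us m y"
    using k(2) by simp
qed

lemma multibang_Lipschitz: "(us m)-lipschitz_on UNIV (multibang us m)"
proof (rule lipschitz_onI)
  have one: "multibang us m x - multibang us m y \<le> us m * \<bar>x - y\<bar>" for x y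
  proof -
    obtain k where k: "k \<le> m" "multibang us m x = mb_slope k * x + mb_offset k" using multibang_max(1)
      by blast
    have "multibang us m x - multibang us m y \<le> mb_slope k * (x - y)"
      using multibang_max(2)[OF k(1), of y] k(2) by (simp add: algebra_simps)
    also have "\<dots> \<le> \<bar>mb_slope k\<bar> * \<bar>x - y\<bar>" by (metis abs_ge_self abs_mult)
    also have "\<dots> \<le> us m * \<bar>x - y\<bar>" by (intro mult_right_mono mb_slope_bound[OF k(1)]) auto
    finally show ?thesis .
  qed
  show "dist (multibang us m x) (multibang us m y) \<le> us m * dist x y" for x y
    using one[of x y] one[of y x] by (simp add: dist_real_def abs_le_iff abs_minus_commute)
  show "0 \<le> us m" using us_m_pos by simp
qed

end

section \<open>The smoothed truncation\<close>

lemma power_max0_deriv: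
  "((\<lambda>x. max 0 x ^ Suc (Suc n)) has_real_derivative (real (Suc (Suc n)) * max 0 x ^ Suc n)) (at x)"
proof -
  consider "x < 0" | "x = 0" | "x > 0" by linarith
  then show ?thesis
  proof cases
    case 1
    have "((\<lambda>x. max 0 x ^ Suc (Suc n)) has_real_derivative 0) (at x)"
      by (rule has_field_derivative_transform_within_open[of "\<lambda>_. 0" 0 x "{..<0}"]) (use 1 in auto)
    then show ?thesis using 1 by simp
  next
    case 2
    \<comment> \<open>The exponent is at least 2, so the difference quotient at the kink is a
      positive power of the positive part and tends to 0.\<close>
    have "((\<lambda>y. (max 0 y ^ Suc (Suc n) - max 0 0 ^ Suc (Suc n)) / (y - 0)) \<longlongrightarrow> 0) (at (0::real))"
    proof (rule Lim_transform_eventually)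
      show "((\<lambda>y. max 0 y ^ Suc n) \<longlongrightarrow> 0) (at (0::real))"
        by (rule tendsto_eq_intros tendsto_max refl | simp)+
      show "\<forall>\<^sub>F y in at (0::real). max 0 y ^ Suc n = (max 0 y ^ Suc (Suc n) - max 0 0 ^ Suc (Suc n)) / (y
        - 0)"
        unfolding eventually_at_filter by (rule always_eventually) (auto simp: max_def)
    qed
    then show ?thesis using 2 by (simp add: has_field_derivative_iff)
  next
    case 3
    have "((\<lambda>x. x ^ Suc (Suc n)) has_real_derivative (real (Suc (Suc n)) * x ^ Suc n)) (at x)"
      by (rule DERIV_power_Suc[THEN DERIV_cong, OF DERIV_ident]) simp
    then have "((\<lambda>x. max 0 x ^ Suc (Suc n)) has_real_derivative (real (Suc (Suc n)) * x ^ Suc n)) (at x)"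
      by (rule has_field_derivative_transform_within_open[of _ _ _ "{0<..}"]) (use 3 in auto)
    then show ?thesis using 3 by simp
  qed
qed

text \<open>Both transition zones of \<open>rho\<close> are rescaled copies of one cubic profile; the positive parts make
  its differentiability at the nodes automatic.\<close>

definition profile :: "real \<Rightarrow> real" where
  "profile x = x + max 0 x ^ 2 - max 0 x ^ 3 + max 0 (x - 1) ^ 3 + 2 * max 0 (x - 1) ^ 2"

definition profile' :: "real \<Rightarrow> real" where
  "profile' x = 1 + 2 * max 0 x - 3 * max 0 x ^ 2 + 3 * max 0 (x - 1) ^ 2 + 4 * max 0 (x - 1)"

lemma profile_deriv: "(profile has_real_derivative profile' x) (at x)"
proof -
  have s: "((\<lambda>x. max 0 x ^ 2) has_real_derivative 2 * max 0 x) (at x)" for x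
    using power_max0_deriv[of 0 x] by (simp add: numeral_2_eq_2)
  have q: "((\<lambda>x. max 0 x ^ 3) has_real_derivative 3 * max 0 x ^ 2) (at x)" for x
    using power_max0_deriv[of 1 x] by (simp add: numeral_3_eq_3 numeral_2_eq_2)
  have sh: "((\<lambda>x. F (x - 1)) has_real_derivative d) (at x)" if "(F has_real_derivative d) (at (x
    - 1))" for F d
    using that DERIV_shift[of F d x "-1"] by simp
  have s1: "((\<lambda>x. max 0 (x - 1) ^ 2) has_real_derivative 2 * max 0 (x - 1)) (at x)"
    using sh[of "\<lambda>x. max 0 x ^ 2"] s by blast
  have q1: "((\<lambda>x. max 0 (x - 1) ^ 3) has_real_derivative 3 * max 0 (x - 1) ^ 2) (at x)"
    using sh[of "\<lambda>x. max 0 x ^ 3"] q by blast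
  have "(profile has_real_derivative (1 + 2 * max 0 x - 3 * max 0 x ^ 2 + 3 * max 0 (x - 1) ^ 2
    + 2 * (2 * max 0 (x - 1)))) (at x)"
    unfolding profile_def[abs_def] by (intro DERIV_add DERIV_diff DERIV_ident s q s1 q1 DERIV_cmult)
  then show ?thesis by (simp add: profile'_def)
qed

lemma profile'_bound: "\<bar>profile' x\<bar> \<le> 2"
proof -
  consider "x \<le> 0" | "0 \<le> x" "x \<le> 1" | "1 \<le> x" by linarith
  then show ?thesis
  proof cases
    case 1 then show ?thesis by (simp add: profile'_def)
  next
    case 2
    have "profile' x = (1 - x) * (1 + 3 * x)" using 2
      by (simp add: profile'_def power2_eq_square algebra_simps)
    moreover have "0 \<le> (1 - x) * (1 + 3 * x)" using 2 by simp
    \<comment> \<open>The maximum of this parabola is 4 / 3, attained at x = 1 / 3.\<close>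
    moreover have "(1 - x) * (1 + 3 * x) \<le> 2"
      using zero_le_power2[of "x - 1/3"] by (simp add: power2_eq_square algebra_simps)
    ultimately show ?thesis by simp
  next
    case 3
    then show ?thesis by (simp add: profile'_def power2_eq_square algebra_simps)
  qed
qed

text \<open>The profile is the identity on the negative axis. For t \<le> um the first profile
  therefore cancels um - t and leaves minus e times the second; for t \<ge> 0 the second cancels - t
  and leaves um plus e times the first. At most one of them is nonlinear at a given t.\<close>

lemma rho_profile:
  assumes e: "e > 0" and um: "um > 0"
  shows "rho e um t = um - t + e * profile ((t - um) / e) - e * profile (- t / e)"
proof -
  have low: "profile x = x" if "x \<le> 0" for x using that by (simp add: profile_def)
  have mid: "profile x = x + x\<^sup>2 - x ^ 3" if "0 \<le> x" "x \<le> 1" for x using that by (simp add: profile_def)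
  have high: "profile x = 1" if "1 \<le> x" for x
    using that by (simp add: profile_def power2_eq_square power3_eq_cube algebra_simps)
  have lo1: "profile ((t - um) / e) = (t - um) / e" if "t \<le> um"
    by (rule low) (use that e in \<open>simp add: divide_le_0_iff\<close>)
  have lo2: "profile (- t / e) = - t / e" if "0 \<le> t"
    by (rule low) (use that e in \<open>simp add: divide_le_0_iff\<close>)
  have mi1: "profile ((t - um) / e) = (t - um) / e + ((t - um) / e)\<^sup>2 - ((t - um) / e) ^ 3" if "um \<le> t" "t
    \<le> um + e"
    by (rule mid) (use that e in \<open>auto simp: pos_divide_le_eq\<close>)
  have mi2: "profile (- t / e) = (- t / e) + (- t / e)\<^sup>2 - (- t / e) ^ 3" if "- e \<le> t" "t \<le> 0"
    by (rule mid) (use that e in \<open>auto simp: pos_divide_le_eq pos_le_divide_eq simp del: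
      minus_divide_left[symmetric] divide_minus_left\<close>)
  have hi1: "profile ((t - um) / e) = 1" if "um + e \<le> t"
    by (rule high) (use that e in \<open>simp add: pos_le_divide_eq\<close>)
  have hi2: "profile (- t / e) = 1" if "t \<le> - e"
    by (rule high) (use that e in \<open>simp add: pos_le_divide_eq del: divide_minus_left\<close>)
  consider "t \<le> - e" | "- e < t" "t \<le> 0" | "0 < t" "t \<le> um" | "um < t" "t \<le> um + e" | "um + e < t"
    by linarith
  then show ?thesis
  proof cases
    case 1
    have p: "profile ((t - um) / e) = (t - um) / e" "profile (- t / e) = 1"
      using 1 e um lo1 hi2 by auto
    show ?thesis unfolding p using 1 e by (simp add: rho_def)
  next
    case 2
    have p: "profile ((t - um) / e) = (t - um) / e" "profile (- t / e) = (- t / e) + (- t / e)\<^sup>2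
      - (- t / e) ^ 3"
      by (rule lo1, use 2 um in simp, rule mi2) (use 2 in auto)
    show ?thesis unfolding p using 2 e
      by (simp add: rho_def power2_eq_square power3_eq_cube field_simps)
  next
    case 3
    have p: "profile ((t - um) / e) = (t - um) / e" "profile (- t / e) = - t / e"
      by (rule lo1, use 3 in simp, rule lo2) (use 3 in auto)
    show ?thesis unfolding p using 3 e by (simp add: rho_def)
  next
    case 4
    have p: "profile ((t - um) / e) = (t - um) / e + ((t - um) / e)\<^sup>2 - ((t - um) / e) ^ 3"
      "profile (- t / e) = - t / e"
      by (rule mi1, use 4 in simp, use 4 in simp, rule lo2) (use 4 um in auto)
    show ?thesis unfolding p using 4 e um
      by (simp add: rho_def power2_eq_square power3_eq_cube field_simps)
  next
    case 5
    have p: "profile ((t - um) / e) = 1" "profile (- t / e) = - t / e"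
      by (rule hi1, use 5 in simp, rule lo2) (use 5 e um in auto)
    show ?thesis unfolding p using 5 e um by (simp add: rho_def)
  qed
qed

lemma profile_range: "0 \<le> x \<Longrightarrow> 0 \<le> profile x \<and> profile x \<le> 1"
proof -
  assume x: "0 \<le> x"
  show ?thesis
  proof (cases "x \<le> 1")
    case True
    have p: "profile x = x + x\<^sup>2 - x ^ 3" using x True by (simp add: profile_def)
    have "profile x = x + x\<^sup>2 * (1 - x)" unfolding p
      by (simp add: power2_eq_square power3_eq_cube algebra_simps)
    moreover have "1 - profile x = (1 - x) * (1 - x) * (1 + x)" unfolding p
      by (simp add: power2_eq_square power3_eq_cube algebra_simps)
    moreover have "0 \<le> x\<^sup>2 * (1 - x)" "0 \<le> (1 - x) * (1 - x) * (1 + x)" using x True by auto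
    ultimately show ?thesis using x by linarith
  next
    case False
    then have "profile x = 1" by (simp add: profile_def power2_eq_square power3_eq_cube algebra_simps)
    then show ?thesis by simp
  qed
qed

lemma rho_range:
  assumes e: "e > 0" and um: "um > 0"
  shows "- e \<le> rho e um t" "rho e um t \<le> um + e"
proof -
  have low: "profile x = x" if "x \<le> 0" for x using that by (simp add: profile_def)
  consider "t \<le> 0" | "0 < t" "t \<le> um" | "um < t" by linarith
  then have "- e \<le> rho e um t \<and> rho e um t \<le> um + e"
  proof cases
    case 1
    have "profile ((t - um) / e) = (t - um) / e" by (rule low) (use 1 e um in \<open>simp add: divide_le_0_iff\<close>)
    then have "rho e um t = - (e * profile (- t / e))" using e um by (simp add: rho_profile)
    moreover have "0 \<le> - t / e" using 1 e by (intro divide_nonneg_pos) auto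
    then have "0 \<le> profile (- t / e)" "profile (- t / e) \<le> 1" using profile_range by auto
    then have "0 \<le> e * profile (- t / e)" "e * profile (- t / e) \<le> e * 1" using e
      by (auto intro: mult_left_mono)
    ultimately show ?thesis using um e by linarith
  next
    case 2
    then show ?thesis using e by (simp add: rho_def)
  next
    case 3
    have "profile (- t / e) = - t / e" by (rule low) (use 3 e um in \<open>simp add: divide_le_0_iff\<close>)
    then have "rho e um t = um + e * profile ((t - um) / e)" using e um by (simp add: rho_profile)
    moreover have "0 \<le> (t - um) / e" using 3 e by (intro divide_nonneg_pos) auto
    then have "0 \<le> profile ((t - um) / e)" "profile ((t - um) / e) \<le> 1" using profile_range by auto
    then have "0 \<le> e * profile ((t - um) / e)" "e * profile ((t - um) / e) \<le> e * 1" using e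
      by (auto intro: mult_left_mono)
    ultimately show ?thesis using um e by linarith
  qed
  then show "- e \<le> rho e um t" "rho e um t \<le> um + e" by auto
qed

lemma phi_deriv:
  assumes e: "e > 0" and u: "umin < umax"
  shows "(phi e umin umax has_real_derivative (profile' ((t - (umax - umin)) / e) + profile' (- t / e)
    - 1)) (at t)"
proof -
  let ?um = "umax - umin"
  have "((\<lambda>t. (t - ?um) / e) has_real_derivative 1 / e) (at t)" using e
    by (auto intro!: derivative_eq_intros)
  then have 1: "((\<lambda>t. profile ((t - ?um) / e)) has_real_derivative profile' ((t
    - ?um) / e) * (1 / e)) (at t)"
    by (rule DERIV_chain2[OF profile_deriv])
  have "((\<lambda>t. - t / e) has_real_derivative - 1 / e) (at t)" using e by (auto intro!: derivative_eq_intros)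
  then have 2: "((\<lambda>t. profile (- t / e)) has_real_derivative profile' (- t / e) * (- 1 / e)) (at t)"
    by (rule DERIV_chain2[OF profile_deriv])
  have "((\<lambda>t. umin + (?um - t + e * profile ((t - ?um) / e) - e * profile (- t / e))) has_real_derivative
     (0 + (0 - 1 + e * (profile' ((t - ?um) / e) * (1 / e)) - e * (profile' (- t / e) * (- 1 / e))))) (at
       t)"
    by (intro DERIV_add DERIV_diff DERIV_const DERIV_ident DERIV_cmult 1 2)
  moreover have "phi e umin umax = (\<lambda>t. umin + (?um - t + e * profile ((t - ?um) / e)
    - e * profile (- t / e)))"
    using e u by (simp add: fun_eq_iff phi_def rho_profile)
  moreover have "0 + (0 - 1 + e * (profile' ((t - ?um) / e) * (1 / e))
    - e * (profile' (- t / e) * (- 1 / e)))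
      = profile' ((t - ?um) / e) + profile' (- t / e) - 1"
    using e by simp
  ultimately show ?thesis by (simp only:)
qed

lemma phi_deriv_eq:
  "e > 0 \<Longrightarrow> umin < umax \<Longrightarrow> deriv (phi e umin umax) t = profile' ((t - (umax - umin)) / e)
    + profile' (- t / e) - 1"
  by (intro DERIV_imp_deriv phi_deriv)

text \<open>The constant is 2 + 2 + 1, from the slopes of the two profiles and the constant
  term.\<close>

lemma phi_deriv_bound: "e > 0 \<Longrightarrow> umin < umax \<Longrightarrow> \<bar>deriv (phi e umin umax) t\<bar> \<le> 5"
  using profile'_bound[of "(t - (umax - umin)) / e"] profile'_bound[of "- t / e"]
  by (simp only: phi_deriv_eq)

lemma phi_deriv_measurable:
  assumes "e > 0" "umin < umax" shows "deriv (phi e umin umax) \<in> borel_measurable borel"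
proof -
  have [measurable]: "profile' \<in> borel_measurable borel" unfolding profile'_def[abs_def] by measurable
  have "deriv (phi e umin umax) = (\<lambda>t. profile' ((t - (umax - umin)) / e) + profile' (- t / e) - 1)"
    using phi_deriv_eq[OF assms] by (simp add: fun_eq_iff)
  then show ?thesis by simp
qed

lemma phi_Lipschitz:
  assumes "e > 0" "umin < umax" shows "5-lipschitz_on UNIV (phi e umin umax)"
proof (rule lipschitz_onI)
  have main: "\<bar>phi e umin umax b - phi e umin umax a\<bar> \<le> 5 * (b - a)" if ab: "a < b" for a b
  proof -
    have "\<exists>x>a. x < b \<and> phi e umin umax b - phi e umin umax a = (b - a) * deriv (phi e umin umax) x"
      by (rule MVT2[OF ab]) (use phi_deriv[OF assms] phi_deriv_eq[OF assms] in simp)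
    then obtain x where "phi e umin umax b - phi e umin umax a = (b - a) * deriv (phi e umin umax) x"
      by blast
    then have "\<bar>phi e umin umax b - phi e umin umax a\<bar> = (b - a) * \<bar>deriv (phi e umin umax) x\<bar>"
      using ab by (simp add: abs_mult)
    also have "\<dots> \<le> (b - a) * 5" using ab by (intro mult_left_mono phi_deriv_bound assms) auto
    finally show ?thesis by simp
  qed
  show "dist (phi e umin umax x) (phi e umin umax y) \<le> 5 * dist x y" for x y
    using main[of x y] main[of y x] by (cases x y rule: linorder_cases) (auto simp: dist_real_def)
qed simp

lemma phi_range:
  assumes "e > 0" "umin < umax"
  shows "umin - e \<le> phi e umin umax t" "phi e umin umax t \<le> umax + e"
  using rho_range[OF assms(1), of "umax - umin" t] assms(2) by (auto simp: phi_def)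

lemma phi_const:
  assumes e: "e > 0" and u: "umin < umax"
  shows "umax - umin + e \<le> t \<Longrightarrow> phi e umin umax t = phi e umin umax (umax - umin + e)"
    and "t \<le> - (umax - umin + e) \<Longrightarrow> phi e umin umax t = phi e umin umax (- (umax - umin + e))"
proof -
  let ?um = "umax - umin"
  have high: "profile x = 1" if "1 \<le> x" for x
    using that by (simp add: profile_def power2_eq_square power3_eq_cube algebra_simps)
  have low: "profile x = x" if "x \<le> 0" for x using that by (simp add: profile_def)
  have "rho e ?um t = ?um + e" if "?um + e \<le> t" for t
  proof -
    have "profile ((t - ?um) / e) = 1"
      by (rule high) (use that e in \<open>simp add: pos_le_divide_eq\<close>)
    moreover have "profile (- t / e) = - t / e"
      by (rule low) (use that e u in \<open>simp add: divide_le_0_iff\<close>)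
    ultimately show ?thesis using e u by (simp add: rho_profile)
  qed
  then show "?um + e \<le> t \<Longrightarrow> phi e umin umax t = phi e umin umax (?um + e)" by (simp add: phi_def)
  show "t \<le> - (?um + e) \<Longrightarrow> phi e umin umax t = phi e umin umax (- (?um + e))"
    using u by (simp add: phi_def rho_def)
qed

section \<open>Lebesgue spaces\<close>

lemma Lp_measurable: "f \<in> Lp q \<Omega> \<Longrightarrow> f \<in> borel_measurable (lebesgue_on \<Omega>)"
  by (simp add: Lp_def)

lemma Lp_bounded:
  fixes f :: "'a::euclidean_space \<Rightarrow> real"
  assumes "finite_measure (lebesgue_on \<Omega>)" "f \<in> borel_measurable (lebesgue_on \<Omega>)"
    "AE x in lebesgue_on \<Omega>. \<bar>f x\<bar> \<le> B" "q \<ge> 0"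
  shows "f \<in> Lp q \<Omega>"
proof -
  interpret finite_measure "lebesgue_on \<Omega>" by fact
  have [measurable]: "f \<in> borel_measurable (lebesgue_on \<Omega>)" by fact
  have "integrable (lebesgue_on \<Omega>) (\<lambda>x. norm (f x) powr q)"
  proof (rule integrable_const_bound[of _ "B powr q"])
    show "AE x in lebesgue_on \<Omega>. norm (norm (f x) powr q) \<le> B powr q"
      using assms(3) by eventually_elim (use assms(4) in \<open>auto intro: powr_mono2\<close>)
  qed measurable
  then show ?thesis using assms(2) by (simp add: Lp_def)
qed

lemma Lp_bound:
  fixes f g :: "'a::euclidean_space \<Rightarrow> real"
  assumes g: "g \<in> Lp q \<Omega>" and f: "f \<in> borel_measurable (lebesgue_on \<Omega>)" and q: "q \<ge> 0"
    and le: "AE x in lebesgue_on \<Omega>. \<bar>f x\<bar> \<le> k * \<bar>g x\<bar>" and k: "k \<ge> 0"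
  shows "f \<in> Lp q \<Omega>"
proof -
  have [measurable]: "f \<in> borel_measurable (lebesgue_on \<Omega>)" by fact
  have "integrable (lebesgue_on \<Omega>) (\<lambda>x. norm (f x) powr q)"
  proof (rule Bochner_Integration.integrable_bound)
    show "integrable (lebesgue_on \<Omega>) (\<lambda>x. k powr q * norm (g x) powr q)" using g by (simp add: Lp_def)
    show "AE x in lebesgue_on \<Omega>. norm (norm (f x) powr q) \<le> norm (k powr q * norm (g x) powr q)"
      using le
    proof eventually_elim
      case (elim x)
      then have "norm (f x) powr q \<le> (k * \<bar>g x\<bar>) powr q" using q by (intro powr_mono2) auto
      then show ?case using k by (simp add: powr_mult)
    qed
  qed measurable
  then show ?thesis using f by (simp add: Lp_def)
qed

lemma Lp_add:
  fixes f g :: "'a::euclidean_space \<Rightarrow> real"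
  assumes f: "f \<in> Lp q \<Omega>" and g: "g \<in> Lp q \<Omega>" and q: "q \<ge> 0"
  shows "(\<lambda>x. f x + g x) \<in> Lp q \<Omega>"
proof -
  have [measurable]: "f \<in> borel_measurable (lebesgue_on \<Omega>)" "g \<in> borel_measurable (lebesgue_on \<Omega>)"
    using f g by (auto simp: Lp_def)
  have "integrable (lebesgue_on \<Omega>) (\<lambda>x. norm (f x + g x) powr q)"
  proof (rule Bochner_Integration.integrable_bound)
    show "integrable (lebesgue_on \<Omega>) (\<lambda>x. 2 powr q * (norm (f x) powr q + norm (g x) powr q))" using f g
      by (simp add: Lp_def)
    show "AE x in lebesgue_on \<Omega>. norm (norm (f x + g x) powr q) \<le> norm (2 powr q * (norm (f x) powr q
      + norm (g x) powr q))"
    proof (rule AE_I2)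
      fix x
      have "norm (f x + g x) powr q \<le> (2 * max \<bar>f x\<bar> \<bar>g x\<bar>) powr q" using q by (intro powr_mono2) auto
      also have "\<dots> = 2 powr q * (max \<bar>f x\<bar> \<bar>g x\<bar>) powr q" by (simp add: powr_mult)
      also have "(max \<bar>f x\<bar> \<bar>g x\<bar>) powr q \<le> norm (f x) powr q + norm (g x) powr q" by (auto simp: max_def)
      finally show "norm (norm (f x + g x) powr q) \<le> norm (2 powr q * (norm (f x) powr q
        + norm (g x) powr q))"
        by (simp add: mult_left_mono)
    qed
  qed measurable
  then show ?thesis by (simp add: Lp_def)
qed

lemma Lp_cmult:
  fixes f :: "'a::euclidean_space \<Rightarrow> real"
  assumes "f \<in> Lp q \<Omega>" "q \<ge> 0" shows "(\<lambda>x. c * f x) \<in> Lp q \<Omega>"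
  by (rule Lp_bound[OF assms(1) _ assms(2), of _ "\<bar>c\<bar>"]) (use Lp_measurable[OF assms(1)] in \<open>auto simp:
    abs_mult\<close>)

lemma Lp_diff:
  fixes f g :: "'a::euclidean_space \<Rightarrow> real"
  assumes "f \<in> Lp q \<Omega>" "g \<in> Lp q \<Omega>" "q \<ge> 0" shows "(\<lambda>x. f x - g x) \<in> Lp q \<Omega>"
  using Lp_add[OF assms(1) Lp_cmult[OF assms(2,3), of "-1"] assms(3)] by simp

lemma Lp_imp_integrable:
  fixes f :: "'a::euclidean_space \<Rightarrow> real"
  assumes "finite_measure (lebesgue_on \<Omega>)" "f \<in> Lp q \<Omega>" "q \<ge> 1"
  shows "integrable (lebesgue_on \<Omega>) f"
proof -
  interpret finite_measure "lebesgue_on \<Omega>" by fact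
  show ?thesis
  proof (rule Bochner_Integration.integrable_bound[OF _ Lp_measurable[OF assms(2)]])
    show "integrable (lebesgue_on \<Omega>) (\<lambda>x. 1 + norm (f x) powr q)" using assms(2) by (simp add: Lp_def)
    have "a \<le> 1 + a powr q" if "a \<ge> 0" for a :: real
    proof (cases "a \<le> 1")
      case False
      then have "a powr 1 \<le> a powr q" using assms(3) by (intro powr_mono) auto
      then show ?thesis using False by simp
    qed (use powr_ge_zero[of a q] in linarith)
    then show "AE x in lebesgue_on \<Omega>. norm (f x) \<le> norm (1 + norm (f x) powr q)"
      by (intro AE_I2) (simp add: abs_of_nonneg)
  qed
qed

lemma Lp_dual_integrable:
  fixes f g :: "'a::euclidean_space \<Rightarrow> real"
  assumes f: "f \<in> Lp p \<Omega>" and g: "g \<in> Lp q \<Omega>" and pq: "p > 1" "q > 1" "1 / p + 1 / q = 1"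
  shows "integrable (lebesgue_on \<Omega>) (\<lambda>x. f x * g x)"
proof (rule Bochner_Integration.integrable_bound)
  have [measurable]: "f \<in> borel_measurable (lebesgue_on \<Omega>)" "g \<in> borel_measurable (lebesgue_on \<Omega>)"
    using f g by (auto simp: Lp_def)
  show "integrable (lebesgue_on \<Omega>) (\<lambda>x. norm (f x) powr p / p + norm (g x) powr q / q)" using f g
    by (simp add: Lp_def)
  show "(\<lambda>x. f x * g x) \<in> borel_measurable (lebesgue_on \<Omega>)" by measurable
  show "AE x in lebesgue_on \<Omega>. norm (f x * g x) \<le> norm (norm (f x) powr p / p + norm (g x) powr q / q)"
  proof (rule AE_I2)
    fix x
    have "\<bar>f x\<bar> * \<bar>g x\<bar> \<le> \<bar>f x\<bar> powr p / p + \<bar>g x\<bar> powr q / q" by (rule Youngs_inequality[OF pq]) auto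
    then show "norm (f x * g x) \<le> norm (norm (f x) powr p / p + norm (g x) powr q / q)"
      by (simp add: abs_mult)
  qed
qed

text \<open>The inner product is at most the square of the larger norm, so its power s / 2 is at
  most the sum of the s-th powers.\<close>

lemma Lp_inner_half:
  fixes f g :: "'a::euclidean_space \<Rightarrow> 'b::euclidean_space"
  assumes f: "f \<in> Lp s \<Omega>" and g: "g \<in> Lp s \<Omega>" and s: "s > 0"
  shows "(\<lambda>x. f x \<bullet> g x) \<in> Lp (s / 2) \<Omega>"
proof -
  have [measurable]: "f \<in> borel_measurable (lebesgue_on \<Omega>)" "g \<in> borel_measurable (lebesgue_on \<Omega>)"
    using f g by (auto simp: Lp_def)
  have "integrable (lebesgue_on \<Omega>) (\<lambda>x. norm (f x \<bullet> g x) powr (s / 2))"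
  proof (rule Bochner_Integration.integrable_bound)
    show "integrable (lebesgue_on \<Omega>) (\<lambda>x. norm (f x) powr s + norm (g x) powr s)" using f g
      by (simp add: Lp_def)
    show "AE x in lebesgue_on \<Omega>. norm (norm (f x \<bullet> g x) powr (s / 2)) \<le> norm (norm (f x) powr s
      + norm (g x) powr s)"
    proof (rule AE_I2)
      fix x
      let ?M = "max (norm (f x)) (norm (g x))"
      have M: "0 \<le> ?M" by (rule order_trans[OF norm_ge_zero max.cobounded1])
      have "\<bar>f x \<bullet> g x\<bar> \<le> norm (f x) * norm (g x)" by (rule Cauchy_Schwarz_ineq2)
      also have "\<dots> \<le> ?M * ?M" by (intro mult_mono M) auto
      finally have "\<bar>f x \<bullet> g x\<bar> powr (s / 2) \<le> (?M * ?M) powr (s / 2)" using s by (intro powr_mono2) auto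
      also have "\<dots> = ?M powr (s / 2) * ?M powr (s / 2)" using M by (simp only: powr_mult)
      also have "\<dots> = ?M powr s" using M by (simp flip: powr_add)
      also have "\<dots> \<le> norm (f x) powr s + norm (g x) powr s" by (auto simp: max_def)
      finally show "norm (norm (f x \<bullet> g x) powr (s / 2)) \<le> norm (norm (f x) powr s + norm (g x) powr s)"
        by simp
    qed
  qed measurable
  then show ?thesis by (simp add: Lp_def)
qed

section \<open>Regularity of the reduced gradient\<close>

lemma state_weak_solution:
  fixes \<Omega> :: "'a::euclidean_space set"
  assumes \<Omega>: "open \<Omega>" "bounded \<Omega>" and f: "f \<in> Lp 2 \<Omega>" and c: "c > 0"
    and wm: "w \<in> borel_measurable (lebesgue_on \<Omega>)" and wb: "AE x in lebesgue_on \<Omega>. c \<le> w x \<and> w x \<le> K"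
  shows "weak_solution \<Omega> w f (state \<Omega> f w)"
proof -
  have "f \<in> L2 (lebesgue_on \<Omega>)" using f by (simp add: Lp2_eq_L2)
  from weak_solution_exists[OF \<Omega> wm c wb this] show ?thesis unfolding state_def by (rule someI_ex)
qed

lemma adjoint_weak_solution:
  fixes \<Omega> :: "'a::euclidean_space set"
  assumes \<Omega>: "open \<Omega>" "bounded \<Omega>" and f: "f \<in> Lp 2 \<Omega>" and z: "z \<in> Lp 2 \<Omega>" and c: "c > 0"
    and wm: "w \<in> borel_measurable (lebesgue_on \<Omega>)" and wb: "AE x in lebesgue_on \<Omega>. c \<le> w x \<and> w x \<le> K"
  shows "(\<lambda>x. - (state \<Omega> f w x - z x)) \<in> Lp 2 \<Omega>"
    and "weak_solution \<Omega> w (\<lambda>x. - (state \<Omega> f w x - z x)) (adjoint_state \<Omega> f z w)"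
proof -
  have "state \<Omega> f w \<in> W1p 2 \<Omega>" using state_weak_solution[OF \<Omega> f c wm wb]
    by (simp add: weak_solution_def W1p0_def)
  then have "state \<Omega> f w \<in> L2 (lebesgue_on \<Omega>)" by (rule W12_L2(1)[OF \<Omega>(1)])
  then have "(\<lambda>x. (-1) * (state \<Omega> f w x - z x)) \<in> L2 (lebesgue_on \<Omega>)" using z
    by (intro L2_cmult L2_diff) (auto simp: Lp2_eq_L2)
  then have L: "(\<lambda>x. - (state \<Omega> f w x - z x)) \<in> L2 (lebesgue_on \<Omega>)" by simp
  then show "(\<lambda>x. - (state \<Omega> f w x - z x)) \<in> Lp 2 \<Omega>" by (simp add: Lp2_eq_L2)
  show "weak_solution \<Omega> w (\<lambda>x. - (state \<Omega> f w x - z x)) (adjoint_state \<Omega> f z w)"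
    unfolding adjoint_state_def using weak_solution_exists[OF \<Omega> wm c wb L] by (rule someI_ex)
qed

text \<open>The state and the adjoint state solve equations with coefficient w and right-hand sides
  in L^2, so the regularity hypothesis puts both into W^{1,s}, and the inner product of their
  gradients into L^{s/2}.\<close>

lemma tracking_deriv_Lp:
  fixes \<Omega> :: "'a::euclidean_space set"
  assumes \<Omega>: "open \<Omega>" "bounded \<Omega>" and f: "f \<in> Lp 2 \<Omega>" and z: "z \<in> Lp 2 \<Omega>" and c: "c > 0"
    and wm: "w \<in> borel_measurable (lebesgue_on \<Omega>)" and wb: "AE x in lebesgue_on \<Omega>. c \<le> w x \<and> w x \<le> K"
    and reg: "regularity_exponent \<Omega> \<epsilon> umin umax s" and adm: "w \<in> admissible_coeff \<Omega> \<epsilon> umin umax"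
  shows "tracking_deriv \<Omega> f z w \<in> Lp (s / 2) \<Omega>"
proof -
  have s: "s > 2" and W: "\<And>r y. r \<in> Lp 2 \<Omega> \<Longrightarrow> weak_solution \<Omega> w r y \<Longrightarrow> y \<in> W1p s \<Omega>"
    using reg adm by (auto simp: regularity_exponent_def)
  have "state \<Omega> f w \<in> W1p s \<Omega>" by (rule W[OF f state_weak_solution[OF \<Omega> f c wm wb]])
  moreover have "adjoint_state \<Omega> f z w \<in> W1p s \<Omega>"
    by (rule W[OF adjoint_weak_solution[OF \<Omega> f z c wm wb]])
  ultimately show ?thesis
    unfolding tracking_deriv_def using s by (intro Lp_inner_half W1p_weak_grad(2)[OF \<Omega>(1)]) auto
qed

section \<open>The optimality condition\<close>

definition truncate_at :: "real \<Rightarrow> real \<Rightarrow> real" where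
  "truncate_at k t = max (- k) (min t k)"

lemma truncate_at_Lipschitz: "1-lipschitz_on UNIV (truncate_at k)"
  by (rule lipschitz_onI) (auto simp: truncate_at_def dist_real_def abs_if max_def min_def)

lemma truncate_at_zero: "0 \<le> k \<Longrightarrow> truncate_at k 0 = 0"
  by (auto simp: truncate_at_def)

lemma truncate_at_bound: "0 \<le> k \<Longrightarrow> \<bar>truncate_at k t\<bar> \<le> k"
  by (auto simp: truncate_at_def)

lemma truncate_at_abs_le: "0 \<le> k \<Longrightarrow> \<bar>truncate_at k t\<bar> \<le> \<bar>t\<bar>"
  by (auto simp: truncate_at_def)

lemma truncate_at_eq: "\<bar>t\<bar> \<le> k \<Longrightarrow> truncate_at k t = t"
  by (auto simp: truncate_at_def)

lemma truncate_at_tendsto: "(\<lambda>n. truncate_at (real n) t) \<longlonglongrightarrow> t"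
proof (rule tendsto_eventually)
  obtain N where "\<bar>t\<bar> \<le> real N" using real_arch_simple by blast
  then show "\<forall>\<^sub>F n in sequentially. truncate_at (real n) t = t"
    by (intro eventually_sequentiallyI[of N]) (auto intro!: truncate_at_eq)
qed

lemma truncate_at_measurable: "truncate_at k \<in> borel_measurable borel"
  unfolding truncate_at_def[abs_def] by measurable

section \<open>The minimizer and its first-order condition\<close>

locale bv_minimizer =
  fixes \<Omega> :: "'a::euclidean_space set" and f z u :: "'a \<Rightarrow> real"
    and \<alpha> \<beta> \<epsilon> umin umax s :: real and us :: "nat \<Rightarrow> real" and m :: nat
  assumes dom: "bounded_lipschitz_domain \<Omega>" and \<alpha>: "\<alpha> > 0" and \<beta>: "\<beta> > 0"
    and f: "f \<in> Lp 2 \<Omega>" and z: "z \<in> Lp 2 \<Omega>"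
    and umin: "0 < umin" and umax: "umin < umax"
    and m: "2 \<le> m" and us1: "us 1 = 0" and usm: "us m = umax - umin"
    and mono: "\<And>i. i \<in> {1..<m} \<Longrightarrow> us i < us (Suc i)"
    and \<epsilon>: "0 < \<epsilon>" "\<epsilon> < umin / 4"
    and reg: "regularity_exponent \<Omega> \<epsilon> umin umax s"
    and minimizer: "local_minimizer_BV \<Omega> (objective \<Omega> \<alpha> \<beta> \<epsilon> umin umax us m f z) u"
begin

abbreviation "D \<equiv> lebesgue_on \<Omega>"
abbreviation "g \<equiv> multibang us m"
abbreviation "\<Phi> \<equiv> phi \<epsilon> umin umax"
abbreviation "p \<equiv> s / (s - 2)"
abbreviation "R \<equiv> umax - umin + \<epsilon>"

definition reduced_gradient :: "'a \<Rightarrow> real" where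
  "reduced_gradient x = tracking_deriv \<Omega> f z (superpos \<epsilon> umin umax u) x * superpos_deriv \<epsilon> umin umax u x"

lemma \<Omega>: "open \<Omega>" "bounded \<Omega>"
  using dom by (auto simp: bounded_lipschitz_domain_def)

lemma fin: "finite_measure D"
  by (rule finite_measure_domain[OF \<Omega>])

text \<open>The exponent p is conjugate to s / 2; the last identity says that subgradients with
  respect to L^p live where the reduced gradient does.\<close>

lemma s: "s > 2" and p: "p > 1" "s / 2 > 1" "1 / p + 1 / (s / 2) = 1" "p / (p - 1) = s / 2"
proof -
  show s: "s > 2" using reg by (simp add: regularity_exponent_def)
  show "p > 1" "s / 2 > 1" using s by (auto simp: field_simps)
  show "1 / p + 1 / (s / 2) = 1" using s by (simp add: field_simps)
  have "p - 1 = 2 / (s - 2)" using s by (simp add: field_simps)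
  then show "p / (p - 1) = s / 2" using s by (simp add: field_simps)
qed

lemma u_BV: "u \<in> BV \<Omega>"
  using minimizer by (simp add: local_minimizer_BV_def)

lemma BV_integrable: "v \<in> BV \<Omega> \<Longrightarrow> integrable D v"
  by (simp add: BV_def)

lemma BV_measurable: "v \<in> BV \<Omega> \<Longrightarrow> v \<in> borel_measurable D"
  by (rule borel_measurable_integrable[OF BV_integrable])

lemma g_convex: "convex_on UNIV g"
  by (rule multibang_convex[OF m us1 mono])

lemma g_Lipschitz: "(us m)-lipschitz_on UNIV g"
  by (rule multibang_Lipschitz[OF m us1 mono])

lemma g_measurable [measurable]: "g \<in> borel_measurable borel"
  by (rule borel_measurable_continuous_onI[OF lipschitz_on_continuous_on[OF g_Lipschitz]])

lemma dg_measurable [measurable]: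
  "dplus g \<in> borel_measurable borel" "dminus g \<in> borel_measurable borel"
  by (rule dplus_measurable[OF g_convex g_Lipschitz])+

lemma g_abs: "\<bar>g t\<bar> \<le> us m * \<bar>t\<bar>"
proof -
  have "g 0 = 0" using us1 by (simp add: multibang_def)
  then show ?thesis using lipschitz_onD[OF g_Lipschitz, of t 0] by (simp add: dist_real_def)
qed

lemma g_integrable: assumes "integrable D v" shows "integrable D (\<lambda>x. g (v x))"
proof (rule Bochner_Integration.integrable_bound)
  have [measurable]: "v \<in> borel_measurable D" using assms by simp
  show "integrable D (\<lambda>x. us m * \<bar>v x\<bar>)" using assms by simp
  show "(\<lambda>x. g (v x)) \<in> borel_measurable D" by measurable
  show "AE x in D. norm (g (v x)) \<le> norm (us m * \<bar>v x\<bar>)"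
    using g_abs by (intro AE_I2) (auto intro: order_trans[OF _ abs_ge_self])
qed

lemma dg_bound: "\<bar>max (dminus g t * h) (dplus g t * h)\<bar> \<le> us m * \<bar>h\<bar>"
proof -
  have "\<bar>dminus g t * h\<bar> \<le> us m * \<bar>h\<bar>" "\<bar>dplus g t * h\<bar> \<le> us m * \<bar>h\<bar>"
    unfolding abs_mult by (intro mult_right_mono dminus_abs[OF g_Lipschitz] dplus_abs[OF g_Lipschitz]
      abs_ge_zero)+
  then show ?thesis by (simp add: max_def)
qed

lemma truncation_BV:
  assumes "v \<in> BV \<Omega>" "0 \<le> k"
  shows "(\<lambda>x. truncate_at k (v x)) \<in> BV \<Omega>" "tv \<Omega> (\<lambda>x. truncate_at k (v x)) \<le> tv \<Omega> v"
  by (rule Lipschitz_comp_BV[OF \<Omega>(1) assms(1) truncate_at_Lipschitz truncate_at_zero[OF assms(2)]])+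

text \<open>The point u + t (v - u) has BV distance at most t (\<integral> |v - u| + TV v + TV u)
  from u, so local minimality applies for small t. Convexity of TV makes its contribution linear in
  t at once, while the tracking term and G are kept as increments because their limits are taken by
  different arguments.\<close>

lemma descent:
  assumes v: "v \<in> BV \<Omega>"
  obtains t0 where "0 < t0" "t0 \<le> 1"
    "\<And>t. 0 < t \<Longrightarrow> t \<le> t0 \<Longrightarrow>
      0 \<le> tracking \<Omega> f z (\<lambda>x. \<Phi> (u x + t * (v x - u x))) - tracking \<Omega> f z (\<lambda>x. \<Phi> (u x))
        + \<alpha> * ((\<integral>x. g (u x + t * (v x - u x)) \<partial>D) - (\<integral>x. g (u x) \<partial>D)) + t * (\<beta> * (tv \<Omega> v - tv \<Omega> u))"
proof -
  obtain \<delta> where \<delta>: "\<delta> > 0"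
    and min: "\<And>w. w \<in> BV \<Omega> \<Longrightarrow> BV_norm \<Omega> (\<lambda>x. w x - u x) < ereal \<delta> \<Longrightarrow>
      objective \<Omega> \<alpha> \<beta> \<epsilon> umin umax us m f z u \<le> objective \<Omega> \<alpha> \<beta> \<epsilon> umin umax us m f z w"
    using minimizer by (auto simp: local_minimizer_BV_def)
  define A where "A = (\<integral>x. \<bar>v x - u x\<bar> \<partial>D) + tv \<Omega> v + tv \<Omega> u"
  have A: "A \<ge> 0" unfolding A_def using tv_nonneg[OF \<Omega>(1)] v u_BV
    by (intro add_nonneg_nonneg Bochner_Integration.integral_nonneg) auto
  show ?thesis
  proof (rule that)
    \<comment> \<open>The cap at 1 keeps the combination convex; A + 1 covers A = 0, and the factor
      2 makes the inequality for the distance strict.\<close>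
    show "0 < min 1 (\<delta> / (2 * (A + 1)))" using \<delta> A by simp
    fix t assume t: "0 < t" "t \<le> min 1 (\<delta> / (2 * (A + 1)))"
    have "t * A \<le> t * (A + 1)" using t by simp
    also have "\<dots> \<le> \<delta> / (2 * (A + 1)) * (A + 1)" using t A by (intro mult_right_mono) auto
    also have "\<dots> = \<delta> / 2" using A by (simp add: field_simps)
    also have "\<dots> < \<delta>" using \<delta> by simp
    finally have tA: "t * A < \<delta>" .
    let ?w = "\<lambda>x. u x + t * (v x - u x)"
    have w_eq: "?w = (\<lambda>x. (1 - t) * u x + t * v x)" by (auto simp: algebra_simps)
    have w: "?w \<in> BV \<Omega>" unfolding w_eq by (rule BV_lincomb(1)[OF \<Omega>(1) u_BV v])
    have tvw: "tv \<Omega> ?w \<le> (1 - t) * tv \<Omega> u + t * tv \<Omega> v"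
      unfolding w_eq using BV_lincomb(2)[OF \<Omega>(1) u_BV v, of "1 - t" t] t by simp
    have d_eq: "(\<lambda>x. ?w x - u x) = (\<lambda>x. (- t) * u x + t * v x)" by (auto simp: algebra_simps)
    have d: "(\<lambda>x. ?w x - u x) \<in> BV \<Omega>" unfolding d_eq by (rule BV_lincomb(1)[OF \<Omega>(1) u_BV v])
    have tvd: "tv \<Omega> (\<lambda>x. ?w x - u x) \<le> t * tv \<Omega> u + t * tv \<Omega> v"
      unfolding d_eq using BV_lincomb(2)[OF \<Omega>(1) u_BV v, of "- t" t] t by simp
    have "(\<integral>x. \<bar>?w x - u x\<bar> \<partial>D) = t * (\<integral>x. \<bar>v x - u x\<bar> \<partial>D)" using t by (simp add: abs_mult)
    then have "BV_norm \<Omega> (\<lambda>x. ?w x - u x) \<le> ereal (t * A)"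
      unfolding BV_norm_def TV_eq_tv[OF \<Omega>(1) d] A_def using tvd by (simp add: algebra_simps)
    also have "\<dots> < ereal \<delta>" using tA by simp
    finally have "objective \<Omega> \<alpha> \<beta> \<epsilon> umin umax us m f z u \<le> objective \<Omega> \<alpha> \<beta> \<epsilon> umin umax us m f z ?w"
      by (rule min[OF w])
    then have "tracking \<Omega> f z (\<lambda>x. \<Phi> (u x)) + \<alpha> * (\<integral>x. g (u x) \<partial>D) + \<beta> * tv \<Omega> u
        \<le> tracking \<Omega> f z (\<lambda>x. \<Phi> (?w x)) + \<alpha> * (\<integral>x. g (?w x) \<partial>D) + \<beta> * tv \<Omega> ?w"
      unfolding objective_def TV_eq_tv[OF \<Omega>(1) w] TV_eq_tv[OF \<Omega>(1) u_BV] superpos_def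
        multibang_functional_def by simp
    moreover have "\<beta> * tv \<Omega> ?w \<le> \<beta> * ((1 - t) * tv \<Omega> u + t * tv \<Omega> v)" using tvw \<beta> by simp
    ultimately show "0 \<le> tracking \<Omega> f z (\<lambda>x. \<Phi> (u x + t * (v x - u x))) - tracking \<Omega> f z (\<lambda>x. \<Phi> (u x))
        + \<alpha> * ((\<integral>x. g (u x + t * (v x - u x)) \<partial>D) - (\<integral>x. g (u x) \<partial>D)) + t * (\<beta> * (tv \<Omega> v - tv \<Omega> u))"
      by (simp add: algebra_simps)
  qed simp
qed

text \<open>Truncating \<open>u\<close> at \<open>R\<close> leaves \<open>\<Phi>(u)\<close> unchanged and does not increase \<open>TV\<close>; the strict decrease
  of \<open>G\<close> where \<open>\<bar>u\<bar> > R\<close> forces that set to be negligible.\<close>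

lemma u_bounded: "AE x in D. \<bar>u x\<bar> \<le> R"
proof -
  have R: "0 < R" using umax \<epsilon> by simp
  let ?v = "\<lambda>x. truncate_at R (u x)"
  let ?e = "\<lambda>x. max 0 (\<bar>u x\<bar> - R)"
  have v: "?v \<in> BV \<Omega>" "tv \<Omega> ?v \<le> tv \<Omega> u" using truncation_BV[OF u_BV] R by auto
  obtain t where t: "0 < t" "t \<le> 1" and *: "\<And>t'. 0 < t' \<Longrightarrow> t' \<le> t \<Longrightarrow>
      0 \<le> tracking \<Omega> f z (\<lambda>x. \<Phi> (u x + t' * (?v x - u x))) - tracking \<Omega> f z (\<lambda>x. \<Phi> (u x))
        + \<alpha> * ((\<integral>x. g (u x + t' * (?v x - u x)) \<partial>D) - (\<integral>x. g (u x) \<partial>D)) + t' * (\<beta> * (tv \<Omega> ?v - tv \<Omega> u))"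
    using descent[OF v(1)] by blast
  \<comment> \<open>Minimality is available only for small steps, so the comparison is made on the
    segment towards the truncation and not at its end. For |y| > R this segment stays beyond R or -
    R, where \<Phi> is constant and g is affine with slope us m or - us m.\<close>
  have pt: "\<Phi> (y + t * (truncate_at R y - y)) = \<Phi> y \<and>
      g (y + t * (truncate_at R y - y)) = g y - t * us m * max 0 (\<bar>y\<bar> - R)" for y
  proof -
    consider "\<bar>y\<bar> \<le> R" | "R < y" | "y < - R" by linarith
    then show ?thesis
    proof cases
      case 1
      then show ?thesis by (simp add: truncate_at_eq)
    next
      case 2
      have T: "truncate_at R y = R" using 2 R by (simp add: truncate_at_def)
      have "t * (y - R) \<le> 1 * (y - R)" using t 2 by (intro mult_right_mono) auto
      then have ge: "R \<le> y + t * (R - y)" by (simp add: algebra_simps)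
      have "g w = us m * w - (us m)\<^sup>2 / 2" if "R \<le> w" for w
        using that us1 usm umax \<epsilon> by (simp add: multibang_def)
      from this[OF ge] this[of y] have "g (y + t * (R - y)) = g y - t * us m * (y - R)"
        using 2 by (simp add: algebra_simps)
      moreover have "\<Phi> (y + t * (R - y)) = \<Phi> y"
        using phi_const(1)[OF \<epsilon>(1) umax ge] phi_const(1)[OF \<epsilon>(1) umax, of y] 2 by simp
      ultimately show ?thesis unfolding T using 2 R by simp
    next
      case 3
      have T: "truncate_at R y = - R" using 3 R by (simp add: truncate_at_def)
      have "t * (- R - y) \<le> 1 * (- R - y)" using t 3 by (intro mult_right_mono) auto
      then have le: "y + t * (- R - y) \<le> - R" by (simp add: algebra_simps)
      have "g w = - us m * w" if "w \<le> - R" for w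
        using that us1 R by (simp add: multibang_def)
      from this[OF le] this[of y] have "g (y + t * (- R - y)) = g y - t * us m * (- y - R)"
        using 3 by (simp add: algebra_simps)
      moreover have "\<Phi> (y + t * (- R - y)) = \<Phi> y"
        using phi_const(2)[OF \<epsilon>(1) umax le] phi_const(2)[OF \<epsilon>(1) umax, of y] 3 by simp
      ultimately show ?thesis unfolding T using 3 R by simp
    qed
  qed
  interpret finite_measure D by (rule fin)
  have u: "integrable D u" by (rule BV_integrable[OF u_BV])
  have e: "integrable D ?e" using u
    by (intro Bochner_Integration.integrable_max Bochner_Integration.integrable_diff) auto
  have "(\<integral>x. g (u x) - t * us m * ?e x \<partial>D) = (\<integral>x. g (u x) \<partial>D) - t * us m * (\<integral>x. ?e x \<partial>D)"
    using g_integrable[OF u] e by (subst Bochner_Integration.integral_diff) auto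
  then have "0 \<le> - (\<alpha> * (t * us m * (\<integral>x. ?e x \<partial>D))) + t * (\<beta> * (tv \<Omega> ?v - tv \<Omega> u))"
    using *[OF t(1) order_refl] by (simp add: pt)
  moreover have "t * (\<beta> * (tv \<Omega> ?v - tv \<Omega> u)) \<le> 0"
    using t \<beta> v(2) by (intro mult_nonneg_nonpos) auto
  ultimately have "(\<alpha> * (t * us m)) * (\<integral>x. ?e x \<partial>D) \<le> 0" by (simp add: mult.assoc)
  moreover have "0 < \<alpha> * (t * us m)" using \<alpha> t usm umax by simp
  ultimately have "(\<integral>x. ?e x \<partial>D) \<le> 0" by (metis mult_pos_pos not_le)
  moreover have "0 \<le> (\<integral>x. ?e x \<partial>D)" by (rule Bochner_Integration.integral_nonneg) simp
  ultimately have "(\<integral>x. ?e x \<partial>D) = 0" by simp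
  then have "AE x in D. ?e x = 0" using integral_nonneg_eq_0_iff_AE[OF e] by simp
  then show ?thesis by eventually_elim (simp add: max_def split: if_splits)
qed

lemma u_Lp: "q \<ge> 0 \<Longrightarrow> u \<in> Lp q \<Omega>"
  by (rule Lp_bounded[OF fin BV_measurable[OF u_BV] u_bounded])

lemma \<Phi>_measurable [measurable]: "\<Phi> \<in> borel_measurable borel"
  by (rule borel_measurable_continuous_onI[OF lipschitz_on_continuous_on[OF phi_Lipschitz[OF \<epsilon>(1) umax]]])

lemma reduced_gradient_Lp: "reduced_gradient \<in> Lp (s / 2) \<Omega>"
proof -
  have [measurable]: "u \<in> borel_measurable D" by (rule BV_measurable[OF u_BV])
  have d[measurable]: "deriv \<Phi> \<in> borel_measurable borel" by (rule phi_deriv_measurable[OF \<epsilon>(1) umax])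
  let ?w = "superpos \<epsilon> umin umax u"
  have wm[measurable]: "?w \<in> borel_measurable D" unfolding superpos_def by measurable
  have rng: "umin - \<epsilon> \<le> ?w x" "?w x \<le> umax + \<epsilon>" for x
    using phi_range[OF \<epsilon>(1) umax] by (auto simp: superpos_def)
  have "\<bar>?w x\<bar> \<le> umax + \<epsilon>" for x using rng[of x] \<epsilon> umin by (auto simp: abs_if)
  moreover have "umin / 2 - 2 * \<epsilon> < ?w x \<and> ?w x < 2 * umax + 2 * \<epsilon>" for x
    using rng[of x] \<epsilon> umin umax by auto
  ultimately have adm: "?w \<in> admissible_coeff \<Omega> \<epsilon> umin umax"
    by (auto simp: admissible_coeff_def Linfty_def intro!: AE_I2)
  \<comment> \<open>The bounds umin - \<epsilon> and umax + \<epsilon> come from the range of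
    \<Phi>; the lower one is a positive ellipticity constant because \<epsilon> < umin / 4.\<close>
  have tL: "tracking_deriv \<Omega> f z ?w \<in> Lp (s / 2) \<Omega>"
    using \<epsilon> umin rng by (intro tracking_deriv_Lp[OF \<Omega> f z _ wm _ reg adm, of "umin - \<epsilon>" "umax
      + \<epsilon>"]) (auto intro!: AE_I2)
  from Lp_measurable[OF this] have [measurable]: "tracking_deriv \<Omega> f z ?w \<in> borel_measurable D" .
  have m: "reduced_gradient \<in> borel_measurable D"
    unfolding reduced_gradient_def[abs_def] superpos_deriv_def by measurable
  have le: "AE x in D. \<bar>reduced_gradient x\<bar> \<le> 5 * \<bar>tracking_deriv \<Omega> f z ?w x\<bar>"
  proof (rule AE_I2)
    fix x
    have "\<bar>tracking_deriv \<Omega> f z ?w x\<bar> * \<bar>deriv \<Phi> (u x)\<bar> \<le> \<bar>tracking_deriv \<Omega> f z ?w x\<bar> * 5"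
      by (intro mult_left_mono phi_deriv_bound[OF \<epsilon>(1) umax]) auto
    then show "\<bar>reduced_gradient x\<bar> \<le> 5 * \<bar>tracking_deriv \<Omega> f z ?w x\<bar>"
      by (simp add: reduced_gradient_def superpos_deriv_def abs_mult mult.commute)
  qed
  show ?thesis using p(2) by (intro Lp_bound[OF tL m _ le]) auto
qed

text \<open>The inequality of \<open>descent\<close> is divided by t. Boundedness of u and v gives
  the uniform bound \<tau> n * 5 (k + R) on the change of the coefficient, as the tracking
  derivative requires; the quotients of G are dominated by us m |v - u|.\<close>

lemma first_order_bounded:
  assumes v: "v \<in> BV \<Omega>" and k: "AE x in D. \<bar>v x\<bar> \<le> k"
  shows "0 \<le> (\<integral>x. reduced_gradient x * (v x - u x) \<partial>D)
    + \<alpha> * (\<integral>x. max (dminus g (u x) * (v x - u x)) (dplus g (u x) * (v x - u x)) \<partial>D) + \<beta> * (tv \<Omega> v - tv \<Omega> u)"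
proof -
  have [measurable]: "u \<in> borel_measurable D" "v \<in> borel_measurable D" using BV_measurable u_BV v by auto
  have iu: "integrable D u" "integrable D v" using BV_integrable u_BV v by auto
  obtain t0 where t0: "0 < t0" "t0 \<le> 1" and desc: "\<And>t. 0 < t \<Longrightarrow> t \<le> t0 \<Longrightarrow>
      0 \<le> tracking \<Omega> f z (\<lambda>x. \<Phi> (u x + t * (v x - u x))) - tracking \<Omega> f z (\<lambda>x. \<Phi> (u x))
        + \<alpha> * ((\<integral>x. g (u x + t * (v x - u x)) \<partial>D) - (\<integral>x. g (u x) \<partial>D)) + t * (\<beta> * (tv \<Omega> v - tv \<Omega> u))"
    using descent[OF v] by blast
  \<comment> \<open>A sequence in (0, t0] on which minimality is known; starting the reciprocals at
    Suc n keeps it below t0.\<close>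
  define \<tau> where "\<tau> n = t0 * inverse (real (Suc n))" for n
  have "inverse (real (Suc n)) \<le> 1" for n by (simp add: inverse_le_1_iff)
  then have \<tau>: "\<tau> n > 0" "\<tau> n \<le> t0" for n using t0 by (auto simp: \<tau>_def mult_le_cancel_left1)
  have \<tau>0: "\<tau> \<longlonglongrightarrow> 0" using tendsto_mult_left[OF LIMSEQ_inverse_real_of_nat, of t0]
    by (simp add: \<tau>_def[abs_def])
  let ?F = "\<lambda>n. (tracking \<Omega> f z (\<lambda>x. \<Phi> (u x + \<tau> n * (v x - u x))) - tracking \<Omega> f z (\<lambda>x. \<Phi> (u x))) / \<tau> n"
  let ?G = "\<lambda>n. ((\<integral>x. g (u x + \<tau> n * (v x - u x)) \<partial>D) - (\<integral>x. g (u x) \<partial>D)) / \<tau> n"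
  have rng: "AE x in D. umin - \<epsilon> \<le> \<Phi> (w x) \<and> \<Phi> (w x) \<le> umax + \<epsilon>" for w :: "'a \<Rightarrow> real"
    using phi_range[OF \<epsilon>(1) umax] by (intro AE_I2) auto
  have F: "?F \<longlonglongrightarrow> (\<integral>x. (deriv \<Phi> (u x) * (v x - u x)) * tracking_deriv \<Omega> f z (\<lambda>x. \<Phi> (u x)) x \<partial>D)"
  proof (rule tracking_directional_derivative[OF \<Omega> f z _ _ rng _ rng \<tau>(1) \<tau>0, where M = "5 * (k + R)"])
    show "0 < umin - \<epsilon>" using \<epsilon> umin by simp
    show "AE x in D. \<bar>\<Phi> (u x + \<tau> n * (v x - u x)) - \<Phi> (u x)\<bar> \<le> \<tau> n * (5 * (k + R))" for n
      using k u_bounded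
    proof eventually_elim
      case (elim x)
      have "\<bar>\<Phi> (u x + \<tau> n * (v x - u x)) - \<Phi> (u x)\<bar> \<le> 5 * \<bar>\<tau> n * (v x - u x)\<bar>"
        using lipschitz_onD[OF phi_Lipschitz[OF \<epsilon>(1) umax], of "u x + \<tau> n * (v x - u x)" "u x"]
          by (simp add: dist_real_def)
      also have "\<dots> = \<tau> n * (5 * \<bar>v x - u x\<bar>)" using \<tau>(1)[of n] by (simp add: abs_mult)
      also have "\<dots> \<le> \<tau> n * (5 * (k + R))" using elim \<tau>(1)[of n] by (intro mult_left_mono) auto
      finally show ?case .
    qed
    show "AE x in D. (\<lambda>n. (\<Phi> (u x + \<tau> n * (v x - u x)) - \<Phi> (u x)) / \<tau> n) \<longlonglongrightarrow> deriv \<Phi> (u x) * (v x - u x)"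
    proof (rule AE_I2)
      fix x
      have "(\<Phi> has_real_derivative deriv \<Phi> (u x)) (at (u x + 0 * (v x - u x)))"
        using phi_deriv[OF \<epsilon>(1) umax, of "u x"] phi_deriv_eq[OF \<epsilon>(1) umax, of "u x"] by simp
      moreover have "((\<lambda>r. u x + r * (v x - u x)) has_real_derivative v x - u x) (at 0)"
        by (auto intro!: derivative_eq_intros)
      ultimately have "((\<lambda>r. \<Phi> (u x + r * (v x - u x))) has_real_derivative deriv \<Phi> (u x) * (v x
        - u x)) (at 0)"
        by (rule DERIV_chain2)
      then have "(\<lambda>r. (\<Phi> (u x + r * (v x - u x)) - \<Phi> (u x)) / r) \<midarrow>0\<rightarrow> deriv \<Phi> (u x) * (v x - u x)"
        by (simp add: DERIV_def)
      moreover have "filterlim \<tau> (at 0) sequentially"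
        using \<tau>0 \<tau>(1) by (intro filterlim_atI) (auto intro!: always_eventually simp:
          less_imp_neq[symmetric])
      ultimately show "(\<lambda>n. (\<Phi> (u x + \<tau> n * (v x - u x)) - \<Phi> (u x)) / \<tau> n) \<longlonglongrightarrow> deriv \<Phi> (u x) * (v x - u x)"
        by (rule filterlim_compose)
    qed
    have [measurable]: "deriv \<Phi> \<in> borel_measurable borel" by (rule phi_deriv_measurable[OF \<epsilon>(1) umax])
    show "(\<lambda>x. deriv \<Phi> (u x) * (v x - u x)) \<in> borel_measurable D" by measurable
  qed measurable
  have "(\<lambda>n. \<integral>x. (g (u x + \<tau> n * (v x - u x)) - g (u x)) / \<tau> n \<partial>D)
      \<longlonglongrightarrow> (\<integral>x. max (dminus g (u x) * (v x - u x)) (dplus g (u x) * (v x - u x)) \<partial>D)"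
  proof (rule integral_dominated_convergence[where w = "\<lambda>x. us m * \<bar>v x - u x\<bar>"])
    show "integrable D (\<lambda>x. us m * \<bar>v x - u x\<bar>)" using iu by simp
    show "AE x in D. (\<lambda>n. (g (u x + \<tau> n * (v x - u x)) - g (u x)) / \<tau> n)
        \<longlonglongrightarrow> max (dminus g (u x) * (v x - u x)) (dplus g (u x) * (v x - u x))"
      by (intro AE_I2 directional_tendsto[OF g_convex g_Lipschitz \<tau>(1) \<tau>0])
    show "AE x in D. norm ((g (u x + \<tau> n * (v x - u x)) - g (u x)) / \<tau> n) \<le> us m * \<bar>v x - u x\<bar>" for n
    proof (rule AE_I2)
      fix x
      have "\<bar>g (u x + \<tau> n * (v x - u x)) - g (u x)\<bar> \<le> us m * \<bar>\<tau> n * (v x - u x)\<bar>"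
        using lipschitz_onD[OF g_Lipschitz, of "u x + \<tau> n * (v x - u x)" "u x"] by (simp add: dist_real_def)
      then show "norm ((g (u x + \<tau> n * (v x - u x)) - g (u x)) / \<tau> n) \<le> us m * \<bar>v x - u x\<bar>"
        using \<tau>(1)[of n] by (simp add: abs_mult pos_divide_le_eq mult_ac)
    qed
  qed measurable
  moreover have "(\<lambda>n. \<integral>x. (g (u x + \<tau> n * (v x - u x)) - g (u x)) / \<tau> n \<partial>D) = ?G"
    using g_integrable[of "\<lambda>x. u x + \<tau> _ * (v x - u x)"] g_integrable[of u] iu by (intro ext) simp
  ultimately have G: "?G \<longlonglongrightarrow> (\<integral>x. max (dminus g (u x) * (v x - u x)) (dplus g (u x) * (v x - u x)) \<partial>D)"
    by (simp only:)
  have "0 \<le> ?F n + \<alpha> * ?G n + \<beta> * (tv \<Omega> v - tv \<Omega> u)" for n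
  proof -
    have "0 \<le> \<tau> n * (?F n + \<alpha> * ?G n + \<beta> * (tv \<Omega> v - tv \<Omega> u))"
      using desc[OF \<tau>, of n] \<tau>(1)[of n] by (simp add: distrib_left)
    then show ?thesis using \<tau>(1)[of n] by (simp add: zero_le_mult_iff)
  qed
  then have "0 \<le> (\<integral>x. (deriv \<Phi> (u x) * (v x - u x)) * tracking_deriv \<Omega> f z (\<lambda>x. \<Phi> (u x)) x \<partial>D)
      + \<alpha> * (\<integral>x. max (dminus g (u x) * (v x - u x)) (dplus g (u x) * (v x - u x)) \<partial>D) + \<beta> * (tv \<Omega> v - tv \<Omega>
        u)"
    by (intro LIMSEQ_le_const[OF tendsto_add[OF tendsto_add[OF F tendsto_mult_left[OF G]] tendsto_const]])
      auto
  then show ?thesis by (simp add: reduced_gradient_def superpos_def superpos_deriv_def mult_ac)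
qed

text \<open>The bounded case is applied to truncations of v. Their total variation is at most that
  of v, so the TV term is estimated before the limit and its convergence plays no part. The reduced
  gradient in L^{s/2} paired with v in L^p gives the majorant for the tracking term, while the
  penalty term has a majorant in L^1.\<close>

lemma first_order:
  assumes v: "v \<in> BV \<Omega>" "v \<in> Lp p \<Omega>"
  shows "0 \<le> (\<integral>x. reduced_gradient x * (v x - u x) \<partial>D)
    + \<alpha> * (\<integral>x. max (dminus g (u x) * (v x - u x)) (dplus g (u x) * (v x - u x)) \<partial>D) + \<beta> * (tv \<Omega> v - tv \<Omega> u)"
proof -
  have [measurable]: "u \<in> borel_measurable D" "v \<in> borel_measurable D" using BV_measurable u_BV v by auto
  have [measurable]: "reduced_gradient \<in> borel_measurable D" by (rule Lp_measurable[OF reduced_gradient_Lp])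
  have [measurable]: "truncate_at k \<in> borel_measurable borel" for k by (rule truncate_at_measurable)
  have iu: "integrable D u" "integrable D v" using BV_integrable u_BV v by auto
  have p0: "p \<ge> 0" using p by simp
  let ?h = "\<lambda>n x. truncate_at (real n) (v x) - u x"
  have h: "\<bar>?h n x\<bar> \<le> \<bar>v x\<bar> + \<bar>u x\<bar>" for n x using truncate_at_abs_le[of "real n" "v x"] by simp
  have h_lim: "(\<lambda>n. ?h n x) \<longlonglongrightarrow> v x - u x" for x by (intro tendsto_intros truncate_at_tendsto)
  have 1: "(\<lambda>n. \<integral>x. reduced_gradient x * ?h n x \<partial>D) \<longlonglongrightarrow> (\<integral>x. reduced_gradient x * (v x - u x) \<partial>D)"
  proof (rule integral_dominated_convergence[where w = "\<lambda>x. \<bar>v x * reduced_gradient x\<bar>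
    + \<bar>u x * reduced_gradient x\<bar>"])
    show "integrable D (\<lambda>x. \<bar>v x * reduced_gradient x\<bar> + \<bar>u x * reduced_gradient x\<bar>)"
      using Lp_dual_integrable[OF v(2) reduced_gradient_Lp p(1-3)] Lp_dual_integrable[OF u_Lp[OF p0]
        reduced_gradient_Lp p(1-3)]
      by simp
    show "AE x in D. (\<lambda>n. reduced_gradient x * ?h n x) \<longlonglongrightarrow> reduced_gradient x * (v x - u x)"
      by (intro AE_I2 tendsto_mult_left h_lim)
    show "AE x in D. norm (reduced_gradient x * ?h n x) \<le> \<bar>v x * reduced_gradient x\<bar>
      + \<bar>u x * reduced_gradient x\<bar>" for n
    proof (rule AE_I2)
      fix x
      have "\<bar>reduced_gradient x\<bar> * \<bar>?h n x\<bar> \<le> \<bar>reduced_gradient x\<bar> * (\<bar>v x\<bar> + \<bar>u x\<bar>)"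
        by (intro mult_left_mono h) auto
      then show "norm (reduced_gradient x * ?h n x) \<le> \<bar>v x * reduced_gradient x\<bar>
        + \<bar>u x * reduced_gradient x\<bar>"
        by (simp add: abs_mult distrib_right mult.commute)
    qed
  qed measurable
  have 2: "(\<lambda>n. \<integral>x. max (dminus g (u x) * ?h n x) (dplus g (u x) * ?h n x) \<partial>D)
      \<longlonglongrightarrow> (\<integral>x. max (dminus g (u x) * (v x - u x)) (dplus g (u x) * (v x - u x)) \<partial>D)"
  proof (rule integral_dominated_convergence[where w = "\<lambda>x. us m * (\<bar>v x\<bar> + \<bar>u x\<bar>)"])
    show "integrable D (\<lambda>x. us m * (\<bar>v x\<bar> + \<bar>u x\<bar>))" using iu by simp
    show "AE x in D. (\<lambda>n. max (dminus g (u x) * ?h n x) (dplus g (u x) * ?h n x))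
        \<longlonglongrightarrow> max (dminus g (u x) * (v x - u x)) (dplus g (u x) * (v x - u x))"
      by (intro AE_I2 tendsto_max tendsto_mult_left h_lim)
    show "AE x in D. norm (max (dminus g (u x) * ?h n x) (dplus g (u x) * ?h n x)) \<le> us m * (\<bar>v x\<bar>
      + \<bar>u x\<bar>)" for n
    proof (rule AE_I2)
      fix x
      have "us m * \<bar>?h n x\<bar> \<le> us m * (\<bar>v x\<bar> + \<bar>u x\<bar>)" using usm umax by (intro mult_left_mono h) auto
      then show "norm (max (dminus g (u x) * ?h n x) (dplus g (u x) * ?h n x)) \<le> us m * (\<bar>v x\<bar> + \<bar>u x\<bar>)"
        using dg_bound[of "u x" "?h n x"] by simp
    qed
  qed measurable
  have "0 \<le> (\<integral>x. reduced_gradient x * ?h n x \<partial>D)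
      + \<alpha> * (\<integral>x. max (dminus g (u x) * ?h n x) (dplus g (u x) * ?h n x) \<partial>D) + \<beta> * (tv \<Omega> v - tv \<Omega> u)" for n
  proof -
    have "\<beta> * (tv \<Omega> (\<lambda>x. truncate_at (real n) (v x)) - tv \<Omega> u) \<le> \<beta> * (tv \<Omega> v - tv \<Omega> u)"
      using truncation_BV(2)[OF v(1), of "real n"] \<beta> by simp
    moreover have "AE x in D. \<bar>truncate_at (real n) (v x)\<bar> \<le> real n" by (intro AE_I2 truncate_at_bound) simp
    ultimately show ?thesis
      using first_order_bounded[OF truncation_BV(1)[OF v(1), of "real n"], of "real n"] by simp
  qed
  then show ?thesis
    by (intro LIMSEQ_le_const[OF tendsto_add[OF tendsto_add[OF 1 tendsto_mult_left[OF 2]] tendsto_const]])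
      auto
qed

lemma multiplier:
  obtains \<xi> where "\<xi> \<in> borel_measurable D" "\<And>x. \<alpha> * dminus g (u x) \<le> \<xi> x" "\<And>x. \<xi> x \<le> \<alpha> * dplus g (u x)"
    "\<And>v. v \<in> BV \<Omega> \<Longrightarrow> v \<in> Lp p \<Omega> \<Longrightarrow>
      0 \<le> (\<integral>x. \<xi> x * (v x - u x) \<partial>D) + (\<integral>x. reduced_gradient x * (v x - u x) \<partial>D) + \<beta> * (tv \<Omega> v - tv \<Omega> u)"
proof -
  have [measurable]: "u \<in> borel_measurable D" using BV_measurable u_BV by auto
  have p0: "p \<ge> 0" and p1: "p \<ge> 1" using p by auto
  \<comment> \<open>Directions instead of points: u is moved to the origin because the functional to
    be linearized is homogeneous in h. All other terms are collected in q, which is convex through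
    TV.\<close>
  define C where "C = {h \<in> Lp p \<Omega>. (\<lambda>x. u x + h x) \<in> BV \<Omega>}"
  define q where "q h = (\<integral>x. reduced_gradient x * h x \<partial>D) + \<beta> * (tv \<Omega> (\<lambda>x. u x + h x) - tv \<Omega> u)" for h
  have grad_int: "integrable D (\<lambda>x. reduced_gradient x * h x)" if "h \<in> Lp p \<Omega>" for h
    using Lp_dual_integrable[OF that reduced_gradient_Lp p(1-3)] by (simp add: mult.commute)
  have comb: "c *\<^sub>R h + d *\<^sub>R k = (\<lambda>x. c * h x + d * k x)" for c d and h k :: "'a \<Rightarrow> real"
    by (auto simp: plus_fun_def scaleR_fun_def)
  have comb_u: "(\<lambda>x. u x + (c * h x + d * k x)) = (\<lambda>x. c * (u x + h x) + d * (u x + k x))" if "c + d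
    = 1" for c d h k
  proof
    fix x
    have "u x = (c + d) * u x" using that by simp
    then show "u x + (c * h x + d * k x) = c * (u x + h x) + d * (u x + k x)" by (simp add: algebra_simps)
  qed
  have "\<exists>\<xi>\<in>borel_measurable D. (\<forall>x. \<alpha> * dminus g (u x) \<le> \<xi> x \<and> \<xi> x \<le> \<alpha> * dplus g (u x))
      \<and> (\<forall>h\<in>C. 0 \<le> (\<integral>x. \<xi> x * h x \<partial>D) + q h)"
  proof (rule dominated_convex_representation[OF fin, where K = "\<alpha> * us m"])
    show "\<bar>\<alpha> * dminus g (u x)\<bar> \<le> \<alpha> * us m" "\<bar>\<alpha> * dplus g (u x)\<bar> \<le> \<alpha> * us m"
      "\<alpha> * dminus g (u x) \<le> \<alpha> * dplus g (u x)" for x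
      using \<alpha> dminus_abs[OF g_Lipschitz] dplus_abs[OF g_Lipschitz] dminus_le_dplus[OF g_convex g_Lipschitz]
      by (auto simp: abs_mult)
    show "integrable D h" if "h \<in> C" for h using Lp_imp_integrable[OF fin _ p1] that by (auto simp: C_def)
    have "(\<lambda>x. 0) \<in> Lp p \<Omega>" by (simp add: Lp_def)
    then have "(\<lambda>x. 0) \<in> C" using u_BV by (simp add: C_def)
    then show "C \<noteq> {}" by blast
    show "convex_on C q"
      unfolding convex_on_def
    proof (intro conjI ballI allI impI)
      show "convex C"
      proof (rule convexI)
        fix h k :: "'a \<Rightarrow> real" and c d :: real assume hk: "h \<in> C" "k \<in> C" and cd: "0 \<le> c" "0 \<le> d" "c + d
          = 1"
        have "(\<lambda>x. c * h x + d * k x) \<in> Lp p \<Omega>" using hk p0 by (intro Lp_add Lp_cmult) (auto simp: C_def)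
        moreover have "(\<lambda>x. u x + (c * h x + d * k x)) \<in> BV \<Omega>"
          unfolding comb_u[OF cd(3)] using hk by (intro BV_lincomb(1)[OF \<Omega>(1)]) (auto simp: C_def)
        ultimately show "c *\<^sub>R h + d *\<^sub>R k \<in> C" unfolding comb by (simp add: C_def)
      qed
      fix h k c d assume hk: "h \<in> C" "k \<in> C" and cd: "0 \<le> c" "0 \<le> d" "c + d = (1::real)"
      have hk': "integrable D (\<lambda>x. reduced_gradient x * h x)" "integrable D (\<lambda>x. reduced_gradient x * k x)"
        "(\<lambda>x. u x + h x) \<in> BV \<Omega>" "(\<lambda>x. u x + k x) \<in> BV \<Omega>"
        using hk grad_int by (auto simp: C_def)
      have "tv \<Omega> (\<lambda>x. u x + (c * h x + d * k x)) \<le> c * tv \<Omega> (\<lambda>x. u x + h x) + d * tv \<Omega> (\<lambda>x. u x + k x)"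
        unfolding comb_u[OF cd(3)] using BV_lincomb(2)[OF \<Omega>(1) hk'(3,4), of c d] cd by simp
      then have "tv \<Omega> (\<lambda>x. u x + (c * h x + d * k x)) - tv \<Omega> u
          \<le> c * (tv \<Omega> (\<lambda>x. u x + h x) - tv \<Omega> u) + d * (tv \<Omega> (\<lambda>x. u x + k x) - tv \<Omega> u)"
        using arg_cong[OF cd(3), of "\<lambda>r. r * tv \<Omega> u"] by (simp add: algebra_simps)
      from mult_left_mono[OF this, of \<beta>] \<beta>
      have "\<beta> * (tv \<Omega> (\<lambda>x. u x + (c * h x + d * k x)) - tv \<Omega> u)
          \<le> c * (\<beta> * (tv \<Omega> (\<lambda>x. u x + h x) - tv \<Omega> u)) + d * (\<beta> * (tv \<Omega> (\<lambda>x. u x + k x) - tv \<Omega> u))"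
        by (simp add: algebra_simps)
      moreover have "(\<integral>x. reduced_gradient x * (c * h x + d * k x) \<partial>D)
          = c * (\<integral>x. reduced_gradient x * h x \<partial>D) + d * (\<integral>x. reduced_gradient x * k x \<partial>D)"
      proof -
        have "(\<integral>x. reduced_gradient x * (c * h x + d * k x) \<partial>D)
            = (\<integral>x. c * (reduced_gradient x * h x) + d * (reduced_gradient x * k x)
              \<partial>D)" by (simp add: algebra_simps)
        then show ?thesis using hk' by simp
      qed
      ultimately show "q (c *\<^sub>R h + d *\<^sub>R k) \<le> c * q h + d * q k"
        unfolding comb q_def by (simp add: algebra_simps)
    qed
    show "0 \<le> (\<integral>x. max (\<alpha> * dminus g (u x) * h x) (\<alpha> * dplus g (u x) * h x) \<partial>D) + q h" if h: "h \<in> C" for h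
    proof -
      have "max (\<alpha> * dminus g (u x) * h x) (\<alpha> * dplus g (u x) * h x)
        = \<alpha> * max (dminus g (u x) * h x) (dplus g (u x) * h x)" for x
        using \<alpha> by (simp add: max_mult_distrib_left mult.assoc)
      then show ?thesis
        using first_order[of "\<lambda>x. u x + h x"] h Lp_add[OF u_Lp[OF p0] _ p0, of h] by (simp add: q_def C_def)
    qed
  qed measurable
  then obtain \<xi> where \<xi>: "\<xi> \<in> borel_measurable D" "\<And>x. \<alpha> * dminus g (u x) \<le> \<xi> x" "\<And>x. \<xi> x
    \<le> \<alpha> * dplus g (u x)"
    and *: "\<And>h. h \<in> C \<Longrightarrow> 0 \<le> (\<integral>x. \<xi> x * h x \<partial>D) + q h" by blast
  show ?thesis
  proof (rule that[OF \<xi>])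
    fix v assume v: "v \<in> BV \<Omega>" "v \<in> Lp p \<Omega>"
    have "(\<lambda>x. v x - u x) \<in> C" using v Lp_diff[OF v(2) u_Lp[OF p0] p0] by (simp add: C_def)
    from *[OF this] show "0 \<le> (\<integral>x. \<xi> x * (v x - u x) \<partial>D) + (\<integral>x. reduced_gradient x * (v x - u x) \<partial>D)
      + \<beta> * (tv \<Omega> v - tv \<Omega> u)"
      by (simp add: q_def)
  qed
qed

lemma optimality:
  "(\<lambda>x. - reduced_gradient x) \<in> weighted_sum
     \<alpha> (subdifferential_Lp p \<Omega> (\<lambda>u. ereal (multibang_functional \<Omega> us m u)) u)
     \<beta> (subdifferential_Lp p \<Omega> (TV \<Omega>) u)"
proof -
  obtain \<xi> where \<xi>: "\<xi> \<in> borel_measurable D" "\<And>x. \<alpha> * dminus g (u x) \<le> \<xi> x" "\<And>x. \<xi> x \<le> \<alpha> * dplus g (u x)"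
    and ineq: "\<And>v. v \<in> BV \<Omega> \<Longrightarrow> v \<in> Lp p \<Omega> \<Longrightarrow>
      0 \<le> (\<integral>x. \<xi> x * (v x - u x) \<partial>D) + (\<integral>x. reduced_gradient x * (v x - u x) \<partial>D) + \<beta> * (tv \<Omega> v - tv \<Omega> u)"
    using multiplier by blast
  have p0: "p \<ge> 0" and p1: "p \<ge> 1" and s0: "s / 2 \<ge> 0" using p by auto
  have uLp: "u \<in> Lp p \<Omega>" by (rule u_Lp[OF p0])
  have [measurable]: "\<xi> \<in> borel_measurable D" by fact
  have sub: "dminus g (u x) \<le> \<xi> x / \<alpha>" "\<xi> x / \<alpha> \<le> dplus g (u x)" for x
    using \<xi>(2,3)[of x] \<alpha> by (auto simp: pos_le_divide_eq pos_divide_le_eq mult.commute)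
  \<comment> \<open>Lying between the one-sided derivatives, the multiplier inherits the Lipschitz
    constant of g as a bound; on a domain of finite measure this puts it into L^{s/2}.\<close>
  have "\<bar>\<xi> x / \<alpha>\<bar> \<le> us m" for x
    using sub[of x] dminus_abs[OF g_Lipschitz, of "u x"] dplus_abs[OF g_Lipschitz, of "u x"] by linarith
  then have \<xi>_Lp: "(\<lambda>x. \<xi> x / \<alpha>) \<in> Lp (s / 2) \<Omega>" by (intro Lp_bounded[OF fin _ _ s0]) (auto intro!: AE_I2)
  from Lp_cmult[OF this s0, of \<alpha>] have \<xi>_Lp': "\<xi> \<in> Lp (s / 2) \<Omega>" using \<alpha> by simp
  have G: "(\<lambda>x. \<xi> x / \<alpha>) \<in> subdifferential_Lp p \<Omega> (\<lambda>u. ereal (multibang_functional \<Omega> us m u)) u"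
  proof -
    have "(\<integral>x. g (u x) \<partial>D) + (\<integral>x. \<xi> x / \<alpha> * (v x - u x) \<partial>D) \<le> (\<integral>x. g (v x) \<partial>D)" if v: "v \<in> Lp p \<Omega>" for v
    proof -
      have "integrable D (\<lambda>x. (v x - u x) * (\<xi> x / \<alpha>))"
        by (rule Lp_dual_integrable[OF Lp_diff[OF v uLp p0] \<xi>_Lp p(1-3)])
      then have i: "integrable D (\<lambda>x. \<xi> x / \<alpha> * (v x - u x))" by (simp only: mult.commute)
      have gu: "integrable D (\<lambda>x. g (u x))" "integrable D (\<lambda>x. g (v x))"
        using g_integrable Lp_imp_integrable[OF fin _ p1] uLp v by auto
      have "(\<integral>x. g (u x) \<partial>D) + (\<integral>x. \<xi> x / \<alpha> * (v x - u x) \<partial>D) = (\<integral>x. g (u x) + \<xi> x / \<alpha> * (v x - u x) \<partial>D)"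
        by (rule Bochner_Integration.integral_add[OF gu(1) i, symmetric])
      also have "\<dots> \<le> (\<integral>x. g (v x) \<partial>D)"
        by (intro integral_mono Bochner_Integration.integrable_add gu i subgradient_ineq[OF g_convex
          g_Lipschitz] sub)
      finally show ?thesis .
    qed
    then show ?thesis
      unfolding subdifferential_Lp_def p(4) multibang_functional_def using \<xi>_Lp uLp by simp
  qed
  \<comment> \<open>Solved from - reduced_gradient = \<alpha> (\<xi> / \<alpha>) + \<beta> \<eta>;
    the variational inequality divided by \<beta> is then the subgradient inequality for TV.\<close>
  let ?\<eta> = "\<lambda>x. (- 1 / \<beta>) * (reduced_gradient x + \<xi> x)"
  have \<eta>_Lp: "?\<eta> \<in> Lp (s / 2) \<Omega>" by (intro Lp_cmult Lp_add reduced_gradient_Lp \<xi>_Lp' s0)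
  have T: "?\<eta> \<in> subdifferential_Lp p \<Omega> (TV \<Omega>) u"
  proof -
    have "TV \<Omega> u + ereal (\<integral>x. ?\<eta> x * (v x - u x) \<partial>D) \<le> TV \<Omega> v" if v: "v \<in> Lp p \<Omega>" for v
    proof (cases "v \<in> BV \<Omega>")
      case False
      then show ?thesis by (simp add: TV_def)
    next
      case True
      have h: "(\<lambda>x. v x - u x) \<in> Lp p \<Omega>" by (rule Lp_diff[OF v uLp p0])
      have "integrable D (\<lambda>x. (v x - u x) * reduced_gradient x)" "integrable D (\<lambda>x. (v x - u x) * \<xi> x)"
        by (rule Lp_dual_integrable[OF h _ p(1-3)], rule reduced_gradient_Lp \<xi>_Lp')+
      then have i: "integrable D (\<lambda>x. reduced_gradient x * (v x - u x))" "integrable D (\<lambda>x. \<xi> x * (v x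
        - u x))"
        by (simp_all only: mult.commute)
      have "(\<integral>x. ?\<eta> x * (v x - u x) \<partial>D) = (\<integral>x. (- 1 / \<beta>) * (reduced_gradient x * (v x - u x) + \<xi> x * (v x
        - u x)) \<partial>D)"
        by (simp only: mult.assoc distrib_right)
      also have "\<dots> = (- 1 / \<beta>) * ((\<integral>x. reduced_gradient x * (v x - u x) \<partial>D) + (\<integral>x. \<xi> x * (v x - u x) \<partial>D))"
        using i by (simp only: Bochner_Integration.integral_mult_right_zero
          Bochner_Integration.integral_add)
      also have "\<dots> \<le> tv \<Omega> v - tv \<Omega> u"
        using ineq[OF True v] \<beta> by (simp add: field_simps)
      finally show ?thesis by (simp add: TV_eq_tv[OF \<Omega>(1)] True u_BV)
    qed
    then show ?thesis
      unfolding subdifferential_Lp_def p(4) using \<eta>_Lp uLp by (simp add: TV_eq_tv[OF \<Omega>(1) u_BV])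
  qed
  have eq: "(\<lambda>x. - reduced_gradient x) = (\<lambda>x. \<alpha> * (\<xi> x / \<alpha>) + \<beta> * ?\<eta> x)"
    using \<alpha> \<beta> by (simp add: fun_eq_iff)
  show ?thesis unfolding weighted_sum_def mem_Collect_eq
    by (intro exI conjI) (rule eq, rule G, rule T)
qed

lemma weighted_sum_Lp:
  "weighted_sum \<alpha> (subdifferential_Lp p \<Omega> H u) \<beta> (subdifferential_Lp p \<Omega> K u) \<subseteq> Lp (s / 2) \<Omega>"
  unfolding weighted_sum_def subdifferential_Lp_def p(4) using p(2) by (auto intro!: Lp_add Lp_cmult)

end

theorem theorem4p2:
  fixes \<Omega> :: "'a::euclidean_space set"
    and f z ubar :: "'a \<Rightarrow> real"
    and \<alpha> \<beta> \<epsilon> umin umax s :: real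
    and us :: "nat \<Rightarrow> real" and m :: nat
  assumes "bounded_lipschitz_domain \<Omega>"
    and "\<alpha> > 0" and "\<beta> > 0"
    and "f \<in> Lp 2 \<Omega>" and "z \<in> Lp 2 \<Omega>"
    and "0 < umin" and "umin < umax"
    and "2 \<le> m" and "us 1 = 0" and "us m = umax - umin"
    and "\<And>i. i \<in> {1..<m} \<Longrightarrow> us i < us (Suc i)"
    and "0 < \<epsilon>" and "\<epsilon> < umin / 4"
    and "regularity_exponent \<Omega> \<epsilon> umin umax s"
    and "local_minimizer_BV \<Omega> (objective \<Omega> \<alpha> \<beta> \<epsilon> umin umax us m f z) ubar"
  shows "(\<lambda>x. - (tracking_deriv \<Omega> f z (superpos \<epsilon> umin umax ubar) x
                 * superpos_deriv \<epsilon> umin umax ubar x))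
         \<in> weighted_sum
             \<alpha> (subdifferential_Lp (s / (s - 2)) \<Omega>
                  (\<lambda>u. ereal (multibang_functional \<Omega> us m u)) ubar)
             \<beta> (subdifferential_Lp (s / (s - 2)) \<Omega> (TV \<Omega>) ubar)
       \<and> weighted_sum
             \<alpha> (subdifferential_Lp (s / (s - 2)) \<Omega>
                  (\<lambda>u. ereal (multibang_functional \<Omega> us m u)) ubar)
             \<beta> (subdifferential_Lp (s / (s - 2)) \<Omega> (TV \<Omega>) ubar)
         \<subseteq> Lp (s / 2) \<Omega>"
proof -
  interpret bv_minimizer \<Omega> f z ubar \<alpha> \<beta> \<epsilon> umin umax s us m
    by unfold_locales (use assms in auto)
  show ?thesis using optimality weighted_sum_Lp by (simp add: reduced_gradient_def)
qed

end
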